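(* Let $r\in\mathbb{N}$, $A_0>1$ and $0<q\le p\le\infty$. There exist constants $C,c_0>0$, independent of $f$ and $t$, such that for every $f\in L^p(\Omega)$, $$\omega_\Omega^r(f,t;A_0)_p\le C\,\tau_r(f,c_0t)_{p,q},\qquad 0<t\le1 .$$
   Context: Let $d\ge1$ be an integer; $\|\cdot\|$ is the Euclidean norm, $e_1,\dots,e_{d+1}$ the standard basis of $\mathbb{R}^{d+1}$, $|E|$ Lebesgue measure, $\mathrm{dist}(\xi,E)=\inf_{\eta\in E}\|\xi-\eta\|$; points of $\mathbb{R}^{d+1}$ are written $(x,y)$ with $x\in\mathbb{R}^d$, $y\in\mathbb{R}$. **$C^2$-domain.** A bounded domain $\Omega_0\subset\mathbb{R}^{d+1}$ is $C^2$ if there exist $\delta>0$, $M>0$ and a finite cover of its boundary $\Gamma$ by connected open sets $U_1,\dots,U_J$ such that (i) for every $x\in\Omega_0$ with $\mathrm{dist}(x,\Gamma)<\delta$ there is $j$ with $x\in U_j$ and $\mathrm{dist}(x,\partial U_j)>\delta$; (ii) for each $j$ there is a Cartesian coordinate system $(\xi_{j,1},\dots,\xi_{j,d+1})$ in $U_j$ in which $\Omega_0\cap U_j$ is represented by $\xi_{j,d+1}\le f_j(\xi_{j,1},\dots,\xi_{j,d})$ with $f_j:\mathbb{R}^d\to\mathbb{R}$ of class $C^2$ and $\max_{i,k}\|\partial_i\partial_kf_j\|_\infty\le M$. Throughout, $\Omega$ is a fixed closure of an open, connected, bounded $C^2$-domain in $\mathbb{R}^{d+1}$, with boundary $\Gamma=\partial\Omega$.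 $L^p(\Omega)$, $0<p<\infty$, is with respect to Lebesgue measure; $L^\infty(\Omega)$ means $C(\Omega)$ with the uniform norm. **Differences.** $\triangle_\xi^rf(\eta)=\sum_{j=0}^r(-1)^{r+j}\binom rjf(\eta+j\xi)$; $\triangle_\xi^r(f,\Omega,\eta)=\triangle_\xi^rf(\eta)$ if the segment $[\eta,\eta+r\xi]\subset\Omega$, and $0$ otherwise; $\widetilde\triangle_\xi^r(f,\Omega,\eta)=\triangle_\xi^r(f,\Omega,\eta-\frac r2\xi)$. **Average moduli.** $\rho_\Omega(\xi,\eta)=\|\xi-\eta\|+|\sqrt{\mathrm{dist}(\xi,\Gamma)}-\sqrt{\mathrm{dist}(\eta,\Gamma)}|$, $U(\xi,t)=\{\eta\in\Omega:\rho_\Omega(\xi,\eta)\le t\}$, $$w_r(f,\xi,\delta)_q=\Big(\frac1{|U(\xi,\delta)|}\int_{U(\xi,\delta)}|\triangle^r_{(\eta-\xi)/r}(f,\Omega,\xi)|^q\,d\eta\Big)^{1/q}\ (0<q<\infty),\quad w_r(f,\xi,\delta)_\infty=\sup_{\eta\in U(\xi,\delta)}|\triangle^r_{(\eta-\xi)/r}(f,\Omega,\xi)|,$$ and $\tau_r(f,\delta)_{p,q}=\|w_r(f,\cdot,\delta)_q\|_{L^p(\Omega)}$. **Domains of special type.** $G\subset\mathbb{R}^{d+1}$ is an upward $x_{d+1}$-domain with base size $b>0$ and parameter $L\ge1$ if $G=\xi+\{(x,y):x\in(-b,b)^d,\ g(x)-Lb<y\le g(x)\}$ with $\xi\in\mathbb{R}^{d+1}$,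 $g\in C^2(\mathbb{R}^d)$. For $\lambda\in(0,2]$ put $G(\lambda)=\xi+\{(x,y):x\in(-\lambda b,\lambda b)^d,\ g(x)-\lambda Lb<y\le g(x)\}$, $\partial'G(\lambda)=\xi+\{(x,g(x)):x\in(-\lambda b,\lambda b)^d\}$, $\partial'G=\partial'G(1)$, $\partial'G^*=\partial'G(2)$ and $G^*=\xi+\{(x,y):x\in(-2b,2b)^d,\ \min_{u\in[-2b,2b]^d}g(u)-4Lb<y\le g(x)\}$. It is always assumed that $L\ge4\sqrt d\max_{x\in[-2b,2b]^d}\|\nabla g(x)\|+1$. Upward $x_j$-domains ($1\le j\le d$) and their associated sets are the images of upward $x_{d+1}$-domains and their associated sets under the map $\sigma_j$ swapping the $j$-th and $(d+1)$-st coordinates; downward $x_j$-domains ($1\le j\le d+1$) and their associated sets are the images of those of upward $x_j$-domains under the map $\tau_j$ changing the sign of the $j$-th coordinate. All of these are called domains of special type. A domain of special type $G\subset\Omega$ is attached to $\Gamma$ if $\overline{G^*}\cap\Gamma=\overline{\partial'G^*}$ and $G^*=Q\cap\Omega$ for some open rectangular box $Q$ (sides parallel to the axes). There is a finite cover of $\Gamma$ by domains of special type $G_1,\dots,G_{m_0}\subset\Omega$ attached to $\Gamma$; such a cover is fixed. **Modulus $\omega_\Omega^r(f,t;A_0)_p$.** Let $\varphi_\Omega(e,\xi)=\max\{\sqrt{l_1l_2}:l_1,l_2\ge0,\ [\xi-l_1e,\xi+l_2e]\subset\Omega\}$ and $$\omega_{\Omega,\varphi}^r(f,t;e)_p=\sup_{|h|\le\min\{t,1\}}\big\|\widetilde\triangle^r_{h\varphi_\Omega(e,\cdot)e}(f,\Omega,\cdot)\big\|_{L^p(\Omega)},\qquad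 \omega_{\Omega,\varphi}^r(f,t)_p=\max_{1\le j\le d+1}\omega_{\Omega,\varphi}^r(f,t;e_j)_p .$$ For an upward $x_{d+1}$-domain $G=\{(x,y):x\in(-b,b)^d,\ g(x)-Lb<y\le g(x)\}\subset\Omega$ with base size $b>0$, parameter $L\ge1$ and $g\in C^2(\mathbb{R}^d)$ (that is, with $\xi=0$), let $\xi_j(u)=e_j+\partial_jg(u)e_{d+1}$, $1\le j\le d$, $G^t=\{\xi\in G:\mathrm{dist}(\xi,\partial'G)\ge A_0t^2\}$, $I_x(tb)=\{u\in(-b,b)^d:\|u-x\|\le tb\}$, and for $0<t\le1$ $$\widetilde\omega_G^r(f,t)_p=\sup_{0<s\le t,\ 1\le j\le d}\Big(\int_{G^t}\Big[\frac1{(tb)^d}\int_{I_x(tb)}|\triangle^r_{s\xi_j(u)}(f,\Omega,(x,y))|^p\,du\Big]dx\,dy\Big)^{1/p}$$ (with the $L^\infty$-norm replacing the $L^p$-norm if $p=\infty$). For a general domain of special type $G\subset\Omega$, $\widetilde\omega^r_G(f,t)_p=\widetilde\omega^r_{T(G)}(f\circ T^{-1},t)_p$ (with $T(\Omega)$ in place of $\Omega$), where $T$ is a composition of a translation and reflections $\sigma_j,\tau_j$ taking $G$ to an upward $x_{d+1}$-domain with $\xi=0$. Finally, the dependence on $A_0$ being displayed, $$\omega^r_\Omega(f,t;A_0)_p=\omega^r_{\Omega,\varphi}(f,t)_p+\sum_{j=1}^{m_0}\widetilde\omega^r_{G_j}(f,t)_p .$$ *)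

theory Defs
  imports "HOL-Analysis.Analysis"
begin

text \<open>
  Points of the \<open>(d+1)\<close>-dimensional space are pairs \<open>(x, y)\<close> with \<open>d = CARD('n)\<close>; the product type
  carries the Euclidean norm and Lebesgue measure. The coordinates are indexed by
  \<^typ>\<open>'n option\<close>, with \<^const>\<open>None\<close> for the last one. Moduli take values in \<^typ>\<open>ennreal\<close>, so that
  suprema and integrals need no side conditions, and exponents \<open>p, q \<in> (0, \<infinity>]\<close> are \<^typ>\<open>ennreal\<close> too.
\<close>

type_synonym 'n pt = "(real ^ 'n) \<times> real"

section \<open>\<open>C\<^sup>2\<close> functions and domains\<close>

definition partial_deriv :: "'n::finite \<Rightarrow> (real ^ 'n \<Rightarrow> real) \<Rightarrow> real ^ 'n \<Rightarrow> real" where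
  "partial_deriv i f x = frechet_derivative f (at x) (axis i 1)"

definition grad :: "(real ^ 'n::finite \<Rightarrow> real) \<Rightarrow> real ^ 'n \<Rightarrow> real ^ 'n" where
  "grad f x = (\<chi> i. partial_deriv i f x)"

definition C2_fun :: "(real ^ 'n::finite \<Rightarrow> real) \<Rightarrow> bool" where
  "C2_fun f \<longleftrightarrow> f differentiable_on UNIV \<and>
     (\<forall>i. partial_deriv i f differentiable_on UNIV) \<and>
     (\<forall>i k. continuous_on UNIV (partial_deriv i (partial_deriv k f)))"

text \<open>
  The Cartesian coordinates of \<open>\<xi>\<close> in a patch \<open>U\<close> are \<open>R (\<xi> - c)\<close>. Since \<open>\<Omega>0\<close> is open, its part in
  \<open>U\<close> is the strict subgraph (the non-strict one would make it relatively clopen in the connected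
  set \<open>U\<close>); then \<open>closure \<Omega>0 \<inter> U\<close> is the non-strict subgraph. No patch is the whole space, because
  \<open>\<Omega>0\<close> is bounded; hence \<open>frontier U \<noteq> {}\<close> whenever \<open>\<xi> \<in> U\<close>, and the convention
  \<open>infdist \<xi> {} = 0\<close> plays no role.
\<close>

definition C2_domain :: "'n::finite pt set \<Rightarrow> bool" where
  "C2_domain \<Omega>0 \<longleftrightarrow> open \<Omega>0 \<and> connected \<Omega>0 \<and> bounded \<Omega>0 \<and> \<Omega>0 \<noteq> {} \<and>
     (\<exists>\<delta>>0. \<exists>M>0. \<exists>\<U>. finite \<U> \<and> frontier \<Omega>0 \<subseteq> \<Union>\<U> \<and>
        (\<forall>U\<in>\<U>. open U \<and> connected U) \<and>
        (\<forall>\<xi>\<in>\<Omega>0. infdist \<xi> (frontier \<Omega>0) < \<delta> \<longrightarrow>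
           (\<exists>U\<in>\<U>. \<xi> \<in> U \<and> infdist \<xi> (frontier U) > \<delta>)) \<and>
        (\<forall>U\<in>\<U>. \<exists>(R :: 'n pt \<Rightarrow> 'n pt) c f. orthogonal_transformation R \<and> C2_fun f \<and>
           (\<forall>i k x. \<bar>partial_deriv i (partial_deriv k f) x\<bar> \<le> M) \<and>
           \<Omega>0 \<inter> U = {\<xi> \<in> U. snd (R (\<xi> - c)) < f (fst (R (\<xi> - c)))}))"

section \<open>\<open>L\<^sup>p\<close> norms\<close>

text \<open>Only used for \<open>a > 0\<close>.\<close>

definition epowr :: "ennreal \<Rightarrow> real \<Rightarrow> ennreal" where
  "epowr x a = (if x = \<infinity> then \<infinity> else ennreal (enn2real x powr a))"

text \<open>For \<open>p = \<infinity>\<close> this is the uniform norm, not the essential supremum.\<close>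

definition Lp_norm :: "ennreal \<Rightarrow> 'a::euclidean_space set \<Rightarrow> ('a \<Rightarrow> ennreal) \<Rightarrow> ennreal" where
  "Lp_norm p S F =
     (if p = \<infinity> then (SUP x\<in>S. F x)
      else epowr (\<integral>\<^sup>+x\<in>S. epowr (F x) (enn2real p) \<partial>lebesgue) (1 / enn2real p))"

definition in_Lp :: "ennreal \<Rightarrow> 'a::euclidean_space set \<Rightarrow> ('a \<Rightarrow> real) \<Rightarrow> bool" where
  "in_Lp p \<Omega> f \<longleftrightarrow>
     (if p = \<infinity> then continuous_on \<Omega> f
      else f \<in> borel_measurable (lebesgue_on \<Omega>) \<and> Lp_norm p \<Omega> (\<lambda>x. ennreal \<bar>f x\<bar>) < \<infinity>)"

section \<open>Differences\<close>

definition fin_diff :: "nat \<Rightarrow> 'a::real_vector \<Rightarrow> ('a \<Rightarrow> real) \<Rightarrow> 'a \<Rightarrow> real" where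
  "fin_diff r \<xi> f \<eta> = (\<Sum>j=0..r. (-1) ^ (r + j) * real (r choose j) * f (\<eta> + real j *\<^sub>R \<xi>))"

definition dom_diff :: "nat \<Rightarrow> 'a::real_vector \<Rightarrow> ('a \<Rightarrow> real) \<Rightarrow> 'a set \<Rightarrow> 'a \<Rightarrow> real" where
  "dom_diff r \<xi> f \<Omega> \<eta> =
     (if closed_segment \<eta> (\<eta> + real r *\<^sub>R \<xi>) \<subseteq> \<Omega> then fin_diff r \<xi> f \<eta> else 0)"

definition sym_diff :: "nat \<Rightarrow> 'a::real_vector \<Rightarrow> ('a \<Rightarrow> real) \<Rightarrow> 'a set \<Rightarrow> 'a \<Rightarrow> real" where
  "sym_diff r \<xi> f \<Omega> \<eta> = dom_diff r \<xi> f \<Omega> (\<eta> - (real r / 2) *\<^sub>R \<xi>)"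

section \<open>Average moduli\<close>

definition rho :: "'a::euclidean_space set \<Rightarrow> 'a \<Rightarrow> 'a \<Rightarrow> real" where
  "rho \<Omega> \<xi> \<eta> =
     norm (\<xi> - \<eta>) + \<bar>sqrt (infdist \<xi> (frontier \<Omega>)) - sqrt (infdist \<eta> (frontier \<Omega>))\<bar>"

definition rho_ball :: "'a::euclidean_space set \<Rightarrow> 'a \<Rightarrow> real \<Rightarrow> 'a set" where
  "rho_ball \<Omega> \<xi> t = {\<eta> \<in> \<Omega>. rho \<Omega> \<xi> \<eta> \<le> t}"

definition w_mod :: "nat \<Rightarrow> 'a::euclidean_space set \<Rightarrow> ennreal \<Rightarrow> ('a \<Rightarrow> real) \<Rightarrow> 'a \<Rightarrow> real \<Rightarrow> ennreal" where
  "w_mod r \<Omega> q f \<xi> \<delta> =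
     (if q = \<infinity>
      then (SUP \<eta>\<in>rho_ball \<Omega> \<xi> \<delta>. ennreal \<bar>dom_diff r ((\<eta> - \<xi>) /\<^sub>R real r) f \<Omega> \<xi>\<bar>)
      else epowr
        ((\<integral>\<^sup>+\<eta>\<in>rho_ball \<Omega> \<xi> \<delta>.
            ennreal (\<bar>dom_diff r ((\<eta> - \<xi>) /\<^sub>R real r) f \<Omega> \<xi>\<bar> powr enn2real q) \<partial>lebesgue)
          / emeasure lebesgue (rho_ball \<Omega> \<xi> \<delta>))
        (1 / enn2real q))"

definition tau_mod :: "nat \<Rightarrow> 'a::euclidean_space set \<Rightarrow> ennreal \<Rightarrow> ennreal \<Rightarrow> ('a \<Rightarrow> real) \<Rightarrow> real \<Rightarrow> ennreal" where
  "tau_mod r \<Omega> p q f \<delta> = Lp_norm p \<Omega> (\<lambda>\<xi>. w_mod r \<Omega> q f \<xi> \<delta>)"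

section \<open>Domains of special type\<close>

definition cube :: "real \<Rightarrow> (real ^ 'n::finite) set" where
  "cube a = {x. \<forall>i. - a < x $ i \<and> x $ i < a}"

definition ccube :: "real \<Rightarrow> (real ^ 'n::finite) set" where
  "ccube a = {x. \<forall>i. - a \<le> x $ i \<and> x $ i \<le> a}"

definition swap_last :: "'n::finite \<Rightarrow> 'n pt \<Rightarrow> 'n pt" where
  "swap_last j = (\<lambda>(x, y). (\<chi> i. if i = j then y else x $ i, x $ j))"

definition flip_coord :: "'n::finite option \<Rightarrow> 'n pt \<Rightarrow> 'n pt" where
  "flip_coord k = (\<lambda>(x, y). case k of
       None \<Rightarrow> (x, - y)
     | Some j \<Rightarrow> (\<chi> i. if i = j then - (x $ i) else x $ i, y))"

text \<open>
  The associated sets depend on \<open>g\<close> on the cube of side \<open>4b\<close>, not only on the domain as a set,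
  hence a domain of special type is represented by its defining data: the coordinate it is
  oriented along, whether it is a downward domain, and \<open>\<xi>, b, L, g\<close> of the upward
  \<open>x\<^bsub>d+1\<^esub>\<close>-domain it is an image of.
\<close>

record 'n special_dom =
  sd_coord :: "'n option"
  sd_down :: bool
  sd_xi :: "'n pt"
  sd_b :: real
  sd_L :: real
  sd_g :: "real ^ 'n \<Rightarrow> real"

definition special_dom_valid :: "'n::finite special_dom \<Rightarrow> bool" where
  "special_dom_valid D \<longleftrightarrow> sd_b D > 0 \<and> sd_L D \<ge> 1 \<and> C2_fun (sd_g D) \<and>
     sd_L D \<ge> 4 * sqrt (real CARD('n)) * (SUP x\<in>ccube (2 * sd_b D). norm (grad (sd_g D) x)) + 1"

text \<open>
  The sets \<open>G(\<lambda>)\<close>, \<open>\<partial>'G(\<lambda>)\<close> (with \<open>\<lambda> = a\<close>) and \<open>G\<^sup>*\<close> of an upward \<open>x\<^bsub>d+1\<^esub>\<close>-domain with \<open>\<xi> = 0\<close>; the infimum below is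
  attained since \<open>g\<close> is continuous.
\<close>

definition up_dom :: "real \<Rightarrow> real \<Rightarrow> (real ^ 'n::finite \<Rightarrow> real) \<Rightarrow> real \<Rightarrow> 'n pt set" where
  "up_dom b L g a = {(x, y). x \<in> cube (a * b) \<and> g x - a * L * b < y \<and> y \<le> g x}"

definition up_bd :: "real \<Rightarrow> (real ^ 'n::finite \<Rightarrow> real) \<Rightarrow> real \<Rightarrow> 'n pt set" where
  "up_bd b g a = (\<lambda>x. (x, g x)) ` cube (a * b)"

definition up_star :: "real \<Rightarrow> real \<Rightarrow> (real ^ 'n::finite \<Rightarrow> real) \<Rightarrow> 'n pt set" where
  "up_star b L g =
     {(x, y). x \<in> cube (2 * b) \<and> (INF u\<in>ccube (2 * b). g u) - 4 * L * b < y \<and> y \<le> g x}"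

text \<open>
  The map carrying the upward \<open>x\<^bsub>d+1\<^esub>\<close>-domain with \<open>\<xi> = 0\<close> to the given domain: translation by \<open>\<xi>\<close>,
  then \<open>\<sigma>\<^sub>j\<close> for an \<open>x\<^sub>j\<close>-domain with \<open>j \<le> d\<close>, then \<open>\<tau>\<^sub>j\<close> for a downward one. Its inverse is a
  composition of a translation and of maps \<open>\<sigma>\<^sub>j\<close>, \<open>\<tau>\<^sub>j\<close>, and is taken as the normalising map \<open>T\<close>.
\<close>

definition sd_map :: "'n::finite special_dom \<Rightarrow> 'n pt \<Rightarrow> 'n pt" where
  "sd_map D \<eta> =
     (if sd_down D then flip_coord (sd_coord D) else id)
       ((case sd_coord D of None \<Rightarrow> id | Some j \<Rightarrow> swap_last j) (sd_xi D + \<eta>))"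

definition sd_set :: "'n::finite special_dom \<Rightarrow> 'n pt set" where
  "sd_set D = sd_map D ` up_dom (sd_b D) (sd_L D) (sd_g D) 1"

definition sd_star :: "'n::finite special_dom \<Rightarrow> 'n pt set" where
  "sd_star D = sd_map D ` up_star (sd_b D) (sd_L D) (sd_g D)"

definition sd_bd_star :: "'n::finite special_dom \<Rightarrow> 'n pt set" where
  "sd_bd_star D = sd_map D ` up_bd (sd_b D) (sd_g D) 2"

definition attached :: "'n::finite pt set \<Rightarrow> 'n special_dom \<Rightarrow> bool" where
  "attached \<Omega> D \<longleftrightarrow> closure (sd_star D) \<inter> frontier \<Omega> = closure (sd_bd_star D) \<and>
     (\<exists>u v. sd_star D = box u v \<inter> \<Omega>)"

definition special_cover :: "'n::finite pt set \<Rightarrow> 'n special_dom list \<Rightarrow> bool" where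
  "special_cover \<Omega> Gs \<longleftrightarrow>
     (\<forall>D\<in>set Gs. special_dom_valid D \<and> sd_set D \<subseteq> \<Omega> \<and> attached \<Omega> D) \<and>
     frontier \<Omega> \<subseteq> (\<Union>D\<in>set Gs. sd_set D)"

section \<open>The modulus of smoothness\<close>

text \<open>For \<open>\<xi> \<in> \<Omega>\<close> and \<open>\<Omega>\<close> compact the supremum is a maximum.\<close>

definition phi :: "'a::euclidean_space set \<Rightarrow> 'a \<Rightarrow> 'a \<Rightarrow> real" where
  "phi \<Omega> e \<xi> = Sup {sqrt (l1 * l2) | l1 l2. l1 \<ge> 0 \<and> l2 \<ge> 0 \<and>
     closed_segment (\<xi> - l1 *\<^sub>R e) (\<xi> + l2 *\<^sub>R e) \<subseteq> \<Omega>}"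

definition omega_phi_dir ::
  "nat \<Rightarrow> 'a::euclidean_space set \<Rightarrow> ennreal \<Rightarrow> ('a \<Rightarrow> real) \<Rightarrow> real \<Rightarrow> 'a \<Rightarrow> ennreal" where
  "omega_phi_dir r \<Omega> p f t e =
     (SUP h\<in>{h. \<bar>h\<bar> \<le> min t 1}.
        Lp_norm p \<Omega> (\<lambda>\<eta>. ennreal \<bar>sym_diff r ((h * phi \<Omega> e \<eta>) *\<^sub>R e) f \<Omega> \<eta>\<bar>))"

definition omega_phi ::
  "nat \<Rightarrow> 'a::euclidean_space set \<Rightarrow> ennreal \<Rightarrow> ('a \<Rightarrow> real) \<Rightarrow> real \<Rightarrow> ennreal" where
  "omega_phi r \<Omega> p f t = (MAX e\<in>Basis. omega_phi_dir r \<Omega> p f t e)"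

definition tang :: "(real ^ 'n::finite \<Rightarrow> real) \<Rightarrow> 'n \<Rightarrow> real ^ 'n \<Rightarrow> 'n pt" where
  "tang g j u = (axis j 1, partial_deriv j g u)"

definition up_inner ::
  "real \<Rightarrow> real \<Rightarrow> real \<Rightarrow> (real ^ 'n::finite \<Rightarrow> real) \<Rightarrow> real \<Rightarrow> 'n pt set" where
  "up_inner A0 b L g t = {\<xi> \<in> up_dom b L g 1. infdist \<xi> (up_bd b g 1) \<ge> A0 * t\<^sup>2}"

definition near_cube :: "real \<Rightarrow> real \<Rightarrow> real ^ 'n::finite \<Rightarrow> (real ^ 'n) set" where
  "near_cube b a x = {u \<in> cube b. norm (u - x) \<le> a}"

definition omega_up ::
  "nat \<Rightarrow> real \<Rightarrow> 'n::finite pt set \<Rightarrow> real \<Rightarrow> real \<Rightarrow> (real ^ 'n \<Rightarrow> real) \<Rightarrow> ennreal \<Rightarrow>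
     ('n pt \<Rightarrow> real) \<Rightarrow> real \<Rightarrow> ennreal" where
  "omega_up r A0 \<Omega> b L g p f t =
     (SUP s\<in>{0<..t}. SUP j.
        if p = \<infinity>
        then (SUP \<eta>\<in>up_inner A0 b L g t. SUP u\<in>near_cube b (t * b) (fst \<eta>).
                ennreal \<bar>dom_diff r (s *\<^sub>R tang g j u) f \<Omega> \<eta>\<bar>)
        else epowr
          (\<integral>\<^sup>+\<eta>\<in>up_inner A0 b L g t.
             (ennreal (1 / (t * b) ^ CARD('n)) *
              (\<integral>\<^sup>+u\<in>near_cube b (t * b) (fst \<eta>).
                 ennreal (\<bar>dom_diff r (s *\<^sub>R tang g j u) f \<Omega> \<eta>\<bar> powr enn2real p) \<partial>lebesgue))
           \<partial>lebesgue)
          (1 / enn2real p))"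

text \<open>With \<open>T\<close> the inverse of \<open>sd_map D\<close>, the preimage below is \<open>T(\<Omega>)\<close>.\<close>

definition omega_special ::
  "nat \<Rightarrow> real \<Rightarrow> 'n::finite pt set \<Rightarrow> 'n special_dom \<Rightarrow> ennreal \<Rightarrow> ('n pt \<Rightarrow> real) \<Rightarrow> real \<Rightarrow> ennreal"
  where
  "omega_special r A0 \<Omega> D p f t =
     omega_up r A0 (sd_map D -` \<Omega>) (sd_b D) (sd_L D) (sd_g D) p (f \<circ> sd_map D) t"

definition omega_mod ::
  "nat \<Rightarrow> real \<Rightarrow> 'n::finite pt set \<Rightarrow> 'n special_dom list \<Rightarrow> ennreal \<Rightarrow> ('n pt \<Rightarrow> real) \<Rightarrow> real \<Rightarrow> ennreal"
  where
  "omega_mod r A0 \<Omega> Gs p f t = omega_phi r \<Omega> p f t + (\<Sum>D\<leftarrow>Gs. omega_special r A0 \<Omega> D p f t)"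

end

theory Submission
  imports Defs
begin

text \<open>
  The \<open>C\<^sup>2\<close> condition enters mainly through inner and outer tangent balls of a fixed radius at every
  boundary point; these control \<open>dist (\<cdot>, \<Gamma>)\<close> to second order. Given a segment \<open>[x, x + r H]\<close> in \<open>\<Omega>\<close>
  along which \<open>sqrt (dist (\<cdot>, \<Gamma>))\<close> varies by \<open>O(t)\<close>, an identity expresses \<open>\<Delta>\<^sup>r f\<close> with step \<open>H\<close> at \<open>x\<close>
  through differences whose steps are perturbed by an additional vector \<open>s\<close>. Averaging over \<open>s\<close> in a
  set whose measure is comparable to that of the balls \<open>U(\<cdot>, c t)\<close>, it is bounded by the average modulus at one of
  finitely many points \<open>x + (m/N) H\<close>. Both the step \<open>h \<phi>(e, \<eta>) e\<close> and the tangential steps satisfy the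
  hypothesis: the first because \<open>\<phi>\<^sup>2\<close> is the product of the distances to the ends of the
  chord, the second because the tangents deviate from the level sets of the distance by \<open>O(t + dist)\<close>.
  Taking \<open>L\<^sup>p\<close> norms in \<open>\<eta>\<close> then costs only changes of variables \<open>\<eta> \<mapsto> \<eta> + \<kappa> \<phi>(e, \<eta>) e\<close> on chords, where \<open>\<phi>\<close> is
  concave, and translations.
\<close>

section \<open>Finite differences\<close>

text \<open>The obstacle is the cut-off in \<open>dom_diff\<close>: it is zero as soon as its
  segment leaves \<open>\<Omega>\<close>, so every perturbed segment has to be shown to lie in
  \<open>\<Omega>\<close>, and this for a large set of shifts s. Near the boundary a ball of shifts
  fails. The set used there is a slab along the tangent plane, of tangential size t and thickness
  \<open>t * (t + sqrt (dl x))\<close>, displaced inwards by a multiple of t^2 in order to beat the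
  curvature. Its volume, t^(d+1) times \<open>t + sqrt (dl x)\<close>, dominates that of the balls
  \<open>U(\<xi>, c t)\<close> up to a constant, because a change of the root of the distance by t
  is a change of the distance by about t times (t + root). For the same reason all estimates along
  segments are brought to the form
  \<open>dl b \<le> dl a + C * (t\<^sup>2 + t * sqrt (dl a))\<close>, which is equivalent in effect
  to an O(t) bound for the roots. The point at which the average modulus is finally evaluated
  depends on f and on the segment without any control; it is one of finitely many, so the sum over
  all candidates is integrated instead.\<close>

lemma fin_diff_Suc:
  "fin_diff (Suc r) \<xi> f \<eta> = fin_diff r \<xi> (\<lambda>x. f (x + \<xi>) - f x) \<eta>"
proof -
  define c where "c k j = (-1) ^ (k + j) * real (k choose j)" for k j :: nat
  define v where "v j = f (\<eta> + real j *\<^sub>R \<xi>)" for j :: nat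
  have c_last: "c r (Suc r) = 0" and c_pascal: "c (Suc r) (Suc j) = c r j - c r (Suc j)"
    and c_first: "c (Suc r) 0 = - c r 0" for j
    by (auto simp: c_def algebra_simps)
  have "(\<Sum>j\<le>Suc r. c (Suc r) j * v j) = c (Suc r) 0 * v 0 + (\<Sum>j\<le>r. c (Suc r) (Suc j) * v (Suc j))"
    by (rule sum.atMost_Suc_shift)
  also have "\<dots> = (\<Sum>j\<le>r. c r j * v (Suc j)) - (c r 0 * v 0 + (\<Sum>j\<le>r. c r (Suc j) * v (Suc j)))"
    by (simp add: c_pascal c_first algebra_simps sum_subtractf)
  also have "c r 0 * v 0 + (\<Sum>j\<le>r. c r (Suc j) * v (Suc j)) = (\<Sum>j\<le>Suc r. c r j * v j)"
    by (rule sum.atMost_Suc_shift[symmetric])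
  also have "\<dots> = (\<Sum>j\<le>r. c r j * v j)" by (simp add: c_last)
  finally have "(\<Sum>j\<le>Suc r. c (Suc r) j * v j) = (\<Sum>j\<le>r. c r j * (v (Suc j) - v j))"
    by (simp add: algebra_simps sum_subtractf)
  then show ?thesis
    by (simp add: fin_diff_def c_def v_def atMost_atLeast0 algebra_simps)
qed

lemma fin_diff_0 [simp]: "fin_diff 0 \<xi> f \<eta> = f \<eta>"
  by (simp add: fin_diff_def)

lemma fin_diff_zero_step: "r \<ge> 1 \<Longrightarrow> fin_diff r 0 f \<eta> = 0"
  by (cases r) (simp_all add: fin_diff_Suc, simp add: fin_diff_def)

lemma fin_diff_sum: "fin_diff r \<xi> (\<lambda>x. \<Sum>k\<in>A. F k x) \<eta> = (\<Sum>k\<in>A. fin_diff r \<xi> (F k) \<eta>)"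
  unfolding fin_diff_def sum_distrib_left by (rule sum.swap)

lemma fin_diff_shift: "fin_diff r \<xi> (\<lambda>x. f (x + a)) \<eta> = fin_diff r \<xi> f (\<eta> + a)"
  by (simp add: fin_diff_def algebra_simps)

text \<open>A difference with a long step is a combination of differences with a short step: the operator
  \<open>\<triangle>\<^bsub>N\<xi>\<^esub>\<close> is the sum of \<open>N\<close> shifted copies of \<open>\<triangle>\<^bsub>\<xi>\<^esub>\<close>.\<close>

lemma fin_diff_split_bound:
  fixes f :: "'a::real_vector \<Rightarrow> real"
  assumes "\<And>k. k \<le> r * (N - 1) \<Longrightarrow> \<bar>fin_diff r \<xi> f (\<eta> + real k *\<^sub>R \<xi>)\<bar> \<le> M"
      and "N \<ge> 1"
  shows "\<bar>fin_diff r (real N *\<^sub>R \<xi>) f \<eta>\<bar> \<le> real N ^ r * M"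
  using assms
proof (induction r arbitrary: f \<eta>)
  case 0
  then show ?case using "0.prems"(1)[of 0] by simp
next
  case (Suc r)
  define g where "g = (\<lambda>x. f (x + \<xi>) - f x)"
  have tele: "f (x + real N *\<^sub>R \<xi>) - f x = (\<Sum>k<N. g (x + real k *\<^sub>R \<xi>))" for x
    using sum_lessThan_telescope[of "\<lambda>k. f (x + real k *\<^sub>R \<xi>)" N]
    by (simp add: g_def algebra_simps)
  \<comment> \<open>Only one of the differences is telescoped; the others keep the long step and are
    left to the induction hypothesis for \<open>g\<close>, at base points shifted by k < N. This is
    why the range of shifts grows by \<open>N - 1\<close> with each order.\<close>
  have *: "fin_diff (Suc r) (real N *\<^sub>R \<xi>) f \<eta> = (\<Sum>k<N. fin_diff r (real N *\<^sub>R \<xi>) g (\<eta> + real k *\<^sub>R \<xi>))"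
    by (simp add: fin_diff_Suc tele fin_diff_sum fin_diff_shift)
  have "\<bar>fin_diff r (real N *\<^sub>R \<xi>) g (\<eta> + real k *\<^sub>R \<xi>)\<bar> \<le> real N ^ r * M" if "k < N" for k
  proof (rule Suc.IH)
    fix i assume "i \<le> r * (N - 1)"
    with that have "i + k \<le> Suc r * (N - 1)" by simp
    from Suc.prems(1)[OF this]
    show "\<bar>fin_diff r \<xi> g (\<eta> + real k *\<^sub>R \<xi> + real i *\<^sub>R \<xi>)\<bar> \<le> M"
      by (simp add: fin_diff_Suc g_def algebra_simps)
  qed (use Suc.prems in simp)
  then have "(\<Sum>k<N. \<bar>fin_diff r (real N *\<^sub>R \<xi>) g (\<eta> + real k *\<^sub>R \<xi>)\<bar>) \<le> (\<Sum>k<N. real N ^ r * M)"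
    by (intro sum_mono) auto
  from order_trans[OF sum_abs this] show ?case
    unfolding * by (simp add: mult.assoc)
qed

text \<open>Both sides are the double sum of the values of f at x + l h + k l s, with weights
  symmetric in k and l. Summing over k inside gives differences with step l s, summing over l inside
  gives differences with step h + k s.\<close>

lemma fin_diff_double_sum:
  fixes f :: "'a::real_vector \<Rightarrow> real"
  shows "(\<Sum>l=0..r. (-1) ^ l * real (r choose l) * fin_diff r (real l *\<^sub>R s) f (x + real l *\<^sub>R h)) =
     (\<Sum>k=0..r. (-1) ^ k * real (r choose k) * fin_diff r (h + real k *\<^sub>R s) f x)"
  unfolding fin_diff_def sum_distrib_left
  by (subst sum.swap) (intro sum.cong refl, simp add: algebra_simps power_add)

text \<open>In \<open>fin_diff_double_sum\<close> the term k = 0 on the right is the wanted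
  difference, while the term l = 0 on the left has step zero and vanishes because
  \<open>r \<ge> 1\<close>. Every remaining difference contains s with a factor of at least 1, which
  is what makes averaging over s possible.\<close>

lemma fin_diff_perturb:
  fixes f :: "'a::real_vector \<Rightarrow> real"
  assumes "r \<ge> 1"
    and "\<And>l. 1 \<le> l \<Longrightarrow> l \<le> r \<Longrightarrow> \<bar>fin_diff r (real l *\<^sub>R s) f (x + real l *\<^sub>R h)\<bar> \<le> M"
    and "\<And>l. 1 \<le> l \<Longrightarrow> l \<le> r \<Longrightarrow> \<bar>fin_diff r (h + real l *\<^sub>R s) f x\<bar> \<le> M"
  shows "\<bar>fin_diff r h f x\<bar> \<le> 2 ^ (r + 1) * M"
proof -
  define A where "A l = fin_diff r (real l *\<^sub>R s) f (x + real l *\<^sub>R h)" for l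
  define B where "B l = fin_diff r (h + real l *\<^sub>R s) f x" for l
  have M: "M \<ge> 0" using assms(2)[of 1] assms(1) abs_ge_zero order_trans by fastforce
  have eq: "fin_diff r h f x = (\<Sum>l=1..r. (-1) ^ l * real (r choose l) * (A l - B l))"
    using fin_diff_double_sum[of r s f x h]
    by (simp add: sum.atLeast_Suc_atMost fin_diff_zero_step[OF assms(1)] A_def B_def
        algebra_simps sum_subtractf)
  have "\<bar>fin_diff r h f x\<bar> \<le> (\<Sum>l=1..r. real (r choose l) * (2 * M))"
    unfolding eq
  proof (intro order_trans[OF sum_abs] sum_mono)
    fix l assume l: "l \<in> {1..r}"
    have "\<bar>A l - B l\<bar> \<le> 2 * M" using assms(2)[of l] assms(3)[of l] l by (simp add: A_def B_def)
    then show "\<bar>(-1) ^ l * real (r choose l) * (A l - B l)\<bar> \<le> real (r choose l) * (2 * M)"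
      by (simp add: abs_mult mult_left_mono power_abs)
  qed
  also have "\<dots> \<le> (\<Sum>l\<le>r. real (r choose l) * (2 * M))"
    by (intro sum_mono2) (use M in auto)
  also have "\<dots> = real (\<Sum>l\<le>r. r choose l) * (2 * M)" by (simp add: sum_distrib_right)
  also have "\<dots> = 2 ^ (r + 1) * M" by (simp add: choose_row_sum)
  finally show ?thesis .
qed

section \<open>Tangent balls and the distance to the boundary\<close>

text \<open>At each boundary point there are an interior and an exterior tangent ball, both of radius
  \<open>1 / (2 * K)\<close>.\<close>

locale two_ball =
  fixes \<Omega> :: "'a::euclidean_space set" and K :: real
  assumes compact: "compact \<Omega>" and nonempty: "\<Omega> \<noteq> {}" and K_pos: "K > 0"
    and balls: "\<And>z. z \<in> frontier \<Omega> \<Longrightarrow> \<exists>n. norm n = 1 \<and>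
      (\<forall>w\<in>\<Omega>. n \<bullet> (w - z) \<le> K * (norm (w - z))\<^sup>2) \<and>
      (\<forall>w. n \<bullet> (w - z) < - K * (norm (w - z))\<^sup>2 \<longrightarrow> w \<in> \<Omega>)"
begin

text \<open>An exterior unit normal without reference to a chart. The two inequalities say that
  \<open>\<Omega>\<close> avoids the open ball of radius \<open>1 / (2 * K)\<close> about z + n / (2
  K) and contains the one about z - n / (2 K).\<close>

definition normal :: "'a \<Rightarrow> 'a \<Rightarrow> bool" where
  "normal z n \<longleftrightarrow> z \<in> frontier \<Omega> \<and> norm n = 1 \<and>
      (\<forall>w\<in>\<Omega>. n \<bullet> (w - z) \<le> K * (norm (w - z))\<^sup>2) \<and>
      (\<forall>w. n \<bullet> (w - z) < - K * (norm (w - z))\<^sup>2 \<longrightarrow> w \<in> \<Omega>)"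

abbreviation dl :: "'a \<Rightarrow> real" where "dl x \<equiv> infdist x (frontier \<Omega>)"

lemma closed: "closed \<Omega>"
  using compact compact_imp_closed by blast

lemma normal_exists: "z \<in> frontier \<Omega> \<Longrightarrow> \<exists>n. normal z n"
  using balls[of z] by (auto simp: normal_def)

lemma normal_norm: "normal z n \<Longrightarrow> norm n = 1" "normal z n \<Longrightarrow> n \<bullet> n = 1"
  by (auto simp: normal_def norm_eq_1)

lemma normal_out: "normal z n \<Longrightarrow> w \<in> \<Omega> \<Longrightarrow> n \<bullet> (w - z) \<le> K * (norm (w - z))\<^sup>2"
  by (auto simp: normal_def)

lemma normal_in: "normal z n \<Longrightarrow> n \<bullet> (w - z) < - K * (norm (w - z))\<^sup>2 \<Longrightarrow> w \<in> \<Omega>"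
  by (auto simp: normal_def)

lemma normal_in_interior:
  assumes "normal z n" "n \<bullet> (w - z) < - K * (norm (w - z))\<^sup>2"
  shows "w \<in> interior \<Omega>"
proof -
  have "open {w. n \<bullet> (w - z) < - K * (norm (w - z))\<^sup>2}"
    by (intro open_Collect_less continuous_intros)
  moreover have "{w. n \<bullet> (w - z) < - K * (norm (w - z))\<^sup>2} \<subseteq> \<Omega>"
    using normal_in[OF assms(1)] by blast
  ultimately show ?thesis using assms(2) interiorI by blast
qed

lemma normal_frontier:
  assumes "normal z n" "w \<in> frontier \<Omega>"
  shows "n \<bullet> (w - z) \<ge> - K * (norm (w - z))\<^sup>2"
  using normal_in_interior[OF assms(1), of w] assms(2) by (force simp: frontier_def)

lemma frontier_nonempty: "frontier \<Omega> \<noteq> {}"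
  using compact nonempty compact_imp_bounded frontier_eq_empty not_bounded_UNIV by metis

lemma frontier_subset: "frontier \<Omega> \<subseteq> \<Omega>"
  by (simp add: closed frontier_subset_closed)

lemma nearest_point: obtains z where "z \<in> frontier \<Omega>" "dl x = norm (x - z)"
proof -
  obtain z where "z \<in> frontier \<Omega>" "dl x = dist x z"
    using infdist_attains_inf[OF frontier_closed frontier_nonempty] by metis
  then show ?thesis using that by (simp add: dist_norm)
qed

lemma dl_le: "z \<in> frontier \<Omega> \<Longrightarrow> dl x \<le> norm (x - z)"
  using infdist_le[of z "frontier \<Omega>" x] by (simp add: dist_norm)

lemma dl_nonneg [simp]: "dl x \<ge> 0" by (rule infdist_nonneg)

lemma dl_lipschitz: "\<bar>dl x - dl y\<bar> \<le> norm (x - y)"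
  using infdist_triangle_abs[of x "frontier \<Omega>" y] by (simp add: dist_norm)

lemma ball_in_domain:
  assumes "x \<in> \<Omega>" "norm (w - x) < dl x"
  shows "w \<in> interior \<Omega>"
proof (rule ccontr)
  assume "w \<notin> interior \<Omega>"
  have seg: "connected (closed_segment x w)" by simp
  have "norm (y - x) \<le> norm (w - x)" if "y \<in> closed_segment x w" for y
    using segment_bound1[OF that] .
  moreover obtain y where "y \<in> closed_segment x w" "y \<in> frontier \<Omega>"
  proof (cases "w \<in> \<Omega>")
    case True
    then have "w \<in> frontier \<Omega>" using \<open>w \<notin> interior \<Omega>\<close> by (simp add: frontier_def closed)
    then show ?thesis using that[of w] by auto
  next
    case False
    then have "closed_segment x w \<inter> frontier \<Omega> \<noteq> {}"
      by (intro connected_Int_frontier[OF seg]) (use assms in auto)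
    then show ?thesis using that by blast
  qed
  ultimately have "norm (y - x) \<le> norm (w - x)" "dl x \<le> norm (x - y)" using dl_le by auto
  then show False using assms(2) by (simp add: norm_minus_commute)
qed

text \<open>If the direction m from z to x were not -n, the vector n + m would have a positive inner
  product with both n and m. A small step from z along it would enter the ball of radius
  \<open>dl x\<close> about x, hence \<open>\<Omega>\<close>, and at the same time the exterior ball
  at z.\<close>

lemma nearest_normal:
  assumes x: "x \<in> \<Omega>" and z: "dl x = norm (x - z)" and n: "normal z n"
  shows "x = z - dl x *\<^sub>R n"
proof (cases "dl x = 0")
  case True
  then show ?thesis using z by auto
next
  case False
  define d where "d = dl x"
  have d: "d > 0" using False dl_nonneg[of x] unfolding d_def by linarith
  define m where "m = (x - z) /\<^sub>R d"
  have "norm m = 1" using d z by (simp add: m_def d_def)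
  then have nm: "m \<bullet> m = 1" by (simp add: norm_eq_1)
  have xz: "x = z + d *\<^sub>R m" using d by (simp add: m_def)
  have "n + m = 0"
  proof (rule ccontr)
    assume "n + m \<noteq> 0"
    define w where "w = n + m"
    have ww: "w \<bullet> w > 0" using \<open>n + m \<noteq> 0\<close> by (simp add: w_def)
    have wm: "w \<bullet> m = w \<bullet> w / 2" "n \<bullet> w = w \<bullet> w / 2" using nm normal_norm[OF n]
      by (simp_all add: w_def inner_simps inner_commute)
    \<comment> \<open>The bound \<open>d / 2\<close> puts the new point strictly inside the ball
      about x; the bound \<open>1 / (4 * K)\<close> makes it violate the exterior ball condition at
      z.\<close>
    define e where "e = min (d / 2) (1 / (4 * K))"
    have e: "e > 0" "e \<le> d / 2" "e \<le> 1 / (4 * K)" using d K_pos by (auto simp: e_def)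
    have zx: "z + e *\<^sub>R w - x = e *\<^sub>R w - d *\<^sub>R m" using xz by simp
    have "(norm (z + e *\<^sub>R w - x))\<^sup>2 = e\<^sup>2 * (w \<bullet> w) - 2 * e * d * (w \<bullet> m) + d\<^sup>2"
      unfolding power2_norm_eq_inner zx
      by (simp add: inner_simps nm inner_commute[of m w] power2_eq_square algebra_simps)
    also have "\<dots> = d\<^sup>2 - e * (w \<bullet> w) * (d - e)"
      by (simp add: wm power2_eq_square algebra_simps)
    also have "\<dots> < d\<^sup>2" using e d ww by simp
    finally have "norm (z + e *\<^sub>R w - x) < d" using d by (meson power_less_imp_less_base less_imp_le)
    then have "z + e *\<^sub>R w \<in> \<Omega>" using ball_in_domain[OF x, of "z + e *\<^sub>R w"] interior_subset d_def by blast
    from normal_out[OF n this] have "e * (w \<bullet> w / 2) \<le> K * (e\<^sup>2 * (w \<bullet> w))"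
      by (simp add: wm power_mult_distrib power2_norm_eq_inner)
    then have "e * (w \<bullet> w) * (1/2) \<le> e * (w \<bullet> w) * (K * e)" by (simp add: power2_eq_square algebra_simps)
    then have "1/2 \<le> K * e" using e ww by (simp add: mult_le_cancel_left)
    moreover have "K * e \<le> 1/4" using e(3) K_pos by (simp add: field_simps)
    ultimately show False by simp
  qed
  then have "m = - n" by (simp add: eq_neg_iff_add_eq_0 add.commute)
  then show ?thesis using xz by (simp add: d_def)
qed

lemma norm_decomp:
  assumes "norm n = 1" "v \<bullet> n = 0"
  shows "(norm (v + k *\<^sub>R n))\<^sup>2 = (norm v)\<^sup>2 + k\<^sup>2" "(norm (v - k *\<^sub>R n))\<^sup>2 = (norm v)\<^sup>2 + k\<^sup>2"
  using assms unfolding power2_norm_eq_inner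
  by (simp_all add: inner_simps norm_eq_1 inner_commute[of n v] power2_eq_square)

text \<open>The segment in direction n through the point z + v of the tangent plane starts in the
  interior ball and ends in the exterior one, so it crosses the boundary. The half-length h = 2 K
  |v|^2 suffices, since h < |v| gives K (|v|^2 + h^2) < h.\<close>

lemma frontier_tangent:
  assumes n: "normal z n" and v: "v \<bullet> n = 0" "norm v < 1 / (2 * K)"
  obtains a where "z + v + a *\<^sub>R n \<in> frontier \<Omega>" "\<bar>a\<bar> \<le> 2 * K * (norm v)\<^sup>2"
proof (cases "v = 0")
  case True
  then show ?thesis using that[of 0] n by (auto simp: normal_def)
next
  case False
  define h where "h = 2 * K * (norm v)\<^sup>2"
  have nn: "n \<bullet> n = 1" "n \<bullet> v = 0" using normal_norm[OF n] v by (auto simp: inner_commute)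
  have h0: "h > 0" using False K_pos by (simp add: h_def)
  have "2 * K * norm v < 1" using v(2) K_pos by (simp add: field_simps)
  then have "(2 * K * norm v) * norm v < 1 * norm v" using False by (intro mult_strict_right_mono) auto
  then have "h < norm v" by (simp add: h_def power2_eq_square mult.assoc)
  then have "h\<^sup>2 < (norm v)\<^sup>2" using h0 by (simp add: power_strict_mono)
  then have key: "K * ((norm v)\<^sup>2 + h\<^sup>2) < h" using K_pos by (simp add: h_def algebra_simps)
  have "n \<bullet> (z + v - h *\<^sub>R n - z) < - K * (norm (z + v - h *\<^sub>R n - z))\<^sup>2"
    using key norm_decomp(2)[OF normal_norm(1)[OF n] v(1), of h] by (simp add: inner_simps nn)
  then have 1: "z + v - h *\<^sub>R n \<in> \<Omega>" using normal_in[OF n] by blast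
  have 2: "z + v + h *\<^sub>R n \<notin> \<Omega>"
  proof
    assume "z + v + h *\<^sub>R n \<in> \<Omega>"
    from normal_out[OF n this] show False
      using key norm_decomp(1)[OF normal_norm(1)[OF n] v(1), of h] by (simp add: inner_simps nn)
  qed
  have "closed_segment (z + v - h *\<^sub>R n) (z + v + h *\<^sub>R n) \<inter> frontier \<Omega> \<noteq> {}"
    by (rule connected_Int_frontier) (use 1 2 in auto)
  then obtain y where y: "y \<in> closed_segment (z + v - h *\<^sub>R n) (z + v + h *\<^sub>R n)" "y \<in> frontier \<Omega>" by blast
  then obtain u where u: "0 \<le> u" "u \<le> 1" "y = (1 - u) *\<^sub>R (z + v - h *\<^sub>R n) + u *\<^sub>R (z + v + h *\<^sub>R n)"
    by (auto simp: in_segment)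
  have "y = z + v + ((u * h) *\<^sub>R n - ((1 - u) * h) *\<^sub>R n)" unfolding u(3) by (simp add: algebra_simps)
  also have "(u * h) *\<^sub>R n - ((1 - u) * h) *\<^sub>R n = ((2 * u - 1) * h) *\<^sub>R n"
    unfolding scaleR_left_diff_distrib[symmetric] by (simp add: algebra_simps)
  finally have "y = z + v + ((2 * u - 1) * h) *\<^sub>R n" .
  moreover have "\<bar>(2 * u - 1) * h\<bar> \<le> h" using u(1,2) h0
    by (simp add: abs_mult mult_le_cancel_right1 abs_le_iff)
  ultimately show ?thesis using that y(2) h_def by auto
qed

lemma dl_upper:
  assumes n: "normal z n" and v: "v \<bullet> n = 0" "norm v < 1 / (2 * K)"
  shows "dl (z + v - k *\<^sub>R n) \<le> \<bar>k\<bar> + 2 * K * (norm v)\<^sup>2"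
proof -
  obtain a where a: "z + v + a *\<^sub>R n \<in> frontier \<Omega>" "\<bar>a\<bar> \<le> 2 * K * (norm v)\<^sup>2"
    using frontier_tangent[OF assms] .
  have "dl (z + v - k *\<^sub>R n) \<le> norm ((z + v - k *\<^sub>R n) - (z + v + a *\<^sub>R n))" using dl_le[OF a(1)] .
  also have "\<dots> = norm ((- (k + a)) *\<^sub>R n)" by (simp add: algebra_simps)
  also have "\<dots> \<le> \<bar>k\<bar> + \<bar>a\<bar>" using normal_norm(1)[OF n] by simp
  finally show ?thesis using a(2) by simp
qed

text \<open>The interior tangent ball, with centre c and radius R, keeps the whole boundary at
  distance at least R from c, so \<open>dl w\<close> is at least R - |w - c|. What remains is an
  upper bound for |w - c|.\<close>

lemma dl_lower:
  assumes n: "normal z n" and v: "v \<bullet> n = 0" and k: "k \<le> 1 / (4 * K)"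
  shows "dl (z + v - k *\<^sub>R n) \<ge> k - 2 * K * (norm v)\<^sup>2"
proof -
  define R where "R = 1 / (2 * K)"
  have R: "R > 0" "k \<le> R / 2" and KR: "K * R = 1 / 2"
    using K_pos k by (auto simp: R_def)
  have kK: "k * (4 * K) \<le> 1" using k K_pos by (simp add: pos_le_divide_eq)
  define c where "c = z - R *\<^sub>R n"
  have nn: "n \<bullet> n = 1" using normal_norm[OF n] by simp
  define w where "w = z + v - k *\<^sub>R n"
  have far: "norm (y - c) \<ge> R" if y: "y \<in> frontier \<Omega>" for y
  proof -
    have "(norm (y - c))\<^sup>2 = (norm ((y - z) + R *\<^sub>R n))\<^sup>2" by (simp add: c_def algebra_simps)
    also have "\<dots> = (norm (y - z))\<^sup>2 + 2 * R * (n \<bullet> (y - z)) + R\<^sup>2"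
      unfolding power2_norm_eq_inner
      by (simp add: inner_simps nn inner_commute[of y n] inner_commute[of z n] power2_eq_square algebra_simps)
    also have "\<dots> \<ge> R\<^sup>2"
    proof -
      have "R * (- K * (norm (y - z))\<^sup>2) \<le> R * (n \<bullet> (y - z))"
        by (rule mult_left_mono[OF normal_frontier[OF n y]]) (use R in linarith)
      moreover have "R * (- K * (norm (y - z))\<^sup>2) = - (K * R) * (norm (y - z))\<^sup>2"
        by (simp only: mult.assoc mult.commute mult.left_commute mult_minus_left mult_minus_right)
      ultimately show ?thesis unfolding KR by linarith
    qed
    finally show ?thesis using R(1) by (meson norm_ge_zero power2_le_imp_le)
  qed
  have wc: "norm (w - c) \<le> (R - k) + 2 * K * (norm v)\<^sup>2"
  proof (rule power2_le_imp_le)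
    have "(norm (w - c))\<^sup>2 = (norm (v + (R - k) *\<^sub>R n))\<^sup>2" by (simp add: w_def c_def algebra_simps)
    also have "\<dots> = (norm v)\<^sup>2 + (R - k)\<^sup>2" using norm_decomp(1)[OF normal_norm(1)[OF n] v] .
    also have "\<dots> \<le> (R - k)\<^sup>2 + 2 * (R - k) * (2 * K * (norm v)\<^sup>2)"
    proof -
      \<comment> \<open>Here \<open>k \<le> R / 2\<close> enters: the cross term of the square
        absorbs |v|^2.\<close>
      have "2 * (R - k) * (2 * K) = 4 * (K * R) - 4 * k * K" by (simp add: algebra_simps)
      then have "1 \<le> 2 * (R - k) * (2 * K)" using KR kK by linarith
      then show ?thesis using mult_right_mono[of 1 "2 * (R - k) * (2 * K)" "(norm v)\<^sup>2"]
        by (simp add: algebra_simps)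
    qed
    also have "\<dots> \<le> ((R - k) + 2 * K * (norm v)\<^sup>2)\<^sup>2" by (simp add: power2_sum)
    finally show "(norm (w - c))\<^sup>2 \<le> ((R - k) + 2 * K * (norm v)\<^sup>2)\<^sup>2" .
    have "0 \<le> R - k" "0 \<le> 2 * K * (norm v)\<^sup>2" using R K_pos by simp_all
    then show "0 \<le> (R - k) + 2 * K * (norm v)\<^sup>2" by linarith
  qed
  obtain y where y: "y \<in> frontier \<Omega>" "dl w = norm (w - y)" using nearest_point .
  have "R \<le> norm (w - y) + norm (w - c)"
    using far[OF y(1)] norm_triangle_ineq[of "y - w" "w - c"] by (simp add: norm_minus_commute)
  then show ?thesis using wc y(2) by (simp add: w_def)
qed

text \<open>After \<open>dl_upper\<close> and \<open>dl_lower\<close> only negative k is in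
  question, that is, points beyond the tangent plane. For them the exterior ball forces |k| to be at
  most 2 K |v|^2, so replacing k by |k| costs at most 4 K |v|^2.\<close>

lemma dl_approx:
  assumes n: "normal z n" and v: "v \<bullet> n = 0" "norm v < 1 / (2 * K)" and k: "\<bar>k\<bar> \<le> 1 / (4 * K)"
    and w: "z + v - k *\<^sub>R n \<in> \<Omega>"
  shows "\<bar>dl (z + v - k *\<^sub>R n) - k\<bar> \<le> 6 * K * (norm v)\<^sup>2"
proof -
  have nn: "n \<bullet> n = 1" "n \<bullet> v = 0" using normal_norm[OF n] v by (auto simp: inner_commute)
  have "- k \<le> K * ((norm v)\<^sup>2 + k\<^sup>2)"
    using normal_out[OF n w] norm_decomp(2)[OF normal_norm(1)[OF n] v(1), of k]
    by (simp add: inner_simps nn)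
  moreover have "K * k\<^sup>2 \<le> \<bar>k\<bar> / 2"
  proof -
    have "K * \<bar>k\<bar> \<le> 1 / 2" using k K_pos by (simp add: field_simps)
    then have "(K * \<bar>k\<bar>) * \<bar>k\<bar> \<le> 1/2 * \<bar>k\<bar>" by (intro mult_right_mono) auto
    then show ?thesis by (simp add: power2_eq_square mult.assoc)
  qed
  ultimately have "\<bar>k\<bar> \<le> k + 4 * K * (norm v)\<^sup>2" using K_pos by (simp add: algebra_simps abs_if split: if_splits)
  moreover have "K * (norm v)\<^sup>2 \<ge> 0" using K_pos by simp
  ultimately show ?thesis using dl_upper[OF n v, of k] dl_lower[OF n v(1), of k] k
    by (simp add: abs_le_iff)
qed

text \<open>Points of the interior ball at z belong to \<open>\<Omega>\<close>, hence avoid the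
  exterior ball at \<open>z'\<close>. Testing with such points at distance about \<rho> from z
  bounds the part of \<open>n'\<close> orthogonal to n by a multiple of \<open>K * \<rho>\<close>
  and keeps \<open>n'\<close> from pointing against n.\<close>

lemma normals_close:
  assumes n: "normal z n" and n': "normal z' n'" and \<rho>: "norm (z - z') \<le> \<rho>" "0 < \<rho>" "\<rho> < 1 / (2 * K)"
  shows "u \<bullet> n = 0 \<Longrightarrow> n' \<bullet> u \<le> 12 * K * \<rho> * norm u" and "n' \<bullet> n \<ge> - 5 * K * \<rho>"
proof -
  have nn: "n \<bullet> n = 1" using normal_norm[OF n] by simp
  have K\<rho>: "2 * K * \<rho> < 1" using \<rho> K_pos by (simp add: field_simps)
  have z: "z \<in> frontier \<Omega>" using n by (simp add: normal_def)
  have low: "n' \<bullet> (z - z') \<ge> - K * \<rho>\<^sup>2"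
  proof -
    have "K * (norm (z - z'))\<^sup>2 \<le> K * \<rho>\<^sup>2" using \<rho> K_pos by (intro mult_left_mono power_mono) auto
    then show ?thesis using normal_frontier[OF n' z] by simp
  qed
  have up: "n' \<bullet> (w - z) \<le> K * (norm (w - z) + \<rho>)\<^sup>2 + K * \<rho>\<^sup>2" if w: "w \<in> \<Omega>" for w
  proof -
    have "norm (w - z') \<le> norm (w - z) + \<rho>"
      using \<rho>(1) norm_triangle_ineq[of "w - z" "z - z'"] by simp
    then have "K * (norm (w - z'))\<^sup>2 \<le> K * (norm (w - z) + \<rho>)\<^sup>2"
      using K_pos by (intro mult_left_mono power_mono) auto
    moreover have "n' \<bullet> (w - z) = n' \<bullet> (w - z') - n' \<bullet> (z - z')" by (simp add: inner_simps)
    ultimately show ?thesis using normal_out[OF n' w] low by linarith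
  qed
  show "n' \<bullet> n \<ge> - 5 * K * \<rho>"
  proof -
    have "(K * \<rho>) * \<rho> < 1 * \<rho>" using K\<rho> \<rho>(2) by (intro mult_strict_right_mono) auto
    then have *: "K * \<rho>\<^sup>2 < \<rho>" unfolding power2_eq_square by linarith
    have "n \<bullet> (z - \<rho> *\<^sub>R n - z) = - \<rho>" "norm (z - \<rho> *\<^sub>R n - z) = \<rho>"
      using \<rho>(2) normal_norm(1)[OF n] by (simp_all add: nn)
    then have "z - \<rho> *\<^sub>R n \<in> \<Omega>" using * by (intro normal_in[OF n]) (simp only: mult_minus_left neg_less_iff_less)
    from up[OF this] have "- \<rho> * (n' \<bullet> n) \<le> K * (2 * \<rho>)\<^sup>2 + K * \<rho>\<^sup>2"
      using \<rho>(2) normal_norm(1)[OF n] by simp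
    then have "\<rho> * (- (n' \<bullet> n)) \<le> \<rho> * (5 * K * \<rho>)" by (simp add: power2_eq_square algebra_simps)
    then have "- (n' \<bullet> n) \<le> 5 * K * \<rho>" using \<rho>(2) mult_le_cancel_left_pos by blast
    then show ?thesis by simp
  qed
  assume u: "u \<bullet> n = 0"
  show "n' \<bullet> u \<le> 12 * K * \<rho> * norm u"
  proof (cases "u = 0")
    case False
    define e where "e = \<rho> / norm u"
    \<comment> \<open>The depth by which a point of the tangent plane at distance \<rho> from z has
      to be lowered to reach the interior ball. The terms K (3 \<rho>)^2, K \<rho>^2 and h add up to
      the constant 12.\<close>
    define h where "h = 2 * K * \<rho>\<^sup>2"
    have nu: "norm (e *\<^sub>R u) = \<rho>" "(e *\<^sub>R u) \<bullet> n = 0" using \<rho>(2) False u by (auto simp: e_def)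
    have h: "0 < h" "h < \<rho>" using K\<rho> K_pos \<rho>(2) mult_strict_right_mono[of "2*K*\<rho>" 1 \<rho>]
      by (auto simp: h_def power2_eq_square)
    have sq: "(norm (e *\<^sub>R u - h *\<^sub>R n))\<^sup>2 = \<rho>\<^sup>2 + h\<^sup>2"
      using norm_decomp(2)[OF normal_norm(1)[OF n] nu(2), of h] nu(1) by simp
    have "h\<^sup>2 < \<rho>\<^sup>2" using h by (simp add: power_strict_mono)
    then have "K * (\<rho>\<^sup>2 + h\<^sup>2) < h" using K_pos by (simp add: h_def)
    moreover have "n \<bullet> (e *\<^sub>R u - h *\<^sub>R n) = - h" using nu(2) nn by (simp add: inner_simps inner_commute[of n u])
    ultimately have "z + (e *\<^sub>R u - h *\<^sub>R n) \<in> \<Omega>"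
      by (intro normal_in[OF n]) (use sq in simp)
    from up[OF this] have *: "e * (n' \<bullet> u) - h * (n' \<bullet> n) \<le> K * (norm (e *\<^sub>R u - h *\<^sub>R n) + \<rho>)\<^sup>2 + K * \<rho>\<^sup>2"
      by (simp add: inner_simps)
    have "norm (e *\<^sub>R u - h *\<^sub>R n) \<le> 2 * \<rho>"
      using norm_triangle_ineq4[of "e *\<^sub>R u" "h *\<^sub>R n"] nu(1) normal_norm(1)[OF n] h by simp
    then have "K * (norm (e *\<^sub>R u - h *\<^sub>R n) + \<rho>)\<^sup>2 \<le> K * (3 * \<rho>)\<^sup>2"
      using K_pos \<rho> by (intro mult_left_mono power_mono) auto
    moreover have "h * (n' \<bullet> n) \<le> h"
      using h Cauchy_Schwarz_ineq2[of n' n] normal_norm(1)[OF n] normal_norm(1)[OF n']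
      by (simp add: mult_le_cancel_left2)
    ultimately have "e * (n' \<bullet> u) \<le> 12 * K * \<rho>\<^sup>2" using * by (simp add: h_def power2_eq_square)
    then have "\<rho> * (n' \<bullet> u) \<le> \<rho> * (12 * K * \<rho> * norm u)"
      using False by (simp add: e_def field_simps power2_eq_square)
    then show ?thesis using \<rho>(2) by (simp add: mult_le_cancel_left_pos)
  qed simp
qed

text \<open>The part u of \<open>n'\<close> orthogonal to n satisfies |u|^2 =
  \<open>n' \<bullet> u\<close> and this is at most |u| / 2, whence the square of
  \<open>n' \<bullet> n\<close> is at least 3/4. The crude lower bound -5/24 excludes the negative
  root.\<close>

lemma normals_inner:
  assumes n: "normal z n" and n': "normal z' n'" and \<rho>: "norm (z - z') \<le> \<rho>" "0 < \<rho>" "24 * K * \<rho> \<le> 1"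
  shows "n' \<bullet> n \<ge> 1 / 2"
proof -
  have \<rho>2: "\<rho> < 1 / (2 * K)" using \<rho> K_pos by (simp add: field_simps)
  note close = normals_close[OF n n' \<rho>(1,2) \<rho>2]
  define a where "a = n' \<bullet> n"
  define u where "u = n' - a *\<^sub>R n"
  have nn: "n \<bullet> n = 1" "n' \<bullet> n' = 1" using normal_norm[OF n] normal_norm[OF n'] by auto
  have un: "u \<bullet> n = 0" by (simp add: u_def a_def inner_simps nn)
  have uu: "n' \<bullet> u = (norm u)\<^sup>2" "(norm u)\<^sup>2 = 1 - a\<^sup>2"
    unfolding power2_norm_eq_inner
    by (simp_all add: u_def a_def inner_simps nn power2_eq_square inner_commute[of n n'])
  have "(norm u)\<^sup>2 \<le> 1 / 2 * norm u"
  proof -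
    have "12 * K * \<rho> * norm u \<le> 1 / 2 * norm u" using \<rho> by (intro mult_right_mono) auto
    then show ?thesis using close(1)[OF un] uu by simp
  qed
  have "\<not> norm u > 1/2"
  proof
    assume "norm u > 1/2"
    then have "1/2 * norm u < norm u * norm u" by (intro mult_strict_right_mono) auto
    then show False using \<open>(norm u)\<^sup>2 \<le> 1 / 2 * norm u\<close> by (simp add: power2_eq_square)
  qed
  then have "norm u \<le> 1/2" by simp
  then have "(norm u)\<^sup>2 \<le> (1/2)\<^sup>2" by (intro power_mono) auto
  then have "a\<^sup>2 \<ge> 3/4" using uu by (simp add: power2_eq_square)
  moreover have "a \<ge> - 5 / 24" using close(2) \<rho> by (simp add: a_def)
  moreover have "a\<^sup>2 \<le> (1/2)\<^sup>2" if "\<bar>a\<bar> \<le> 1/2"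
    using power_mono[OF that, of 2] by simp
  ultimately show ?thesis unfolding a_def[symmetric] by (force simp: power2_eq_square)
qed

end

section \<open>Volumes of slabs\<close>

lemma tangential_norm_le:
  fixes n w :: "'a::real_inner"
  assumes "norm n = 1"
  shows "norm (w - (n \<bullet> w) *\<^sub>R n) \<le> norm w" "(w - (n \<bullet> w) *\<^sub>R n) \<bullet> n = 0"
proof -
  have nn: "n \<bullet> n = 1" using assms by (simp add: norm_eq_1)
  then show "(w - (n \<bullet> w) *\<^sub>R n) \<bullet> n = 0" by (simp add: inner_simps inner_commute[of w n])
  have "(w - (n \<bullet> w) *\<^sub>R n) \<bullet> (w - (n \<bullet> w) *\<^sub>R n) = w \<bullet> w - (n \<bullet> w) * (n \<bullet> w)"
    by (simp add: inner_diff_left inner_diff_right nn inner_commute[of w n])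
  also have "\<dots> \<le> w \<bullet> w" by simp
  finally show "norm (w - (n \<bullet> w) *\<^sub>R n) \<le> norm w" unfolding norm_le .
qed

lemma nat_floor_bounds:
  fixes x :: real
  assumes "1 \<le> x"
  shows "real (nat \<lfloor>x\<rfloor>) \<le> x" "x \<le> 2 * real (nat \<lfloor>x\<rfloor>)"
proof -
  have 1: "1 \<le> \<lfloor>x\<rfloor>" using assms by simp
  then have 2: "real (nat \<lfloor>x\<rfloor>) = of_int \<lfloor>x\<rfloor>" by (intro of_nat_nat) linarith
  show "real (nat \<lfloor>x\<rfloor>) \<le> x" "x \<le> 2 * real (nat \<lfloor>x\<rfloor>)"
    unfolding 2 using 1 by linarith+
qed

lemma nat_ceiling_bounds:
  fixes x :: real
  assumes "1 \<le> x"
  shows "2 * x \<le> real (nat \<lceil>2 * x\<rceil>)" "real (nat \<lceil>2 * x\<rceil>) + 1 \<le> 4 * x"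
proof -
  have "0 \<le> \<lceil>2 * x\<rceil>" using assms by linarith
  then have 2: "real (nat \<lceil>2 * x\<rceil>) = of_int \<lceil>2 * x\<rceil>" by (rule of_nat_nat)
  show "2 * x \<le> real (nat \<lceil>2 * x\<rceil>)" "real (nat \<lceil>2 * x\<rceil>) + 1 \<le> 4 * x"
    unfolding 2 using assms by linarith+
qed

text \<open>A packing argument: the translates by 2 i \<mu> n with i < M, where M is about t /
  \<mu>, occupy disjoint ranges of heights and stay in \<open>cball \<xi> (3 * t)\<close>. This
  gives the volume without coordinates adapted to n.\<close>

lemma slab_measure_upper:
  fixes n \<xi> :: "'a::euclidean_space"
  assumes n: "norm n = 1" and l: "0 < \<mu>" "\<mu> \<le> t"
  shows "t * measure lebesgue {w \<in> cball \<xi> t. a \<le> n \<bullet> w \<and> n \<bullet> w \<le> a + \<mu>}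
    \<le> 2 * 3 ^ DIM('a) * unit_ball_vol DIM('a) * \<mu> * t ^ DIM('a)"
proof -
  define E where "E = {w \<in> cball \<xi> t. a \<le> n \<bullet> w \<and> n \<bullet> w \<le> a + \<mu>}"
  have nn: "n \<bullet> n = 1" using n by (simp add: norm_eq_1)
  have "E = cball \<xi> t \<inter> ({w. a \<le> n \<bullet> w} \<inter> {w. n \<bullet> w \<le> a + \<mu>})" by (auto simp: E_def)
  moreover have "compact \<dots>"
    by (intro compact_Int_closed compact_cball closed_Int closed_halfspace_le closed_halfspace_ge)
  ultimately have E: "compact E" by simp
  define M where "M = nat \<lfloor>t / \<mu>\<rfloor>"
  have ge1: "t / \<mu> \<ge> 1" using l by simp
  note M = nat_floor_bounds[OF ge1, folded M_def]
  define F where "F i = (+) ((2 * real i * \<mu>) *\<^sub>R n) ` E" for i :: nat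
  have F: "F i \<in> fmeasurable lebesgue" "measure lebesgue (F i) = measure lebesgue E" for i
    unfolding F_def using compact_translation[OF E]
    by (simp_all add: measure_translation lmeasurable_compact)
  have disj: "disjnt (F i) (F j)" if "i \<noteq> j" for i j
  proof -
    have loc: "2 * real i * \<mu> + a \<le> n \<bullet> w" "n \<bullet> w \<le> 2 * real i * \<mu> + a + \<mu>" if "w \<in> F i" for w i
      using that by (auto simp: F_def E_def inner_add_right nn)
    have gap: "2 * real j * \<mu> \<ge> 2 * real i * \<mu> + 2 * \<mu>" if "i < j" for i j :: nat
    proof -
      have "real i + 1 \<le> real j" using that by linarith
      then have "(real i + 1) * (2 * \<mu>) \<le> real j * (2 * \<mu>)" using l by (intro mult_right_mono) auto
      then show ?thesis by (simp add: algebra_simps)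
    qed
    have *: "False" if "i < j" "w \<in> F i" "w \<in> F j" for i j w
      using loc(2)[OF that(2)] loc(1)[OF that(3)] gap[OF that(1)] l by linarith
    show ?thesis using *[of i j] *[of j i] \<open>i \<noteq> j\<close> unfolding disjnt_iff nat_neq_iff by blast
  qed
  have sub: "(\<Union>i<M. F i) \<subseteq> cball \<xi> (3 * t)"
  proof clarify
    fix i w assume "i < M" "w \<in> F i"
    then obtain e where e: "e \<in> cball \<xi> t" "w = (2 * real i * \<mu>) *\<^sub>R n + e" by (auto simp: F_def E_def)
    have "real i * \<mu> \<le> t"
    proof -
      have "real i * \<mu> \<le> (t / \<mu>) * \<mu>" using \<open>i < M\<close> M l by (intro mult_right_mono) auto
      then show ?thesis using l by simp
    qed
    then have "norm (w - e) \<le> 2 * t" using e(2) n l by simp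
    then have "dist e w \<le> 2 * t" by (simp add: dist_norm norm_minus_commute)
    then show "w \<in> cball \<xi> (3 * t)" using e(1) dist_triangle[of \<xi> w e] by simp
  qed
  have "real M * measure lebesgue E = (\<Sum>i<M. measure lebesgue (F i))" by (simp add: F(2))
  also have "\<dots> = measure lebesgue (\<Union>i<M. F i)"
    by (rule measure_UNION'[symmetric]) (use F disj in \<open>auto simp: pairwise_def\<close>)
  also have "\<dots> \<le> measure lebesgue (cball \<xi> (3 * t))"
    by (intro measure_mono_fmeasurable sub) (use F in \<open>auto intro!: sets.finite_UN simp: fmeasurableD\<close>)
  also have "\<dots> = unit_ball_vol DIM('a) * (3 * t) ^ DIM('a)"
    using l by (simp add: measure_completion content_cball)
  finally have *: "real M * measure lebesgue E \<le> unit_ball_vol DIM('a) * (3 * t) ^ DIM('a)" .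
  have "t \<le> 2 * \<mu> * real M" using M(2) l by (simp add: field_simps)
  then have "t * measure lebesgue E \<le> (2 * \<mu>) * (real M * measure lebesgue E)"
    using mult_right_mono[of t "2 * \<mu> * real M" "measure lebesgue E"] by (simp add: mult.assoc)
  also have "\<dots> \<le> (2 * \<mu>) * (unit_ball_vol DIM('a) * (3 * t) ^ DIM('a))"
    using l by (intro mult_left_mono *) auto
  finally show ?thesis by (simp add: E_def power_mult_distrib mult_ac)
qed

lemma slab_compact:
  fixes n :: "'a::euclidean_space"
  assumes n: "norm n = 1"
  shows "compact {w. norm (w - (n \<bullet> w) *\<^sub>R n) \<le> t \<and> a \<le> n \<bullet> w \<and> n \<bullet> w \<le> a + \<mu>}" (is "compact ?S")
proof -
  have "norm w \<le> t + \<bar>a\<bar> + \<bar>\<mu>\<bar>" if "w \<in> ?S" for w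
  proof -
    have "norm w \<le> norm (w - (n \<bullet> w) *\<^sub>R n) + norm ((n \<bullet> w) *\<^sub>R n)"
      using norm_triangle_ineq[of "w - (n \<bullet> w) *\<^sub>R n" "(n \<bullet> w) *\<^sub>R n"] by simp
    moreover have "\<bar>n \<bullet> w\<bar> \<le> \<bar>a\<bar> + \<bar>\<mu>\<bar>" using that by auto
    ultimately show ?thesis using that n by auto
  qed
  then have "bounded ?S" unfolding bounded_iff by blast
  moreover have "closed ?S"
    by (intro closed_Collect_conj closed_Collect_le continuous_intros)
  ultimately show ?thesis using compact_eq_bounded_closed by blast
qed

text \<open>The covering counterpart of the packing argument: about 2 t / \<mu> translates of the
  cylinder, spaced by its height \<mu>, cover the ball of radius t. The base height a is arbitrary,
  which allows cylinders pushed away from the tangent plane.\<close>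

lemma slab_measure_lower:
  fixes n :: "'a::euclidean_space"
  assumes n: "norm n = 1" and l: "0 < \<mu>" "\<mu> \<le> t"
  shows "unit_ball_vol DIM('a) * \<mu> * t ^ DIM('a) \<le>
     4 * t * measure lebesgue {w. norm (w - (n \<bullet> w) *\<^sub>R n) \<le> t \<and> a \<le> n \<bullet> w \<and> n \<bullet> w \<le> a + \<mu>}"
proof -
  define S where "S = {w. norm (w - (n \<bullet> w) *\<^sub>R n) \<le> t \<and> a \<le> n \<bullet> w \<and> n \<bullet> w \<le> a + \<mu>}"
  have nn: "n \<bullet> n = 1" using n by (simp add: norm_eq_1)
  have S: "compact S" unfolding S_def by (rule slab_compact[OF n])
  define M where "M = nat \<lceil>2 * (t / \<mu>)\<rceil>"
  have ge1: "t / \<mu> \<ge> 1" using l by simp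
  note M = nat_ceiling_bounds[OF ge1, folded M_def]
  define F where "F i = (+) ((real i * \<mu> - t - a) *\<^sub>R n) ` S" for i :: nat
  have F: "F i \<in> fmeasurable lebesgue" "measure lebesgue (F i) = measure lebesgue S" for i
    unfolding F_def using compact_translation[OF S]
    by (simp_all add: measure_translation lmeasurable_compact)
  have sub: "cball 0 t \<subseteq> (\<Union>i\<le>M. F i)"
  proof
    fix w :: 'a assume "w \<in> cball 0 t"
    then have w: "norm w \<le> t" by simp
    then have nw: "\<bar>n \<bullet> w\<bar> \<le> t" using Cauchy_Schwarz_ineq2[of n w] n by simp
    define i where "i = nat \<lfloor>(n \<bullet> w + t) / \<mu>\<rfloor>"
    have nonneg: "(n \<bullet> w + t) / \<mu> \<ge> 0" using nw l by simp
    then have i: "real i \<le> (n \<bullet> w + t) / \<mu>" "(n \<bullet> w + t) / \<mu> \<le> real i + 1" unfolding i_def by linarith+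
    have i': "real i * \<mu> \<le> n \<bullet> w + t" "n \<bullet> w + t \<le> real i * \<mu> + \<mu>"
      using i l by (simp_all add: pos_le_divide_eq pos_divide_le_eq algebra_simps)
    have "(n \<bullet> w + t) / \<mu> \<le> (2 * t) / \<mu>" using nw l by (intro divide_right_mono) auto
    then have "i \<le> M" using i(1) M(1) by simp
    define w' where "w' = w - (real i * \<mu> - t - a) *\<^sub>R n"
    have hw: "n \<bullet> w' = n \<bullet> w - (real i * \<mu> - t - a)" by (simp add: w'_def inner_simps nn)
    have "w' - (n \<bullet> w') *\<^sub>R n = w - (n \<bullet> w) *\<^sub>R n" unfolding hw by (simp add: w'_def algebra_simps)
    then have "w' \<in> S" using hw i' tangential_norm_le(1)[OF n, of w] w by (simp add: S_def)
    moreover have "w = (real i * \<mu> - t - a) *\<^sub>R n + w'" by (simp add: w'_def)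
    ultimately have "w \<in> F i" unfolding F_def by blast
    then show "w \<in> (\<Union>i\<le>M. F i)" using \<open>i \<le> M\<close> by blast
  qed
  have t: "t > 0" using l by simp
  have "unit_ball_vol DIM('a) * t ^ DIM('a) = measure lebesgue (cball (0::'a) t)"
    using t by (simp add: measure_completion content_cball)
  also have "\<dots> \<le> measure lebesgue (\<Union>i\<le>M. F i)"
    by (intro measure_mono_fmeasurable sub) (use F in \<open>auto intro!: fmeasurable.finite_UN\<close>)
  also have "\<dots> \<le> (\<Sum>i\<le>M. measure lebesgue (F i))"
    by (intro measure_UNION_le) (use F in \<open>auto simp: fmeasurableD\<close>)
  also have "\<dots> = (real M + 1) * measure lebesgue S" by (simp add: F(2))
  also have "\<dots> \<le> 4 * (t / \<mu>) * measure lebesgue S" by (intro mult_right_mono M) auto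
  finally have "\<mu> * (unit_ball_vol DIM('a) * t ^ DIM('a)) \<le> \<mu> * (4 * (t / \<mu>) * measure lebesgue S)"
    using l by (intro mult_left_mono) auto
  then show ?thesis using l by (simp add: S_def mult_ac)
qed

text \<open>Turns bounds for the distance to the boundary into bounds for its square root, as
  \<open>rho\<close> requires. If the roots differed by more than (2 C + 1) t, then t and
  \<open>sqrt b\<close> would both be at most \<open>sqrt a + sqrt b\<close>, and dividing the
  hypothesis by this sum gives a difference of at most 2 C t.\<close>

lemma sqrt_diff_le:
  assumes "0 \<le> a" "0 \<le> b" "0 \<le> C" "0 < t" "\<bar>a - b\<bar> \<le> C * (t\<^sup>2 + t * sqrt b)"
  shows "\<bar>sqrt a - sqrt b\<bar> \<le> (2 * C + 1) * t"
proof (rule ccontr)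
  define D where "D = \<bar>sqrt a - sqrt b\<bar>"
  assume "\<not> \<bar>sqrt a - sqrt b\<bar> \<le> (2 * C + 1) * t"
  then have D: "D > (2 * C + 1) * t" by (simp add: D_def)
  have "a - b = (sqrt a - sqrt b) * (sqrt a + sqrt b)" using assms by (simp add: algebra_simps)
  then have eq: "\<bar>a - b\<bar> = D * (sqrt a + sqrt b)" using assms(1,2) by (simp add: D_def abs_mult)
  have "(2 * C + 1) * t = 2 * (C * t) + t" "0 \<le> C * t" using assms by (simp_all add: algebra_simps)
  then have Dt: "D > t" using D by linarith
  have sab: "D \<le> sqrt a + sqrt b" "sqrt b \<le> sqrt a + sqrt b"
    using real_sqrt_ge_zero[OF assms(1)] real_sqrt_ge_zero[OF assms(2)] unfolding D_def by linarith+
  have "(2 * C + 1) * t * (sqrt a + sqrt b) \<le> D * (sqrt a + sqrt b)"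
    using D assms by (intro mult_right_mono) auto
  moreover have "C * (t * t + t * sqrt b) \<le> C * (t * (sqrt a + sqrt b) + t * (sqrt a + sqrt b))"
    using assms sab Dt by (intro mult_left_mono add_mono) auto
  ultimately have "(2 * C + 1) * t * (sqrt a + sqrt b) \<le> 2 * C * t * (sqrt a + sqrt b)"
    using eq assms(5) by (simp add: power2_eq_square algebra_simps)
  then have "t * (sqrt a + sqrt b) \<le> 0" by (simp add: algebra_simps)
  moreover have "t * (sqrt a + sqrt b) > 0" using sab Dt assms(4) by (intro mult_pos_pos) auto
  ultimately show False by simp
qed

lemma rho_ball_compact:
  fixes \<Omega> :: "'a::euclidean_space set"
  assumes "compact \<Omega>"
  shows "compact (rho_ball \<Omega> \<xi> t)"
proof -
  have "rho_ball \<Omega> \<xi> t = \<Omega> \<inter> {\<eta>. rho \<Omega> \<xi> \<eta> \<le> t}" by (auto simp: rho_ball_def)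
  moreover have "closed {\<eta>. rho \<Omega> \<xi> \<eta> \<le> t}" unfolding rho_def
    by (intro closed_Collect_le continuous_intros)
  ultimately show ?thesis using compact_Int_closed[OF assms] by simp
qed

section \<open>Volume of the balls of the boundary-adapted metric\<close>

context two_ball
begin

text \<open>Second-order comparison of \<open>dl\<close> with an affine function: near x the
  distance to the boundary is the depth below the tangent plane at the nearest point z. As x lies on
  the normal through z, the tangential part of w - z is that of w - x, so the error is controlled by
  \<rho> alone and not by \<open>dl x\<close>.\<close>

lemma dl_height:
  assumes x: "x \<in> \<Omega>" and z: "dl x = norm (x - z)" and n: "normal z n"
    and w: "w \<in> \<Omega>" and \<rho>: "norm (w - x) \<le> \<rho>" "\<rho> \<le> 1 / (8 * K)" and d: "dl x \<le> 1 / (8 * K)"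
  shows "\<bar>dl w - n \<bullet> (z - w)\<bar> \<le> 6 * K * \<rho>\<^sup>2"
proof -
  have n1: "norm n = 1" and nn: "n \<bullet> n = 1" using normal_norm[OF n] by auto
  define d' where "d' = dl x"
  have xz: "x = z - d' *\<^sub>R n" unfolding d'_def by (rule nearest_normal[OF x z n])
  define k where "k = n \<bullet> (z - w)"
  define v where "v = (w - z) - (n \<bullet> (w - z)) *\<^sub>R n"
  have weq: "w = z + v - k *\<^sub>R n" by (simp add: v_def k_def algebra_simps inner_diff_right)
  have vn: "v \<bullet> n = 0" unfolding v_def by (rule tangential_norm_le(2)[OF n1])
  have "v = (w - x) - (n \<bullet> (w - x)) *\<^sub>R n"
    unfolding v_def xz by (simp add: inner_diff_right nn algebra_simps)
  then have "norm v \<le> norm (w - x)" using tangential_norm_le(1)[OF n1, of "w - x"] by (simp only:)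
  then have v: "norm v \<le> \<rho>" using \<rho>(1) by linarith
  have kd: "k - d' = n \<bullet> (x - w)" unfolding k_def xz by (simp add: inner_diff_right nn)
  have "\<bar>n \<bullet> (x - w)\<bar> \<le> \<rho>"
    using Cauchy_Schwarz_ineq2[of n "x - w"] n1 \<rho>(1) by (simp add: norm_minus_commute)
  then have "\<bar>k\<bar> \<le> \<rho> + d'" using kd dl_nonneg[of x] unfolding d'_def by linarith
  moreover have 4: "1 / (8 * K) + 1 / (8 * K) = 1 / (4 * K)" using K_pos by (simp add: field_simps)
  ultimately have k: "\<bar>k\<bar> \<le> 1 / (4 * K)" using \<rho>(2) d unfolding d'_def by linarith
  have "1 / (8 * K) < 1 / (2 * K)" using K_pos by (simp add: field_simps)
  then have "norm v < 1 / (2 * K)" using v \<rho>(2) by linarith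
  from dl_approx[OF n vn this k] have "\<bar>dl w - k\<bar> \<le> 6 * K * (norm v)\<^sup>2"
    using w unfolding weq[symmetric] .
  also have "\<dots> \<le> 6 * K * \<rho>\<^sup>2" using v K_pos by (intro mult_left_mono power_mono) auto
  finally show ?thesis by (simp add: k_def)
qed

text \<open>Close to the boundary the ball lies in a slab: a change of the root by t changes
  \<open>dl\<close> by at most t (t + 2 s), and \<open>dl\<close> is a height up to 6 K t^2. If t +
  s is bounded below, the volume of a Euclidean ball of radius t is already of the claimed
  size.\<close>

lemma rho_ball_measure_upper:
  obtains C where "C > 0"
    "\<And>\<xi> t. \<xi> \<in> \<Omega> \<Longrightarrow> t > 0 \<Longrightarrow> measure lebesgue (rho_ball \<Omega> \<xi> t) \<le> C * t ^ DIM('a) * (t + sqrt (dl \<xi>))"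
proof -
  define \<omega> where "\<omega> = unit_ball_vol (DIM('a))"
  have \<omega>: "\<omega> > 0" by (simp add: \<omega>_def)
  define D where "D = 2 * (6 * K + 3)"
  have D: "D > 0" using K_pos by (simp add: D_def)
  define c1 where "c1 = min (1 / (8 * K)) (sqrt (1 / (8 * K)))"
  have c1: "c1 > 0" using K_pos by (simp add: c1_def)
  define C where "C = \<omega> / c1 + (\<omega> + 2 * 3 ^ DIM('a) * \<omega>) * D"
  have "C > 0" using \<omega> c1 D by (simp add: C_def add_pos_pos)
  moreover have "measure lebesgue (rho_ball \<Omega> \<xi> t) \<le> C * t ^ DIM('a) * (t + sqrt (dl \<xi>))"
    if \<xi>: "\<xi> \<in> \<Omega>" and t: "t > 0" for \<xi> t
  proof -
    define s where "s = sqrt (dl \<xi>)"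
    have s: "s \<ge> 0" "s\<^sup>2 = dl \<xi>" by (simp_all add: s_def)
    have meas: "rho_ball \<Omega> \<xi> t \<in> fmeasurable lebesgue"
      using rho_ball_compact[OF compact] lmeasurable_compact by blast
    have Uball: "rho_ball \<Omega> \<xi> t \<subseteq> cball \<xi> t"
      by (auto simp: rho_ball_def rho_def dist_norm)
    have "measure lebesgue (rho_ball \<Omega> \<xi> t) \<le> measure lebesgue (cball \<xi> t)"
      by (intro measure_mono_fmeasurable Uball) (use meas in \<open>auto simp: fmeasurableD\<close>)
    also have "\<dots> = \<omega> * t ^ DIM('a)" using t by (simp add: measure_completion content_cball \<omega>_def)
    finally have triv: "measure lebesgue (rho_ball \<Omega> \<xi> t) \<le> \<omega> * t ^ DIM('a)" .
    consider "t + s \<ge> c1" | "t + s < c1" by linarith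
    then show ?thesis
    proof cases
      case 1
      have "\<omega> * t ^ DIM('a) = \<omega> / c1 * t ^ DIM('a) * c1" using c1 by simp
      also have "\<dots> \<le> C * t ^ DIM('a) * (t + s)" using 1 c1 \<omega> t D s
        by (intro mult_mono) (auto simp: C_def add_nonneg_nonneg)
      finally show ?thesis using triv by (simp add: s_def)
    next
      case 2
      have sm: "t < 1 / (8 * K)" "s < sqrt (1 / (8 * K))" using 2 s t by (auto simp: c1_def)
      have d8: "dl \<xi> < 1 / (8 * K)" using sm(2) by (simp add: s_def)
      obtain z where z: "z \<in> frontier \<Omega>" "dl \<xi> = norm (\<xi> - z)" using nearest_point .
      obtain n where n: "normal z n" using normal_exists[OF z(1)] by blast
      have \<xi>z: "\<xi> = z - dl \<xi> *\<^sub>R n" by (rule nearest_normal[OF \<xi> z(2) n])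
      have nn: "n \<bullet> n = 1" and n1: "norm n = 1" using normal_norm[OF n] by auto
      define \<mu> where "\<mu> = t * ((6 * K + 3) * (t + s))"
      have sub: "rho_ball \<Omega> \<xi> t \<subseteq> {w \<in> cball \<xi> t. (n \<bullet> z - dl \<xi> - \<mu>) \<le> n \<bullet> w \<and> n \<bullet> w \<le> (n \<bullet> z - dl \<xi> - \<mu>) + 2 * \<mu>}"
      proof
        fix \<eta> assume \<eta>: "\<eta> \<in> rho_ball \<Omega> \<xi> t"
        then have \<eta>\<Omega>: "\<eta> \<in> \<Omega>" and sum: "norm (\<xi> - \<eta>) + \<bar>s - sqrt (dl \<eta>)\<bar> \<le> t"
          by (simp_all add: rho_ball_def rho_def s_def)
        have d: "norm (\<xi> - \<eta>) \<le> t" "\<bar>s - sqrt (dl \<eta>)\<bar> \<le> t"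
          using sum norm_ge_zero[of "\<xi> - \<eta>"] by linarith+
        define k where "k = n \<bullet> (z - \<eta>)"
        have "\<bar>dl \<eta> - k\<bar> \<le> 6 * K * t\<^sup>2"
          unfolding k_def using d(1) sm(1) d8
          by (intro dl_height[OF \<xi> z(2) n \<eta>\<Omega>]) (simp_all add: norm_minus_commute)
        note 1 = this
        have "dl \<eta> - dl \<xi> = (sqrt (dl \<eta>) - s) * (sqrt (dl \<eta>) + s)"
          using s by (simp add: algebra_simps power2_eq_square)
        then have "\<bar>dl \<eta> - dl \<xi>\<bar> = \<bar>s - sqrt (dl \<eta>)\<bar> * (sqrt (dl \<eta>) + s)"
          using s by (simp add: abs_mult abs_minus_commute)
        also have "\<dots> \<le> t * (t + 2 * s)" using d(2) s t by (intro mult_mono) auto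
        finally have 2: "\<bar>dl \<eta> - dl \<xi>\<bar> \<le> t * (t + 2 * s)" .
        have "6 * K * t\<^sup>2 + t * (t + 2 * s) \<le> \<mu>"
        proof -
          have "\<mu> = 6 * K * t\<^sup>2 + 3 * t\<^sup>2 + 6 * (K * (t * s)) + 3 * (t * s)"
            by (simp add: \<mu>_def power2_eq_square algebra_simps)
          moreover have "t * (t + 2 * s) = t\<^sup>2 + 2 * (t * s)" by (simp add: power2_eq_square algebra_simps)
          moreover have "0 \<le> K * (t * s)" "0 \<le> t * s" "0 \<le> t\<^sup>2" using K_pos t s by simp_all
          ultimately show ?thesis by linarith
        qed
        then have "\<bar>k - dl \<xi>\<bar> \<le> \<mu>" using 1 2 by linarith
        moreover have "n \<bullet> \<eta> = n \<bullet> z - k" by (simp add: k_def inner_simps)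
        ultimately have "n \<bullet> z - dl \<xi> - \<mu> \<le> n \<bullet> \<eta>" "n \<bullet> \<eta> \<le> (n \<bullet> z - dl \<xi> - \<mu>) + 2 * \<mu>" by linarith+
        moreover have "\<eta> \<in> cball \<xi> t" using d(1) by (simp add: dist_norm)
        ultimately show "\<eta> \<in> {w \<in> cball \<xi> t. (n \<bullet> z - dl \<xi> - \<mu>) \<le> n \<bullet> w \<and> n \<bullet> w \<le> (n \<bullet> z - dl \<xi> - \<mu>) + 2 * \<mu>}"
          by blast
      qed
      have l0: "2 * \<mu> > 0" using t s K_pos by (simp add: \<mu>_def)
      have l2: "2 * \<mu> = t * (D * (t + s))" by (simp add: \<mu>_def D_def)
      have fin: "\<omega>' * (D * (t + s)) * t ^ DIM('a) \<le> C * t ^ DIM('a) * (t + s)"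
        if "\<omega>' \<le> \<omega> + 2 * 3 ^ DIM('a) * \<omega>" for \<omega>'
      proof -
        have "\<omega>' * D \<le> C" unfolding C_def using that D \<omega> c1
          by (intro order_trans[OF mult_right_mono[OF that]]) auto
        then have "\<omega>' * D * (t ^ DIM('a) * (t + s)) \<le> C * (t ^ DIM('a) * (t + s))"
          using t s by (intro mult_right_mono) auto
        then show ?thesis by (simp add: mult_ac)
      qed
      show ?thesis
      proof (cases "2 * \<mu> \<le> t")
        case True
        have "t * measure lebesgue (rho_ball \<Omega> \<xi> t) \<le>
            t * measure lebesgue {w \<in> cball \<xi> t. (n \<bullet> z - dl \<xi> - \<mu>) \<le> n \<bullet> w \<and> n \<bullet> w \<le> (n \<bullet> z - dl \<xi> - \<mu>) + 2 * \<mu>}"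
        proof (intro mult_left_mono measure_mono_fmeasurable sub)
          have "closed {w. (n \<bullet> z - dl \<xi> - \<mu>) \<le> n \<bullet> w \<and> n \<bullet> w \<le> (n \<bullet> z - dl \<xi> - \<mu>) + 2 * \<mu>}"
            by (intro closed_Collect_conj closed_Collect_le continuous_intros)
          from compact_Int_closed[OF compact_cball this]
          show "{w \<in> cball \<xi> t. (n \<bullet> z - dl \<xi> - \<mu>) \<le> n \<bullet> w \<and> n \<bullet> w \<le> (n \<bullet> z - dl \<xi> - \<mu>) + 2 * \<mu>} \<in> fmeasurable lebesgue"
            unfolding Int_def mem_Collect_eq by (rule lmeasurable_compact)
        qed (use meas t in \<open>auto simp: fmeasurableD\<close>)
        also have "\<dots> \<le> 2 * 3 ^ DIM('a) * \<omega> * (2 * \<mu>) * t ^ DIM('a)"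
          using slab_measure_upper[OF n1 l0 True] unfolding \<omega>_def by blast
        also have "\<dots> = t * ((2 * 3 ^ DIM('a) * \<omega>) * (D * (t + s)) * t ^ DIM('a))" unfolding l2 by simp
        finally have "measure lebesgue (rho_ball \<Omega> \<xi> t) \<le> (2 * 3 ^ DIM('a) * \<omega>) * (D * (t + s)) * t ^ DIM('a)"
          using t mult_le_cancel_left_pos by blast
        then show ?thesis using fin[of "2 * 3 ^ DIM('a) * \<omega>"] \<omega> by (simp add: s_def)
      next
        \<comment> \<open>A slab thicker than t is outside the range of
          \<open>slab_measure_upper\<close>, but then \<open>D * (t + s)\<close> is at least 1 and
          the trivial bound is enough.\<close>
        case False
        then have "t * (D * (t + s)) \<ge> t * 1" using l2 by simp
        then have "D * (t + s) \<ge> 1" using t mult_le_cancel_left_pos by blast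
        then have "\<omega> * t ^ DIM('a) * 1 \<le> \<omega> * t ^ DIM('a) * (D * (t + s))"
          using \<omega> t by (intro mult_left_mono) auto
        moreover have "\<omega> * t ^ DIM('a) * (D * (t + s)) = \<omega> * (D * (t + s)) * t ^ DIM('a)" by (simp only: mult_ac)
        moreover have "\<omega> * (D * (t + s)) * t ^ DIM('a) \<le> C * t ^ DIM('a) * (t + s)" using \<omega> by (intro fin) simp
        ultimately show ?thesis using triv unfolding s_def[symmetric] by linarith
      qed
    qed
  qed
  ultimately show ?thesis using that by blast
qed

end

section \<open>Shifts that keep segments inside the domain\<close>

context two_ball
begin

text \<open>At the infimum a of the parameters outside \<open>\<Omega>\<close> the point still lies
  in the closed set \<open>\<Omega>\<close>, while exits occur arbitrarily soon after a. If
  \<open>n \<bullet> s\<close> were negative, the ray would run inside the interior ball for a while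
  after a.\<close>

lemma exit_point:
  assumes p: "p \<in> \<Omega>" and \<sigma>: "0 \<le> \<sigma>" "p + \<sigma> *\<^sub>R s \<notin> \<Omega>"
  obtains \<sigma>' where "0 \<le> \<sigma>'" "\<sigma>' \<le> \<sigma>" "p + \<sigma>' *\<^sub>R s \<in> frontier \<Omega>"
    "\<And>n. normal (p + \<sigma>' *\<^sub>R s) n \<Longrightarrow> n \<bullet> s \<ge> 0"
proof -
  define T where "T = {\<tau> \<in> {0..\<sigma>}. p + \<tau> *\<^sub>R s \<notin> \<Omega>}"
  have T: "T \<noteq> {}" "bdd_below T" using \<sigma> by (auto simp: T_def intro!: bdd_belowI[of _ 0])
  define a where "a = Inf T"
  have lower: "a \<le> \<tau>" if "\<tau> \<in> T" for \<tau> unfolding a_def using that T(2) by (rule cInf_lower)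
  have a: "0 \<le> a" "a \<le> \<sigma>"
    using lower[of \<sigma>] \<sigma> unfolding a_def by (auto simp: T_def intro!: cInf_greatest)
  have in_a: "p + a *\<^sub>R s \<in> \<Omega>"
  proof (rule ccontr)
    assume out: "p + a *\<^sub>R s \<notin> \<Omega>"
    then have "a > 0" using p a(1) by (cases "a = 0") auto
    have "open ((\<lambda>\<tau>. p + \<tau> *\<^sub>R s) -` (- \<Omega>))"
      by (intro open_vimage continuous_intros) (use closed in \<open>simp add: open_Compl\<close>)
    moreover have "a \<in> (\<lambda>\<tau>. p + \<tau> *\<^sub>R s) -` (- \<Omega>)" using out by simp
    ultimately obtain e where e: "e > 0" "ball a e \<subseteq> (\<lambda>\<tau>. p + \<tau> *\<^sub>R s) -` (- \<Omega>)"
      using open_contains_ball by metis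
    define b where "b = max (a / 2) (a - e / 2)"
    have b: "0 \<le> b" "b < a" "b \<in> ball a e" using \<open>a > 0\<close> e(1) by (auto simp: b_def dist_real_def)
    then have "b \<in> T" using e(2) a by (auto simp: T_def)
    then show False using lower[of b] b by simp
  qed
  have near: "\<exists>\<tau>. a < \<tau> \<and> \<tau> < a + e \<and> p + \<tau> *\<^sub>R s \<notin> \<Omega>" if "e > 0" for e
  proof -
    have "\<exists>\<tau>\<in>T. \<tau> < a + e"
      using cInf_lessD[of T "a + e"] T(1) that unfolding a_def by force
    then obtain \<tau> where \<tau>: "\<tau> \<in> T" "\<tau> < a + e" by blast
    have "\<tau> \<noteq> a" using in_a \<tau>(1) by (auto simp: T_def)
    then show ?thesis using \<tau> lower[OF \<tau>(1)] by (intro exI[of _ \<tau>]) (auto simp: T_def)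
  qed
  have fr: "p + a *\<^sub>R s \<in> frontier \<Omega>"
  proof (rule ccontr)
    assume "p + a *\<^sub>R s \<notin> frontier \<Omega>"
    then have "a \<in> (\<lambda>\<tau>. p + \<tau> *\<^sub>R s) -` interior \<Omega>"
      using in_a closure_subset by (auto simp: frontier_def)
    moreover have "open ((\<lambda>\<tau>. p + \<tau> *\<^sub>R s) -` interior \<Omega>)"
      by (intro open_vimage continuous_intros) simp
    ultimately obtain e where e: "e > 0" "ball a e \<subseteq> (\<lambda>\<tau>. p + \<tau> *\<^sub>R s) -` interior \<Omega>"
      using open_contains_ball by metis
    obtain \<tau> where \<tau>: "a < \<tau>" "\<tau> < a + e" "p + \<tau> *\<^sub>R s \<notin> \<Omega>" using near[OF e(1)] by blast
    then have "\<tau> \<in> ball a e" by (simp add: dist_real_def)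
    then show False using e(2) \<tau>(3) interior_subset by blast
  qed
  have "n \<bullet> s \<ge> 0" if n: "normal (p + a *\<^sub>R s) n" for n
  proof (rule ccontr)
    assume "\<not> n \<bullet> s \<ge> 0"
    then have neg: "n \<bullet> s < 0" by simp
    define X where "X = K * (norm s)\<^sup>2 + 1"
    have X: "X > 0" using K_pos by (simp add: X_def add_nonneg_pos)
    \<comment> \<open>For parameter increments h < e one has h K |s|^2 < -
      \<open>n \<bullet> s\<close>, which is the condition for the interior ball.\<close>
    define e where "e = (- (n \<bullet> s)) / X"
    have e: "e > 0" unfolding e_def by (rule divide_pos_pos) (use neg X in simp_all)
    obtain \<tau> where \<tau>: "a < \<tau>" "\<tau> < a + e" "p + \<tau> *\<^sub>R s \<notin> \<Omega>" using near[OF e] by blast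
    define h where "h = \<tau> - a"
    have h: "0 < h" "h < e" using \<tau> by (auto simp: h_def)
    have diff: "p + \<tau> *\<^sub>R s - (p + a *\<^sub>R s) = h *\<^sub>R s" by (simp add: h_def algebra_simps)
    have "h * X < - (n \<bullet> s)" using h(2) X unfolding e_def by (simp only: pos_less_divide_eq)
    moreover have "h * (K * (norm s)\<^sup>2) \<le> h * X" using h by (simp add: X_def)
    ultimately have "h * (K * (norm s)\<^sup>2) < - (n \<bullet> s)" by linarith
    then have "h * (h * (K * (norm s)\<^sup>2)) < h * (- (n \<bullet> s))" using h by (intro mult_strict_left_mono) auto
    then have "n \<bullet> (h *\<^sub>R s) < - K * (norm (h *\<^sub>R s))\<^sup>2"
      by (simp add: power_mult_distrib power2_eq_square algebra_simps)
    then have "p + \<tau> *\<^sub>R s \<in> \<Omega>" by (intro normal_in[OF n]) (simp only: diff)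
    then show False using \<tau>(3) by simp
  qed
  then show ?thesis using that[OF a fr] by blast
qed

lemma dl_bounded: obtains D where "D > 0" "\<And>x. x \<in> \<Omega> \<Longrightarrow> dl x \<le> D"
proof -
  obtain B where B: "\<And>x. x \<in> \<Omega> \<Longrightarrow> norm x \<le> B"
    using compact_imp_bounded[OF compact] unfolding bounded_iff by blast
  obtain z where z: "z \<in> frontier \<Omega>" using frontier_nonempty by blast
  have "dl x \<le> \<bar>2 * B\<bar> + 1" if "x \<in> \<Omega>" for x
  proof -
    have "norm z \<le> B" using z frontier_subset B by blast
    then show ?thesis using dl_le[OF z, of x] norm_triangle_ineq4[of x z] B[OF that] by linarith
  qed
  then show ?thesis using that[of "\<bar>2 * B\<bar> + 1"] by auto
qed

text \<open>Far from the boundary a ball of shifts of radius t serves. Near it the shifts have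
  tangential part at most t and inward component between A t^2 and A t^2 + t (t +
  \<open>sqrt (dl x)\<close>). The offset A t^2 outweighs the turning of the normal on the scale t,
  so no ray in such a direction can exit, and the total inward component changes \<open>dl\<close>
  only by the allowed amount. One set has to serve all base points p near x and all multiples up to
  \<open>R\<^sup>2\<close>, because the perturbation identity uses several of them at once.\<close>

lemma push_set:
  assumes R: "R \<ge> 1"
  obtains t0 c1 c2 where "t0 > 0" "c1 > 0" "c2 > 0"
    "\<And>x t. x \<in> \<Omega> \<Longrightarrow> 0 < t \<Longrightarrow> t \<le> t0 \<Longrightarrow> \<exists>S. compact S \<and>
       c1 * t ^ DIM('a) * (t + sqrt (dl x)) \<le> measure lebesgue S \<and>
       (\<forall>s\<in>S. norm s \<le> 3 * t \<and> (\<forall>p\<in>\<Omega>. \<forall>\<sigma>\<in>{0..R\<^sup>2}. norm (p - x) \<le> R * t \<longrightarrow>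
          p + \<sigma> *\<^sub>R s \<in> \<Omega> \<and> \<bar>dl (p + \<sigma> *\<^sub>R s) - dl p\<bar> \<le> c2 * (t\<^sup>2 + t * sqrt (dl x))))"
proof -
  obtain Dm where Dm: "Dm > 0" "\<And>x. x \<in> \<Omega> \<Longrightarrow> dl x \<le> Dm" using dl_bounded by blast
  define \<omega> where "\<omega> = unit_ball_vol (DIM('a))"
  have \<omega>: "\<omega> > 0" by (simp add: \<omega>_def)
  \<comment> \<open>All points visited stay within 4 R^2 t of x, so an exit point and the foot z of
    x are at most C1 t apart. At the exit the tangential part of a shift contributes at most 12 K C1
    t^2 to the outward component, the offset at most - A t^2 / 2; A is chosen so that the sum is -
    t^2 / 2.\<close>
  define C1 where "C1 = 8 * R\<^sup>2"
  define A where "A = 24 * (K * C1) + 1"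
  define d0 where "d0 = min (1 / 4) (1 / (8 * K))"
  \<comment> \<open>The four bounds give, in order: thickness at most t (with
    \<open>d0 \<le> 1 / 4\<close>), offset A t^2 at most t, applicability of
    \<open>normals_inner\<close>, and displacements that stay in the range of
    \<open>dl_height\<close> or, far from the boundary, in the ball of radius
    \<open>dl x\<close>.\<close>
  define t0 where "t0 = min (min (1 / 2) (1 / A)) (min (1 / (24 * (K * C1))) (d0 / (8 * R\<^sup>2)))"
  \<comment> \<open>One constant for each case: the volume of the slab near the boundary, and the
    volume of a ball where t + \<open>sqrt (dl x)\<close> is at most
    \<open>1 / 2 + sqrt Dm\<close>.\<close>
  define c1 where "c1 = min (\<omega> / 4) (\<omega> / (1 / 2 + sqrt Dm))"
  define c2 where "c2 = R\<^sup>2 * (A + 1) + 102 * (K * R ^ 4) + R\<^sup>2 / sqrt d0"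
  have R2: "R \<le> R\<^sup>2" "1 \<le> R\<^sup>2" "R\<^sup>2 \<le> R ^ 4"
    using R power_increasing[of 1 2 R] power_increasing[of 0 2 R] power_increasing[of 2 4 R] by auto
  have C1: "C1 > 0" "C1 \<ge> 8" using R2 by (auto simp: C1_def)
  have KC: "K * C1 > 0" using K_pos C1 by simp
  have A: "A > 0" using KC by (simp add: A_def)
  have d0: "0 < d0" "d0 \<le> 1 / 4" "d0 \<le> 1 / (8 * K)" using K_pos by (auto simp: d0_def)
  have R20: "0 < R\<^sup>2" using R2(2) by linarith
  have "0 < d0 / (8 * R\<^sup>2)" by (intro divide_pos_pos) (use d0 R20 in simp_all)
  then have t0: "t0 > 0" using A KC by (simp add: t0_def)
  have sD: "1 / 2 + sqrt Dm > 0" using Dm by (simp add: add_pos_pos)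
  have c1: "c1 > 0" using \<omega> sD by (simp add: c1_def)
  have sd0: "sqrt d0 > 0" using d0 by simp
  have c2_parts: "0 < R\<^sup>2 * (A + 1)" "0 < 102 * (K * R ^ 4)" "0 < R\<^sup>2 / sqrt d0"
    using R2 A K_pos sd0 R by simp_all
  then have c2: "c2 > 0" unfolding c2_def by linarith
  show ?thesis
  proof (rule that[OF t0 c1 c2])
    fix x t assume x: "x \<in> \<Omega>" and t: "0 < t" "t \<le> t0"
    define q where "q = sqrt (dl x)"
    have q: "0 \<le> q" "q\<^sup>2 = dl x" by (simp_all add: q_def)
    have tb: "t \<le> 1 / 2" "t \<le> 1 / A" "t \<le> 1 / (24 * (K * C1))" "t \<le> d0 / (8 * R\<^sup>2)"
      using t(2) unfolding t0_def by auto
    have At: "A * t \<le> 1" using tb(2) A by (simp add: pos_le_divide_eq mult.commute)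
    have KCt: "24 * (K * C1) * t \<le> 1" using tb(3) KC by (simp add: pos_le_divide_eq mult.commute)
    have dt: "8 * R\<^sup>2 * t \<le> d0"
      using tb(4) R2 by (subst (asm) pos_le_divide_eq) (auto simp: mult.commute)
    have e: "t\<^sup>2 + t * sqrt (dl x) = t * (t + q)" by (simp add: q_def power2_eq_square algebra_simps)
    have Rt: "R * t \<le> R\<^sup>2 * t" using R2 t by (intro mult_right_mono) auto
    show "\<exists>S. compact S \<and> c1 * t ^ DIM('a) * (t + sqrt (dl x)) \<le> measure lebesgue S \<and>
       (\<forall>s\<in>S. norm s \<le> 3 * t \<and> (\<forall>p\<in>\<Omega>. \<forall>\<sigma>\<in>{0..R\<^sup>2}. norm (p - x) \<le> R * t \<longrightarrow>
          p + \<sigma> *\<^sub>R s \<in> \<Omega> \<and> \<bar>dl (p + \<sigma> *\<^sub>R s) - dl p\<bar> \<le> c2 * (t\<^sup>2 + t * sqrt (dl x))))"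
    proof (cases "dl x \<le> d0")
      case False
      \<comment> \<open>Away from the boundary t is of order t \<open>sqrt (dl x)\<close>, so the
        Lipschitz bound for \<open>dl\<close> is sufficient.\<close>
      define S where "S = cball (0::'a) t"
      have "q \<le> sqrt Dm" unfolding q_def using Dm(2)[OF x] by simp
      then have "t + q \<le> 1 / 2 + sqrt Dm" using tb(1) by linarith
      then have "c1 * (t + q) \<le> (\<omega> / (1 / 2 + sqrt Dm)) * (1 / 2 + sqrt Dm)"
        using \<omega> sD t q by (intro mult_mono) (auto simp: c1_def)
      also have "\<dots> = \<omega>" using sD by simp
      finally have "c1 * (t + q) * t ^ DIM('a) \<le> \<omega> * t ^ DIM('a)" using t by (intro mult_right_mono) auto
      moreover have "measure lebesgue S = \<omega> * t ^ DIM('a)"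
        unfolding S_def \<omega>_def using t by (simp add: measure_completion content_cball)
      ultimately have mS: "c1 * t ^ DIM('a) * (t + sqrt (dl x)) \<le> measure lebesgue S"
        by (simp add: q_def mult_ac)
      have "p + \<sigma> *\<^sub>R s \<in> \<Omega> \<and> \<bar>dl (p + \<sigma> *\<^sub>R s) - dl p\<bar> \<le> c2 * (t\<^sup>2 + t * sqrt (dl x))"
        if s: "s \<in> S" and \<sigma>: "\<sigma> \<in> {0..R\<^sup>2}" and p: "p \<in> \<Omega>" "norm (p - x) \<le> R * t" for s \<sigma> p
      proof
        have "\<sigma> * norm s \<le> R\<^sup>2 * t" using s \<sigma> by (intro mult_mono) (auto simp: S_def)
        then have ns: "norm (\<sigma> *\<^sub>R s) \<le> R\<^sup>2 * t" using \<sigma> by simp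
        have "p + \<sigma> *\<^sub>R s - x = (p - x) + \<sigma> *\<^sub>R s" by simp
        then have "norm (p + \<sigma> *\<^sub>R s - x) \<le> norm (p - x) + norm (\<sigma> *\<^sub>R s)" by (metis norm_triangle_ineq)
        also have "\<dots> < dl x" using p(2) ns Rt dt False t R2 mult_pos_pos[of "R\<^sup>2" t] by linarith
        finally show "p + \<sigma> *\<^sub>R s \<in> \<Omega>" using ball_in_domain[OF x] interior_subset by blast
        have "\<bar>dl (p + \<sigma> *\<^sub>R s) - dl p\<bar> \<le> R\<^sup>2 * t"
          using dl_lipschitz[of "p + \<sigma> *\<^sub>R s" p] ns by simp
        also have "\<dots> = R\<^sup>2 / sqrt d0 * (t * sqrt d0)" using sd0 by simp
        also have "\<dots> \<le> c2 * (t * (t + q))"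
        proof (rule mult_mono)
          show "R\<^sup>2 / sqrt d0 \<le> c2" using c2_parts unfolding c2_def by linarith
          have "sqrt d0 \<le> q" using False by (simp add: q_def)
          then show "t * sqrt d0 \<le> t * (t + q)" using t by simp
        qed (use c2 sd0 t in simp_all)
        finally show "\<bar>dl (p + \<sigma> *\<^sub>R s) - dl p\<bar> \<le> c2 * (t\<^sup>2 + t * sqrt (dl x))" unfolding e .
      qed
      moreover have "norm s \<le> 3 * t" if "s \<in> S" for s using that t by (simp add: S_def)
      moreover have "compact S" by (simp add: S_def)
      ultimately show ?thesis using mS by blast
    next
      case True
      obtain z where z: "z \<in> frontier \<Omega>" "dl x = norm (x - z)" using nearest_point .
      obtain n where n: "normal z n" using normal_exists[OF z(1)] by blast
      have nn: "n \<bullet> n = 1" and n1: "norm n = 1" "norm (- n) = 1" using normal_norm[OF n] by auto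
      define l where "l = t * (t + q)"
      have "q \<le> sqrt (1 / 4)" unfolding q_def using True d0 by (simp only: real_sqrt_le_iff)
      then have q2: "q \<le> 1 / 2" by (simp add: real_sqrt_divide)
      have "t * (t + q) \<le> t * 1" using t tb(1) q2 by (intro mult_left_mono) auto
      then have l: "0 < l" "l \<le> t" using t q by (auto simp: l_def)
      \<comment> \<open>Heights are measured along the inward normal - n; the range of length l is
        exactly what a change of \<open>dl\<close> by t (t + q) permits.\<close>
      define S where "S = {w. norm (w - ((- n) \<bullet> w) *\<^sub>R (- n)) \<le> t \<and> A * t\<^sup>2 \<le> (- n) \<bullet> w \<and> (- n) \<bullet> w \<le> A * t\<^sup>2 + l}"
      have "\<omega> * l * t ^ DIM('a) \<le> 4 * t * measure lebesgue S"
        unfolding S_def \<omega>_def using slab_measure_lower[OF n1(2) l] .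
      then have "t * (\<omega> / 4 * ((t + q) * t ^ DIM('a))) \<le> t * measure lebesgue S"
        unfolding l_def by (simp add: mult_ac)
      then have "\<omega> / 4 * ((t + q) * t ^ DIM('a)) \<le> measure lebesgue S" using t mult_le_cancel_left_pos by blast
      moreover have "c1 * ((t + q) * t ^ DIM('a)) \<le> \<omega> / 4 * ((t + q) * t ^ DIM('a))"
      proof (rule mult_right_mono)
        show "c1 \<le> \<omega> / 4" unfolding c1_def by (rule min.cobounded1)
      qed (use t q in simp)
      ultimately have mS: "c1 * t ^ DIM('a) * (t + sqrt (dl x)) \<le> measure lebesgue S"
        unfolding q_def[symmetric] by (simp add: mult_ac)
      have At2: "A * t\<^sup>2 \<le> t" using mult_right_mono[OF At, of t] t by (simp add: power2_eq_square mult.assoc)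
      have S_props: "norm (s - (n \<bullet> s) *\<^sub>R n) \<le> t" "A * t\<^sup>2 \<le> - (n \<bullet> s)" "- (n \<bullet> s) \<le> A * t\<^sup>2 + l" "norm s \<le> 3 * t"
        if s: "s \<in> S" for s
      proof -
        show 1: "norm (s - (n \<bullet> s) *\<^sub>R n) \<le> t" "A * t\<^sup>2 \<le> - (n \<bullet> s)" "- (n \<bullet> s) \<le> A * t\<^sup>2 + l"
          using s by (simp_all add: S_def)
        have "norm s \<le> norm (s - (n \<bullet> s) *\<^sub>R n) + norm ((n \<bullet> s) *\<^sub>R n)"
          using norm_triangle_ineq[of "s - (n \<bullet> s) *\<^sub>R n" "(n \<bullet> s) *\<^sub>R n"] by simp
        moreover have "norm ((n \<bullet> s) *\<^sub>R n) = \<bar>n \<bullet> s\<bar>" using n1 by simp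
        moreover have "A * t\<^sup>2 \<ge> 0" using A by simp
        ultimately show "norm s \<le> 3 * t" using 1 At2 l by linarith
      qed
      have "p + \<sigma> *\<^sub>R s \<in> \<Omega> \<and> \<bar>dl (p + \<sigma> *\<^sub>R s) - dl p\<bar> \<le> c2 * (t\<^sup>2 + t * sqrt (dl x))"
        if s: "s \<in> S" and \<sigma>: "\<sigma> \<in> {0..R\<^sup>2}" and p: "p \<in> \<Omega>" "norm (p - x) \<le> R * t" for s \<sigma> p
      proof
        note S_s = S_props[OF s]
        have dist: "norm (p + \<tau> *\<^sub>R s - x) \<le> 4 * R\<^sup>2 * t" if "0 \<le> \<tau>" "\<tau> \<le> R\<^sup>2" for \<tau>
        proof -
          have "p + \<tau> *\<^sub>R s - x = (p - x) + \<tau> *\<^sub>R s" by simp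
          then have "norm (p + \<tau> *\<^sub>R s - x) \<le> norm (p - x) + norm (\<tau> *\<^sub>R s)" by (metis norm_triangle_ineq)
          moreover have "\<tau> * norm s \<le> R\<^sup>2 * (3 * t)" using that S_s(4) by (intro mult_mono) auto
          ultimately show ?thesis using p(2) Rt that(1) by simp
        qed
        show in\<Omega>: "p + \<sigma> *\<^sub>R s \<in> \<Omega>"
        proof (rule ccontr)
          \<comment> \<open>At the first exit the outward component of s is nonnegative; the offset
            will show that it is negative.\<close>
          assume "p + \<sigma> *\<^sub>R s \<notin> \<Omega>"
          with p(1) \<sigma> obtain \<sigma>' where \<sigma>': "0 \<le> \<sigma>'" "\<sigma>' \<le> \<sigma>" "p + \<sigma>' *\<^sub>R s \<in> frontier \<Omega>"
            "\<And>n. normal (p + \<sigma>' *\<^sub>R s) n \<Longrightarrow> n \<bullet> s \<ge> 0"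
            using exit_point[of p \<sigma> s] by (metis atLeastAtMost_iff)
          define w where "w = p + \<sigma>' *\<^sub>R s"
          obtain n' where n': "normal w n'" using normal_exists \<sigma>'(3) w_def by blast
          have pos: "n' \<bullet> s \<ge> 0" using \<sigma>'(4) n' w_def by blast
          have "norm (w - x) \<le> 4 * R\<^sup>2 * t" using dist[of \<sigma>'] \<sigma>' \<sigma> by (simp add: w_def)
          then have wx: "norm (x - w) \<le> 4 * R\<^sup>2 * t" by (simp add: norm_minus_commute)
          have "dl x \<le> norm (x - w)" using dl_le \<sigma>'(3) w_def by blast
          moreover have "norm (z - w) \<le> norm (z - x) + norm (x - w)"
            using norm_triangle_ineq[of "z - x" "x - w"] by simp
          ultimately have zw: "norm (z - w) \<le> C1 * t"
            using wx z(2) by (simp add: C1_def norm_minus_commute)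
          have C1t: "0 < C1 * t" "24 * K * (C1 * t) \<le> 1" using C1 t KCt by (simp_all add: mult_ac)
          have "C1 * t < 1 / (2 * K)" using C1t K_pos by (simp add: pos_less_divide_eq mult_ac)
          note close = normals_close(1)[OF n n' zw C1t(1) this]
          note inner = normals_inner[OF n n' zw C1t]
          define u where "u = s - (n \<bullet> s) *\<^sub>R n"
          have "u \<bullet> n = 0" unfolding u_def by (rule tangential_norm_le(2)[OF n1(1)])
          from close[OF this] have "n' \<bullet> u \<le> 12 * K * (C1 * t) * norm u" .
          also have "\<dots> \<le> 12 * K * (C1 * t) * t"
            using S_s(1) K_pos C1t by (intro mult_left_mono) (auto simp: u_def)
          finally have 1: "n' \<bullet> u \<le> 12 * (K * C1) * t\<^sup>2" by (simp add: power2_eq_square mult_ac)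
          have "0 \<le> A * t\<^sup>2" using A by simp
          then have "0 \<le> - (n \<bullet> s)" using S_s(2) by linarith
          then have "(A * t\<^sup>2) * (1 / 2) \<le> (- (n \<bullet> s)) * (n' \<bullet> n)"
            by (intro mult_mono S_s(2) inner) simp_all
          moreover have "n' \<bullet> s = n' \<bullet> u + (n \<bullet> s) * (n' \<bullet> n)" by (simp add: u_def inner_diff_right)
          ultimately have "n' \<bullet> s \<le> 12 * (K * C1) * t\<^sup>2 - A * t\<^sup>2 / 2" using 1 by simp
          also have "\<dots> = - t\<^sup>2 / 2" by (simp add: A_def algebra_simps)
          finally have "n' \<bullet> s \<le> - t\<^sup>2 / 2" .
          moreover have "t\<^sup>2 > 0" using t by simp
          ultimately show False using pos by linarith
        qed
        have d8: "dl x \<le> 1 / (8 * K)" using True d0 by linarith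
        have R8: "4 * R\<^sup>2 * t \<le> 1 / (8 * K)" "R * t \<le> 1 / (8 * K)"
          using dt d0 Rt R2 t mult_pos_pos[of "R\<^sup>2" t] by linarith+
        have "norm (p + \<sigma> *\<^sub>R s - x) \<le> 4 * R\<^sup>2 * t" using dist \<sigma> by simp
        note h1 = dl_height[OF x z(2) n in\<Omega> this R8(1) d8]
        note h2 = dl_height[OF x z(2) n p(1) p(2) R8(2) d8]
        \<comment> \<open>Errors of \<open>dl_height\<close> at the shifted point and at p; together
          they account for the coefficient 102 in c2.\<close>
        have "6 * K * (4 * R\<^sup>2 * t)\<^sup>2 + 6 * K * (R * t)\<^sup>2 = 96 * (K * R ^ 4) * t\<^sup>2 + 6 * (K * R\<^sup>2) * t\<^sup>2"
          by (simp add: power_mult_distrib power2_eq_square power4_eq_xxxx)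
        also have "\<dots> \<le> 96 * (K * R ^ 4) * t\<^sup>2 + 6 * (K * R ^ 4) * t\<^sup>2"
          using R2 K_pos by (intro add_left_mono mult_right_mono mult_left_mono) auto
        also have "\<dots> = 102 * (K * R ^ 4) * t\<^sup>2" by simp
        also have "\<dots> \<le> 102 * (K * R ^ 4) * l"
        proof (rule mult_left_mono)
          show "t\<^sup>2 \<le> l" using t q by (simp add: l_def power2_eq_square)
        qed (use c2_parts in simp)
        finally have h3: "6 * K * (4 * R\<^sup>2 * t)\<^sup>2 + 6 * K * (R * t)\<^sup>2 \<le> 102 * (K * R ^ 4) * l" .
        have h4: "n \<bullet> (z - (p + \<sigma> *\<^sub>R s)) - n \<bullet> (z - p) = \<sigma> * (- (n \<bullet> s))" by (simp add: inner_diff_right inner_add_right)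
        have h5: "\<sigma> * (- (n \<bullet> s)) \<le> R\<^sup>2 * ((A + 1) * l)"
        proof (rule mult_mono)
          have "A * t\<^sup>2 \<le> A * l" using t q A by (simp add: l_def power2_eq_square)
          then show "- (n \<bullet> s) \<le> (A + 1) * l" using S_s(3) by (simp add: algebra_simps)
          have "0 \<le> A * t\<^sup>2" using A by simp
          then show "0 \<le> - (n \<bullet> s)" using S_s(2) by linarith
        qed (use \<sigma> in auto)
        have h6: "0 \<le> \<sigma> * (- (n \<bullet> s))"
        proof -
          have "0 \<le> A * t\<^sup>2" using A by simp
          then have "0 \<le> - (n \<bullet> s)" using S_s(2) by linarith
          then show ?thesis using \<sigma> by (intro mult_nonneg_nonneg) auto
        qed
        have "\<bar>dl (p + \<sigma> *\<^sub>R s) - dl p\<bar> \<le> R\<^sup>2 * ((A + 1) * l) + 102 * (K * R ^ 4) * l"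
          using h1 h2 h3 h4 h5 h6 by linarith
        also have "\<dots> = (R\<^sup>2 * (A + 1) + 102 * (K * R ^ 4)) * l" by (simp add: algebra_simps)
        also have "\<dots> \<le> c2 * l" using c2_parts l by (intro mult_right_mono) (auto simp: c2_def)
        finally show "\<bar>dl (p + \<sigma> *\<^sub>R s) - dl p\<bar> \<le> c2 * (t\<^sup>2 + t * sqrt (dl x))" unfolding e l_def .
      qed
      moreover have "compact S" unfolding S_def by (rule slab_compact[OF n1(2)])
      ultimately show ?thesis using mS S_props(4) by blast
    qed
  qed
qed

end

section \<open>Averaging the differences\<close>

lemma nn_integral_affine_le:
  fixes G :: "'a::euclidean_space \<Rightarrow> ennreal"
  assumes [measurable]: "G \<in> borel_measurable borel" and c: "c \<ge> 1"
  shows "(\<integral>\<^sup>+ s. G (a + c *\<^sub>R s) \<partial>lborel) \<le> (\<integral>\<^sup>+ s. G s \<partial>lborel)"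
proof -
  have "(\<integral>\<^sup>+ s. G s \<partial>lborel) = (\<integral>\<^sup>+ s. ennreal (\<bar>c\<bar> ^ DIM('a)) * G (a + c *\<^sub>R s) \<partial>lborel)"
    using c by (subst lborel_affine[of c a]) (simp_all add: nn_integral_density nn_integral_distr)
  also have "\<dots> \<ge> (\<integral>\<^sup>+ s. 1 * G (a + c *\<^sub>R s) \<partial>lborel)"
    using c by (intro nn_integral_mono mult_right_mono) (auto simp: one_le_power)
  finally show ?thesis by simp
qed

text \<open>Makes the case distinction in \<open>dom_diff\<close> Borel in both end points jointly:
  the inclusion is an intersection of closed conditions, one for each u in [0, 1].\<close>

lemma closed_segments_inside:
  fixes \<Omega> :: "'a::euclidean_space set"
  assumes "closed \<Omega>"
  shows "closed {p. closed_segment (fst p) (snd p) \<subseteq> \<Omega>}"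
proof -
  have "{p. closed_segment (fst p) (snd p) \<subseteq> \<Omega>} =
      (\<Inter>u\<in>{0..1}. (\<lambda>p. (1 - u) *\<^sub>R fst p + u *\<^sub>R snd p) -` \<Omega>)"
    unfolding closed_segment_def by (auto simp: subset_eq, blast)
  also have "closed \<dots>"
    by (intro closed_INT ballI continuous_closed_vimage assms continuous_intros)
  finally show ?thesis .
qed

lemma closed_rho_ball_graph:
  fixes \<Omega> :: "'a::euclidean_space set"
  assumes "closed \<Omega>"
  shows "closed {p. snd p \<in> rho_ball \<Omega> (fst p) t}"
proof -
  have "{p. snd p \<in> rho_ball \<Omega> (fst p) t} = (snd -` \<Omega>) \<inter> {p. rho \<Omega> (fst p) (snd p) \<le> t}"
    by (auto simp: rho_ball_def)
  moreover have "closed (snd -` \<Omega> :: ('a \<times> 'a) set)"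
    by (intro continuous_closed_vimage assms continuous_intros)
  moreover have "closed {p. rho \<Omega> (fst p) (snd p) \<le> t}" unfolding rho_def
    by (intro closed_Collect_le continuous_intros)
  ultimately show ?thesis by (simp add: closed_Int)
qed

lemma dom_diff_end:
  "r \<ge> 1 \<Longrightarrow> dom_diff r ((\<eta> - \<xi>) /\<^sub>R real r) f \<Omega> \<xi> =
    (if closed_segment \<xi> \<eta> \<subseteq> \<Omega> then fin_diff r ((\<eta> - \<xi>) /\<^sub>R real r) f \<xi> else 0)"
  by (simp add: dom_diff_def)

lemma dom_diff_measurable:
  fixes f :: "'a::euclidean_space \<Rightarrow> real"
  assumes \<Omega>: "closed \<Omega>" and f: "f \<in> borel_measurable borel" and r: "r \<ge> 1"
  shows "(\<lambda>p. dom_diff r ((snd p - fst p) /\<^sub>R real r) f \<Omega> (fst p)) \<in> borel_measurable borel"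
proof -
  have [measurable]: "{p. closed_segment (fst p) (snd p) \<subseteq> \<Omega>} \<in> sets borel"
    using closed_segments_inside[OF \<Omega>] by simp
  have [measurable]: "(\<lambda>p. f (fst p + real j *\<^sub>R ((snd p - fst p) /\<^sub>R real r))) \<in> borel_measurable borel" for j
    by (rule measurable_compose[OF borel_measurable_continuous_onI f]) (intro continuous_intros)
  have "(\<lambda>p. dom_diff r ((snd p - fst p) /\<^sub>R real r) f \<Omega> (fst p)) =
     (\<lambda>p. indicator {p. closed_segment (fst p) (snd p) \<subseteq> \<Omega>} p * fin_diff r ((snd p - fst p) /\<^sub>R real r) f (fst p))"
    unfolding dom_diff_end[OF r] by auto
  also have "\<dots> \<in> borel_measurable borel" unfolding fin_diff_def by measurable
  finally show ?thesis .
qed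

text \<open>The cut-off to the ball is part of the integrand, so that measurability in the pair of
  points can be stated and the integral runs over the whole space.\<close>

definition w_integrand ::
  "nat \<Rightarrow> 'a::euclidean_space set \<Rightarrow> real \<Rightarrow> ('a \<Rightarrow> real) \<Rightarrow> real \<Rightarrow> 'a \<Rightarrow> 'a \<Rightarrow> ennreal" where
  "w_integrand r \<Omega> Q f \<delta> \<xi> \<eta> =
     ennreal (\<bar>dom_diff r ((\<eta> - \<xi>) /\<^sub>R real r) f \<Omega> \<xi>\<bar> powr Q) * indicator (rho_ball \<Omega> \<xi> \<delta>) \<eta>"

lemma w_integrand_measurable:
  assumes \<Omega>: "closed \<Omega>" and f: "f \<in> borel_measurable borel" and r: "r \<ge> 1"
  shows "(\<lambda>p. w_integrand r \<Omega> Q f \<delta> (fst p) (snd p)) \<in> borel_measurable borel"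
    and "w_integrand r \<Omega> Q f \<delta> \<xi> \<in> borel_measurable borel"
proof -
  have [measurable]: "{p. snd p \<in> rho_ball \<Omega> (fst p) \<delta>} \<in> sets borel"
    using closed_rho_ball_graph[OF \<Omega>] by simp
  note [measurable] = dom_diff_measurable[OF assms]
  have "(\<lambda>p. w_integrand r \<Omega> Q f \<delta> (fst p) (snd p)) = (\<lambda>p.
     ennreal (\<bar>dom_diff r ((snd p - fst p) /\<^sub>R real r) f \<Omega> (fst p)\<bar> powr Q) *
     indicator {p. snd p \<in> rho_ball \<Omega> (fst p) \<delta>} p)"
    by (auto simp: w_integrand_def indicator_def)
  also have "\<dots> \<in> borel_measurable borel" by measurable
  finally show *: "(\<lambda>p. w_integrand r \<Omega> Q f \<delta> (fst p) (snd p)) \<in> borel_measurable borel" .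
  have "(\<lambda>\<eta>. w_integrand r \<Omega> Q f \<delta> (fst (\<xi>, \<eta>)) (snd (\<xi>, \<eta>))) \<in> borel_measurable borel"
    by (rule measurable_compose[OF borel_measurable_continuous_onI *]) (intro continuous_intros)
  then show "w_integrand r \<Omega> Q f \<delta> \<xi> \<in> borel_measurable borel" by simp
qed

text \<open>For Borel f the integral over \<open>lebesgue\<close> becomes one over
  \<open>lborel\<close>, where affine substitutions and Fubini apply.\<close>

lemma w_mod_finite:
  assumes "q \<noteq> \<infinity>" "closed \<Omega>" "f \<in> borel_measurable borel" "r \<ge> 1"
  shows "w_mod r \<Omega> q f \<xi> \<delta> = epowr
    ((\<integral>\<^sup>+\<eta>. w_integrand r \<Omega> (enn2real q) f \<delta> \<xi> \<eta> \<partial>lborel) / emeasure lebesgue (rho_ball \<Omega> \<xi> \<delta>)) (1 / enn2real q)"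
  using assms w_integrand_measurable(2)[OF assms(2-4), of "enn2real q" \<delta> \<xi>]
  by (simp add: w_mod_def w_integrand_def[abs_def] nn_integral_completion)

lemma epowr_less_imp:
  assumes "epowr y (1 / Q) < ennreal E" "Q > 0"
  shows "y \<le> ennreal (E powr Q)"
proof -
  have y: "y \<noteq> \<infinity>" using assms(1) by (auto simp: epowr_def)
  then have "enn2real y powr (1 / Q) < E" using assms(1) by (simp add: epowr_def ennreal_less_iff)
  then have "(enn2real y powr (1 / Q)) powr Q \<le> E powr Q" using assms(2) by (intro powr_mono2) auto
  then have "enn2real y \<le> E powr Q" using assms(2) by (simp add: powr_powr)
  then have "ennreal (enn2real y) \<le> ennreal (E powr Q)" by (rule ennreal_leI)
  moreover have "ennreal (enn2real y) = y" using y by (intro ennreal_enn2real) (simp add: less_top)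
  ultimately show ?thesis by (simp only:)
qed

text \<open>The bound of \<open>fin_diff_perturb\<close> is raised to the power q and integrated
  over s in S. In each term the map from s to the far end point is affine with a dilation factor of
  at least 1, and the end point stays in the ball, so the integral is at most the one in
  \<open>w_mod\<close> at some x + l H; B compares the measures of the ball and of S. Arguing by
  contradiction treats all base points at once and makes the moduli finite automatically.\<close>

lemma average_step:
  fixes f :: "'a::euclidean_space \<Rightarrow> real"
  assumes \<Omega>: "compact \<Omega>" and f: "f \<in> borel_measurable borel" and r: "r \<ge> 1" and q: "0 < q" and B: "B > 0"
    and S: "compact S" "measure lebesgue S > 0"
    and seg: "\<And>l s. l \<in> {1..r} \<Longrightarrow> s \<in> S \<Longrightarrow>
       closed_segment (x + real l *\<^sub>R H) (x + real l *\<^sub>R H + (real r * real l) *\<^sub>R s) \<subseteq> \<Omega> \<and>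
       closed_segment x (x + real r *\<^sub>R H + (real r * real l) *\<^sub>R s) \<subseteq> \<Omega> \<and>
       x + real l *\<^sub>R H + (real r * real l) *\<^sub>R s \<in> rho_ball \<Omega> (x + real l *\<^sub>R H) \<delta> \<and>
       x + real r *\<^sub>R H + (real r * real l) *\<^sub>R s \<in> rho_ball \<Omega> x \<delta>"
    and meas: "\<And>l. l \<le> r \<Longrightarrow> measure lebesgue (rho_ball \<Omega> (x + real l *\<^sub>R H) \<delta>) \<le> B * measure lebesgue S"
    and C: "C = 2 ^ (r + 1) * (if q = \<infinity> then 1 else (2 * real r * B + 1) powr (1 / enn2real q))"
  shows "\<exists>l\<le>r. ennreal \<bar>fin_diff r H f x\<bar> \<le> ennreal C * w_mod r \<Omega> q f (x + real l *\<^sub>R H) \<delta>"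
proof -
  have r0: "real r > 0" using r by simp
  define G where "G \<xi> \<eta> = \<bar>dom_diff r ((\<eta> - \<xi>) /\<^sub>R real r) f \<Omega> \<xi>\<bar>" for \<xi> \<eta>
  \<comment> \<open>The far end is shifted by r l s because \<open>w_mod\<close> divides the
    displacement by r: the step becomes l s at the base x + l H, and H + l s at the base x.\<close>
  have G1: "\<bar>fin_diff r (real l *\<^sub>R s) f (x + real l *\<^sub>R H)\<bar> =
      G (x + real l *\<^sub>R H) (x + real l *\<^sub>R H + (real r * real l) *\<^sub>R s)" if "l \<in> {1..r}" "s \<in> S" for l s
  proof -
    have eq: "(x + real l *\<^sub>R H + (real r * real l) *\<^sub>R s - (x + real l *\<^sub>R H)) /\<^sub>R real r = real l *\<^sub>R s"
      using r0 by (simp add: divide_simps)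
    show ?thesis using seg[OF that] unfolding G_def eq dom_diff_def by simp
  qed
  have G2: "\<bar>fin_diff r (H + real l *\<^sub>R s) f x\<bar> =
      G x (x + real r *\<^sub>R H + (real r * real l) *\<^sub>R s)" if "l \<in> {1..r}" "s \<in> S" for l s
  proof -
    have "(x + real r *\<^sub>R H + (real r * real l) *\<^sub>R s - x) /\<^sub>R real r = H + real l *\<^sub>R s"
      using r0 by (simp add: scaleR_add_right divide_simps)
    then show ?thesis using seg[OF that] unfolding G_def dom_diff_end[OF r] by simp
  qed
  define D where "D = \<bar>fin_diff r H f x\<bar>"
  have bound: "D \<le> 2 ^ (r + 1) * M"
    if "s \<in> S" "\<And>l. l \<in> {1..r} \<Longrightarrow> G (x + real l *\<^sub>R H) (x + real l *\<^sub>R H + (real r * real l) *\<^sub>R s) \<le> M"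
      "\<And>l. l \<in> {1..r} \<Longrightarrow> G x (x + real r *\<^sub>R H + (real r * real l) *\<^sub>R s) \<le> M" for s M
    unfolding D_def
  proof (rule fin_diff_perturb[OF r])
    fix l assume "1 \<le> l" "l \<le> r"
    then have l: "l \<in> {1..r}" by simp
    show "\<bar>fin_diff r (real l *\<^sub>R s) f (x + real l *\<^sub>R H)\<bar> \<le> M" using that(2)[OF l] G1[OF l that(1)] by simp
    show "\<bar>fin_diff r (H + real l *\<^sub>R s) f x\<bar> \<le> M" using that(3)[OF l] G2[OF l that(1)] by simp
  qed
  have "2 * real r * B + 1 > 0" using B by (simp add: add_nonneg_pos)
  then have C0: "C > 0" by (simp add: C)
  have "\<exists>l\<le>r. ennreal (D / C) \<le> w_mod r \<Omega> q f (x + real l *\<^sub>R H) \<delta>"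
  proof (rule ccontr)
    assume neg: "\<not> ?thesis"
    have less: "w_mod r \<Omega> q f (x + real l *\<^sub>R H) \<delta> < ennreal (D / C)" if "l \<le> r" for l
      using that neg not_le by blast
    from less[of 0] have "ennreal (D / C) > 0" by (metis le0 not_gr_zero not_less_zero)
    then have "D / C > 0" by simp
    then have D0: "D > 0" using C0 by (simp add: zero_less_divide_iff)
    show False
    proof (cases "q = \<infinity>")
      case True
      obtain s where s: "s \<in> S" using S(2) by fastforce
      \<comment> \<open>Only finitely many values occur, so their maximum is still strictly below D
        / C; this replaces the integration, and one shift s suffices.\<close>
      obtain D' where D': "D' < D / C" "\<And>l. l \<in> {1..r} \<Longrightarrow> G (x + real l *\<^sub>R H) (x + real l *\<^sub>R H + (real r * real l) *\<^sub>R s) \<le> D'"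
         "\<And>l. l \<in> {1..r} \<Longrightarrow> G x (x + real r *\<^sub>R H + (real r * real l) *\<^sub>R s) \<le> D'"
      proof -
        have lt: "G \<xi> \<eta> < D / C" if "\<eta> \<in> rho_ball \<Omega> \<xi> \<delta>" "w_mod r \<Omega> q f \<xi> \<delta> < ennreal (D / C)" for \<xi> \<eta>
        proof -
          have "ennreal (G \<xi> \<eta>) \<le> w_mod r \<Omega> q f \<xi> \<delta>"
            unfolding w_mod_def G_def using True that(1) by (auto intro: SUP_upper)
          then have "ennreal (G \<xi> \<eta>) < ennreal (D / C)" using that(2) by (rule le_less_trans)
          then show ?thesis by (simp add: ennreal_less_iff G_def)
        qed
        define Vs where "Vs = (\<lambda>l. G (x + real l *\<^sub>R H) (x + real l *\<^sub>R H + (real r * real l) *\<^sub>R s)) ` {1..r} \<union>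
           (\<lambda>l. G x (x + real r *\<^sub>R H + (real r * real l) *\<^sub>R s)) ` {1..r}"
        have fin: "finite Vs" "Vs \<noteq> {}" using r by (auto simp: Vs_def)
        have "v < D / C" if "v \<in> Vs" for v
          using that seg[OF _ s] lt less[of 0] less by (auto simp: Vs_def)
        then have "Max Vs < D / C" using fin by simp
        moreover have "v \<le> Max Vs" if "v \<in> Vs" for v using fin that by simp
        ultimately show ?thesis by (intro that[of "Max Vs"]) (auto simp: Vs_def)
      qed
      from bound[OF s D'(2,3)] have "D \<le> 2 ^ (r + 1) * D'" .
      also have "\<dots> < 2 ^ (r + 1) * (D / C)" by (rule mult_strict_left_mono[OF D'(1)]) simp
      also have "\<dots> = D" using True by (simp add: C)
      finally show False by simp
    next
      case False
      define Q where "Q = enn2real q"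
      have Q: "Q > 0" using q False by (simp add: Q_def enn2real_positive_iff less_top)
      have cl: "closed \<Omega>" using \<Omega> compact_imp_closed by blast
      let ?W = "w_integrand r \<Omega> Q f \<delta>"
      note Wm[measurable] = w_integrand_measurable(2)[OF cl f r, of Q \<delta>]
      define E where "E = (D / C) powr Q"
      define MS where "MS = measure lebesgue S"
      have E0: "E \<ge> 0" by (simp add: E_def)
      have "emeasure lborel S = emeasure lebesgue S" using borel_compact[OF S(1)] by simp
      then have MS: "MS > 0" "emeasure lborel S = ennreal MS"
        using S(2) emeasure_eq_measure2[OF lmeasurable_compact[OF S(1)]] by (simp_all add: MS_def)
      have Wint: "(\<integral>\<^sup>+\<eta>. ?W (x + real l *\<^sub>R H) \<eta> \<partial>lborel) \<le> ennreal (E * (B * MS))" if l: "l \<le> r" for l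
      proof -
        define \<xi> where "\<xi> = x + real l *\<^sub>R H"
        define m where "m = emeasure lebesgue (rho_ball \<Omega> \<xi> \<delta>)"
        have lm: "rho_ball \<Omega> \<xi> \<delta> \<in> lmeasurable" using rho_ball_compact[OF \<Omega>] lmeasurable_compact by blast
        then have m: "m = ennreal (measure lebesgue (rho_ball \<Omega> \<xi> \<delta>))" "m \<noteq> \<infinity>"
          by (simp_all add: m_def emeasure_eq_measure2)
        have y: "(\<integral>\<^sup>+\<eta>. ?W \<xi> \<eta> \<partial>lborel) / m \<le> ennreal E"
          using less[OF l] unfolding w_mod_finite[OF False cl f r] E_def
          by (intro epowr_less_imp[OF _ Q]) (simp add: \<xi>_def m_def Q_def)
        have "(\<integral>\<^sup>+\<eta>. ?W \<xi> \<eta> \<partial>lborel) \<le> ennreal E * m"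
        \<comment> \<open>Over a null ball the quotient cannot be multiplied back, but there the
          integral itself vanishes.\<close>
        proof (cases "m = 0")
          case True
          then have "AE \<eta> in lebesgue. \<eta> \<notin> rho_ball \<Omega> \<xi> \<delta>"
            using lm by (intro AE_not_in) (auto simp: null_sets_def m_def fmeasurableD)
          then have "AE \<eta> in lebesgue. ?W \<xi> \<eta> = 0" by eventually_elim (simp add: w_integrand_def)
          from nn_integral_cong_AE[OF this] have "(\<integral>\<^sup>+\<eta>. ?W \<xi> \<eta> \<partial>lebesgue) = 0" by simp
          then show ?thesis by (simp add: nn_integral_completion)
        next
          case False
          then have "m / m = 1" using m(2) by (simp add: ennreal_divide_self less_top)
          then have "(\<integral>\<^sup>+\<eta>. ?W \<xi> \<eta> \<partial>lborel) = (\<integral>\<^sup>+\<eta>. ?W \<xi> \<eta> \<partial>lborel) / m * m"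
            by (simp add: ennreal_divide_times)
          also have "\<dots> \<le> ennreal E * m" using y by (rule mult_right_mono) simp
          finally show ?thesis .
        qed
        also have "\<dots> \<le> ennreal E * ennreal (B * MS)"
          using meas[OF l] unfolding m(1) MS_def \<xi>_def by (intro mult_left_mono ennreal_leI) auto
        finally show ?thesis using E0 by (simp add: \<xi>_def ennreal_mult')
      qed
      define A1 where "A1 l s = ?W (x + real l *\<^sub>R H) (x + real l *\<^sub>R H + (real r * real l) *\<^sub>R s)" for l s
      define A2 where "A2 l s = ?W x (x + real r *\<^sub>R H + (real r * real l) *\<^sub>R s)" for l s
      have A12: "A1 l s = ennreal (G (x + real l *\<^sub>R H) (x + real l *\<^sub>R H + (real r * real l) *\<^sub>R s) powr Q)"
         "A2 l s = ennreal (G x (x + real r *\<^sub>R H + (real r * real l) *\<^sub>R s) powr Q)"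
        if "l \<in> {1..r}" "s \<in> S" for l s
        using seg[OF that] by (simp_all add: A1_def A2_def w_integrand_def G_def)
      have [measurable]: "A1 l \<in> borel_measurable borel" "A2 l \<in> borel_measurable borel" for l
        unfolding A1_def A2_def by measurable
      have intA: "(\<integral>\<^sup>+s. A1 l s \<partial>lborel) \<le> ennreal (E * (B * MS))" "(\<integral>\<^sup>+s. A2 l s \<partial>lborel) \<le> ennreal (E * (B * MS))"
        if "l \<in> {1..r}" for l
      proof -
        have "1 * 1 \<le> real r * real l" using that by (intro mult_mono) auto
        then have c: "real r * real l \<ge> 1" by simp
        show "(\<integral>\<^sup>+s. A1 l s \<partial>lborel) \<le> ennreal (E * (B * MS))" unfolding A1_def
          using that by (intro order_trans[OF nn_integral_affine_le[OF Wm c] Wint]) auto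
        show "(\<integral>\<^sup>+s. A2 l s \<partial>lborel) \<le> ennreal (E * (B * MS))" unfolding A2_def
          using Wint[of 0] by (intro order_trans[OF nn_integral_affine_le[OF Wm c]]) auto
      qed
      define P where "P = (2 ^ (r + 1)) powr Q"
      have P: "P > 0" by (simp add: P_def)
      have point: "ennreal (D powr Q) \<le> ennreal P * (\<Sum>l=1..r. A1 l s + A2 l s)" if s: "s \<in> S" for s
      proof -
        define g1 where "g1 l = G (x + real l *\<^sub>R H) (x + real l *\<^sub>R H + (real r * real l) *\<^sub>R s)" for l
        define g2 where "g2 l = G x (x + real r *\<^sub>R H + (real r * real l) *\<^sub>R s)" for l
        have g: "g1 l \<ge> 0" "g2 l \<ge> 0" for l by (simp_all add: g1_def g2_def G_def)
        \<comment> \<open>Bounding every value by the q-th root of the sum of all q-th powers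
          replaces the maximum by something that can be integrated in s.\<close>
        define T where "T = (\<Sum>l=1..r. g1 l powr Q + g2 l powr Q)"
        have "g1 l \<le> T powr (1 / Q) \<and> g2 l \<le> T powr (1 / Q)" if l: "l \<in> {1..r}" for l
        proof -
          have "g1 l powr Q + g2 l powr Q \<le> T" unfolding T_def
            by (rule member_le_sum[OF l]) auto
          moreover have "g1 l powr Q \<ge> 0" "g2 l powr Q \<ge> 0" by simp_all
          ultimately have "g1 l powr Q \<le> T" "g2 l powr Q \<le> T" by linarith+
          then have "(g1 l powr Q) powr (1 / Q) \<le> T powr (1 / Q)" "(g2 l powr Q) powr (1 / Q) \<le> T powr (1 / Q)"
            using Q by (auto intro!: powr_mono2)
          then show ?thesis using Q g[of l] by (simp add: powr_powr)
        qed
        then have "D \<le> 2 ^ (r + 1) * T powr (1 / Q)"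
          by (intro bound[OF s]) (auto simp: g1_def g2_def)
        then have "D powr Q \<le> (2 ^ (r + 1) * T powr (1 / Q)) powr Q" using D0 Q by (intro powr_mono2) auto
        also have "\<dots> = P * T" using Q by (simp add: powr_mult P_def powr_powr T_def sum_nonneg)
        finally have "ennreal (D powr Q) \<le> ennreal (P * T)" by (rule ennreal_leI)
        also have "\<dots> = ennreal P * ennreal T" using P by (simp add: ennreal_mult')
        also have "ennreal T = (\<Sum>l=1..r. ennreal (g1 l powr Q + g2 l powr Q))"
          unfolding T_def by (rule sum_ennreal[symmetric]) simp
        also have "\<dots> = (\<Sum>l=1..r. A1 l s + A2 l s)"
          by (intro sum.cong refl) (simp add: A12[OF _ s] g1_def g2_def ennreal_plus)
        finally show ?thesis .
      qed
      have [measurable]: "S \<in> sets borel" using S(1) by (simp add: borel_compact)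
      have "ennreal (D powr Q * MS) = (\<integral>\<^sup>+s. ennreal (D powr Q) * indicator S s \<partial>lborel)"
        using MS by (simp add: nn_integral_cmult_indicator ennreal_mult')
      also have "\<dots> \<le> (\<integral>\<^sup>+s. ennreal P * (\<Sum>l=1..r. A1 l s + A2 l s) \<partial>lborel)"
        using point by (intro nn_integral_mono) (simp add: indicator_def)
      also have "\<dots> = ennreal P * (\<Sum>l=1..r. (\<integral>\<^sup>+s. A1 l s \<partial>lborel) + (\<integral>\<^sup>+s. A2 l s \<partial>lborel))"
        by (simp add: nn_integral_cmult nn_integral_sum nn_integral_add)
      also have "\<dots> \<le> ennreal P * (\<Sum>l=1..r. ennreal (E * (B * MS)) + ennreal (E * (B * MS)))"
        by (intro mult_left_mono sum_mono add_mono intA) auto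
      also have "(\<Sum>l=1..r. ennreal (E * (B * MS)) + ennreal (E * (B * MS))) = ennreal (2 * real r * (E * (B * MS)))"
      proof -
        define a where "a = E * (B * MS)"
        have a: "a \<ge> 0" using E0 B MS by (simp add: a_def)
        have "ennreal a + ennreal a = ennreal (2 * a)" using a by (simp flip: ennreal_plus)
        then have "(\<Sum>l=1..r. ennreal a + ennreal a) = ennreal (real r) * ennreal (2 * a)"
          by (simp add: ennreal_of_nat_eq_real_of_nat)
        also have "\<dots> = ennreal (real r * (2 * a))" using a by (simp flip: ennreal_mult')
        finally show ?thesis by (simp add: a_def mult_ac)
      qed
      also have "ennreal P * \<dots> = ennreal (P * (2 * real r * (E * (B * MS))))"
        using P by (simp add: ennreal_mult')
      finally have "ennreal (D powr Q * MS) \<le> ennreal (P * (2 * real r * (E * (B * MS))))" .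
      then have "D powr Q * MS \<le> P * (2 * real r * (E * (B * MS)))"
        by (subst (asm) ennreal_le_iff) (use P E0 B MS in auto)
      then have le: "D powr Q \<le> P * (2 * real r * (E * B))" using MS(1)
        by (simp add: mult.assoc[symmetric])
      \<comment> \<open>The summand 1 makes Y strictly larger than the coefficient 2 r B obtained by
        integration, and this strictness is the contradiction.\<close>
      define Y where "Y = 2 * real r * B + 1"
      have Y: "Y > 0" using B by (simp add: Y_def add_nonneg_pos)
      have "C powr Q = P * Y" unfolding C P_def Y_def using False Q Y
        by (simp add: powr_mult powr_powr Q_def Y_def)
      then have "E * (P * Y) = D powr Q"
        unfolding E_def using C0 D0 P Y by (simp add: powr_divide)
      then have "E * (P * Y) \<le> E * (P * (Y - 1))" using le by (simp add: Y_def mult_ac)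
      moreover have "E > 0" using D0 C0 by (simp add: E_def)
      ultimately show False using P by simp
    qed
  qed
  then obtain l where l: "l \<le> r" "ennreal (D / C) \<le> w_mod r \<Omega> q f (x + real l *\<^sub>R H) \<delta>" by blast
  have "ennreal D = ennreal C * ennreal (D / C)" using C0 by (simp add: D_def flip: ennreal_mult')
  also have "\<dots> \<le> ennreal C * w_mod r \<Omega> q f (x + real l *\<^sub>R H) \<delta>" using l(2) by (rule mult_left_mono) simp
  finally show ?thesis using l(1) unfolding D_def by blast
qed

context two_ball
begin

text \<open>\<open>push_set\<close> is used with R = r, since the multiples r l of a shift reach
  r^2. The threshold t0 comes from \<open>push_set\<close> alone and precedes \<kappa> in the order
  of quantifiers; this is essential for splitting long steps, where \<kappa> is chosen in terms of
  t0.\<close>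

lemma local_estimate:
  assumes r: "r \<ge> 1" and q: "0 < q"
  obtains t0 where "t0 > 0"
    "\<And>\<kappa>. \<kappa> > 0 \<Longrightarrow> \<exists>C c0. C > 0 \<and> c0 > 0 \<and> (\<forall>f x H t. f \<in> borel_measurable borel \<longrightarrow> x \<in> \<Omega> \<longrightarrow> 0 < t \<longrightarrow> t \<le> t0 \<longrightarrow>
       norm H \<le> t \<longrightarrow> closed_segment x (x + real r *\<^sub>R H) \<subseteq> \<Omega> \<longrightarrow>
       (\<forall>l\<le>r. \<bar>sqrt (dl (x + real l *\<^sub>R H)) - sqrt (dl x)\<bar> \<le> \<kappa> * t) \<longrightarrow>
       (\<exists>l\<le>r. ennreal \<bar>fin_diff r H f x\<bar> \<le> ennreal C * w_mod r \<Omega> q f (x + real l *\<^sub>R H) (c0 * t)))"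
proof -
  define R where "R = real r"
  have R: "R \<ge> 1" using r by (simp add: R_def)
  obtain t0 c1 c2 where push: "t0 > 0" "c1 > 0" "c2 > 0"
    "\<And>x t. x \<in> \<Omega> \<Longrightarrow> 0 < t \<Longrightarrow> t \<le> t0 \<Longrightarrow> \<exists>S. compact S \<and>
       c1 * t ^ DIM('a) * (t + sqrt (dl x)) \<le> measure lebesgue S \<and>
       (\<forall>s\<in>S. norm s \<le> 3 * t \<and> (\<forall>p\<in>\<Omega>. \<forall>\<sigma>\<in>{0..R\<^sup>2}. norm (p - x) \<le> R * t \<longrightarrow>
          p + \<sigma> *\<^sub>R s \<in> \<Omega> \<and> \<bar>dl (p + \<sigma> *\<^sub>R s) - dl p\<bar> \<le> c2 * (t\<^sup>2 + t * sqrt (dl x))))"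
    using push_set[OF R] by blast
  obtain CU where CU: "CU > 0"
    "\<And>\<xi> t. \<xi> \<in> \<Omega> \<Longrightarrow> t > 0 \<Longrightarrow> measure lebesgue (rho_ball \<Omega> \<xi> t) \<le> CU * t ^ DIM('a) * (t + sqrt (dl \<xi>))"
    using rho_ball_measure_upper by blast
  show ?thesis
  proof (rule that[OF push(1)])
    fix \<kappa> :: real assume \<kappa>: "\<kappa> > 0"
    \<comment> \<open>The factor 1 + \<kappa> exchanges the root of \<open>dl x\<close> for the root
      at the point that is actually shifted.\<close>
    define c3 where "c3 = c2 * (1 + \<kappa>)"
    have c3: "c3 > 0" using push(3) \<kappa> by (simp add: c3_def)
    \<comment> \<open>The summands cover the contributions to \<open>rho\<close>: the lengths of the
      shift and of r H, the oscillation of the root along H, and its change under the shift.\<close>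
    define c0 where "c0 = 4 * R\<^sup>2 + R + \<kappa> + (2 * c3 + 1)"
    have c0: "c0 > 0" "c0 \<ge> 1" using R \<kappa> c3 unfolding c0_def by (simp_all add: add_pos_pos add_nonneg_pos add_increasing)
    \<comment> \<open>Ratio of the upper bound for the ball of radius c0 t to the lower bound for S;
      the factor \<open>c0 + \<kappa>\<close> absorbs the change of the root from x to x + l
      H.\<close>
    define B where "B = CU * c0 ^ DIM('a) * (c0 + \<kappa>) / c1"
    have B: "B > 0" using CU c0 \<kappa> push by (simp add: B_def)
    define C where "C = 2 ^ (r + 1) * (if q = \<infinity> then 1 else (2 * real r * B + 1) powr (1 / enn2real q))"
    have "2 * real r * B + 1 > 0" using B by (simp add: add_nonneg_pos)
    then have C: "C > 0" by (simp add: C_def)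
    show "\<exists>C c0. C > 0 \<and> c0 > 0 \<and> (\<forall>f x H t. f \<in> borel_measurable borel \<longrightarrow> x \<in> \<Omega> \<longrightarrow> 0 < t \<longrightarrow> t \<le> t0 \<longrightarrow>
       norm H \<le> t \<longrightarrow> closed_segment x (x + real r *\<^sub>R H) \<subseteq> \<Omega> \<longrightarrow>
       (\<forall>l\<le>r. \<bar>sqrt (dl (x + real l *\<^sub>R H)) - sqrt (dl x)\<bar> \<le> \<kappa> * t) \<longrightarrow>
       (\<exists>l\<le>r. ennreal \<bar>fin_diff r H f x\<bar> \<le> ennreal C * w_mod r \<Omega> q f (x + real l *\<^sub>R H) (c0 * t)))"
    proof (rule exI[of _ C], rule exI[of _ c0], intro conjI C c0(1) allI impI)
      fix f :: "'a \<Rightarrow> real" and x H :: 'a and t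
      assume f: "f \<in> borel_measurable borel" and x: "x \<in> \<Omega>" and t: "0 < t" "t \<le> t0"
        and H: "norm H \<le> t" and seg: "closed_segment x (x + real r *\<^sub>R H) \<subseteq> \<Omega>"
        and osc: "\<forall>l\<le>r. \<bar>sqrt (dl (x + real l *\<^sub>R H)) - sqrt (dl x)\<bar> \<le> \<kappa> * t"
      define d where "d = sqrt (dl x)"
      have d: "d \<ge> 0" by (simp add: d_def)
      obtain S where S: "compact S" "c1 * t ^ DIM('a) * (t + d) \<le> measure lebesgue S"
        and S3: "\<And>s. s \<in> S \<Longrightarrow> norm s \<le> 3 * t"
        and Sin: "\<And>s p \<sigma>. s \<in> S \<Longrightarrow> p \<in> \<Omega> \<Longrightarrow> norm (p - x) \<le> R * t \<Longrightarrow> 0 \<le> \<sigma> \<Longrightarrow> \<sigma> \<le> R\<^sup>2 \<Longrightarrow> p + \<sigma> *\<^sub>R s \<in> \<Omega>"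
        and Sdl: "\<And>s p \<sigma>. s \<in> S \<Longrightarrow> p \<in> \<Omega> \<Longrightarrow> norm (p - x) \<le> R * t \<Longrightarrow> 0 \<le> \<sigma> \<Longrightarrow> \<sigma> \<le> R\<^sup>2 \<Longrightarrow>
              \<bar>dl (p + \<sigma> *\<^sub>R s) - dl p\<bar> \<le> c2 * (t\<^sup>2 + t * d)"
      proof -
        obtain S where "compact S" "c1 * t ^ DIM('a) * (t + sqrt (dl x)) \<le> measure lebesgue S"
          and *: "\<forall>s\<in>S. norm s \<le> 3 * t \<and> (\<forall>p\<in>\<Omega>. \<forall>\<sigma>\<in>{0..R\<^sup>2}. norm (p - x) \<le> R * t \<longrightarrow>
          p + \<sigma> *\<^sub>R s \<in> \<Omega> \<and> \<bar>dl (p + \<sigma> *\<^sub>R s) - dl p\<bar> \<le> c2 * (t\<^sup>2 + t * sqrt (dl x)))"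
          using push(4)[OF x t] by blast
        then show ?thesis by (intro that[of S]) (simp_all add: d_def)
      qed
      have "0 < c1 * t ^ DIM('a) * (t + d)" using push(2) t d by (simp add: add_pos_nonneg)
      then have mS: "measure lebesgue S > 0" using S(2) by linarith
      have base: "x + \<tau> *\<^sub>R H \<in> \<Omega>" "norm (x + \<tau> *\<^sub>R H - x) \<le> R * t" if "0 \<le> \<tau>" "\<tau> \<le> R" for \<tau>
      proof -
        have "x + \<tau> *\<^sub>R H = (1 - \<tau> / R) *\<^sub>R x + (\<tau> / R) *\<^sub>R (x + real r *\<^sub>R H)"
          using R by (simp add: R_def[symmetric] algebra_simps)
        then have "x + \<tau> *\<^sub>R H \<in> closed_segment x (x + real r *\<^sub>R H)"
          using that R unfolding in_segment by (intro exI[of _ "\<tau> / R"]) simp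
        then show "x + \<tau> *\<^sub>R H \<in> \<Omega>" using seg by blast
        have "\<tau> * norm H \<le> R * t" using that H t by (intro mult_mono) auto
        then show "norm (x + \<tau> *\<^sub>R H - x) \<le> R * t" using that by simp
      qed
      have move: "norm (\<sigma> *\<^sub>R s) \<le> 3 * R\<^sup>2 * t" "\<bar>sqrt (dl (x + real l *\<^sub>R H + \<sigma> *\<^sub>R s)) - sqrt (dl (x + real l *\<^sub>R H))\<bar> \<le> (2 * c3 + 1) * t"
        if s: "s \<in> S" and l: "l \<le> r" and \<sigma>: "0 \<le> \<sigma>" "\<sigma> \<le> R\<^sup>2" for s \<sigma> l
      proof -
        have "\<sigma> * norm s \<le> R\<^sup>2 * (3 * t)" using S3[OF s] \<sigma> by (intro mult_mono) auto
        then show "norm (\<sigma> *\<^sub>R s) \<le> 3 * R\<^sup>2 * t" using \<sigma> by simp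
        define p where "p = x + real l *\<^sub>R H"
        have "real l \<le> R" using l by (simp add: R_def)
        then have p: "p \<in> \<Omega>" "norm (p - x) \<le> R * t" using base[of "real l"] by (auto simp: p_def)
        have "d \<le> sqrt (dl p) + \<kappa> * t" using osc l unfolding d_def p_def by (smt (verit))
        then have "t * d \<le> t * (sqrt (dl p) + \<kappa> * t)" using t by (intro mult_left_mono) auto
        moreover have "(1 + \<kappa>) * (t\<^sup>2 + t * sqrt (dl p)) = t\<^sup>2 + t * (sqrt (dl p) + \<kappa> * t) + \<kappa> * (t * sqrt (dl p))"
          by (simp add: power2_eq_square algebra_simps)
        moreover have "0 \<le> \<kappa> * (t * sqrt (dl p))" using t \<kappa> by simp
        ultimately have "t\<^sup>2 + t * d \<le> (1 + \<kappa>) * (t\<^sup>2 + t * sqrt (dl p))" by linarith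
        then have "c2 * (t\<^sup>2 + t * d) \<le> c2 * ((1 + \<kappa>) * (t\<^sup>2 + t * sqrt (dl p)))"
          using push(3) by (intro mult_left_mono) auto
        then have "\<bar>dl (p + \<sigma> *\<^sub>R s) - dl p\<bar> \<le> c3 * (t\<^sup>2 + t * sqrt (dl p))"
          using Sdl[OF s p \<sigma>] unfolding c3_def by (simp add: mult.assoc)
        then show "\<bar>sqrt (dl (x + real l *\<^sub>R H + \<sigma> *\<^sub>R s)) - sqrt (dl (x + real l *\<^sub>R H))\<bar> \<le> (2 * c3 + 1) * t"
          unfolding p_def[symmetric] using t c3 by (intro sqrt_diff_le) auto
      qed
      have R2: "0 \<le> R\<^sup>2 * t" "0 \<le> R * t" "0 \<le> \<kappa> * t" "0 \<le> c3 * t" using R t \<kappa> c3 by simp_all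
      have c0t: "c0 * t = 4 * (R\<^sup>2 * t) + R * t + \<kappa> * t + (2 * c3 + 1) * t" by (simp add: c0_def algebra_simps)
      show "\<exists>l\<le>r. ennreal \<bar>fin_diff r H f x\<bar> \<le> ennreal C * w_mod r \<Omega> q f (x + real l *\<^sub>R H) (c0 * t)"
      proof (rule average_step[OF compact f r q B S(1) mS _ _ C_def])
        fix l s assume l: "l \<in> {1..r}" and s: "s \<in> S"
        define \<sigma> where "\<sigma> = real r * real l"
        have lR: "real l \<le> R" "l \<le> r" using l by (auto simp: R_def)
        have "R * real l \<le> R * R" using lR R by (intro mult_left_mono) auto
        then have \<sigma>: "0 \<le> \<sigma>" "\<sigma> \<le> R\<^sup>2" by (simp_all add: \<sigma>_def power2_eq_square R_def)
        have scal: "u * \<sigma> \<le> R\<^sup>2" if "0 \<le> u" "u \<le> 1" for u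
        proof -
          have "u * \<sigma> \<le> 1 * R\<^sup>2" using that \<sigma> by (intro mult_mono) auto
          then show ?thesis by simp
        qed
        have 1: "closed_segment (x + real l *\<^sub>R H) (x + real l *\<^sub>R H + \<sigma> *\<^sub>R s) \<subseteq> \<Omega>"
        proof
          fix y assume "y \<in> closed_segment (x + real l *\<^sub>R H) (x + real l *\<^sub>R H + \<sigma> *\<^sub>R s)"
          then obtain u where u: "0 \<le> u" "u \<le> 1" "y = (1 - u) *\<^sub>R (x + real l *\<^sub>R H) + u *\<^sub>R (x + real l *\<^sub>R H + \<sigma> *\<^sub>R s)"
            unfolding in_segment by blast
          have "y = (x + real l *\<^sub>R H) + (u * \<sigma>) *\<^sub>R s" unfolding u(3) by (simp add: algebra_simps)
          then show "y \<in> \<Omega>" using Sin[OF s base[of "real l"], of "u * \<sigma>"] lR u \<sigma> scal by simp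
        qed
        have 2: "closed_segment x (x + real r *\<^sub>R H + \<sigma> *\<^sub>R s) \<subseteq> \<Omega>"
        proof
          fix y assume "y \<in> closed_segment x (x + real r *\<^sub>R H + \<sigma> *\<^sub>R s)"
          then obtain u where u: "0 \<le> u" "u \<le> 1" "y = (1 - u) *\<^sub>R x + u *\<^sub>R (x + real r *\<^sub>R H + \<sigma> *\<^sub>R s)"
            unfolding in_segment by blast
          have "u * R \<le> 1 * R" using u R by (intro mult_right_mono) auto
          \<comment> \<open>A point of the slanted segment is a point of the original segment
            shifted by a smaller multiple of s, so the property of S applies to it directly.\<close>
          moreover have "y = (x + (u * R) *\<^sub>R H) + (u * \<sigma>) *\<^sub>R s"
            unfolding u(3) R_def by (simp add: algebra_simps)
          ultimately show "y \<in> \<Omega>" using Sin[OF s base[of "u * R"], of "u * \<sigma>"] R u \<sigma> scal by simp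
        qed
        have 3: "x + real l *\<^sub>R H + \<sigma> *\<^sub>R s \<in> rho_ball \<Omega> (x + real l *\<^sub>R H) (c0 * t)"
        proof -
          have "x + real l *\<^sub>R H + \<sigma> *\<^sub>R s \<in> \<Omega>" using 1 by auto
          moreover have "rho \<Omega> (x + real l *\<^sub>R H) (x + real l *\<^sub>R H + \<sigma> *\<^sub>R s) \<le> c0 * t"
            unfolding rho_def c0t using move[OF s lR(2) \<sigma>] R2
            by (simp add: abs_minus_commute)
          ultimately show ?thesis by (simp add: rho_ball_def)
        qed
        have 4: "x + real r *\<^sub>R H + \<sigma> *\<^sub>R s \<in> rho_ball \<Omega> x (c0 * t)"
        proof -
          have "x + real r *\<^sub>R H + \<sigma> *\<^sub>R s \<in> \<Omega>" using 2 by auto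
          moreover have "rho \<Omega> x (x + real r *\<^sub>R H + \<sigma> *\<^sub>R s) \<le> c0 * t"
          proof -
            have eq: "x - (x + real r *\<^sub>R H + \<sigma> *\<^sub>R s) = - (real r *\<^sub>R H + \<sigma> *\<^sub>R s)" by simp
            have "norm (x - (x + real r *\<^sub>R H + \<sigma> *\<^sub>R s)) \<le> norm (real r *\<^sub>R H) + norm (\<sigma> *\<^sub>R s)"
              unfolding eq norm_minus_cancel by (rule norm_triangle_ineq)
            moreover have "norm (real r *\<^sub>R H) \<le> R * t" using base(2)[of R] R by (simp add: R_def)
            moreover have "\<bar>sqrt (dl (x + real r *\<^sub>R H)) - sqrt (dl x)\<bar> \<le> \<kappa> * t" using osc by blast
            ultimately show ?thesis unfolding rho_def c0t
              using move[OF s order_refl \<sigma>] R2 by linarith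
          qed
          ultimately show ?thesis by (simp add: rho_ball_def)
        qed
        show "closed_segment (x + real l *\<^sub>R H) (x + real l *\<^sub>R H + (real r * real l) *\<^sub>R s) \<subseteq> \<Omega> \<and>
          closed_segment x (x + real r *\<^sub>R H + (real r * real l) *\<^sub>R s) \<subseteq> \<Omega> \<and>
          x + real l *\<^sub>R H + (real r * real l) *\<^sub>R s \<in> rho_ball \<Omega> (x + real l *\<^sub>R H) (c0 * t) \<and>
          x + real r *\<^sub>R H + (real r * real l) *\<^sub>R s \<in> rho_ball \<Omega> x (c0 * t)"
          using 1 2 3 4 unfolding \<sigma>_def by blast
      next
        fix l assume l: "l \<le> r"
        then have \<xi>: "x + real l *\<^sub>R H \<in> \<Omega>" using base(1)[of "real l"] by (simp add: R_def)
        have "sqrt (dl (x + real l *\<^sub>R H)) \<le> d + \<kappa> * t" using osc l unfolding d_def by (smt (verit))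
        moreover have "(c0 + \<kappa>) * (t + d) \<ge> c0 * t + \<kappa> * t + d"
        proof -
          have "1 * d \<le> (c0 + \<kappa>) * d" using c0 \<kappa> d by (intro mult_right_mono) auto
          then show ?thesis by (simp add: algebra_simps)
        qed
        ultimately have *: "c0 * t + sqrt (dl (x + real l *\<^sub>R H)) \<le> (c0 + \<kappa>) * (t + d)" by linarith
        have "measure lebesgue (rho_ball \<Omega> (x + real l *\<^sub>R H) (c0 * t)) \<le>
            CU * (c0 * t) ^ DIM('a) * (c0 * t + sqrt (dl (x + real l *\<^sub>R H)))"
          using CU(2)[OF \<xi>, of "c0 * t"] c0 t by simp
        also have "\<dots> \<le> CU * (c0 * t) ^ DIM('a) * ((c0 + \<kappa>) * (t + d))"
          using * CU(1) c0 t by (intro mult_left_mono) auto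
        also have "\<dots> = B * (c1 * t ^ DIM('a) * (t + d))"
          using push(2) by (simp add: B_def power_mult_distrib)
        also have "\<dots> \<le> B * measure lebesgue S" using B S(2) by (intro mult_left_mono) auto
        finally show "measure lebesgue (rho_ball \<Omega> (x + real l *\<^sub>R H) (c0 * t)) \<le> B * measure lebesgue S" .
      qed
    qed
  qed
qed

text \<open>Steps of size comparable to \<open>t\<close> are first split into short ones, so that each of them lies
  in the range of the local estimate.\<close>

lemma split_estimate:
  assumes r: "r \<ge> 1" and q: "0 < q" and K1: "K1 > 0"
  obtains C c0 N where "C > 0" "c0 > 0" "N \<ge> 1"
    "\<And>f x H t. f \<in> borel_measurable borel \<Longrightarrow> 0 < t \<Longrightarrow> t \<le> 1 \<Longrightarrow> norm H \<le> K1 * t \<Longrightarrow>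
       closed_segment x (x + real r *\<^sub>R H) \<subseteq> \<Omega> \<Longrightarrow>
       (\<And>a b. a \<in> closed_segment x (x + real r *\<^sub>R H) \<Longrightarrow> b \<in> closed_segment x (x + real r *\<^sub>R H) \<Longrightarrow>
          \<bar>sqrt (dl a) - sqrt (dl b)\<bar> \<le> K1 * t) \<Longrightarrow>
       \<exists>m\<le>r * N. ennreal \<bar>fin_diff r H f x\<bar> \<le> ennreal C * w_mod r \<Omega> q f (x + (real m / real N) *\<^sub>R H) (c0 * t)"
proof -
  obtain t0 where t0: "t0 > 0" and loc:
    "\<And>\<kappa>. \<kappa> > 0 \<Longrightarrow> \<exists>C c0. C > 0 \<and> c0 > 0 \<and> (\<forall>f x H t. f \<in> borel_measurable borel \<longrightarrow> x \<in> \<Omega> \<longrightarrow> 0 < t \<longrightarrow> t \<le> t0 \<longrightarrow>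
       norm H \<le> t \<longrightarrow> closed_segment x (x + real r *\<^sub>R H) \<subseteq> \<Omega> \<longrightarrow>
       (\<forall>l\<le>r. \<bar>sqrt (dl (x + real l *\<^sub>R H)) - sqrt (dl x)\<bar> \<le> \<kappa> * t) \<longrightarrow>
       (\<exists>l\<le>r. ennreal \<bar>fin_diff r H f x\<bar> \<le> ennreal C * w_mod r \<Omega> q f (x + real l *\<^sub>R H) (c0 * t)))"
    using local_estimate[OF r q] by metis
  \<comment> \<open>Division by N makes each step at most t0 t, so the local estimate is used on the
    scale t0 t; relative to that scale the oscillation bound K1 t has the constant K1 / t0.\<close>
  define N where "N = nat \<lceil>K1 / t0\<rceil> + 1"
  have N: "N \<ge> 1" by (simp add: N_def)
  have "K1 / t0 \<le> real N" unfolding N_def by linarith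
  then have NK: "K1 \<le> t0 * real N" using t0 by (simp add: pos_divide_le_eq mult.commute)
  have "K1 / t0 > 0" using K1 t0 by simp
  from loc[OF this] obtain C c0 where C: "C > 0" "c0 > 0" and est:
    "\<And>f x H t. f \<in> borel_measurable borel \<Longrightarrow> x \<in> \<Omega> \<Longrightarrow> 0 < t \<Longrightarrow> t \<le> t0 \<Longrightarrow>
       norm H \<le> t \<Longrightarrow> closed_segment x (x + real r *\<^sub>R H) \<subseteq> \<Omega> \<Longrightarrow>
       (\<forall>l\<le>r. \<bar>sqrt (dl (x + real l *\<^sub>R H)) - sqrt (dl x)\<bar> \<le> (K1 / t0) * t) \<Longrightarrow>
       (\<exists>l\<le>r. ennreal \<bar>fin_diff r H f x\<bar> \<le> ennreal C * w_mod r \<Omega> q f (x + real l *\<^sub>R H) (c0 * t))"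
    by metis
  show ?thesis
  proof (rule that[of "real N ^ r * C" "c0 * t0" N])
    show "real N ^ r * C > 0" "c0 * t0 > 0" "N \<ge> 1" using C N t0 by simp_all
    fix f :: "'a \<Rightarrow> real" and x H :: 'a and t
    assume f: "f \<in> borel_measurable borel" and t: "0 < t" "t \<le> 1" and H: "norm H \<le> K1 * t"
      and seg: "closed_segment x (x + real r *\<^sub>R H) \<subseteq> \<Omega>"
      and osc: "\<And>a b. a \<in> closed_segment x (x + real r *\<^sub>R H) \<Longrightarrow> b \<in> closed_segment x (x + real r *\<^sub>R H) \<Longrightarrow>
          \<bar>sqrt (dl a) - sqrt (dl b)\<bar> \<le> K1 * t"
    define h where "h = H /\<^sub>R real N"
    have hN: "real N *\<^sub>R h = H" using N by (simp add: h_def)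
    have t': "0 < t0 * t" "t0 * t \<le> t0" using t t0 by (simp_all add: mult_left_le)
    have "norm H \<le> t0 * real N * t" using H mult_right_mono[OF NK, of t] t by linarith
    then have nh: "norm h \<le> t0 * t" using N by (simp add: h_def divide_simps mult_ac)
    have pt: "x + \<tau> *\<^sub>R h \<in> closed_segment x (x + real r *\<^sub>R H)" if "0 \<le> \<tau>" "\<tau> \<le> real (r * N)" for \<tau>
    proof -
      define u where "u = \<tau> / real (r * N)"
      have rN: "real (r * N) > 0" using r N by simp
      have u: "0 \<le> u" "u \<le> 1" "u * real (r * N) = \<tau>"
        unfolding u_def using that rN by (simp_all del: of_nat_mult)
      have "x + \<tau> *\<^sub>R h = (1 - u) *\<^sub>R x + u *\<^sub>R (x + real r *\<^sub>R H)"
        unfolding hN[symmetric] u(3)[symmetric] by (simp add: algebra_simps)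
      then show ?thesis using u unfolding in_segment by blast
    qed
    have "\<exists>m\<le>r * N. ennreal \<bar>fin_diff r h f (x + real k *\<^sub>R h)\<bar> \<le>
        ennreal C * w_mod r \<Omega> q f (x + real m *\<^sub>R h) (c0 * (t0 * t))" if k: "k + r \<le> r * N" for k
    proof -
      have sub: "closed_segment (x + real k *\<^sub>R h) (x + real k *\<^sub>R h + real r *\<^sub>R h) \<subseteq> closed_segment x (x + real r *\<^sub>R H)"
      proof -
        have eq: "x + real k *\<^sub>R h + real r *\<^sub>R h = x + real (k + r) *\<^sub>R h" by (simp add: algebra_simps)
        have "x + real (k + r) *\<^sub>R h \<in> closed_segment x (x + real r *\<^sub>R H)"
          by (rule pt) (use k in \<open>simp_all only: of_nat_le_iff of_nat_0_le_iff\<close>)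
        moreover have "x + real k *\<^sub>R h \<in> closed_segment x (x + real r *\<^sub>R H)"
          by (rule pt) (use k in \<open>simp_all only: of_nat_le_iff of_nat_0_le_iff add_leD1\<close>)
        ultimately show ?thesis unfolding eq subset_closed_segment by blast
      qed
      have "\<bar>sqrt (dl (x + real k *\<^sub>R h + real l *\<^sub>R h)) - sqrt (dl (x + real k *\<^sub>R h))\<bar> \<le> (K1 / t0) * (t0 * t)"
        if "l \<le> r" for l
      proof -
        have eq: "x + real k *\<^sub>R h + real l *\<^sub>R h = x + real (k + l) *\<^sub>R h" by (simp add: algebra_simps)
        have "x + real (k + l) *\<^sub>R h \<in> closed_segment x (x + real r *\<^sub>R H)"
          by (rule pt) (use k that in \<open>simp_all only: of_nat_le_iff of_nat_0_le_iff\<close>)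
        moreover have "x + real k *\<^sub>R h \<in> closed_segment x (x + real r *\<^sub>R H)"
          by (rule pt) (use k in \<open>simp_all only: of_nat_le_iff of_nat_0_le_iff add_leD1\<close>)
        ultimately have "\<bar>sqrt (dl (x + real k *\<^sub>R h + real l *\<^sub>R h)) - sqrt (dl (x + real k *\<^sub>R h))\<bar> \<le> K1 * t"
          unfolding eq by (intro osc)
        then show ?thesis using t0 by simp
      qed
      then have all: "\<forall>l\<le>r. \<bar>sqrt (dl (x + real k *\<^sub>R h + real l *\<^sub>R h)) - sqrt (dl (x + real k *\<^sub>R h))\<bar> \<le> (K1 / t0) * (t0 * t)"
        by blast
      have "x + real k *\<^sub>R h \<in> \<Omega>" using sub seg by auto
      from est[OF f this t' nh _ all] sub seg
      obtain l where l: "l \<le> r" "ennreal \<bar>fin_diff r h f (x + real k *\<^sub>R h)\<bar>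
          \<le> ennreal C * w_mod r \<Omega> q f (x + real k *\<^sub>R h + real l *\<^sub>R h) (c0 * (t0 * t))" by blast
      have eq: "x + real k *\<^sub>R h + real l *\<^sub>R h = x + real (k + l) *\<^sub>R h" by (simp add: algebra_simps)
      have "k + l \<le> r * N" using k l(1) by linarith
      then show ?thesis using l(2) unfolding eq by blast
    qed
    note each = this
    define F where "F k = \<bar>fin_diff r h f (x + real k *\<^sub>R h)\<bar>" for k
    \<comment> \<open>Of all short differences only the largest has to be bounded by a modulus,
      hence a single evaluation point is enough.\<close>
    obtain k where k: "k \<le> r * (N - 1)" "\<And>i. i \<le> r * (N - 1) \<Longrightarrow> F i \<le> F k"
    proof -
      have "finite (F ` {..r * (N - 1)})" "F ` {..r * (N - 1)} \<noteq> {}" by auto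
      then have "Max (F ` {..r * (N - 1)}) \<in> F ` {..r * (N - 1)}" by (rule Max_in)
      then obtain k where k: "Max (F ` {..r * (N - 1)}) = F k" "k \<in> {..r * (N - 1)}" by (rule imageE)
      show ?thesis
      proof (rule that[of k])
        show "k \<le> r * (N - 1)" using k(2) by (simp only: atMost_iff)
        show "F i \<le> F k" if "i \<le> r * (N - 1)" for i
          unfolding k(1)[symmetric] by (rule Max_ge) (use that in \<open>simp_all only: finite_imageI finite_atMost imageI atMost_iff\<close>)
      qed
    qed
    have "\<bar>fin_diff r H f x\<bar> \<le> real N ^ r * F k"
      unfolding hN[symmetric] by (rule fin_diff_split_bound[OF _ N]) (use k(2) in \<open>simp add: F_def\<close>)
    then have first: "ennreal \<bar>fin_diff r H f x\<bar> \<le> ennreal (real N ^ r) * ennreal (F k)"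
      by (simp add: F_def ennreal_leI flip: ennreal_mult)
    have "k + r \<le> r * N" using k(1) N by (cases N) auto
    from each[OF this] obtain m where m: "m \<le> r * N"
        "ennreal (F k) \<le> ennreal C * w_mod r \<Omega> q f (x + real m *\<^sub>R h) (c0 * (t0 * t))" unfolding F_def by blast
    have "ennreal (real N ^ r) * ennreal (F k) \<le> ennreal (real N ^ r) * (ennreal C * w_mod r \<Omega> q f (x + real m *\<^sub>R h) (c0 * (t0 * t)))"
      using m(2) by (rule mult_left_mono) simp
    also have "\<dots> = ennreal (real N ^ r * C) * w_mod r \<Omega> q f (x + (real m / real N) *\<^sub>R H) (c0 * t0 * t)"
      using C by (simp add: ennreal_mult' mult.assoc h_def divide_inverse)
    finally show "\<exists>m\<le>r * N. ennreal \<bar>fin_diff r H f x\<bar> \<le>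
        ennreal (real N ^ r * C) * w_mod r \<Omega> q f (x + (real m / real N) *\<^sub>R H) (c0 * t0 * t)"
      using m(1) order_trans[OF first] by blast
  qed
qed

end

section \<open>Chords\<close>

lemma sqrt_diff_le_symmetric:
  assumes "0 \<le> a" "0 \<le> b" "0 \<le> C" "0 < t"
    "a \<le> b + C * (t\<^sup>2 + t * sqrt b)" "b \<le> a + C * (t\<^sup>2 + t * sqrt a)"
  shows "\<bar>sqrt a - sqrt b\<bar> \<le> (2 * C + 1) * t"
proof (cases "b \<le> a")
  case True
  then show ?thesis using assms by (intro sqrt_diff_le) auto
next
  case False
  then have "\<bar>sqrt b - sqrt a\<bar> \<le> (2 * C + 1) * t" using assms by (intro sqrt_diff_le) auto
  then show ?thesis by (simp add: abs_minus_commute)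
qed

lemma segment_on_line:
  fixes \<xi> e :: "'a::real_vector"
  assumes "a \<le> b"
  shows "closed_segment (\<xi> + a *\<^sub>R e) (\<xi> + b *\<^sub>R e) = (\<lambda>u. \<xi> + u *\<^sub>R e) ` {a..b}"
proof (intro equalityI subsetI)
  fix y assume "y \<in> closed_segment (\<xi> + a *\<^sub>R e) (\<xi> + b *\<^sub>R e)"
  then obtain u where u: "0 \<le> u" "u \<le> 1" "y = (1 - u) *\<^sub>R (\<xi> + a *\<^sub>R e) + u *\<^sub>R (\<xi> + b *\<^sub>R e)"
    unfolding in_segment by blast
  have "y = \<xi> + (a + u * (b - a)) *\<^sub>R e" unfolding u(3) by (simp add: algebra_simps)
  moreover have "u * (b - a) \<le> 1 * (b - a)" using u assms by (intro mult_right_mono) auto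
  moreover have "0 \<le> u * (b - a)" using u assms by simp
  ultimately show "y \<in> (\<lambda>u. \<xi> + u *\<^sub>R e) ` {a..b}" by auto
next
  fix y assume "y \<in> (\<lambda>u. \<xi> + u *\<^sub>R e) ` {a..b}"
  then obtain v where v: "a \<le> v" "v \<le> b" "y = \<xi> + v *\<^sub>R e" by auto
  show "y \<in> closed_segment (\<xi> + a *\<^sub>R e) (\<xi> + b *\<^sub>R e)"
  proof (cases "a = b")
    case True
    then show ?thesis using v by auto
  next
    case False
    define u where "u = (v - a) / (b - a)"
    have u: "0 \<le> u" "u \<le> 1" "u * (b - a) = v - a" using v assms False by (auto simp: u_def)
    have "v = (1 - u) * a + u * b" using u(3) by (simp add: algebra_simps)
    then have "y = \<xi> + ((1 - u) * a + u * b) *\<^sub>R e" using v(3) by (simp only:)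
    then have "y = (1 - u) *\<^sub>R (\<xi> + a *\<^sub>R e) + u *\<^sub>R (\<xi> + b *\<^sub>R e)"
      by (simp add: algebra_simps)
    then show ?thesis using u unfolding in_segment by blast
  qed
qed

lemma segment_from_base:
  fixes \<xi> e :: "'a::real_vector"
  assumes "0 \<le> b"
  shows "closed_segment \<xi> (\<xi> + b *\<^sub>R e) = (\<lambda>u. \<xi> + u *\<^sub>R e) ` {0..b}"
  using segment_on_line[OF assms, of \<xi> e] by simp

definition reach :: "'a::euclidean_space set \<Rightarrow> 'a \<Rightarrow> 'a \<Rightarrow> real" where
  "reach \<Omega> e \<xi> = Sup {l. 0 \<le> l \<and> closed_segment \<xi> (\<xi> + l *\<^sub>R e) \<subseteq> \<Omega>}"

context
  fixes \<Omega> :: "'a::euclidean_space set" and e \<xi> :: 'a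
  assumes compact: "compact \<Omega>" and e: "norm e = 1" and \<xi>: "\<xi> \<in> \<Omega>"
begin

lemma
  shows reach_iff: "0 \<le> l \<Longrightarrow> closed_segment \<xi> (\<xi> + l *\<^sub>R e) \<subseteq> \<Omega> \<longleftrightarrow> l \<le> reach \<Omega> e \<xi>"
    and reach_nonneg: "0 \<le> reach \<Omega> e \<xi>"
proof -
  define S where "S = {l. 0 \<le> l \<and> closed_segment \<xi> (\<xi> + l *\<^sub>R e) \<subseteq> \<Omega>}"
  have "S = {0..} \<inter> (\<lambda>l. (\<xi>, \<xi> + l *\<^sub>R e)) -` {p. closed_segment (fst p) (snd p) \<subseteq> \<Omega>}"
    by (auto simp: S_def)
  moreover have "closed \<dots>"
    by (intro closed_Int closed_atLeast continuous_closed_vimage closed_segments_inside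
        compact_imp_closed compact continuous_intros)
  ultimately have cl: "closed S" by simp
  obtain B where B: "\<And>x. x \<in> \<Omega> \<Longrightarrow> norm x \<le> B"
    using compact_imp_bounded[OF compact] unfolding bounded_iff by blast
  have bd: "l \<le> 2 * B" if "l \<in> S" for l
  proof -
    have "\<xi> + l *\<^sub>R e \<in> \<Omega>" using that by (auto simp: S_def)
    then have "norm ((\<xi> + l *\<^sub>R e) - \<xi>) \<le> B + B"
      using B[OF \<xi>] B[of "\<xi> + l *\<^sub>R e"] norm_triangle_ineq4[of "\<xi> + l *\<^sub>R e" \<xi>] by linarith
    then show ?thesis using that e by (simp add: S_def)
  qed
  have bdd: "bdd_above S" using bd by (rule bdd_aboveI)
  have 0: "0 \<in> S" using \<xi> by (simp add: S_def)
  have "reach \<Omega> e \<xi> = Sup S" by (simp add: reach_def S_def)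
  moreover have "Sup S \<in> S" using closed_contains_Sup[OF _ bdd cl] 0 by blast
  ultimately have R: "reach \<Omega> e \<xi> \<in> S" "\<And>l. l \<in> S \<Longrightarrow> l \<le> reach \<Omega> e \<xi>"
    using cSup_upper[OF _ bdd] by auto
  show "0 \<le> reach \<Omega> e \<xi>" using R(1) by (simp add: S_def)
  show "closed_segment \<xi> (\<xi> + l *\<^sub>R e) \<subseteq> \<Omega> \<longleftrightarrow> l \<le> reach \<Omega> e \<xi>" if l: "0 \<le> l"
  proof
    assume "closed_segment \<xi> (\<xi> + l *\<^sub>R e) \<subseteq> \<Omega>"
    then show "l \<le> reach \<Omega> e \<xi>" using R(2) l by (simp add: S_def)
  next
    assume "l \<le> reach \<Omega> e \<xi>"
    then have "{0..l} \<subseteq> {0..reach \<Omega> e \<xi>}" "0 \<le> reach \<Omega> e \<xi>" using l by auto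
    then have "closed_segment \<xi> (\<xi> + l *\<^sub>R e) \<subseteq> closed_segment \<xi> (\<xi> + reach \<Omega> e \<xi> *\<^sub>R e)"
      unfolding segment_from_base[OF l] segment_from_base[OF \<open>0 \<le> reach \<Omega> e \<xi>\<close>] by (intro image_mono)
    then show "closed_segment \<xi> (\<xi> + l *\<^sub>R e) \<subseteq> \<Omega>" using R(1) by (auto simp: S_def)
  qed
qed

lemma reach_point: "0 \<le> u \<Longrightarrow> u \<le> reach \<Omega> e \<xi> \<Longrightarrow> \<xi> + u *\<^sub>R e \<in> \<Omega>"
  using reach_iff[of u] by auto

lemma reach_frontier: "\<xi> + reach \<Omega> e \<xi> *\<^sub>R e \<in> frontier \<Omega>"
proof (rule ccontr)
  assume "\<xi> + reach \<Omega> e \<xi> *\<^sub>R e \<notin> frontier \<Omega>"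
  moreover have "\<xi> + reach \<Omega> e \<xi> *\<^sub>R e \<in> \<Omega>" using reach_point reach_nonneg by simp
  ultimately have "\<xi> + reach \<Omega> e \<xi> *\<^sub>R e \<in> interior \<Omega>"
    using closure_subset by (auto simp: frontier_def)
  then obtain d where d: "d > 0" "ball (\<xi> + reach \<Omega> e \<xi> *\<^sub>R e) d \<subseteq> \<Omega>"
    using mem_interior by blast
  have "closed_segment \<xi> (\<xi> + (reach \<Omega> e \<xi> + d / 2) *\<^sub>R e) \<subseteq> \<Omega>"
  proof -
    have "\<xi> + u *\<^sub>R e \<in> \<Omega>" if u: "0 \<le> u" "u \<le> reach \<Omega> e \<xi> + d / 2" for u
    proof (cases "u \<le> reach \<Omega> e \<xi>")
      case False
      have "dist (\<xi> + reach \<Omega> e \<xi> *\<^sub>R e) (\<xi> + u *\<^sub>R e) = norm ((reach \<Omega> e \<xi> - u) *\<^sub>R e)"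
        by (simp add: dist_norm algebra_simps)
      also have "\<dots> < d" using False u d e by simp
      finally show ?thesis using d(2) by auto
    qed (use reach_point u in simp)
    moreover have "0 \<le> reach \<Omega> e \<xi> + d / 2" using reach_nonneg d by simp
    ultimately show ?thesis by (simp only: segment_from_base) auto
  qed
  then have "reach \<Omega> e \<xi> + d / 2 \<le> reach \<Omega> e \<xi>"
    using reach_iff[of "reach \<Omega> e \<xi> + d / 2"] reach_nonneg d by simp
  then show False using d by simp
qed

end

lemma segment_reach_iff:
  fixes \<Omega> :: "'a::euclidean_space set"
  assumes "compact \<Omega>" "norm e = 1" "\<xi> \<in> \<Omega>" and l: "0 \<le> l1" "0 \<le> l2"
  shows "closed_segment (\<xi> - l1 *\<^sub>R e) (\<xi> + l2 *\<^sub>R e) \<subseteq> \<Omega> \<longleftrightarrow> l1 \<le> reach \<Omega> (- e) \<xi> \<and> l2 \<le> reach \<Omega> e \<xi>"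
proof -
  have e': "norm (- e) = 1" using assms by simp
  have seg: "closed_segment (\<xi> - l1 *\<^sub>R e) (\<xi> + l2 *\<^sub>R e) = (\<lambda>u. \<xi> + u *\<^sub>R e) ` {- l1..l2}"
    using segment_on_line[of "- l1" l2 \<xi> e] l by simp
  have "{- l1..l2} = {- l1..0} \<union> {0..l2}" using l by auto
  then have un: "(\<lambda>u. \<xi> + u *\<^sub>R e) ` {- l1..l2} = (\<lambda>u. \<xi> + u *\<^sub>R e) ` {- l1..0} \<union> (\<lambda>u. \<xi> + u *\<^sub>R e) ` {0..l2}"
    by (simp only: image_Un)
  have "{- l1..0} = uminus ` {0..l1}" by simp
  then have "(\<lambda>u. \<xi> + u *\<^sub>R e) ` {- l1..0} = (\<lambda>u. \<xi> + (- u) *\<^sub>R e) ` {0..l1}"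
    by (simp only: image_image)
  also have "\<dots> = closed_segment \<xi> (\<xi> + l1 *\<^sub>R (- e))"
    unfolding segment_from_base[OF l(1)] by simp
  finally have "closed_segment (\<xi> - l1 *\<^sub>R e) (\<xi> + l2 *\<^sub>R e) =
      closed_segment \<xi> (\<xi> + l1 *\<^sub>R (- e)) \<union> closed_segment \<xi> (\<xi> + l2 *\<^sub>R e)"
    unfolding seg un segment_from_base[OF l(2)] by (simp only:)
  then show ?thesis
    using reach_iff[OF assms(1) e' assms(3) l(1)] reach_iff[OF assms(1-3) l(2)] by (simp only: Un_subset_iff)
qed

text \<open>The admissible pairs of lengths form a product, because the segment splits at
  \<open>\<xi>\<close> into two independent halves; the supremum is attained at the two maximal
  lengths.\<close>

lemma phi_eq_reach:
  fixes \<Omega> :: "'a::euclidean_space set"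
  assumes "compact \<Omega>" "norm e = 1" "\<xi> \<in> \<Omega>"
  shows "phi \<Omega> e \<xi> = sqrt (reach \<Omega> (- e) \<xi> * reach \<Omega> e \<xi>)"
proof -
  have e': "norm (- e) = 1" using assms by simp
  note nn = reach_nonneg[OF assms(1) e' assms(3)] reach_nonneg[OF assms]
  show ?thesis unfolding phi_def
  proof (rule cSup_eq_maximum)
    show "sqrt (reach \<Omega> (- e) \<xi> * reach \<Omega> e \<xi>) \<in>
      {sqrt (l1 * l2) |l1 l2. 0 \<le> l1 \<and> 0 \<le> l2 \<and> closed_segment (\<xi> - l1 *\<^sub>R e) (\<xi> + l2 *\<^sub>R e) \<subseteq> \<Omega>}"
      using nn segment_reach_iff[OF assms nn] by blast
    fix x assume "x \<in> {sqrt (l1 * l2) |l1 l2. 0 \<le> l1 \<and> 0 \<le> l2 \<and> closed_segment (\<xi> - l1 *\<^sub>R e) (\<xi> + l2 *\<^sub>R e) \<subseteq> \<Omega>}"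
    then obtain l1 l2 where l: "x = sqrt (l1 * l2)" "0 \<le> l1" "0 \<le> l2"
      "closed_segment (\<xi> - l1 *\<^sub>R e) (\<xi> + l2 *\<^sub>R e) \<subseteq> \<Omega>" by blast
    then have "l1 \<le> reach \<Omega> (- e) \<xi>" "l2 \<le> reach \<Omega> e \<xi>" using segment_reach_iff[OF assms l(2,3)] by auto
    then have "l1 * l2 \<le> reach \<Omega> (- e) \<xi> * reach \<Omega> e \<xi>" using l by (intro mult_mono) auto
    then show "x \<le> sqrt (reach \<Omega> (- e) \<xi> * reach \<Omega> e \<xi>)" using l by simp
  qed
qed

context two_ball
begin

text \<open>A point behind \<open>\<zeta>\<close> on the line controls the growth ahead: as the
  height at \<zeta> - \<sigma> e is nonnegative up to a quadratic error, the slope -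
  \<open>n \<bullet> e\<close> is at most \<open>dl \<zeta> / \<sigma> + 6 * K * \<sigma>\<close>.
  The length \<sigma> is left free for balancing the two terms.\<close>

lemma dl_along_line:
  assumes \<zeta>: "\<zeta> \<in> \<Omega>" and e: "norm e = 1" and \<tau>: "0 \<le> \<tau>" "\<zeta> + \<tau> *\<^sub>R e \<in> \<Omega>" "\<tau> \<le> 1 / (8 * K)"
    and \<sigma>: "0 < \<sigma>" "\<zeta> - \<sigma> *\<^sub>R e \<in> \<Omega>" "\<sigma> \<le> 1 / (8 * K)" and d: "dl \<zeta> \<le> 1 / (8 * K)"
  shows "dl (\<zeta> + \<tau> *\<^sub>R e) \<le> dl \<zeta> + \<tau> * (dl \<zeta> / \<sigma> + 6 * K * \<sigma>) + 6 * K * \<tau>\<^sup>2"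
proof -
  obtain z where z: "z \<in> frontier \<Omega>" "dl \<zeta> = norm (\<zeta> - z)" using nearest_point .
  obtain n where n: "normal z n" using normal_exists[OF z(1)] by blast
  define d' where "d' = dl \<zeta>"
  have \<zeta>z: "\<zeta> = z - d' *\<^sub>R n" unfolding d'_def by (rule nearest_normal[OF \<zeta> z(2) n])
  have nn: "n \<bullet> n = 1" using normal_norm[OF n] by simp
  have h: "n \<bullet> (z - (\<zeta> + \<tau> *\<^sub>R e)) = d' - \<tau> * (n \<bullet> e)" "n \<bullet> (z - (\<zeta> - \<sigma> *\<^sub>R e)) = d' + \<sigma> * (n \<bullet> e)"
    unfolding \<zeta>z by (simp_all add: inner_diff_right inner_add_right nn)
  have 1: "\<bar>dl (\<zeta> + \<tau> *\<^sub>R e) - (d' - \<tau> * (n \<bullet> e))\<bar> \<le> 6 * K * \<tau>\<^sup>2"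
    using dl_height[OF \<zeta> z(2) n \<tau>(2) _ \<tau>(3) d] \<tau> e unfolding h by simp
  have 2: "\<bar>dl (\<zeta> - \<sigma> *\<^sub>R e) - (d' + \<sigma> * (n \<bullet> e))\<bar> \<le> 6 * K * \<sigma>\<^sup>2"
    using dl_height[OF \<zeta> z(2) n \<sigma>(2) _ \<sigma>(3) d] \<sigma> e unfolding h by simp
  have "\<sigma> * (- (n \<bullet> e)) \<le> d' + 6 * K * \<sigma>\<^sup>2" using 2 dl_nonneg[of "\<zeta> - \<sigma> *\<^sub>R e"] by linarith
  also have "\<dots> = \<sigma> * (d' / \<sigma> + 6 * K * \<sigma>)" using \<sigma> by (simp add: power2_eq_square algebra_simps)
  finally have "- (n \<bullet> e) \<le> d' / \<sigma> + 6 * K * \<sigma>" using \<sigma>(1) mult_le_cancel_left_pos by blast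
  then have "\<tau> * (- (n \<bullet> e)) \<le> \<tau> * (d' / \<sigma> + 6 * K * \<sigma>)" using \<tau> by (intro mult_left_mono)
  then show ?thesis using 1 unfolding d'_def by linarith
qed

lemma diameter_bound: obtains D where "D \<ge> 1" "\<And>x y. x \<in> \<Omega> \<Longrightarrow> y \<in> \<Omega> \<Longrightarrow> norm (x - y) \<le> D" "\<And>x. x \<in> \<Omega> \<Longrightarrow> dl x \<le> D"
proof -
  obtain B where B: "\<And>x. x \<in> \<Omega> \<Longrightarrow> norm x \<le> B"
    using compact_imp_bounded[OF compact] unfolding bounded_iff by blast
  define D where "D = \<bar>2 * B\<bar> + 1"
  have 1: "norm (x - y) \<le> D" if "x \<in> \<Omega>" "y \<in> \<Omega>" for x y
    using norm_triangle_ineq4[of x y] B[OF that(1)] B[OF that(2)] unfolding D_def by linarith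
  have 2: "dl x \<le> D" if "x \<in> \<Omega>" for x
  proof -
    obtain z where z: "z \<in> frontier \<Omega>" "dl x = norm (x - z)" using nearest_point .
    then show ?thesis using 1[OF that, of z] frontier_subset by auto
  qed
  show ?thesis using 1 2 by (intro that[of D]) (auto simp: D_def)
qed

text \<open>The step is at most \<open>t\<close> times the geometric mean of the two parts of the chord, hence at most of
  order \<open>t * sqrt l\<close> for the distance \<open>l \<ge> dl \<zeta>\<close> of a point of the segment to an end of the chord.\<close>

lemma chord_oscillation:
  fixes \<rho> :: real
  assumes \<rho>: "\<rho> > 0"
  obtains K2 where "K2 > 0"
    "\<And>\<eta> e t w \<alpha> \<beta>. \<eta> \<in> \<Omega> \<Longrightarrow> norm e = 1 \<Longrightarrow> 0 < t \<Longrightarrow> t \<le> 1 \<Longrightarrow>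
       w \<le> \<rho> * t * phi \<Omega> e \<eta> \<Longrightarrow> w \<le> reach \<Omega> e \<eta> \<Longrightarrow> w \<le> reach \<Omega> (- e) \<eta> \<Longrightarrow>
       \<bar>\<alpha>\<bar> \<le> w \<Longrightarrow> \<bar>\<beta>\<bar> \<le> w \<Longrightarrow>
       \<bar>sqrt (dl (\<eta> + \<alpha> *\<^sub>R e)) - sqrt (dl (\<eta> + \<beta> *\<^sub>R e))\<bar> \<le> K2 * t"
proof -
  obtain D where D: "D \<ge> 1" "\<And>x y. x \<in> \<Omega> \<Longrightarrow> y \<in> \<Omega> \<Longrightarrow> norm (x - y) \<le> D" using diameter_bound by metis
  \<comment> \<open>The constant in \<phi> \<le> M max (t, sqrt l1), where l1 is the distance of a
    point of the segment to the end of the chord behind it.\<close>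
  define M where "M = sqrt D + D * \<rho>"
  define t1 where "t1 = min (1 / (16 * K)) (1 / (16 * K * \<rho> * D))"
  define s1 where "s1 = min (1 / (16 * K)) (sqrt (1 / (8 * K)))"
  have D0: "D > 0" using D(1) by linarith
  have "0 < 16 * K * \<rho> * D" "0 < 1 / (8 * K)" using K_pos \<rho> D0 by simp_all
  then have t1: "t1 > 0" and s1: "s1 > 0" unfolding t1_def s1_def using K_pos by simp_all
  define C where "C = 2 * \<rho> * D / t1 + 2 * \<rho> * D / s1 + 2 * \<rho> * M + 2 * \<rho> * D + 12 * \<rho> * D * K + 24 * K * \<rho>\<^sup>2 * D\<^sup>2"
  have M: "M > 0" using D0 \<rho> by (simp add: M_def add_pos_pos)
  have parts: "0 \<le> 2 * \<rho> * D / t1" "0 \<le> 2 * \<rho> * D / s1" "0 \<le> 2 * \<rho> * M" "0 \<le> 2 * \<rho> * D" "0 \<le> 12 * \<rho> * D * K" "0 \<le> 24 * K * \<rho>\<^sup>2 * D\<^sup>2"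
    using t1 s1 M D0 \<rho> K_pos by simp_all
  have C: "C \<ge> 0" using parts unfolding C_def by linarith
  \<comment> \<open>A one-sided bound in the direction of e; the opposite order follows with - e in
    place of e, which leaves \<phi> unchanged.\<close>
  have main: "dl (\<eta> + \<beta> *\<^sub>R e) \<le> dl (\<eta> + \<alpha> *\<^sub>R e) + C * (t\<^sup>2 + t * sqrt (dl (\<eta> + \<alpha> *\<^sub>R e)))"
    if \<eta>: "\<eta> \<in> \<Omega>" and e: "norm e = 1" and t: "0 < t" "t \<le> 1"
      and w: "w \<le> \<rho> * t * phi \<Omega> e \<eta>" "w \<le> reach \<Omega> e \<eta>" "w \<le> reach \<Omega> (- e) \<eta>"
      and \<alpha>: "\<bar>\<alpha>\<bar> \<le> w" and \<beta>: "\<bar>\<beta>\<bar> \<le> w" and ord: "\<alpha> \<le> \<beta>" for \<eta> e t w \<alpha> \<beta>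
  proof -
    have e': "norm (- e) = 1" using e by simp
    define Lp where "Lp = reach \<Omega> e \<eta>"
    define Lm where "Lm = reach \<Omega> (- e) \<eta>"
    define \<phi> where "\<phi> = phi \<Omega> e \<eta>"
    have L: "Lp \<ge> 0" "Lm \<ge> 0"
      unfolding Lp_def Lm_def by (rule reach_nonneg[OF compact e \<eta>], rule reach_nonneg[OF compact e' \<eta>])
    have \<phi>: "\<phi> = sqrt (Lm * Lp)" unfolding \<phi>_def Lp_def Lm_def by (rule phi_eq_reach[OF compact e \<eta>])
    have \<phi>2: "\<phi>\<^sup>2 = Lm * Lp" "\<phi> \<ge> 0" unfolding \<phi> using L by simp_all
    have pt: "\<eta> + u *\<^sub>R e \<in> \<Omega>" if "- Lm \<le> u" "u \<le> Lp" for u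
    proof (cases "u \<ge> 0")
      case True
      then show ?thesis using reach_point[OF compact e \<eta>, of u] that(2) unfolding Lp_def by blast
    next
      case False
      then have "0 \<le> - u" "- u \<le> reach \<Omega> (- e) \<eta>" using that(1) unfolding Lm_def by linarith+
      then have "\<eta> + (- u) *\<^sub>R (- e) \<in> \<Omega>" by (rule reach_point[OF compact e' \<eta>])
      then show ?thesis by simp
    qed
    have endm: "\<eta> + (- Lm) *\<^sub>R e \<in> frontier \<Omega>" using reach_frontier[OF compact e' \<eta>] unfolding Lm_def by simp
    have "norm ((\<eta> + Lp *\<^sub>R e) - (\<eta> + 0 *\<^sub>R e)) \<le> D" "norm ((\<eta> + (- Lm) *\<^sub>R e) - (\<eta> + 0 *\<^sub>R e)) \<le> D"
      by (intro D(2) pt; use L in linarith)+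
    then have LD: "Lp \<le> D" "Lm \<le> D" using L e by (simp_all add: add_diff_eq)
    have "Lm * Lp \<le> D * D" using LD L by (intro mult_mono) auto
    then have "\<phi>\<^sup>2 \<le> D\<^sup>2" by (simp only: \<phi>2(1) power2_eq_square[of D])
    from power2_le_imp_le[OF this] have \<phi>D: "\<phi> \<le> D" using D0 by linarith
    define a where "a = \<eta> + \<alpha> *\<^sub>R e"
    define l1 where "l1 = Lm + \<alpha>"
    have l1: "l1 \<ge> 0" using \<alpha> w(3) unfolding l1_def Lm_def by linarith
    define \<tau> where "\<tau> = \<beta> - \<alpha>"
    have b: "\<eta> + \<beta> *\<^sub>R e = a + \<tau> *\<^sub>R e" unfolding a_def \<tau>_def by (simp add: scaleR_diff_left)
    have \<tau>: "0 \<le> \<tau>" "\<tau> \<le> 2 * \<rho> * t * \<phi>" using ord \<alpha> \<beta> w(1) unfolding \<tau>_def \<phi>_def by linarith+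
    have a\<Omega>: "a \<in> \<Omega>" unfolding a_def by (rule pt; use \<alpha> w(2,3) in \<open>unfold Lp_def Lm_def, linarith\<close>)
    have b\<Omega>: "a + \<tau> *\<^sub>R e \<in> \<Omega>" unfolding b[symmetric] by (rule pt; use \<beta> w(2,3) in \<open>unfold Lp_def Lm_def, linarith\<close>)
    have \<rho>t: "0 < 2 * \<rho> * t" using \<rho> t by simp
    have \<tau>D: "\<tau> \<le> 2 * \<rho> * D * t"
    proof -
      have "2 * \<rho> * t * \<phi> \<le> 2 * \<rho> * t * D" using \<phi>D \<rho>t by (intro mult_left_mono) linarith+
      also have "\<dots> = 2 * \<rho> * D * t" by (simp only: mult.assoc mult.commute mult.left_commute)
      finally show ?thesis using \<tau>(2) by linarith
    qed
    define s where "s = sqrt (dl a)"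
    have s: "s \<ge> 0" "dl a = s * s" by (simp_all add: s_def)
    have "a - (\<eta> + (- Lm) *\<^sub>R e) = l1 *\<^sub>R e" unfolding a_def l1_def by (simp add: scaleR_add_left)
    then have "norm (a - (\<eta> + (- Lm) *\<^sub>R e)) = l1" using e l1 by simp
    then have dl1: "dl a \<le> l1" using dl_le[OF endm, of a] by linarith
    have lip: "dl (a + \<tau> *\<^sub>R e) \<le> dl a + \<tau>" using dl_lipschitz[of "a + \<tau> *\<^sub>R e" a] e \<tau>(1) by simp
    \<comment> \<open>From \<phi>^2 = Lm Lp \<le> D Lm and Lm \<le> l1 + \<rho> t \<phi> one has
      \<phi>^2 \<le> D l1 + D \<rho> t \<phi>, which fails if \<phi> exceeds the claimed
      sum.\<close>
    have \<phi>le: "\<phi> \<le> sqrt (D * l1) + D * \<rho> * t"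
    proof (rule ccontr)
      assume "\<not> ?thesis"
      then have gt: "\<phi> > sqrt (D * l1) + D * \<rho> * t" by simp
      have nn: "0 \<le> sqrt (D * l1)" "0 \<le> D * \<rho> * t" using D0 l1 \<rho> t by simp_all
      have "Lp * Lm \<le> D * Lm" using LD(1) L(2) by (rule mult_right_mono)
      moreover have "Lm \<le> l1 + \<rho> * t * \<phi>" using \<alpha> w(1) unfolding l1_def \<phi>_def by linarith
      then have "D * Lm \<le> D * (l1 + \<rho> * t * \<phi>)" using D0 by (intro mult_left_mono) linarith+
      moreover have "\<phi> * \<phi> = Lp * Lm" using \<phi>2(1) unfolding power2_eq_square by (simp only: mult.commute)
      moreover have "D * (l1 + \<rho> * t * \<phi>) = D * l1 + D * \<rho> * t * \<phi>" by (simp add: algebra_simps)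
      ultimately have 1: "\<phi> * \<phi> \<le> D * l1 + D * \<rho> * t * \<phi>" by linarith
      have pos: "\<phi> > 0" using gt nn by linarith
      have "sqrt (D * l1) * sqrt (D * l1) \<le> sqrt (D * l1) * \<phi>" using gt nn by (intro mult_left_mono) linarith+
      moreover have "sqrt (D * l1) * sqrt (D * l1) = D * l1" using D0 l1 by (intro real_sqrt_mult_self[THEN trans]) simp
      moreover have "(sqrt (D * l1) + D * \<rho> * t) * \<phi> = sqrt (D * l1) * \<phi> + D * \<rho> * t * \<phi>" by (rule distrib_right)
      ultimately have "D * l1 + D * \<rho> * t * \<phi> \<le> (sqrt (D * l1) + D * \<rho> * t) * \<phi>" by linarith
      also have "\<dots> < \<phi> * \<phi>" using gt pos by (rule mult_strict_right_mono)
      finally show False using 1 by simp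
    qed
    have nnX: "0 \<le> t * t" "0 \<le> t * s" using t s by simp_all
    have goal_eq: "C * (t\<^sup>2 + t * sqrt (dl (\<eta> + \<alpha> *\<^sub>R e))) = C * (t * t + t * s)"
      by (simp add: s_def a_def power2_eq_square)
    have cmp: "c * (t * t + t * s) \<le> C * (t * t + t * s)" if "c \<le> C" for c
      using that nnX by (intro mult_right_mono) auto
    have "dl (a + \<tau> *\<^sub>R e) \<le> dl a + C * (t * t + t * s)"
    proof -
      \<comment> \<open>For t or s bounded below, the bound \<tau> = O(t) is already sufficient, and
        for l1 \<le> t^2 even \<tau> = O(t^2) holds. The slope estimate is called for in the last
        case only.\<close>
      consider "t > t1" | "s > s1" | "t \<le> t1" "s \<le> s1" "l1 \<le> t * t" | "t \<le> t1" "s \<le> s1" "l1 > t * t" by linarith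
      then show ?thesis
      proof cases
        case 1
        have "2 * \<rho> * D * t = (2 * \<rho> * D / t1) * (t1 * t)" using t1 by simp
        also have "\<dots> \<le> (2 * \<rho> * D / t1) * (t * t + t * s)"
        proof (rule mult_left_mono[OF _ parts(1)])
          have "t1 * t \<le> t * t" using 1 t by simp
          then show "t1 * t \<le> t * t + t * s" using nnX by linarith
        qed
        also have "\<dots> \<le> C * (t * t + t * s)" by (rule cmp) (use parts in \<open>unfold C_def, linarith\<close>)
        finally show ?thesis using lip \<tau>D by linarith
      next
        case 2
        have "2 * \<rho> * D * t = (2 * \<rho> * D / s1) * (t * s1)" using s1 by simp
        also have "\<dots> \<le> (2 * \<rho> * D / s1) * (t * t + t * s)"
        proof (rule mult_left_mono[OF _ parts(2)])
          have "t * s1 \<le> t * s" using 2 t by simp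
          then show "t * s1 \<le> t * t + t * s" using nnX by linarith
        qed
        also have "\<dots> \<le> C * (t * t + t * s)" by (rule cmp) (use parts in \<open>unfold C_def, linarith\<close>)
        finally show ?thesis using lip \<tau>D by linarith
      next
        case 3
        have "D * l1 \<le> D * (t * t)" using 3(3) D0 by (intro mult_left_mono) linarith+
        then have "sqrt (D * l1) \<le> sqrt (D * (t * t))" by simp
        also have "\<dots> = sqrt D * t" using t by (simp add: real_sqrt_mult)
        finally have "\<phi> \<le> M * t" using \<phi>le by (simp add: M_def algebra_simps)
        then have "2 * \<rho> * t * \<phi> \<le> 2 * \<rho> * t * (M * t)" using \<rho>t by (intro mult_left_mono) linarith+
        also have "\<dots> = (2 * \<rho> * M) * (t * t)" by (simp only: mult.assoc mult.commute mult.left_commute)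
        finally have "\<tau> \<le> (2 * \<rho> * M) * (t * t)" using \<tau>(2) by linarith
        also have "\<dots> \<le> (2 * \<rho> * M) * (t * t + t * s)" using parts(3) nnX by (intro mult_left_mono) auto
        also have "\<dots> \<le> C * (t * t + t * s)" by (rule cmp) (use parts in \<open>unfold C_def, linarith\<close>)
        finally show ?thesis using lip by linarith
      next
        case 4
        have l1p: "l1 > 0" using 4(3) nnX(1) by linarith
        have tl: "t \<le> sqrt l1" using 4(3) t by (intro real_le_rsqrt) (simp add: power2_eq_square)
        have sl: "s \<le> sqrt l1" unfolding s_def using dl1 by simp
        have "0 \<le> D * \<rho>" using D0 \<rho> by simp
        with tl have "D * \<rho> * t \<le> D * \<rho> * sqrt l1" by (rule mult_left_mono)
        moreover have "M * sqrt l1 = sqrt (D * l1) + D * \<rho> * sqrt l1" unfolding M_def real_sqrt_mult by (rule distrib_right)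
        ultimately have "\<phi> \<le> M * sqrt l1" using \<phi>le by linarith
        then have "2 * \<rho> * t * \<phi> \<le> 2 * \<rho> * t * (M * sqrt l1)" using \<rho>t by (intro mult_left_mono) linarith+
        also have "\<dots> = (2 * \<rho> * M) * (t * sqrt l1)" by (simp only: mult.assoc mult.commute mult.left_commute)
        finally have \<tau>l: "\<tau> \<le> (2 * \<rho> * M) * (t * sqrt l1)" using \<tau>(2) by linarith
        \<comment> \<open>The two terms of the slope bound balance at \<sigma> = s + t; the cap l1
          keeps a - \<sigma> e on the chord. When the cap is active the slope may be as large as s /
          sqrt l1, but \<tau> is then of order t sqrt l1 and compensates.\<close>
        define \<sigma> where "\<sigma> = min (s + t) l1"
        have \<sigma>: "0 < \<sigma>" "\<sigma> \<le> s + t" "\<sigma> \<le> l1" using s t l1p by (auto simp: \<sigma>_def)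
        have ts16: "t \<le> 1 / (16 * K)" "t \<le> 1 / (16 * K * \<rho> * D)" "s \<le> 1 / (16 * K)" "s \<le> sqrt (1 / (8 * K))"
          using 4 by (auto simp: t1_def s1_def)
        have h16: "1 / (16 * K) + 1 / (16 * K) = 1 / (8 * K)" using K_pos by (simp add: field_simps)
        have "\<sigma> \<le> 1 / (8 * K)" using \<sigma>(2) ts16 h16 by linarith
        moreover have "dl a \<le> 1 / (8 * K)" using ts16(4) unfolding s_def by simp
        moreover have "\<tau> \<le> 1 / (8 * K)"
        proof -
          have "2 * \<rho> * D * t \<le> 2 * \<rho> * D * (1 / (16 * K * \<rho> * D))" using ts16(2) parts(4) by (rule mult_left_mono)
          also have "\<dots> = 1 / (8 * K)" using \<rho> D0 K_pos by (simp add: divide_simps)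
          finally show ?thesis using \<tau>D by linarith
        qed
        moreover have "a - \<sigma> *\<^sub>R e \<in> \<Omega>"
        proof -
          have "a - \<sigma> *\<^sub>R e = \<eta> + (\<alpha> - \<sigma>) *\<^sub>R e" unfolding a_def by (simp add: scaleR_diff_left)
          moreover have "\<dots> \<in> \<Omega>"
            by (rule pt; use \<sigma>(1,3) \<alpha> w(2) in \<open>unfold l1_def Lp_def, linarith\<close>)
          ultimately show ?thesis by simp
        qed
        ultimately have 5: "dl (a + \<tau> *\<^sub>R e) \<le> dl a + \<tau> * (dl a / \<sigma> + 6 * K * \<sigma>) + 6 * K * \<tau>\<^sup>2"
          by (intro dl_along_line a\<Omega> e \<tau>(1) b\<Omega> \<sigma>(1))
        have "dl a / \<sigma> \<le> s + s / sqrt l1"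
        proof (cases "s + t \<le> l1")
          case True
          then have "\<sigma> = s + t" by (simp add: \<sigma>_def)
          then have "dl a / \<sigma> = s * (s / (s + t))" by (simp add: s(2))
          also have "\<dots> \<le> s * 1" using s(1) t by (intro mult_left_mono) (simp_all add: divide_le_eq_1)
          also have "\<dots> \<le> s + s / sqrt l1" using s(1) l1 by simp
          finally show ?thesis .
        next
          case False
          then have "\<sigma> = l1" by (simp add: \<sigma>_def)
          then have "dl a / \<sigma> = (s / sqrt l1) * (s / sqrt l1)" using l1 by (simp add: s(2))
          also have "\<dots> \<le> (s / sqrt l1) * 1" using s(1) sl l1p by (intro mult_left_mono) simp_all
          finally show ?thesis using s(1) by linarith
        qed
        then have "\<tau> * (dl a / \<sigma> + 6 * K * \<sigma>) \<le> \<tau> * (s + s / sqrt l1 + 6 * K * (s + t))"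
          using \<tau>(1) \<sigma>(2) K_pos by (intro mult_left_mono add_mono) simp_all
        also have "\<dots> = \<tau> * s + (\<tau> / sqrt l1) * s + 6 * K * \<tau> * (s + t)" by (simp add: algebra_simps)
        also have "\<dots> \<le> (2 * \<rho> * D * t) * s + (2 * \<rho> * M * t) * s + 6 * K * (2 * \<rho> * D * t) * (s + t)"
        proof (intro add_mono mult_right_mono \<tau>D mult_left_mono)
          show "\<tau> / sqrt l1 \<le> 2 * \<rho> * M * t" using \<tau>l l1p by (simp add: pos_divide_le_eq mult_ac)
        qed (use s(1) t K_pos in simp_all)
        finally have 6: "\<tau> * (dl a / \<sigma> + 6 * K * \<sigma>) \<le> (2 * \<rho> * D) * (t * s) + (2 * \<rho> * M) * (t * s) + (12 * \<rho> * D * K) * (t * t + t * s)"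
          by (simp add: algebra_simps)
        have "\<tau>\<^sup>2 \<le> (2 * \<rho> * D * t)\<^sup>2" using \<tau>D \<tau>(1) by (intro power_mono)
        then have "6 * K * \<tau>\<^sup>2 \<le> 6 * K * (2 * \<rho> * D * t)\<^sup>2" using K_pos by (intro mult_left_mono) auto
        also have "\<dots> = (24 * K * \<rho>\<^sup>2 * D\<^sup>2) * (t * t)" by (simp add: power2_eq_square)
        finally have 7: "6 * K * \<tau>\<^sup>2 \<le> (24 * K * \<rho>\<^sup>2 * D\<^sup>2) * (t * t)" .
        have up: "c * (t * s) \<le> c * (t * t + t * s)" "c * (t * t) \<le> c * (t * t + t * s)" if "0 \<le> c" for c
          using nnX by (intro mult_left_mono that; linarith)+
        have "dl (a + \<tau> *\<^sub>R e) \<le> dl a + ((2 * \<rho> * D) * (t * t + t * s) + (2 * \<rho> * M) * (t * t + t * s)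
            + (12 * \<rho> * D * K) * (t * t + t * s) + (24 * K * \<rho>\<^sup>2 * D\<^sup>2) * (t * t + t * s))"
          using 5 6 7 up(1)[OF parts(4)] up(1)[OF parts(3)] up(2)[OF parts(6)] by linarith
        also have "\<dots> = dl a + (2 * \<rho> * D + 2 * \<rho> * M + 12 * \<rho> * D * K + 24 * K * \<rho>\<^sup>2 * D\<^sup>2) * (t * t + t * s)"
          by (simp only: distrib_right)
        also have "\<dots> \<le> dl a + C * (t * t + t * s)"
          by (intro add_left_mono cmp) (use parts in \<open>unfold C_def, linarith\<close>)
        finally show ?thesis .
      qed
    qed
    then show ?thesis unfolding goal_eq b by (simp only: a_def)
  qed
  have both: "dl (\<eta> + \<beta> *\<^sub>R e) \<le> dl (\<eta> + \<alpha> *\<^sub>R e) + C * (t\<^sup>2 + t * sqrt (dl (\<eta> + \<alpha> *\<^sub>R e)))"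
    if \<eta>: "\<eta> \<in> \<Omega>" and e: "norm e = 1" and t: "0 < t" "t \<le> 1"
      and w: "w \<le> \<rho> * t * phi \<Omega> e \<eta>" "w \<le> reach \<Omega> e \<eta>" "w \<le> reach \<Omega> (- e) \<eta>"
      and \<alpha>: "\<bar>\<alpha>\<bar> \<le> w" and \<beta>: "\<bar>\<beta>\<bar> \<le> w" for \<eta> e t w \<alpha> \<beta>
  proof (cases "\<alpha> \<le> \<beta>")
    case True
    then show ?thesis using main[OF that] by blast
  next
    case False
    have e': "norm (- e) = 1" using e by simp
    have "phi \<Omega> (- e) \<eta> = phi \<Omega> e \<eta>"
      using phi_eq_reach[OF compact e \<eta>] phi_eq_reach[OF compact e' \<eta>] by (simp add: mult.commute)
    then show ?thesis using main[of \<eta> "- e" t w "- \<alpha>" "- \<beta>"] False that by simp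
  qed
  show ?thesis
  proof (rule that[of "2 * C + 1"])
    show "2 * C + 1 > 0" using C by simp
    fix \<eta> e :: 'a and t w \<alpha> \<beta> :: real
    assume "\<eta> \<in> \<Omega>" "norm e = 1" "0 < t" "t \<le> 1" "w \<le> \<rho> * t * phi \<Omega> e \<eta>" "w \<le> reach \<Omega> e \<eta>"
      "w \<le> reach \<Omega> (- e) \<eta>" "\<bar>\<alpha>\<bar> \<le> w" "\<bar>\<beta>\<bar> \<le> w"
    note A = this
    show "\<bar>sqrt (dl (\<eta> + \<alpha> *\<^sub>R e)) - sqrt (dl (\<eta> + \<beta> *\<^sub>R e))\<bar> \<le> (2 * C + 1) * t"
      using both[OF A] both[OF A(1-7) A(9,8)] C A(3) by (intro sqrt_diff_le_symmetric) auto
  qed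
qed

end

section \<open>Change of variables on chords\<close>

text \<open>A single chord [a, b], with \<phi>(y) the root of (y - a) (b - y). Where a segment of
  half-length c \<phi>(y) fits into the chord, the map y + \<kappa> \<phi>(y) has derivative at
  least 1/2 and stays in [a, b]; the derivative bound is the origin of the factor 2.\<close>

lemma cv_interval:
  fixes G :: "real \<Rightarrow> ennreal"
  assumes G [measurable]: "G \<in> borel_measurable borel" and \<kappa>: "\<bar>\<kappa>\<bar> \<le> c" and ab: "a \<le> b"
  shows "(\<integral>\<^sup>+y. indicator {y \<in> {a..b}. c * sqrt ((y - a) * (b - y)) \<le> min (y - a) (b - y)} y *
      G (y + \<kappa> * sqrt ((y - a) * (b - y))) \<partial>lborel) \<le> 2 * (\<integral>\<^sup>+y. indicator {a..b} y * G y \<partial>lborel)"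
proof (cases "c = 0")
  case True
  then have "\<kappa> = 0" using \<kappa> by simp
  then have "(\<integral>\<^sup>+y. indicator {y \<in> {a..b}. c * sqrt ((y - a) * (b - y)) \<le> min (y - a) (b - y)} y *
      G (y + \<kappa> * sqrt ((y - a) * (b - y))) \<partial>lborel) \<le> (\<integral>\<^sup>+y. indicator {a..b} y * G y \<partial>lborel)"
    by (intro nn_integral_mono) (auto simp: indicator_def)
  also have "\<dots> \<le> 2 * (\<integral>\<^sup>+y. indicator {a..b} y * G y \<partial>lborel)"
    using mult_right_mono[of 1 2 "\<integral>\<^sup>+y. indicator {a..b} y * G y \<partial>lborel"] by simp
  finally show ?thesis .
next
  case False
  then have c: "c > 0" using \<kappa> by linarith
  \<comment> \<open>Here the fitting condition holds with equality: \<alpha> - a = c^2 (b -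
    \<alpha>), and symmetrically for \<beta>.\<close>
  define \<alpha> where "\<alpha> = (a + c\<^sup>2 * b) / (1 + c\<^sup>2)"
  define \<beta> where "\<beta> = (b + c\<^sup>2 * a) / (1 + c\<^sup>2)"
  have c2: "c\<^sup>2 > 0" "1 + c\<^sup>2 > 0" using c by (simp_all add: add_pos_pos)
  define g where "g y = y + \<kappa> * sqrt ((y - a) * (b - y))" for y
  define D where "D = {y \<in> {a..b}. c * sqrt ((y - a) * (b - y)) \<le> min (y - a) (b - y)}"
  have D: "c\<^sup>2 * (b - y) \<le> y - a \<and> c\<^sup>2 * (y - a) \<le> b - y \<and> a < y \<and> y < b \<and> \<alpha> \<le> y \<and> y \<le> \<beta>"
    if y: "y \<in> D" "y \<noteq> a" "y \<noteq> b" for y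
  proof -
    define p where "p = y - a"
    define q where "q = b - y"
    have pq: "p > 0" "q > 0" "c * sqrt (p * q) \<le> p" "c * sqrt (p * q) \<le> q"
      using y by (auto simp: D_def p_def q_def)
    have nn: "0 \<le> c * sqrt (p * q)" using c pq by simp
    have sq: "(c * sqrt (p * q))\<^sup>2 = c\<^sup>2 * p * q" using pq by (simp add: power_mult_distrib)
    have "c\<^sup>2 * p * q \<le> p\<^sup>2" "c\<^sup>2 * p * q \<le> q\<^sup>2"
      using power_mono[OF pq(3) nn, of 2] power_mono[OF pq(4) nn, of 2] unfolding sq by auto
    then have "p * (c\<^sup>2 * q) \<le> p * p" "q * (c\<^sup>2 * p) \<le> q * q" by (simp_all add: power2_eq_square mult_ac)
    then have 1: "c\<^sup>2 * q \<le> p" "c\<^sup>2 * p \<le> q" using pq(1,2) mult_le_cancel_left_pos by blast+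
    have "a + c\<^sup>2 * b \<le> y * (1 + c\<^sup>2)" "y * (1 + c\<^sup>2) \<le> b + c\<^sup>2 * a"
      using 1 unfolding p_def q_def by (simp_all add: algebra_simps)
    then have "\<alpha> \<le> y" "y \<le> \<beta>" using c2(2) unfolding \<alpha>_def \<beta>_def by (simp_all only: pos_divide_le_eq pos_le_divide_eq)
    then show ?thesis using 1 pq(1,2) unfolding p_def q_def by simp
  qed
  \<comment> \<open>The end points a and b also satisfy the fitting condition, but the root is not
    differentiable there; they are split off as a null set.\<close>
  have le: "indicator D y * G (g y) \<le> indicator {\<alpha>..\<beta>} y * G (g y) + indicator {a, b} y * G (g y)" for y
    using D[of y] by (cases "y \<in> {a, b}") (auto simp: indicator_def)
  have [measurable]: "g \<in> borel_measurable borel" unfolding g_def by measurable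
  have "(\<integral>\<^sup>+y. indicator {a, b} y * G (g y) \<partial>lborel) = 0"
    by (rule nn_integral_0_iff_AE[THEN iffD2])
       (auto intro!: AE_I'[of "{a, b}"] simp: null_sets_def indicator_def emeasure_lborel_countable)
  moreover have "(\<integral>\<^sup>+y. indicator D y * G (g y) \<partial>lborel) \<le>
      (\<integral>\<^sup>+y. indicator {\<alpha>..\<beta>} y * G (g y) + indicator {a, b} y * G (g y) \<partial>lborel)"
    by (intro nn_integral_mono le)
  ultimately have I1: "(\<integral>\<^sup>+y. indicator D y * G (g y) \<partial>lborel) \<le> (\<integral>\<^sup>+y. indicator {\<alpha>..\<beta>} y * G (g y) \<partial>lborel)"
    by (simp add: nn_integral_add)
  have I2: "(\<integral>\<^sup>+y. indicator {\<alpha>..\<beta>} y * G (g y) \<partial>lborel) \<le> 2 * (\<integral>\<^sup>+y. indicator {a..b} y * G y \<partial>lborel)"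
  proof (cases "\<alpha> < \<beta>")
    case False
    have "(\<integral>\<^sup>+y. indicator {\<alpha>..\<beta>} y * G (g y) \<partial>lborel) = 0"
      by (rule nn_integral_0_iff_AE[THEN iffD2])
         (use False in \<open>auto intro!: AE_I'[of "{\<alpha>}"] simp: null_sets_def indicator_def emeasure_lborel_countable\<close>)
    then show ?thesis by simp
  next
    case True
    have "\<alpha> * (1 + c\<^sup>2) = a + c\<^sup>2 * b" "\<beta> * (1 + c\<^sup>2) = b + c\<^sup>2 * a" using c2 by (simp_all add: \<alpha>_def \<beta>_def)
    moreover have "a < b"
    proof (rule ccontr)
      assume "\<not> a < b"
      then have "a = b" using ab by simp
      then show False using True unfolding \<alpha>_def \<beta>_def by simp
    qed
    moreover have "0 < c\<^sup>2 * (b - a)" using c2 \<open>a < b\<close> by simp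
    ultimately have "a * (1 + c\<^sup>2) < \<alpha> * (1 + c\<^sup>2)" "\<beta> * (1 + c\<^sup>2) < b * (1 + c\<^sup>2)" by (simp_all add: algebra_simps)
    then have ends: "a < \<alpha>" "\<beta> < b" using c2(2) by (simp_all add: mult_less_cancel_right_pos)
    define g' where "g' y = 1 + \<kappa> * ((a + b - 2 * y) / (2 * sqrt ((y - a) * (b - y))))" for y
    have pos: "(y - a) * (b - y) > 0" if "y \<in> {\<alpha>..\<beta>}" for y using that ends by simp
    have der: "(g has_real_derivative g' y) (at y)" if "y \<in> {\<alpha>..\<beta>}" for y
      unfolding g_def g'_def using pos[OF that]
      by (auto intro!: derivative_eq_intros simp: field_simps)
    have cont: "continuous_on {\<alpha>..\<beta>} g'" unfolding g'_def
      by (intro continuous_intros) (use pos in force)+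
    \<comment> \<open>With p and q the distances to the ends, the perturbation of the derivative is
      \<kappa> (q - p) / (2 sqrt (p q)); the bound c |p - q| \<le> sqrt (p q) follows from c^2 q
      \<le> p and c^2 p \<le> q.\<close>
    have half: "g' y \<ge> 1 / 2" if y: "y \<in> {\<alpha>..\<beta>}" for y
    proof -
      define p where "p = y - a"
      define q where "q = b - y"
      have pq: "p > 0" "q > 0" using y ends by (auto simp: p_def q_def)
      have "a + c\<^sup>2 * b \<le> y * (1 + c\<^sup>2)" "y * (1 + c\<^sup>2) \<le> b + c\<^sup>2 * a"
        using y c2(2) unfolding \<alpha>_def \<beta>_def atLeastAtMost_iff by (simp_all only: pos_divide_le_eq pos_le_divide_eq)
      then have 1: "c\<^sup>2 * q \<le> p" "c\<^sup>2 * p \<le> q" unfolding p_def q_def by (simp_all add: algebra_simps)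
      have key: "c * \<bar>p - q\<bar> \<le> sqrt (p * q)"
      proof (rule real_le_rsqrt)
        show "(c * \<bar>p - q\<bar>)\<^sup>2 \<le> p * q"
        proof (cases "p \<le> q")
          case True
          have "(c * \<bar>p - q\<bar>)\<^sup>2 = c\<^sup>2 * (q - p)\<^sup>2" by (simp add: power_mult_distrib power2_commute)
          also have "(q - p)\<^sup>2 \<le> q\<^sup>2" using True pq by (intro power_mono) auto
          then have "c\<^sup>2 * (q - p)\<^sup>2 \<le> c\<^sup>2 * q\<^sup>2" using c2 by (intro mult_left_mono) auto
          also have "c\<^sup>2 * q\<^sup>2 = (c\<^sup>2 * q) * q" by (simp add: power2_eq_square)
          also have "\<dots> \<le> p * q" using 1(1) pq by (intro mult_right_mono) auto
          finally show ?thesis .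
        next
          case False
          have "(c * \<bar>p - q\<bar>)\<^sup>2 = c\<^sup>2 * (p - q)\<^sup>2" by (simp add: power_mult_distrib)
          also have "(p - q)\<^sup>2 \<le> p\<^sup>2" using False pq by (intro power_mono) auto
          then have "c\<^sup>2 * (p - q)\<^sup>2 \<le> c\<^sup>2 * p\<^sup>2" using c2 by (intro mult_left_mono) auto
          also have "c\<^sup>2 * p\<^sup>2 = (c\<^sup>2 * p) * p" by (simp add: power2_eq_square)
          also have "\<dots> \<le> q * p" using 1(2) pq by (intro mult_right_mono) auto
          finally show ?thesis by (simp add: mult.commute)
        qed
      qed
      have s: "sqrt (p * q) > 0" using pq by simp
      have eq: "a + b - 2 * y = q - p" by (simp add: p_def q_def)
      have "\<bar>\<kappa> * ((q - p) / (2 * sqrt (p * q)))\<bar> = \<bar>\<kappa>\<bar> * \<bar>p - q\<bar> / (2 * sqrt (p * q))"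
        using s by (simp add: abs_mult abs_minus_commute)
      also have "\<dots> \<le> c * \<bar>p - q\<bar> / (2 * sqrt (p * q))"
        using \<kappa> s by (intro divide_right_mono mult_right_mono) auto
      also have "\<dots> \<le> 1 / 2" using key s by (simp add: pos_divide_le_eq)
      finally show ?thesis unfolding g'_def eq p_def[symmetric] q_def[symmetric] by linarith
    qed
    have ga: "a \<le> g \<alpha>" and gb: "g \<beta> \<le> b"
    proof -
      have main: "\<bar>\<kappa> * sqrt ((y - a) * (b - y))\<bar> \<le> min (y - a) (b - y)" if y: "y \<in> {\<alpha>..\<beta>}" for y
      proof -
        define p where "p = y - a"
        define q where "q = b - y"
        have pq: "p > 0" "q > 0" using y ends by (auto simp: p_def q_def)
        have "a + c\<^sup>2 * b \<le> y * (1 + c\<^sup>2)" "y * (1 + c\<^sup>2) \<le> b + c\<^sup>2 * a"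
          using y c2(2) unfolding \<alpha>_def \<beta>_def atLeastAtMost_iff by (simp_all only: pos_divide_le_eq pos_le_divide_eq)
        then have 1: "c\<^sup>2 * q \<le> p" "c\<^sup>2 * p \<le> q" unfolding p_def q_def by (simp_all add: algebra_simps)
        have sq: "(c * sqrt (p * q))\<^sup>2 = c\<^sup>2 * p * q" using pq by (simp add: power_mult_distrib)
        have "p * (c\<^sup>2 * q) \<le> p * p" "q * (c\<^sup>2 * p) \<le> q * q" using 1 pq by (auto intro: mult_left_mono)
        then have "(c * sqrt (p * q))\<^sup>2 \<le> p\<^sup>2" "(c * sqrt (p * q))\<^sup>2 \<le> q\<^sup>2"
          unfolding sq by (simp_all add: power2_eq_square mult_ac)
        from power2_le_imp_le[OF this(1)] power2_le_imp_le[OF this(2)]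
        have "c * sqrt (p * q) \<le> p" "c * sqrt (p * q) \<le> q" using pq by simp_all
        moreover have "\<bar>\<kappa>\<bar> * sqrt (p * q) \<le> c * sqrt (p * q)" using \<kappa> pq by (intro mult_right_mono) auto
        moreover have "\<bar>\<kappa> * sqrt (p * q)\<bar> = \<bar>\<kappa>\<bar> * sqrt (p * q)" using pq by (simp add: abs_mult)
        ultimately show ?thesis unfolding p_def q_def by linarith
      qed
      show "a \<le> g \<alpha>" "g \<beta> \<le> b" using main[of \<alpha>] main[of \<beta>] True unfolding g_def by auto
    qed
    have "(\<integral>\<^sup>+y. indicator {\<alpha>..\<beta>} y * G (g y) \<partial>lborel) \<le> (\<integral>\<^sup>+y. 2 * (G (g y) * g' y * indicator {\<alpha>..\<beta>} y) \<partial>lborel)"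
    proof (rule nn_integral_mono)
      fix y
      show "indicator {\<alpha>..\<beta>} y * G (g y) \<le> 2 * (G (g y) * ennreal (g' y) * indicator {\<alpha>..\<beta>} y)"
      proof (cases "y \<in> {\<alpha>..\<beta>}")
        case True
        have "ennreal 1 \<le> ennreal (2 * g' y)" using half[OF True] by (intro ennreal_leI) simp
        also have "\<dots> = 2 * ennreal (g' y)" using half[OF True] by (simp add: ennreal_mult')
        finally have "1 * G (g y) \<le> (2 * ennreal (g' y)) * G (g y)" by (intro mult_right_mono) auto
        then show ?thesis using True by (simp add: mult_ac)
      qed simp
    qed
    also have "\<dots> = 2 * (\<integral>\<^sup>+y. G (g y) * g' y * indicator {\<alpha>..\<beta>} y \<partial>lborel)"
    proof (rule nn_integral_cmult)
      have [measurable]: "g' \<in> borel_measurable borel" unfolding g'_def by measurable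
      show "(\<lambda>y. G (g y) * ennreal (g' y) * indicator {\<alpha>..\<beta>} y) \<in> borel_measurable lborel" by measurable
    qed
    also have "(\<integral>\<^sup>+y. G (g y) * g' y * indicator {\<alpha>..\<beta>} y \<partial>lborel) = (\<integral>\<^sup>+y. G y * indicator {g \<alpha>..g \<beta>} y \<partial>lborel)"
    proof (rule nn_integral_substitution_aux[symmetric, OF G _ der cont _ True])
      show "0 \<le> g' x" if "x \<in> {\<alpha>..\<beta>}" for x using half[OF that] by linarith
    qed simp
    also have "\<dots> \<le> (\<integral>\<^sup>+y. indicator {a..b} y * G y \<partial>lborel)"
      using ga gb by (intro nn_integral_mono) (auto simp: indicator_def)
    finally show ?thesis by (simp add: mult_left_mono)
  qed
  show ?thesis using order_trans[OF I1 I2] unfolding D_def g_def .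
qed

text \<open>A compact set of reals may have uncountably many components, but each nondegenerate one
  contains a rational number, so those are countable and \<open>cv_interval\<close> applies to each.
  On one-point components the root is zero and the map is the identity, so they can be treated
  together.\<close>

lemma cv_line:
  fixes G :: "real \<Rightarrow> ennreal" and A :: "real set"
  assumes G [measurable]: "G \<in> borel_measurable borel" and \<kappa>: "\<bar>\<kappa>\<bar> \<le> c" and A: "compact A"
    and L: "\<And>y z. y \<in> A \<Longrightarrow> closed_segment y z \<subseteq> A \<longleftrightarrow> y - Lm y \<le> z \<and> z \<le> y + Lp y"
  shows "(\<integral>\<^sup>+y. indicator {y \<in> A. c * sqrt (Lm y * Lp y) \<le> min (Lm y) (Lp y)} y *
      G (y + \<kappa> * sqrt (Lm y * Lp y)) \<partial>lborel) \<le> 2 * (\<integral>\<^sup>+y. indicator A y * G y \<partial>lborel)"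
proof -
  have L0: "0 \<le> Lm y" "0 \<le> Lp y" if "y \<in> A" for y using L[OF that, of y] that by auto
  have tri: "closed_segment x z \<subseteq> closed_segment x y \<union> closed_segment y z" for x y z :: real
    by (auto simp: closed_segment_eq_real_ivl split: if_splits)
  have trans: "closed_segment x z \<subseteq> A" if "closed_segment x y \<subseteq> A" "closed_segment y z \<subseteq> A" for x y z
    using that tri[of x z y] by blast
  define \<rho> where "\<rho> = from_nat_into (\<rat> :: real set)"
  have "(\<rat> :: real set) \<noteq> {}" using Rats_0 by blast
  then have \<rho>: "range \<rho> = \<rat>" unfolding \<rho>_def by (rule range_from_nat_into) (rule countable_rat)
  define a where "a k = \<rho> k - Lm (\<rho> k)" for k
  define b where "b k = \<rho> k + Lp (\<rho> k)" for k
  \<comment> \<open>Selects from each component the rational that comes first in the enumeration, so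
    that no component is counted twice.\<close>
  define fresh where "fresh k \<longleftrightarrow> \<rho> k \<in> A \<and> (\<forall>i<k. \<not> closed_segment (\<rho> i) (\<rho> k) \<subseteq> A)" for k
  define J where "J k = (if fresh k then {a k..b k} else {})" for k
  have J_iff: "y \<in> J k \<longleftrightarrow> fresh k \<and> closed_segment y (\<rho> k) \<subseteq> A" for y k
    unfolding J_def a_def b_def fresh_def using L[of "\<rho> k" y] by (auto simp: closed_segment_commute)
  \<comment> \<open>All points of a component see the same two ends, so the root is the one of
    \<open>cv_interval\<close>.\<close>
  have J_ab: "Lm y = y - a k \<and> Lp y = b k - y \<and> y \<in> A" if y: "y \<in> J k" for y k
  proof -
    have *: "closed_segment y (\<rho> k) \<subseteq> A" "\<rho> k \<in> A" using y J_iff[of y k] by (auto simp: fresh_def)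
    then have yA: "y \<in> A" by auto
    have "closed_segment y z \<subseteq> A \<longleftrightarrow> closed_segment (\<rho> k) z \<subseteq> A" for z
      using trans[OF *(1), of z] trans[of "\<rho> k" y z] *(1) by (auto simp: closed_segment_commute)
    then have "z \<in> {y - Lm y..y + Lp y} \<longleftrightarrow> z \<in> {a k..b k}" for z
      using L[OF yA, of z] L[OF *(2), of z] by (simp add: a_def b_def)
    then have "{y - Lm y..y + Lp y} = {a k..b k}" by blast
    then have "y - Lm y = a k \<and> y + Lp y = b k" using L0[OF yA] by (subst (asm) Icc_eq_Icc) auto
    then show ?thesis using yA by auto
  qed
  have disj: "disjoint_family J"
  proof -
    have "i = k \<or> J i \<inter> J k = {}" if "i \<le> k" for i k
    proof (rule ccontr)
      assume n: "\<not> (i = k \<or> J i \<inter> J k = {})"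
      then obtain y where y: "y \<in> J i" "y \<in> J k" by blast
      have "closed_segment (\<rho> i) (\<rho> k) \<subseteq> A"
        by (rule trans[of _ y]) (use y J_iff in \<open>auto simp: closed_segment_commute\<close>)
      moreover have "i < k" using n that by auto
      ultimately show False using y(2) J_iff fresh_def by blast
    qed
    note half = this
    show ?thesis unfolding disjoint_family_on_def
    proof (intro ballI impI)
      fix i k :: nat assume "i \<noteq> k"
      then show "J i \<inter> J k = {}" using half[of i k] half[of k i] by (cases "i \<le> k") auto
    qed
  qed
  have cover: "\<exists>k. y \<in> J k" if y: "y \<in> A" "Lm y + Lp y > 0" for y
  proof -
    have "y - Lm y < y + Lp y" using y(2) by linarith
    then obtain x where "x \<in> \<rat>" "y - Lm y < x" "x < y + Lp y" using Rats_dense_in_real by blast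
    then have "x \<in> range \<rho>" "closed_segment y x \<subseteq> A" using L[OF y(1), of x] \<rho> by simp_all
    then have ex: "\<exists>k. closed_segment y (\<rho> k) \<subseteq> A" by blast
    define k where "k = (LEAST k. closed_segment y (\<rho> k) \<subseteq> A)"
    have k: "closed_segment y (\<rho> k) \<subseteq> A" unfolding k_def using ex by (rule LeastI_ex)
    have "\<not> closed_segment (\<rho> i) (\<rho> k) \<subseteq> A" if "i < k" for i
    proof
      assume "closed_segment (\<rho> i) (\<rho> k) \<subseteq> A"
      then have "closed_segment y (\<rho> i) \<subseteq> A" using trans[OF k, of "\<rho> i"] by (simp add: closed_segment_commute)
      then show False using not_less_Least[of i "\<lambda>k. closed_segment y (\<rho> k) \<subseteq> A"] that unfolding k_def by blast
    qed
    then have "fresh k" using k unfolding fresh_def by auto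
    then show ?thesis using J_iff k by blast
  qed
  \<comment> \<open>What remains consists of one-point components.\<close>
  define N where "N = A - (\<Union>k. J k)"
  have [measurable]: "J k \<in> sets borel" for k by (simp add: J_def)
  have [measurable]: "A \<in> sets borel" using A by (simp add: borel_compact)
  have [measurable]: "N \<in> sets borel" unfolding N_def by measurable
  define F where "F k y = indicator {y \<in> J k. c * sqrt ((y - a k) * (b k - y)) \<le> min (y - a k) (b k - y)} y *
      G (y + \<kappa> * sqrt ((y - a k) * (b k - y)))" for k y
  have [measurable]: "F k \<in> borel_measurable borel" for k unfolding F_def by measurable
  have FJ: "(\<integral>\<^sup>+y. F k y \<partial>lborel) \<le> 2 * (\<integral>\<^sup>+y. indicator (J k) y * G y \<partial>lborel)" for k
  proof (cases "fresh k")
    case True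
    then have "J k = {a k..b k}" "a k \<le> b k" using L0[of "\<rho> k"] by (auto simp: J_def a_def b_def fresh_def)
    then show ?thesis unfolding F_def using cv_interval[OF G \<kappa>, of "a k" "b k"] by simp
  next
    case False
    then show ?thesis by (simp add: F_def J_def)
  qed
  have "(\<integral>\<^sup>+y. indicator {y \<in> A. c * sqrt (Lm y * Lp y) \<le> min (Lm y) (Lp y)} y *
      G (y + \<kappa> * sqrt (Lm y * Lp y)) \<partial>lborel) \<le> (\<integral>\<^sup>+y. (\<Sum>k. F k y) + 2 * (indicator N y * G y) \<partial>lborel)"
  proof (rule nn_integral_mono)
    fix y
    show "indicator {y \<in> A. c * sqrt (Lm y * Lp y) \<le> min (Lm y) (Lp y)} y * G (y + \<kappa> * sqrt (Lm y * Lp y))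
        \<le> (\<Sum>k. F k y) + 2 * (indicator N y * G y)"
    proof (cases "\<exists>k. y \<in> J k")
      case True
      then obtain k where k: "y \<in> J k" by blast
      have "indicator {y \<in> A. c * sqrt (Lm y * Lp y) \<le> min (Lm y) (Lp y)} y * G (y + \<kappa> * sqrt (Lm y * Lp y)) = F k y"
        unfolding F_def using J_ab[OF k] k by (simp add: indicator_def)
      also have "\<dots> \<le> (\<Sum>k. F k y)" using sum_le_suminf[of "\<lambda>k. F k y" "{k}"] by simp
      finally show ?thesis by (simp add: add_increasing2)
    next
      case False
      show ?thesis
      proof (cases "y \<in> A")
        case True
        then have "y \<in> N" using False by (auto simp: N_def)
        have "\<not> 0 < Lm y + Lp y" using cover[OF True] False by blast
        then have "Lm y = 0" "Lp y = 0" using L0[OF True] by linarith+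
        moreover have "G y \<le> 2 * G y" using mult_right_mono[of 1 2 "G y"] by simp
        ultimately have "G (y + \<kappa> * sqrt (Lm y * Lp y)) \<le> 2 * (indicator N y * G y)" using \<open>y \<in> N\<close> by simp
        then show ?thesis by (simp add: indicator_def add_increasing)
      qed simp
    qed
  qed
  also have "\<dots> = (\<Sum>k. \<integral>\<^sup>+y. F k y \<partial>lborel) + 2 * (\<integral>\<^sup>+y. indicator N y * G y \<partial>lborel)"
    by (simp add: nn_integral_add nn_integral_suminf nn_integral_cmult)
  finally have 1: "(\<integral>\<^sup>+y. indicator {y \<in> A. c * sqrt (Lm y * Lp y) \<le> min (Lm y) (Lp y)} y *
      G (y + \<kappa> * sqrt (Lm y * Lp y)) \<partial>lborel) \<le>
      (\<Sum>k. \<integral>\<^sup>+y. F k y \<partial>lborel) + 2 * (\<integral>\<^sup>+y. indicator N y * G y \<partial>lborel)" .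
  define XJ where "XJ k = (\<integral>\<^sup>+y. indicator (J k) y * G y \<partial>lborel)" for k
  define XN where "XN = (\<integral>\<^sup>+y. indicator N y * G y \<partial>lborel)"
  have "(\<Sum>k. \<integral>\<^sup>+y. F k y \<partial>lborel) \<le> (\<Sum>k. 2 * XJ k)" unfolding XJ_def by (intro suminf_le FJ) auto
  also have "\<dots> = 2 * (\<Sum>k. XJ k)" by (rule ennreal_suminf_cmult)
  finally have 2: "(\<Sum>k. \<integral>\<^sup>+y. F k y \<partial>lborel) + 2 * XN \<le> 2 * ((\<Sum>k. XJ k) + XN)"
    by (simp add: distrib_left add_right_mono)
  have "(\<Sum>k. XJ k) = (\<integral>\<^sup>+y. (\<Sum>k. indicator (J k) y * G y) \<partial>lborel)"
    unfolding XJ_def by (rule nn_integral_suminf[symmetric]) measurable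
  then have "(\<Sum>k. XJ k) + XN = (\<integral>\<^sup>+y. (\<Sum>k. indicator (J k) y * G y) + indicator N y * G y \<partial>lborel)"
    unfolding XN_def by (simp only:) (rule nn_integral_add[symmetric]; measurable)
  also have "\<dots> \<le> (\<integral>\<^sup>+y. indicator A y * G y \<partial>lborel)"
  proof (rule nn_integral_mono)
    fix y
    have "(\<Sum>k. indicator (J k) y * G y) = (\<Sum>k. indicator (J k) y) * G y" by simp
    also have "(\<Sum>k. indicator (J k) y :: ennreal) = indicator (\<Union>k. J k) y" by (rule suminf_indicator[OF disj])
    finally have eq: "(\<Sum>k. indicator (J k) y * G y) = indicator (\<Union>k. J k) y * G y" .
    show "(\<Sum>k. indicator (J k) y * G y) + indicator N y * G y \<le> indicator A y * G y"
      unfolding eq using J_ab[of y] by (auto simp: indicator_def N_def)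
  qed
  finally have "2 * ((\<Sum>k. XJ k) + XN) \<le> 2 * (\<integral>\<^sup>+y. indicator A y * G y \<partial>lborel)"
    by (intro mult_left_mono) auto
  from order_trans[OF 2 this] show ?thesis using 1 unfolding XN_def[symmetric] by (rule order_trans[rotated])
qed

section \<open>Coordinate changes that preserve Lebesgue measure\<close>

definition measure_preserving_map :: "('a::euclidean_space \<Rightarrow> 'a) \<Rightarrow> bool" where
  "measure_preserving_map T \<longleftrightarrow> T \<in> borel_measurable borel \<and>
     (\<forall>F :: 'a \<Rightarrow> ennreal. F \<in> borel_measurable borel \<longrightarrow> (\<integral>\<^sup>+x. F (T x) \<partial>lborel) = (\<integral>\<^sup>+x. F x \<partial>lborel))"

lemma measure_preserving_compose:
  assumes "measure_preserving_map S" "measure_preserving_map T"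
  shows "measure_preserving_map (\<lambda>x. S (T x))"
proof -
  have [measurable]: "S \<in> borel_measurable borel" "T \<in> borel_measurable borel"
    using assms by (auto simp: measure_preserving_map_def)
  have "(\<integral>\<^sup>+x. F (S (T x)) \<partial>lborel) = (\<integral>\<^sup>+x. F x \<partial>lborel)" if [measurable]: "F \<in> borel_measurable borel" for F :: "'a \<Rightarrow> ennreal"
  proof -
    have "(\<lambda>x. F (S x)) \<in> borel_measurable borel" by measurable
    then have "(\<integral>\<^sup>+x. F (S (T x)) \<partial>lborel) = (\<integral>\<^sup>+x. F (S x) \<partial>lborel)"
      using assms(2) unfolding measure_preserving_map_def by blast
    also have "\<dots> = (\<integral>\<^sup>+x. F x \<partial>lborel)" using assms(1) that unfolding measure_preserving_map_def by blast
    finally show ?thesis .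
  qed
  then show ?thesis unfolding measure_preserving_map_def by simp
qed

lemma measure_preserving_translation: "measure_preserving_map (\<lambda>x. a + x :: 'a::euclidean_space)"
  unfolding measure_preserving_map_def
proof (intro conjI allI impI)
  fix F :: "'a \<Rightarrow> ennreal" assume [measurable]: "F \<in> borel_measurable borel"
  have "(\<integral>\<^sup>+x. F x \<partial>lborel) = (\<integral>\<^sup>+x. F x \<partial>distr lborel borel ((+) a))" by (simp add: lborel_distr_plus)
  also have "\<dots> = (\<integral>\<^sup>+x. F (a + x) \<partial>lborel)" by (rule nn_integral_distr) simp_all
  finally show "(\<integral>\<^sup>+x. F (a + x) \<partial>lborel) = (\<integral>\<^sup>+x. F x \<partial>lborel)" by simp
qed simp

lemma swap_last_involution [simp]: "swap_last j (swap_last j \<xi>) = \<xi>"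
  by (cases \<xi>) (auto simp: swap_last_def vec_eq_iff)

lemma swap_last_linear: "linear (swap_last j)"
  by (rule linearI) (auto simp: swap_last_def vec_eq_iff split: prod.splits)

lemma swap_last_inner: "swap_last j \<xi> \<bullet> \<eta> = \<xi> \<bullet> swap_last j \<eta>"
proof -
  obtain x y where \<xi>: "\<xi> = (x, y)" by (cases \<xi>)
  obtain a b where \<eta>: "\<eta> = (a, b)" by (cases \<eta>)
  define R where "R = (\<Sum>i\<in>UNIV - {j}. x $ i * a $ i)"
  have "(\<Sum>i\<in>UNIV - {j}. (if i = j then y else x $ i) * a $ i) = R" "(\<Sum>i\<in>UNIV - {j}. x $ i * (if i = j then b else a $ i)) = R"
    unfolding R_def by (rule sum.cong; simp)+
  then have "(\<Sum>i\<in>UNIV. (if i = j then y else x $ i) * a $ i) = y * a $ j + R"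
    "(\<Sum>i\<in>UNIV. x $ i * (if i = j then b else a $ i)) = x $ j * b + R"
    using sum.remove[of UNIV j "\<lambda>i. (if i = j then y else x $ i) * a $ i"]
      sum.remove[of UNIV j "\<lambda>i. x $ i * (if i = j then b else a $ i)"] by simp_all
  then show ?thesis unfolding \<xi> \<eta> by (simp add: swap_last_def inner_vec_def)
qed

lemma swap_last_norm [simp]: "norm (swap_last j \<xi>) = norm \<xi>"
  by (simp add: norm_eq_sqrt_inner swap_last_inner)

lemma swap_last_axis: "swap_last j (axis j 1, 0) = (0, 1)" "swap_last j (0, 1) = (axis j 1, 0)"
  by (auto simp: swap_last_def vec_eq_iff axis_def)

lemma Basis_pt: "(Basis :: ('n::finite pt) set) = insert (0, 1) (range (\<lambda>j. (axis j 1, 0)))"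
  by (auto simp: Basis_prod_def Basis_vec_def)

lemma swap_last_Basis: "swap_last j ` Basis = Basis"
proof -
  have sub: "swap_last j b \<in> Basis" if b: "b \<in> Basis" for b
  proof -
    have "swap_last j (axis i 1, 0) = (axis i 1, 0)" if "i \<noteq> j" for i
      using that by (auto simp: swap_last_def vec_eq_iff axis_def)
    note fixed = this
    consider "b = (0, 1)" | i where "b = (axis i 1, 0)" using b by (auto simp: Basis_pt)
    then show ?thesis
    proof cases
      case 1
      then show ?thesis unfolding Basis_pt by (simp add: swap_last_axis)
    next
      case (2 i)
      then show ?thesis unfolding Basis_pt by (cases "i = j") (simp_all add: swap_last_axis fixed)
    qed
  qed
  moreover have "b \<in> swap_last j ` Basis" if "b \<in> Basis" for b
    by (rule image_eqI[of _ _ "swap_last j b"]) (simp_all add: sub that)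
  ultimately show ?thesis by blast
qed

lemma linear_borel:
  fixes T :: "'a::euclidean_space \<Rightarrow> 'b::euclidean_space"
  assumes "linear T"
  shows "T \<in> borel_measurable borel"
  using assms by (simp add: borel_measurable_continuous_onI linear_continuous_on linear_linear)

text \<open>The swap is its own adjoint and permutes the basis, so the preimage of a box is a box
  with permuted side lengths, and boxes determine Lebesgue measure.\<close>

lemma measure_preserving_swap: "measure_preserving_map (swap_last j)"
proof -
  have [measurable]: "swap_last j \<in> borel_measurable borel" using swap_last_linear by (rule linear_borel)
  have "lborel = distr lborel borel (swap_last j)"
  proof (rule lborel_eqI)
    fix l u :: "'a pt" assume lu: "\<And>b. b \<in> Basis \<Longrightarrow> l \<bullet> b \<le> u \<bullet> b"
    have B: "swap_last j b \<in> Basis" if "b \<in> Basis" for b using swap_last_Basis[of j] that by blast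
    have "swap_last j -` box l u = box (swap_last j l) (swap_last j u)"
    proof -
      have "swap_last j x \<in> box l u \<longleftrightarrow> x \<in> box (swap_last j l) (swap_last j u)" for x
      proof
        assume *: "swap_last j x \<in> box l u"
        show "x \<in> box (swap_last j l) (swap_last j u)" unfolding mem_box
        proof
          fix b :: "'a pt" assume "b \<in> Basis"
          from *[unfolded mem_box, rule_format, OF B[OF this]]
          show "swap_last j l \<bullet> b < x \<bullet> b \<and> x \<bullet> b < swap_last j u \<bullet> b" by (simp only: swap_last_inner swap_last_involution)
        qed
      next
        assume *: "x \<in> box (swap_last j l) (swap_last j u)"
        show "swap_last j x \<in> box l u" unfolding mem_box
        proof
          fix b :: "'a pt" assume "b \<in> Basis"
          from *[unfolded mem_box, rule_format, OF B[OF this]]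
          show "l \<bullet> b < swap_last j x \<bullet> b \<and> swap_last j x \<bullet> b < u \<bullet> b" by (simp only: swap_last_inner swap_last_involution)
        qed
      qed
      then show ?thesis by blast
    qed
    then have "emeasure (distr lborel borel (swap_last j)) (box l u) = emeasure lborel (box (swap_last j l) (swap_last j u))"
      by (simp add: emeasure_distr)
    also have "\<dots> = (\<Prod>b\<in>Basis. (swap_last j u - swap_last j l) \<bullet> b)"
      using lu B by (intro emeasure_lborel_box) (simp add: swap_last_inner)
    also have "(\<Prod>b\<in>Basis. (swap_last j u - swap_last j l) \<bullet> b) = (\<Prod>b\<in>Basis. (u - l) \<bullet> swap_last j b)"
      by (simp add: swap_last_inner inner_diff_left)
    also have "\<dots> = (\<Prod>b\<in>Basis. (u - l) \<bullet> b)"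
      by (rule prod.reindex_bij_witness[of _ "swap_last j" "swap_last j"]) (auto simp: B)
    finally show "emeasure (distr lborel borel (swap_last j)) (box l u) = ennreal (\<Prod>b\<in>Basis. (u - l) \<bullet> b)" .
  qed simp
  note eq = this
  show ?thesis unfolding measure_preserving_map_def
  proof (intro conjI allI impI)
    fix F :: "'a pt \<Rightarrow> ennreal" assume F: "F \<in> borel_measurable borel"
    have "(\<integral>\<^sup>+x. F x \<partial>lborel) = (\<integral>\<^sup>+x. F x \<partial>distr lborel borel (swap_last j))"
      using arg_cong[OF eq, of "\<lambda>M. \<integral>\<^sup>+x. F x \<partial>M"] .
    also have "\<dots> = (\<integral>\<^sup>+x. F (swap_last j x) \<partial>lborel)" by (rule nn_integral_distr) (simp_all add: F)
    finally show "(\<integral>\<^sup>+x. F (swap_last j x) \<partial>lborel) = (\<integral>\<^sup>+x. F x \<partial>lborel)" by simp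
  qed simp
qed

lemma flip_None: "flip_coord None = (\<lambda>p. (fst p, - snd p))"
  by (auto simp: flip_coord_def)

text \<open>Conjugation with the swap reduces every sign change to that of the last coordinate,
  where Fubini applies directly.\<close>

lemma flip_Some: "flip_coord (Some j) = (\<lambda>p. swap_last j (flip_coord None (swap_last j p)))"
  by (auto simp: flip_coord_def swap_last_def vec_eq_iff fun_eq_iff)

lemma measure_preserving_flip: "measure_preserving_map (flip_coord k)"
proof -
  have 0: "measure_preserving_map (flip_coord None :: 'a pt \<Rightarrow> _)"
    unfolding measure_preserving_map_def flip_None
  proof (intro conjI allI impI)
    show m[measurable]: "(\<lambda>p. (fst p, - snd p) :: 'a pt) \<in> borel_measurable borel"
      by (intro borel_measurable_continuous_onI continuous_intros)
    fix F :: "'a pt \<Rightarrow> ennreal" assume F: "F \<in> borel_measurable borel"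
    have F'[measurable]: "F \<in> borel_measurable (lborel \<Otimes>\<^sub>M lborel)"
      using F by (simp add: lborel_prod)
    have G'[measurable]: "(\<lambda>p. F (fst p, - snd p)) \<in> borel_measurable (lborel \<Otimes>\<^sub>M lborel)"
      using measurable_compose[OF m F] by (simp add: lborel_prod)
    have "(\<integral>\<^sup>+p. F (fst p, - snd p) \<partial>lborel) = (\<integral>\<^sup>+x. \<integral>\<^sup>+y. F (x, - y) \<partial>lborel \<partial>lborel)"
      unfolding lborel_prod[symmetric] using lborel.nn_integral_fst[OF G'] by simp
    also have "\<dots> = (\<integral>\<^sup>+x. \<integral>\<^sup>+y. F (x, y) \<partial>lborel \<partial>lborel)"
    proof (rule nn_integral_cong)
      fix x :: "real ^ 'a"
      have [measurable]: "(\<lambda>y. F (x, y)) \<in> borel_measurable borel"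
        by (rule measurable_compose[OF borel_measurable_continuous_onI F]) (intro continuous_intros)
      show "(\<integral>\<^sup>+y. F (x, - y) \<partial>lborel) = (\<integral>\<^sup>+y. F (x, y) \<partial>lborel)"
        using nn_integral_real_affine[of "\<lambda>y. F (x, y)" "-1" 0] by simp
    qed
    also have "\<dots> = (\<integral>\<^sup>+p. F p \<partial>lborel)"
      unfolding lborel_prod[symmetric] using lborel.nn_integral_fst[OF F'] by simp
    finally show "(\<integral>\<^sup>+p. F (fst p, - snd p) \<partial>lborel) = (\<integral>\<^sup>+p. F p \<partial>lborel)" .
  qed
  show ?thesis
  proof (cases k)
    case (Some j)
    show ?thesis unfolding Some flip_Some
      by (rule measure_preserving_compose[OF measure_preserving_swap
            measure_preserving_compose[OF 0 measure_preserving_swap]])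
  qed (use 0 in simp)
qed

section \<open>Change of variables in the coordinate directions\<close>

definition reach0 :: "'a::euclidean_space set \<Rightarrow> 'a \<Rightarrow> 'a \<Rightarrow> real" where
  "reach0 \<Omega> e \<xi> = (if \<xi> \<in> \<Omega> then reach \<Omega> e \<xi> else 0)"

text \<open>Superlevel sets at positive levels are closed. The value 0 is prescribed outside
  \<open>\<Omega>\<close> because there the supremum in \<open>reach\<close> runs over the empty
  set.\<close>

lemma reach0_measurable:
  assumes "compact \<Omega>" "norm e = 1"
  shows "reach0 \<Omega> e \<in> borel_measurable borel"
proof (rule borel_measurableI_ge)
  fix a :: real
  have cl: "closed \<Omega>" using assms compact_imp_closed by blast
  show "{x \<in> space borel. a \<le> reach0 \<Omega> e x} \<in> sets borel"
  proof (cases "a \<le> 0")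
    case True
    have "a \<le> reach0 \<Omega> e x" for x
      using True reach_nonneg[OF assms, of x] by (auto simp: reach0_def)
    then show ?thesis by simp
  next
    case False
    have "{x \<in> space borel. a \<le> reach0 \<Omega> e x} = (\<lambda>x. (x, x + a *\<^sub>R e)) -` {p. closed_segment (fst p) (snd p) \<subseteq> \<Omega>}"
      using False reach_iff[OF assms, of _ a] by (auto simp: reach0_def)
    moreover have "closed \<dots>"
      by (intro continuous_closed_vimage closed_segments_inside cl continuous_intros)
    ultimately show ?thesis by simp
  qed
qed

text \<open>A predicate of the direction alone, so that it can be transported by
  \<open>swap_last\<close> from the last axis to the others. The indicator demands that the
  symmetric segment of half-length c \<phi> about \<open>\<eta>\<close> fits into the chord;
  \<kappa> selects a point of this segment.\<close>

definition cv_holds :: "'a::euclidean_space \<Rightarrow> bool" where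
  "cv_holds e \<longleftrightarrow> (\<forall>\<Omega> (\<kappa> :: real) c (G :: 'a \<Rightarrow> ennreal). compact \<Omega> \<longrightarrow> \<bar>\<kappa>\<bar> \<le> c \<longrightarrow> G \<in> borel_measurable borel \<longrightarrow>
    (\<integral>\<^sup>+\<eta>. indicator {\<eta> \<in> \<Omega>. c * phi \<Omega> e \<eta> \<le> min (reach \<Omega> (- e) \<eta>) (reach \<Omega> e \<eta>)} \<eta> *
      G (\<eta> + (\<kappa> * phi \<Omega> e \<eta>) *\<^sub>R e) \<partial>lborel) \<le> 2 * (\<integral>\<^sup>+\<eta>. indicator \<Omega> \<eta> * G \<eta> \<partial>lborel))"

text \<open>Fubini over vertical lines: on each fibre of \<open>\<Omega>\<close>, a compact set of
  reals, the two reaches are the distances to the ends of a component, so \<open>cv_line\<close>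
  applies.\<close>

lemma cv_last: "cv_holds ((0, 1) :: 'n::finite pt)"
  unfolding cv_holds_def
proof (intro allI impI)
  let ?e = "(0, 1) :: 'n pt"
  fix \<Omega> :: "('n pt) set" and \<kappa> c :: real and G :: "'n pt \<Rightarrow> ennreal"
  assume \<Omega>: "compact \<Omega>" and \<kappa>: "\<bar>\<kappa>\<bar> \<le> c" and G[measurable]: "G \<in> borel_measurable borel"
  have e: "norm ?e = 1" "norm (- ?e) = 1" by (simp_all add: norm_Pair)
  have [measurable]: "\<Omega> \<in> sets borel" using \<Omega> by (simp add: borel_compact)
  note [measurable] = reach0_measurable[OF \<Omega> e(1)] reach0_measurable[OF \<Omega> e(2)]
  define P where "P \<eta> = sqrt (reach0 \<Omega> (- ?e) \<eta> * reach0 \<Omega> ?e \<eta>)" for \<eta>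
  have [measurable]: "P \<in> borel_measurable borel" unfolding P_def by measurable
  define F where "F \<eta> = indicator {\<eta> \<in> \<Omega>. c * P \<eta> \<le> min (reach0 \<Omega> (- ?e) \<eta>) (reach0 \<Omega> ?e \<eta>)} \<eta> * G (\<eta> + (\<kappa> * P \<eta>) *\<^sub>R ?e)" for \<eta>
  \<comment> \<open>The formula for \<open>phi\<close> holds on \<open>\<Omega>\<close> only;
    rewriting with \<open>reach0\<close> makes the integrand visibly Borel on the whole
    space.\<close>
  have Feq: "indicator {\<eta> \<in> \<Omega>. c * phi \<Omega> ?e \<eta> \<le> min (reach \<Omega> (- ?e) \<eta>) (reach \<Omega> ?e \<eta>)} \<eta> *
      G (\<eta> + (\<kappa> * phi \<Omega> ?e \<eta>) *\<^sub>R ?e) = F \<eta>" for \<eta>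
    using phi_eq_reach[OF \<Omega> e(1), of \<eta>] by (cases "\<eta> \<in> \<Omega>") (simp_all add: F_def P_def reach0_def indicator_def)
  have F[measurable]: "F \<in> borel_measurable borel"
    unfolding F_def by measurable
  have F': "F \<in> borel_measurable (lborel \<Otimes>\<^sub>M lborel)" using F by (simp add: lborel_prod)
  have I': "(\<lambda>\<eta>. indicator \<Omega> \<eta> * G \<eta>) \<in> borel_measurable (lborel \<Otimes>\<^sub>M lborel)" unfolding lborel_prod by measurable
  have "(\<integral>\<^sup>+\<eta>. F \<eta> \<partial>lborel) = (\<integral>\<^sup>+x. \<integral>\<^sup>+y. F (x, y) \<partial>lborel \<partial>lborel)"
    unfolding lborel_prod[symmetric] using lborel.nn_integral_fst[OF F'] by simp
  also have "\<dots> \<le> (\<integral>\<^sup>+x. 2 * (\<integral>\<^sup>+y. indicator \<Omega> (x, y) * G (x, y) \<partial>lborel) \<partial>lborel)"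
  proof (rule nn_integral_mono)
    fix x :: "real ^ 'n"
    define A where "A = Pair x -` \<Omega>"
    have "A = snd ` (\<Omega> \<inter> ({x} \<times> UNIV))"
    proof (intro equalityI subsetI)
      fix y assume "y \<in> A"
      then have "(x, y) \<in> \<Omega> \<inter> ({x} \<times> UNIV)" by (simp add: A_def)
      then have "snd (x, y) \<in> snd ` (\<Omega> \<inter> ({x} \<times> UNIV))" by (rule imageI)
      then show "y \<in> snd ` (\<Omega> \<inter> ({x} \<times> UNIV))" by simp
    qed (auto simp: A_def)
    moreover have "compact \<dots>" using \<Omega>
      by (intro compact_continuous_image continuous_intros compact_Int_closed closed_Times) auto
    ultimately have A: "compact A" by simp
    have Gx: "(\<lambda>y. G (x, y)) \<in> borel_measurable borel"
      by (rule measurable_compose[OF borel_measurable_continuous_onI G]) (intro continuous_intros)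
    have seg: "closed_segment y z \<subseteq> A \<longleftrightarrow> closed_segment (x, y) (x, z) \<subseteq> \<Omega>" for y z
    proof -
      have "(1 - u) *\<^sub>R (x, y) + u *\<^sub>R (x, z) = Pair x ((1 - u) *\<^sub>R y + u *\<^sub>R z)" for u
        by (simp add: scaleR_diff_left)
      then have "closed_segment (x, y) (x, z) = Pair x ` closed_segment y z"
        unfolding closed_segment_def by (simp only:) blast
      then show ?thesis by (auto simp: A_def)
    qed
    define Lm where "Lm y = reach \<Omega> (- ?e) (x, y)" for y
    define Lp where "Lp y = reach \<Omega> ?e (x, y)" for y
    have L: "closed_segment y z \<subseteq> A \<longleftrightarrow> y - Lm y \<le> z \<and> z \<le> y + Lp y" if y: "y \<in> A" for y z
    proof -
      have yO: "(x, y) \<in> \<Omega>" using y by (simp add: A_def)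
      have nn: "0 \<le> Lm y" "0 \<le> Lp y" using reach_nonneg[OF \<Omega> e(1) yO] reach_nonneg[OF \<Omega> e(2) yO] by (simp_all add: Lm_def Lp_def)
      show ?thesis
      proof (cases "y \<le> z")
        case True
        have "(x, z) = (x, y) + (z - y) *\<^sub>R ?e" by simp
        then show ?thesis using reach_iff[OF \<Omega> e(1) yO, of "z - y"] True nn seg[of y z] by (simp add: Lp_def) linarith
      next
        case False
        have "(x, z) = (x, y) + (y - z) *\<^sub>R (- ?e)" by simp
        then show ?thesis using reach_iff[OF \<Omega> e(2) yO, of "y - z"] False nn seg[of y z] by (simp add: Lm_def) linarith
      qed
    qed
    have "(\<integral>\<^sup>+y. F (x, y) \<partial>lborel) = (\<integral>\<^sup>+y. indicator {y \<in> A. c * sqrt (Lm y * Lp y) \<le> min (Lm y) (Lp y)} y *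
      G (x, y + \<kappa> * sqrt (Lm y * Lp y)) \<partial>lborel)"
      by (intro nn_integral_cong) (simp add: F_def P_def reach0_def A_def Lm_def Lp_def indicator_def)
    also have "\<dots> \<le> 2 * (\<integral>\<^sup>+y. indicator A y * G (x, y) \<partial>lborel)" by (rule cv_line[OF Gx \<kappa> A L])
    also have "\<dots> = 2 * (\<integral>\<^sup>+y. indicator \<Omega> (x, y) * G (x, y) \<partial>lborel)" by (simp add: A_def indicator_def)
    finally show "(\<integral>\<^sup>+y. F (x, y) \<partial>lborel) \<le> 2 * (\<integral>\<^sup>+y. indicator \<Omega> (x, y) * G (x, y) \<partial>lborel)" .
  qed
  also have "\<dots> = 2 * (\<integral>\<^sup>+x. \<integral>\<^sup>+y. indicator \<Omega> (x, y) * G (x, y) \<partial>lborel \<partial>lborel)"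
    by (intro nn_integral_cmult lborel.borel_measurable_nn_integral_fst[OF I'])
  also have "\<dots> = 2 * (\<integral>\<^sup>+\<eta>. indicator \<Omega> \<eta> * G \<eta> \<partial>lborel)"
    unfolding lborel_prod[symmetric] using lborel.nn_integral_fst[OF I'] by simp
  finally show "(\<integral>\<^sup>+\<eta>. indicator {\<eta> \<in> \<Omega>. c * phi \<Omega> ?e \<eta> \<le> min (reach \<Omega> (- ?e) \<eta>) (reach \<Omega> ?e \<eta>)} \<eta> *
      G (\<eta> + (\<kappa> * phi \<Omega> ?e \<eta>) *\<^sub>R ?e) \<partial>lborel) \<le> 2 * (\<integral>\<^sup>+\<eta>. indicator \<Omega> \<eta> * G \<eta> \<partial>lborel)"
    unfolding Feq .
qed

lemma reach_swap: "reach (swap_last j ` \<Omega>) (swap_last j e) (swap_last j \<xi>) = reach \<Omega> e \<xi>"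
proof -
  have inj: "inj (swap_last j)" by (rule inj_on_inverseI[of _ "swap_last j"]) simp
  have "closed_segment (swap_last j \<xi>) (swap_last j \<xi> + l *\<^sub>R swap_last j e) \<subseteq> swap_last j ` \<Omega> \<longleftrightarrow>
      closed_segment \<xi> (\<xi> + l *\<^sub>R e) \<subseteq> \<Omega>" for l
  proof -
    have "closed_segment (swap_last j \<xi>) (swap_last j \<xi> + l *\<^sub>R swap_last j e) = swap_last j ` closed_segment \<xi> (\<xi> + l *\<^sub>R e)"
      using closed_segment_linear_image[OF swap_last_linear[of j], of \<xi> "\<xi> + l *\<^sub>R e"]
      by (simp add: linear_add[OF swap_last_linear] linear_scale[OF swap_last_linear])
    then show ?thesis by (simp only: inj_image_subset_iff[OF inj])
  qed
  then show ?thesis unfolding reach_def by (simp only:)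
qed

text \<open>The swap exchanges the given axis with the last one, preserves the measure and carries
  chords of \<open>\<Omega>\<close> to chords of its image.\<close>

lemma cv_Basis:
  fixes e :: "'n::finite pt"
  assumes "e \<in> Basis"
  shows "cv_holds e"
proof -
  have "cv_holds ((axis j 1, 0) :: 'n pt)" for j :: 'n
    unfolding cv_holds_def
  proof (intro allI impI)
    let ?e = "(axis j 1, 0) :: 'n pt" and ?f = "(0, 1) :: 'n pt"
    fix \<Omega> :: "('n pt) set" and \<kappa> c :: real and G :: "'n pt \<Rightarrow> ennreal"
    assume \<Omega>: "compact \<Omega>" and \<kappa>: "\<bar>\<kappa>\<bar> \<le> c" and G[measurable]: "G \<in> borel_measurable borel"
    have e: "norm ?e = 1" "norm ?f = 1" "norm (- ?f) = 1" by (simp_all add: norm_Pair)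
    let ?T = "swap_last j"
    have T[measurable]: "?T \<in> borel_measurable borel" using swap_last_linear by (rule linear_borel)
    define O' where "O' = ?T ` \<Omega>"
    have O': "compact O'" unfolding O'_def using \<Omega>
      by (intro compact_continuous_image linear_continuous_on) (simp_all add: linear_linear swap_last_linear)
    have [measurable]: "O' \<in> sets borel" using O' by (simp add: borel_compact)
    have mem: "?T \<eta> \<in> O' \<longleftrightarrow> \<eta> \<in> \<Omega>" for \<eta>
      unfolding O'_def by (rule inj_image_mem_iff, rule inj_on_inverseI[of _ ?T]) simp
    have rc: "reach O' ?f (?T \<eta>) = reach \<Omega> ?e \<eta>" "reach O' (- ?f) (?T \<eta>) = reach \<Omega> (- ?e) \<eta>" for \<eta>
    proof -
      have neg: "?T (- ?e) = - ?f"
        using linear_neg[OF swap_last_linear, of j ?e] unfolding swap_last_axis(1) .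
      show "reach O' ?f (?T \<eta>) = reach \<Omega> ?e \<eta>"
        using reach_swap[of j \<Omega> ?e \<eta>] unfolding O'_def swap_last_axis(1) .
      show "reach O' (- ?f) (?T \<eta>) = reach \<Omega> (- ?e) \<eta>"
        using reach_swap[of j \<Omega> "- ?e" \<eta>] unfolding O'_def neg .
    qed
    have ph: "phi O' ?f (?T \<eta>) = phi \<Omega> ?e \<eta>" if "\<eta> \<in> \<Omega>" for \<eta>
    proof -
      have "?T \<eta> \<in> O'" using that mem by blast
      from phi_eq_reach[OF O' e(2) this] show ?thesis unfolding phi_eq_reach[OF \<Omega> e(1) that] rc .
    qed
    define H where "H \<eta> = G (?T \<eta>)" for \<eta>
    have [measurable]: "H \<in> borel_measurable borel" unfolding H_def by measurable
    define F where "F \<eta> = indicator {\<eta> \<in> O'. c * phi O' ?f \<eta> \<le> min (reach O' (- ?f) \<eta>) (reach O' ?f \<eta>)} \<eta> *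
      H (\<eta> + (\<kappa> * phi O' ?f \<eta>) *\<^sub>R ?f)" for \<eta>
    have F: "F \<in> borel_measurable borel"
    proof -
      note [measurable] = reach0_measurable[OF O' e(2)] reach0_measurable[OF O' e(3)]
      define P where "P \<eta> = sqrt (reach0 O' (- ?f) \<eta> * reach0 O' ?f \<eta>)" for \<eta>
      have [measurable]: "P \<in> borel_measurable borel" unfolding P_def by measurable
      have "F = (\<lambda>\<eta>. indicator {\<eta> \<in> O'. c * P \<eta> \<le> min (reach0 O' (- ?f) \<eta>) (reach0 O' ?f \<eta>)} \<eta> * H (\<eta> + (\<kappa> * P \<eta>) *\<^sub>R ?f))"
      proof
        fix \<eta>
        show "F \<eta> = indicator {\<eta> \<in> O'. c * P \<eta> \<le> min (reach0 O' (- ?f) \<eta>) (reach0 O' ?f \<eta>)} \<eta> * H (\<eta> + (\<kappa> * P \<eta>) *\<^sub>R ?f)"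
          using phi_eq_reach[OF O' e(2), of \<eta>] by (cases "\<eta> \<in> O'") (simp_all add: F_def P_def reach0_def indicator_def)
      qed
      also have "\<dots> \<in> borel_measurable borel" by measurable
      finally show ?thesis .
    qed
    have "indicator {\<eta> \<in> \<Omega>. c * phi \<Omega> ?e \<eta> \<le> min (reach \<Omega> (- ?e) \<eta>) (reach \<Omega> ?e \<eta>)} \<eta> *
      G (\<eta> + (\<kappa> * phi \<Omega> ?e \<eta>) *\<^sub>R ?e) = F (?T \<eta>)" for \<eta>
    proof (cases "\<eta> \<in> \<Omega>")
      case True
      have "?T (?T \<eta> + a *\<^sub>R ?f) = \<eta> + a *\<^sub>R ?e" for a
        by (simp only: linear_add[OF swap_last_linear] linear_scale[OF swap_last_linear] swap_last_axis swap_last_involution)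
      then show ?thesis unfolding F_def H_def indicator_def mem_Collect_eq unfolding ph[OF True] rc mem by (simp only:)
    next
      case False
      then have "?T \<eta> \<notin> O'" using mem by blast
      then show ?thesis using False by (simp only: F_def indicator_def mem_Collect_eq) simp
    qed
    then have "(\<integral>\<^sup>+\<eta>. indicator {\<eta> \<in> \<Omega>. c * phi \<Omega> ?e \<eta> \<le> min (reach \<Omega> (- ?e) \<eta>) (reach \<Omega> ?e \<eta>)} \<eta> *
      G (\<eta> + (\<kappa> * phi \<Omega> ?e \<eta>) *\<^sub>R ?e) \<partial>lborel) = (\<integral>\<^sup>+\<eta>. F (?T \<eta>) \<partial>lborel)" by simp
    also have "\<dots> = (\<integral>\<^sup>+\<eta>. F \<eta> \<partial>lborel)"
      using measure_preserving_swap[of j, unfolded measure_preserving_map_def, THEN conjunct2, rule_format, OF F] .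
    also have "\<dots> \<le> 2 * (\<integral>\<^sup>+\<eta>. indicator O' \<eta> * H \<eta> \<partial>lborel)"
      unfolding F_def using cv_last[unfolded cv_holds_def, rule_format, OF O' \<kappa> \<open>H \<in> borel_measurable borel\<close>] .
    finally have 1: "(\<integral>\<^sup>+\<eta>. indicator {\<eta> \<in> \<Omega>. c * phi \<Omega> ?e \<eta> \<le> min (reach \<Omega> (- ?e) \<eta>) (reach \<Omega> ?e \<eta>)} \<eta> *
      G (\<eta> + (\<kappa> * phi \<Omega> ?e \<eta>) *\<^sub>R ?e) \<partial>lborel) \<le> 2 * (\<integral>\<^sup>+\<eta>. indicator O' \<eta> * H \<eta> \<partial>lborel)" .
    have "(\<integral>\<^sup>+\<eta>. indicator O' \<eta> * H \<eta> \<partial>lborel) = (\<integral>\<^sup>+\<eta>. indicator O' (?T \<eta>) * H (?T \<eta>) \<partial>lborel)"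
    proof -
      have "(\<lambda>\<eta>. indicator O' \<eta> * H \<eta>) \<in> borel_measurable borel" by measurable
      from measure_preserving_swap[of j, unfolded measure_preserving_map_def, THEN conjunct2, rule_format, OF this]
      show ?thesis by simp
    qed
    also have "\<dots> = (\<integral>\<^sup>+\<eta>. indicator \<Omega> \<eta> * G \<eta> \<partial>lborel)"
      by (intro nn_integral_cong) (simp add: H_def indicator_def mem)
    finally have 2: "(\<integral>\<^sup>+\<eta>. indicator O' \<eta> * H \<eta> \<partial>lborel) = (\<integral>\<^sup>+\<eta>. indicator \<Omega> \<eta> * G \<eta> \<partial>lborel)" .
    show "(\<integral>\<^sup>+\<eta>. indicator {\<eta> \<in> \<Omega>. c * phi \<Omega> ?e \<eta> \<le> min (reach \<Omega> (- ?e) \<eta>) (reach \<Omega> ?e \<eta>)} \<eta> *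
      G (\<eta> + (\<kappa> * phi \<Omega> ?e \<eta>) *\<^sub>R ?e) \<partial>lborel) \<le> 2 * (\<integral>\<^sup>+\<eta>. indicator \<Omega> \<eta> * G \<eta> \<partial>lborel)"
      using 1 unfolding 2 .
  qed
  then show ?thesis using assms cv_last unfolding Basis_pt by blast
qed

section \<open>Tangent balls of a \<open>C\<^sup>2\<close> domain\<close>

lemma C2_fun_has_derivative:
  assumes "f differentiable_on UNIV"
  shows "((\<lambda>s. f (X + s *\<^sub>R v)) has_real_derivative (\<Sum>i\<in>UNIV. v $ i * partial_deriv i f (X + s *\<^sub>R v))) (at s)"
proof -
  define D where "D = frechet_derivative f (at (X + s *\<^sub>R v))"
  have fD: "(f has_derivative D) (at (X + s *\<^sub>R v))"
    using assms unfolding D_def differentiable_on_def by (simp add: frechet_derivative_works)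
  have lin: "linear D" using fD has_derivative_linear by blast
  have "v = (\<Sum>i\<in>UNIV. v $ i *\<^sub>R axis i 1)" using basis_expansion[of v] by (simp add: scalar_mult_eq_scaleR)
  then have "D v = D (\<Sum>i\<in>UNIV. v $ i *\<^sub>R axis i 1)" by simp
  also have "\<dots> = (\<Sum>i\<in>UNIV. v $ i *\<^sub>R D (axis i 1))"
    by (simp only: linear_sum[OF lin] linear_scale[OF lin])
  also have "\<dots> = (\<Sum>i\<in>UNIV. v $ i * partial_deriv i f (X + s *\<^sub>R v))"
    by (simp only: partial_deriv_def D_def real_scaleR_def)
  finally have Dv: "D v = (\<Sum>i\<in>UNIV. v $ i * partial_deriv i f (X + s *\<^sub>R v))" .
  have "((\<lambda>s. X + s *\<^sub>R v) has_derivative (\<lambda>h. h *\<^sub>R v)) (at s)"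
    by (auto intro!: derivative_eq_intros)
  from has_derivative_compose[OF this, of f D] fD
  have "((\<lambda>s. f (X + s *\<^sub>R v)) has_derivative (\<lambda>h. D (h *\<^sub>R v))) (at s)" by simp
  moreover have "(\<lambda>h. D (h *\<^sub>R v)) = (*) (\<Sum>i\<in>UNIV. v $ i * partial_deriv i f (X + s *\<^sub>R v))"
    by (rule ext) (simp only: linear_scale[OF lin] Dv real_scaleR_def mult.commute)
  ultimately show ?thesis unfolding has_field_derivative_def by (simp only:)
qed

text \<open>The mean value theorem twice along the segment. The second derivative in direction v is
  estimated termwise, which produces the square of the dimension and gives away the factor
  1/2.\<close>

lemma C2_fun_taylor:
  fixes f :: "real ^ 'n::finite \<Rightarrow> real"
  assumes f: "C2_fun f" and M: "\<And>i k x. \<bar>partial_deriv i (partial_deriv k f) x\<bar> \<le> M"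
  shows "\<bar>f (X + v) - f X - grad f X \<bullet> v\<bar> \<le> (real CARD('n))\<^sup>2 * M * (norm v)\<^sup>2"
proof -
  define g where "g s = f (X + s *\<^sub>R v)" for s
  define g1 where "g1 s = (\<Sum>i\<in>UNIV. v $ i * partial_deriv i f (X + s *\<^sub>R v))" for s
  define g2 where "g2 s = (\<Sum>i\<in>UNIV. v $ i * (\<Sum>k\<in>UNIV. v $ k * partial_deriv k (partial_deriv i f) (X + s *\<^sub>R v)))" for s
  have d1: "(g has_real_derivative g1 s) (at s)" for s
    unfolding g_def g1_def using f by (intro C2_fun_has_derivative) (simp add: C2_fun_def)
  have d2: "(g1 has_real_derivative g2 s) (at s)" for s
    unfolding g1_def g2_def
    by (intro DERIV_sum DERIV_cmult C2_fun_has_derivative) (use f in \<open>simp add: C2_fun_def\<close>)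
  obtain a where a: "0 < a" "a < 1" "g 1 - g 0 = g1 a" using MVT2[of 0 1 g g1] d1 by auto
  obtain b where b: "g1 a - g1 0 = a * g2 b" using MVT2[of 0 a g1 g2] d2 a by auto
  have M0: "0 \<le> M" using M abs_ge_zero order_trans by blast
  have "\<bar>v $ i * (\<Sum>k\<in>UNIV. v $ k * partial_deriv k (partial_deriv i f) (X + b *\<^sub>R v))\<bar> \<le> norm v * (real CARD('n) * (norm v * M))" for i
    unfolding abs_mult
  proof (intro mult_mono component_le_norm_cart)
    have "\<bar>\<Sum>k\<in>UNIV. v $ k * partial_deriv k (partial_deriv i f) (X + b *\<^sub>R v)\<bar> \<le> (\<Sum>k\<in>(UNIV :: 'n set). norm v * M)"
      by (intro order_trans[OF sum_abs] sum_mono) (unfold abs_mult, intro mult_mono component_le_norm_cart M, simp_all)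
    then show "\<bar>\<Sum>k\<in>UNIV. v $ k * partial_deriv k (partial_deriv i f) (X + b *\<^sub>R v)\<bar> \<le> real CARD('n) * (norm v * M)" by simp
  qed simp_all
  then have "\<bar>g2 b\<bar> \<le> (\<Sum>i\<in>(UNIV :: 'n set). norm v * (real CARD('n) * (norm v * M)))"
    unfolding g2_def by (intro order_trans[OF sum_abs] sum_mono)
  then have g2: "\<bar>g2 b\<bar> \<le> (real CARD('n))\<^sup>2 * M * (norm v)\<^sup>2" by (simp add: power2_eq_square mult_ac)
  have "g1 0 = grad f X \<bullet> v" by (simp add: g1_def grad_def inner_vec_def mult.commute)
  then have "f (X + v) - f X - grad f X \<bullet> v = a * g2 b" using a(3) b by (simp add: g_def)
  also have "\<bar>\<dots>\<bar> \<le> 1 * \<bar>g2 b\<bar>" unfolding abs_mult using a by (intro mult_right_mono) auto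
  finally show ?thesis using g2 by simp
qed

lemma C2_fun_continuous: "C2_fun f \<Longrightarrow> continuous_on UNIV f"
  by (simp add: C2_fun_def differentiable_imp_continuous_on)

text \<open>The covering condition yields around every boundary point z a chart that contains the
  ball of fixed radius \<open>\<delta> / 2\<close>. There the defining function \<Phi> differs from
  its linearisation at z by at most B |w - z|^2, and dividing by the length of the gradient gives
  the two tangent balls.\<close>

lemma C2_domain_two_ball:
  fixes \<Omega>0 :: "'n::finite pt set"
  assumes "C2_domain \<Omega>0"
  obtains K where "two_ball (closure \<Omega>0) K"
proof -
  have op: "open \<Omega>0" and bd: "bounded \<Omega>0" "\<Omega>0 \<noteq> {}" using assms unfolding C2_domain_def by simp_all
  from assms obtain \<delta> M \<U> where \<delta>: "\<delta> > 0" and M: "M > 0"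
    and U0: "\<forall>U\<in>\<U>. open U \<and> connected U"
    and near0: "\<forall>\<xi>\<in>\<Omega>0. infdist \<xi> (frontier \<Omega>0) < \<delta> \<longrightarrow> (\<exists>U\<in>\<U>. \<xi> \<in> U \<and> infdist \<xi> (frontier U) > \<delta>)"
    and chart0: "\<forall>U\<in>\<U>. \<exists>(R :: 'n pt \<Rightarrow> 'n pt) c f. orthogonal_transformation R \<and> C2_fun f \<and>
           (\<forall>i k x. \<bar>partial_deriv i (partial_deriv k f) x\<bar> \<le> M) \<and>
           \<Omega>0 \<inter> U = {\<xi> \<in> U. snd (R (\<xi> - c)) < f (fst (R (\<xi> - c)))}"
    unfolding C2_domain_def by (elim conjE exE) (rule that; assumption)
  have U: "\<And>U. U \<in> \<U> \<Longrightarrow> open U"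
    and near: "\<And>\<xi>. \<xi> \<in> \<Omega>0 \<Longrightarrow> infdist \<xi> (frontier \<Omega>0) < \<delta> \<Longrightarrow> \<exists>U\<in>\<U>. \<xi> \<in> U \<and> infdist \<xi> (frontier U) > \<delta>"
    and chart: "\<And>U. U \<in> \<U> \<Longrightarrow> \<exists>(R :: 'n pt \<Rightarrow> 'n pt) c f. orthogonal_transformation R \<and> C2_fun f \<and>
           (\<forall>i k x. \<bar>partial_deriv i (partial_deriv k f) x\<bar> \<le> M) \<and>
           \<Omega>0 \<inter> U = {\<xi> \<in> U. snd (R (\<xi> - c)) < f (fst (R (\<xi> - c)))}"
    using U0 apply blast
    using near0 apply blast
    by (rule chart0[rule_format])
  define B where "B = (real CARD('n))\<^sup>2 * M"
  \<comment> \<open>B serves near z. At distance \<open>\<delta> / 2\<close> or more the summand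
    \<open>2 / \<delta>\<close> makes K |w - z|^2 at least |w - z|, and both ball conditions become
    trivial by Cauchy-Schwarz.\<close>
  define K where "K = B + 2 / \<delta>"
  have B: "B \<ge> 0" using M by (simp add: B_def)
  have K: "K > 0" "K \<ge> B" "K \<ge> 2 / \<delta>" using B \<delta> by (simp_all add: K_def add_nonneg_pos)
  have "two_ball (closure \<Omega>0) K"
  proof
    show "compact (closure \<Omega>0)" "closure \<Omega>0 \<noteq> {}" "K > 0" using bd K by auto
    fix z assume z: "z \<in> frontier (closure \<Omega>0)"
    have zc: "z \<in> closure \<Omega>0" using z frontier_subset_closed[of "closure \<Omega>0"] by auto
    have zf: "z \<in> frontier \<Omega>0"
      using z interior_mono[OF closure_subset[of \<Omega>0]] unfolding frontier_def closure_closure by blast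
    have "\<delta> / 2 > 0" using \<delta> by simp
    \<comment> \<open>The covering condition speaks of points of the open domain, so it is applied
      to a point x close to z; a ball of radius \<open>\<delta> / 2\<close> about z is still left in
      the patch.\<close>
    then obtain x where x: "x \<in> \<Omega>0" "dist x z < \<delta> / 2" using zc unfolding closure_approachable by blast
    have "infdist x (frontier \<Omega>0) < \<delta>" using infdist_le[OF zf, of x] x(2) \<delta> by linarith
    from near[OF x(1) this] obtain U where UU: "U \<in> \<U>" "x \<in> U" "infdist x (frontier U) > \<delta>" by blast
    have in_U: "w \<in> U" if w: "norm (w - z) < \<delta> / 2" for w
    proof (rule ccontr)
      assume "w \<notin> U"
      then have "closed_segment x w \<inter> frontier U \<noteq> {}"
        by (intro connected_Int_frontier) (use UU(2) ends_in_segment in blast)+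
      then obtain y where y: "y \<in> closed_segment x w" "y \<in> frontier U" by blast
      have "norm (y - x) \<le> norm (w - x)" using segment_bound1[OF y(1)] .
      moreover have "norm (w - x) \<le> norm (w - z) + norm (z - x)" using norm_triangle_ineq[of "w - z" "z - x"] by simp
      moreover have "norm (z - x) < \<delta> / 2" using x(2) by (simp add: dist_norm norm_minus_commute)
      moreover have "infdist x (frontier U) \<le> norm (y - x)" using infdist_le[OF y(2), of x] by (simp add: dist_norm norm_minus_commute)
      ultimately show False using w UU(3) by linarith
    qed
    obtain R :: "'n pt \<Rightarrow> 'n pt" and c f where R: "orthogonal_transformation R" and f: "C2_fun f"
      and fM: "\<And>i k x. \<bar>partial_deriv i (partial_deriv k f) x\<bar> \<le> M"
      and graph: "\<Omega>0 \<inter> U = {\<xi> \<in> U. snd (R (\<xi> - c)) < f (fst (R (\<xi> - c)))}"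
    proof -
      from chart[OF UU(1)] show ?thesis by (elim exE conjE) (rule that; simp)
    qed
    have linR: "linear R" using R orthogonal_transformation_linear by blast
    define \<Phi> where "\<Phi> w = snd (R (w - c)) - f (fst (R (w - c)))" for w
    have contR: "continuous_on UNIV (\<lambda>w. R (w - c))"
    proof -
      have "continuous_on UNIV R" using linR by (simp add: linear_continuous_on linear_linear)
      then show ?thesis by (rule continuous_on_compose2[of _ _ _ "\<lambda>w. w - c"]) (intro continuous_intros, simp)
    qed
    have "continuous_on UNIV (\<lambda>w. f (fst (R (w - c))))"
      by (rule continuous_on_compose2[OF C2_fun_continuous[OF f] continuous_on_fst[OF contR]]) simp
    then have cont\<Phi>: "continuous_on UNIV \<Phi>" unfolding \<Phi>_def
      by (rule continuous_on_diff[OF continuous_on_snd[OF contR]])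
    have \<Phi>_in: "w \<in> \<Omega>0 \<longleftrightarrow> \<Phi> w < 0" if "w \<in> U" for w
    proof -
      have "w \<in> \<Omega>0 \<inter> U \<longleftrightarrow> w \<in> {\<xi> \<in> U. snd (R (\<xi> - c)) < f (fst (R (\<xi> - c)))}" unfolding graph ..
      then show ?thesis using that unfolding \<Phi>_def by simp
    qed
    have \<Phi>_cl: "\<Phi> w \<le> 0" if w: "w \<in> U" "w \<in> closure \<Omega>0" for w
    proof (rule ccontr)
      assume "\<not> \<Phi> w \<le> 0"
      then have "w \<in> U \<inter> {w. 0 < \<Phi> w}" using w by simp
      moreover have "open (U \<inter> {w. 0 < \<Phi> w})"
        by (rule open_Int[OF U[OF UU(1)] open_Collect_less[OF continuous_on_const cont\<Phi>]])
      ultimately have "U \<inter> {w. 0 < \<Phi> w} \<inter> \<Omega>0 \<noteq> {}"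
        using w(2) open_Int_closure_eq_empty[of "U \<inter> {w. 0 < \<Phi> w}" \<Omega>0] by blast
      then obtain v where "v \<in> U" "0 < \<Phi> v" "v \<in> \<Omega>0" by blast
      then show False using \<Phi>_in[of v] by simp
    qed
    have zU: "z \<in> U" using in_U[of z] \<delta> by simp
    \<comment> \<open>As a frontier point of the closure, z cannot belong to the open set
      \<open>\<Omega>0\<close>; together with the bound on the closure this gives \<Phi> z =
      0.\<close>
    have "\<not> \<Phi> z < 0"
    proof
      assume "\<Phi> z < 0"
      then have "z \<in> \<Omega>0" using \<Phi>_in zU by blast
      then have "z \<in> interior (closure \<Omega>0)" using op closure_subset interior_maximal by blast
      then show False using z by (simp add: frontier_def)
    qed
    then have \<Phi>z: "\<Phi> z = 0" using \<Phi>_cl[OF zU zc] by linarith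
    define X where "X = fst (R (z - c))"
    \<comment> \<open>The gradient of y - f(x) in the coordinates of the chart; n is its normalised
      preimage under R.\<close>
    define \<nu> where "\<nu> = (- grad f X, 1 :: real)"
    define N where "N = norm \<nu>"
    have N: "N \<ge> 1" using norm_snd_le[of "1 :: real" "- grad f X"] by (simp add: N_def \<nu>_def)
    from surjD[OF orthogonal_transformation_surj[OF R], of "\<nu> /\<^sub>R N"]
    obtain n where n': "\<nu> /\<^sub>R N = R n" ..
    note n = n'[symmetric]
    \<comment> \<open>The gradient has length N \<ge> 1, so normalising it does not spoil the
      constant.\<close>
    have BK: "B * X \<le> N * (K * X)" if "0 \<le> X" for X
    proof -
      have "B * X \<le> K * X" using K(2) that by (rule mult_right_mono)
      moreover have "1 * (K * X) \<le> N * (K * X)" using N K(1) that by (intro mult_right_mono) simp_all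
      ultimately show ?thesis by linarith
    qed
    have far: "d \<le> K * d\<^sup>2" if "\<delta> / 2 \<le> d" for d
    proof -
      have d: "0 \<le> d" using that \<delta> by linarith
      have "2 / \<delta> * (\<delta> / 2) \<le> K * d" using that K d \<delta> by (intro mult_mono) simp_all
      then have "1 \<le> K * d" using \<delta> by simp
      from mult_right_mono[OF this d] show ?thesis by (simp add: power2_eq_square mult.assoc)
    qed
    have nn: "norm n = 1"
    proof -
      have "norm n = norm (R n)" using orthogonal_transformation_norm[OF R] by simp
      also have "\<dots> = 1 / N * N" unfolding n norm_scaleR N_def by (simp add: divide_inverse)
      also have "\<dots> = 1" using N by simp
      finally show ?thesis .
    qed
    have est: "\<bar>\<Phi> w - N * (n \<bullet> (w - z))\<bar> \<le> B * (norm (w - z))\<^sup>2" for w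
    proof -
      define \<Delta> where "\<Delta> = R (w - z)"
      have Rw: "R (w - c) = R (z - c) + \<Delta>" unfolding \<Delta>_def by (simp flip: linear_add[OF linR])
      have "R n \<bullet> R (w - z) = n \<bullet> (w - z)" using R unfolding orthogonal_transformation_def by blast
      then have "n \<bullet> (w - z) = R n \<bullet> \<Delta>" unfolding \<Delta>_def by (rule sym)
      then have "N * (n \<bullet> (w - z)) = \<nu> \<bullet> \<Delta>" unfolding n using N by simp
      also have "\<dots> = snd \<Delta> - grad f X \<bullet> fst \<Delta>" by (simp add: \<nu>_def inner_prod_def)
      finally have e: "N * (n \<bullet> (w - z)) = snd \<Delta> - grad f X \<bullet> fst \<Delta>" .
      have "\<Phi> w - \<Phi> z = snd \<Delta> - (f (X + fst \<Delta>) - f X)" unfolding \<Phi>_def Rw X_def by simp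
      then have "\<Phi> w - N * (n \<bullet> (w - z)) = - (f (X + fst \<Delta>) - f X - grad f X \<bullet> fst \<Delta>)" unfolding e \<Phi>z by simp
      then have "\<bar>\<Phi> w - N * (n \<bullet> (w - z))\<bar> \<le> B * (norm (fst \<Delta>))\<^sup>2"
        using C2_fun_taylor[OF f fM, of X "fst \<Delta>"] unfolding B_def by (simp only: abs_minus_cancel)
      also have "\<dots> \<le> B * (norm \<Delta>)\<^sup>2" using B norm_fst_le[of "fst \<Delta>" "snd \<Delta>"] by (intro mult_left_mono power_mono) auto
      also have "norm \<Delta> = norm (w - z)" unfolding \<Delta>_def using orthogonal_transformation_norm[OF R] by simp
      finally show ?thesis .
    qed
    show "\<exists>n. norm n = 1 \<and> (\<forall>w\<in>closure \<Omega>0. n \<bullet> (w - z) \<le> K * (norm (w - z))\<^sup>2) \<and>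
      (\<forall>w. n \<bullet> (w - z) < - K * (norm (w - z))\<^sup>2 \<longrightarrow> w \<in> closure \<Omega>0)"
    proof (intro exI[of _ n] conjI ballI allI impI nn)
      fix w assume w: "w \<in> closure \<Omega>0"
      have cs: "n \<bullet> (w - z) \<le> norm (w - z)" using Cauchy_Schwarz_ineq2[of n "w - z"] nn by simp
      show "n \<bullet> (w - z) \<le> K * (norm (w - z))\<^sup>2"
      proof (cases "norm (w - z) < \<delta> / 2")
        case True
        have "N * (n \<bullet> (w - z)) \<le> B * (norm (w - z))\<^sup>2" using est[of w] \<Phi>_cl[OF in_U[OF True] w] by linarith
        also have "\<dots> \<le> N * (K * (norm (w - z))\<^sup>2)" by (rule BK) simp
        finally show ?thesis by (rule mult_left_le_imp_le) (use N in linarith)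
      next
        case False
        then have "norm (w - z) \<le> K * (norm (w - z))\<^sup>2" using far by simp
        then show ?thesis using cs by linarith
      qed
    next
      fix w assume w: "n \<bullet> (w - z) < - K * (norm (w - z))\<^sup>2"
      have cs: "- norm (w - z) \<le> n \<bullet> (w - z)" using Cauchy_Schwarz_ineq2[of n "w - z"] nn by simp
      have "norm (w - z) < \<delta> / 2"
      proof (rule ccontr)
        assume "\<not> norm (w - z) < \<delta> / 2"
        then have "norm (w - z) \<le> K * (norm (w - z))\<^sup>2" using far by simp
        then show False using cs w by linarith
      qed
      then have wU: "w \<in> U" by (rule in_U)
      have "N * (n \<bullet> (w - z)) < N * (- K * (norm (w - z))\<^sup>2)"
        using w by (rule mult_strict_left_mono) (use N in linarith)
      moreover have "N * (- K * (norm (w - z))\<^sup>2) = - (N * (K * (norm (w - z))\<^sup>2))" by simp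
      moreover have "B * (norm (w - z))\<^sup>2 \<le> N * (K * (norm (w - z))\<^sup>2)" by (rule BK) simp
      ultimately have "\<Phi> w < 0" using est[of w] by linarith
      then have "w \<in> \<Omega>0" using \<Phi>_in[OF wU] by blast
      then show "w \<in> closure \<Omega>0" using closure_subset by blast
    qed
  qed
  then show ?thesis using that by blast
qed

section \<open>Domains of special type\<close>

text \<open>The linear part of the affine isometry \<open>sd_map\<close>; it acts on steps of
  differences.\<close>

definition sd_lin :: "'n::finite special_dom \<Rightarrow> 'n pt \<Rightarrow> 'n pt" where
  "sd_lin D v = (if sd_down D then flip_coord (sd_coord D) else id)
       ((case sd_coord D of None \<Rightarrow> id | Some j \<Rightarrow> swap_last j) v)"

lemma flip_linear: "linear (flip_coord k)"
proof -
  have 0: "linear (flip_coord None :: 'a pt \<Rightarrow> 'a pt)" unfolding flip_None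
    by (rule linearI) (auto simp: prod_eq_iff)
  show ?thesis
  proof (cases k)
    case (Some j)
    show ?thesis unfolding Some flip_Some
      using linear_compose[OF linear_compose[OF swap_last_linear[of j] 0] swap_last_linear[of j]] by (simp add: o_def)
  qed (use 0 in simp)
qed

lemma flip_norm: "norm (flip_coord k v) = norm v"
proof -
  have 0: "norm (flip_coord None w) = norm w" for w :: "'a pt"
    unfolding flip_None by (simp add: norm_prod_def)
  show ?thesis by (cases k) (simp_all only: flip_Some 0 swap_last_norm)
qed

lemma sd_lin_linear: "linear (sd_lin D)"
  and sd_lin_norm: "norm (sd_lin D v) = norm v"
  and sd_map_mp: "measure_preserving_map (sd_map D)"
proof -
  define A where "A = (if sd_down D then flip_coord (sd_coord D) else id)"
  define S where "S = (case sd_coord D of None \<Rightarrow> id | Some j \<Rightarrow> swap_last j)"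
  have mpid: "measure_preserving_map (id :: 'a pt \<Rightarrow> 'a pt)" by (simp add: measure_preserving_map_def)
  have A: "linear A" "norm (A v) = norm v" "measure_preserving_map A" for v
    unfolding A_def by (simp_all add: flip_norm flip_linear measure_preserving_flip linear_id mpid)
  have S: "linear S" "norm (S v) = norm v" "measure_preserving_map S" for v
    unfolding S_def using swap_last_linear measure_preserving_swap linear_id mpid by (auto simp: id_def split: option.splits)
  have eq: "sd_lin D = (\<lambda>v. A (S v))" unfolding sd_lin_def A_def S_def by auto
  show "linear (sd_lin D)" unfolding eq using linear_compose[OF S(1) A(1)] by (simp add: o_def)
  show "norm (sd_lin D v) = norm v" unfolding eq A(2) S(2) ..
  have "sd_map D = (\<lambda>v. A (S (sd_xi D + v)))" unfolding sd_map_def A_def S_def by auto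
  then show "measure_preserving_map (sd_map D)"
    using measure_preserving_compose[OF A(3) measure_preserving_compose[OF S(3) measure_preserving_translation]] by simp
qed

lemma sd_map_diff: "sd_map D a - sd_map D b = sd_lin D (a - b)"
  and sd_map_add: "sd_map D (a + v) = sd_map D a + sd_lin D v"
  and sd_map_eq: "sd_map D a = sd_lin D (sd_xi D + a)"
proof -
  show *: "sd_map D a = sd_lin D (sd_xi D + a)" for a by (simp add: sd_map_def sd_lin_def)
  show "sd_map D a - sd_map D b = sd_lin D (a - b)" unfolding * by (simp flip: linear_diff[OF sd_lin_linear])
  show "sd_map D (a + v) = sd_map D a + sd_lin D v" unfolding * by (simp flip: linear_add[OF sd_lin_linear] add: add.assoc)
qed

lemma sd_lin_surj: "surj (sd_lin D)"
proof -
  have "inj (sd_lin D)"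
    unfolding linear_injective_0[OF sd_lin_linear]
  proof (intro allI impI)
    fix v assume "sd_lin D v = 0"
    then have "norm v = 0" using sd_lin_norm[of D v] by simp
    then show "v = 0" by simp
  qed
  then show ?thesis using linear_injective_imp_surjective[OF sd_lin_linear] by blast
qed

lemma sd_map_surj: obtains \<zeta> where "sd_map D \<zeta> = y"
proof -
  obtain v where "y = sd_lin D v" using sd_lin_surj by (metis surjD)
  then have "sd_map D (v - sd_xi D) = y" by (simp add: sd_map_eq)
  then show ?thesis using that by blast
qed

lemma sd_map_segment: "sd_map D ` closed_segment a b = closed_segment (sd_map D a) (sd_map D b)"
proof -
  have "sd_map D ` closed_segment a b = sd_lin D ` ((+) (sd_xi D) ` closed_segment a b)"
    unfolding image_image by (rule image_cong) (simp_all only: sd_map_eq)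
  also have "(+) (sd_xi D) ` closed_segment a b = closed_segment (sd_xi D + a) (sd_xi D + b)"
    by (rule closed_segment_translation[symmetric])
  also have "sd_lin D ` \<dots> = closed_segment (sd_map D a) (sd_map D b)"
    unfolding sd_map_eq by (rule closed_segment_linear_image[OF sd_lin_linear, symmetric])
  finally show ?thesis .
qed

lemma partial_deriv_lipschitz:
  fixes g :: "real ^ 'n::finite \<Rightarrow> real"
  assumes g: "C2_fun g" and b: "b > 0"
  obtains P Q where "P \<ge> 0" "Q \<ge> 0"
    "\<And>j x. x \<in> ccube b \<Longrightarrow> \<bar>partial_deriv j g x\<bar> \<le> P"
    "\<And>j x x'. x \<in> ccube b \<Longrightarrow> x' \<in> ccube b \<Longrightarrow> \<bar>partial_deriv j g x - partial_deriv j g x'\<bar> \<le> Q * norm (x - x')"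
proof -
  have cc: "ccube b = cbox (\<chi> i. - b) (\<chi> i. b)" by (auto simp: ccube_def mem_box_cart)
  have comp: "compact (ccube b :: (real ^ 'n) set)" and conv: "convex (ccube b :: (real ^ 'n) set)" unfolding cc by auto
  have bound: "\<exists>B. \<forall>x\<in>ccube b. \<bar>F x\<bar> \<le> B" if F: "continuous_on UNIV F" for F :: "real ^ 'n \<Rightarrow> real"
  proof -
    have "bounded (F ` ccube b)" using comp F by (intro compact_imp_bounded compact_continuous_image) (auto intro: continuous_on_subset)
    then obtain B where "\<forall>y\<in>F ` ccube b. norm y \<le> B" unfolding bounded_iff by blast
    then have "\<forall>x\<in>ccube b. \<bar>F x\<bar> \<le> B" by simp
    then show ?thesis by blast
  qed
  have c1: "continuous_on UNIV (partial_deriv j g)" and c2: "continuous_on UNIV (partial_deriv i (partial_deriv j g))" for i j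
    using g by (auto simp: C2_fun_def intro: differentiable_imp_continuous_on)
  have "\<forall>j. \<exists>B. \<forall>x\<in>ccube b. \<bar>partial_deriv j g x\<bar> \<le> B" using bound[OF c1] by blast
  then obtain P1 where P1: "\<And>j x. x \<in> ccube b \<Longrightarrow> \<bar>partial_deriv j g x\<bar> \<le> P1 j" by metis
  have "\<forall>ij. \<exists>B. \<forall>x\<in>ccube b. \<bar>partial_deriv (fst ij) (partial_deriv (snd ij) g) x\<bar> \<le> B" using bound[OF c2] by blast
  then obtain Q1 where Q1: "\<And>ij x. x \<in> ccube b \<Longrightarrow> \<bar>partial_deriv (fst ij) (partial_deriv (snd ij) g) x\<bar> \<le> Q1 ij" by metis
  define P where "P = (\<Sum>j\<in>UNIV. \<bar>P1 j\<bar>)"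
  define Q0 where "Q0 = (\<Sum>ij\<in>UNIV. \<bar>Q1 ij\<bar>)"
  have P: "\<bar>partial_deriv j g x\<bar> \<le> P" if "x \<in> ccube b" for j x
  proof -
    have "\<bar>P1 j\<bar> \<le> P" unfolding P_def by (rule member_le_sum) auto
    then show ?thesis using P1[OF that, of j] by linarith
  qed
  have Q0: "\<bar>partial_deriv i (partial_deriv j g) x\<bar> \<le> Q0" if "x \<in> ccube b" for i j x
  proof -
    have "\<bar>Q1 (i, j)\<bar> \<le> Q0" unfolding Q0_def by (rule member_le_sum) auto
    then show ?thesis using Q1[OF that, of "(i, j)"] by simp
  qed
  have "0 \<in> (ccube b :: (real ^ 'n) set)" using b by (simp add: ccube_def)
  then have Q00: "Q0 \<ge> 0" "P \<ge> 0" unfolding Q0_def P_def by (simp_all add: sum_nonneg)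
  define Q where "Q = real CARD('n) * Q0"
  have "\<bar>partial_deriv j g x - partial_deriv j g x'\<bar> \<le> Q * norm (x - x')" if x: "x \<in> ccube b" "x' \<in> ccube b" for j x x'
  proof -
    define v where "v = x - x'"
    have dj: "partial_deriv j g differentiable_on UNIV" using g by (simp add: C2_fun_def)
    obtain a where a: "0 < a" "a < 1" "partial_deriv j g (x' + 1 *\<^sub>R v) - partial_deriv j g (x' + 0 *\<^sub>R v) =
        (1 - 0) * (\<Sum>i\<in>UNIV. v $ i * partial_deriv i (partial_deriv j g) (x' + a *\<^sub>R v))"
      using MVT2[of 0 1 "\<lambda>s. partial_deriv j g (x' + s *\<^sub>R v)"
          "\<lambda>s. \<Sum>i\<in>UNIV. v $ i * partial_deriv i (partial_deriv j g) (x' + s *\<^sub>R v)"] C2_fun_has_derivative[OF dj] by auto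
    have "x' + a *\<^sub>R v = (1 - a) *\<^sub>R x' + a *\<^sub>R x" by (simp add: v_def algebra_simps)
    also have "\<dots> \<in> ccube b" using conv x a by (simp add: convex_alt)
    finally have mem: "x' + a *\<^sub>R v \<in> ccube b" .
    have "\<bar>\<Sum>i\<in>UNIV. v $ i * partial_deriv i (partial_deriv j g) (x' + a *\<^sub>R v)\<bar> \<le> (\<Sum>i\<in>(UNIV :: 'n set). norm v * Q0)"
      by (intro order_trans[OF sum_abs] sum_mono) (unfold abs_mult, intro mult_mono component_le_norm_cart Q0 mem, simp_all)
    then show ?thesis using a(3) by (simp add: v_def Q_def mult_ac)
  qed
  moreover have "Q \<ge> 0" using Q00 by (simp add: Q_def)
  ultimately show ?thesis using that[of P Q] P Q00 by blast
qed

text \<open>On a segment in \<open>\<Omega>\<close> that stays over the cube and above the lower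
  level, membership in the star set amounts to lying in the box, an open condition, and equally to
  lying on or below the graph, a closed one. By connectedness the segment cannot leave the star
  set.\<close>

lemma up_star_connected:
  assumes star: "sd_map D ` up_star b L g = Bx \<inter> \<Omega>" and Bx: "open Bx" and g: "continuous_on UNIV g"
    and p: "p \<in> up_star b L g"
    and seg: "\<And>w. w \<in> closed_segment p p' \<Longrightarrow> fst w \<in> cube (2 * b) \<and> (INF u\<in>ccube (2 * b). g u) - 4 * L * b < snd w \<and> sd_map D w \<in> \<Omega>"
  shows "p' \<in> up_star b L g"
proof -
  define A where "A = closed_segment p p'"
  have "continuous_on UNIV (sd_map D)"
  proof -
    have "sd_map D = (\<lambda>a. sd_lin D (sd_xi D + a))" by (rule ext) (rule sd_map_eq)
    moreover have "continuous_on UNIV (\<lambda>a. sd_lin D (sd_xi D + a))"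
      by (intro continuous_on_compose2[OF linear_continuous_on[of "sd_lin D" UNIV]] continuous_intros)
         (use sd_lin_linear linear_linear in auto)
    ultimately show ?thesis by simp
  qed
  then have openT: "open (sd_map D -` Bx)" using Bx by (simp add: open_vimage)
  have inj: "a = c" if "sd_map D a = sd_map D c" for a c
    using that sd_map_diff[of D a c] sd_lin_norm[of D "a - c"] by simp
  have iff1: "w \<in> up_star b L g \<longleftrightarrow> w \<in> sd_map D -` Bx" if "w \<in> A" for w
  proof -
    have "sd_map D w \<in> \<Omega>" using seg that A_def by blast
    then have "w \<in> sd_map D -` Bx \<longleftrightarrow> sd_map D w \<in> sd_map D ` up_star b L g" unfolding star by blast
    also have "\<dots> \<longleftrightarrow> w \<in> up_star b L g" using inj by blast
    finally show ?thesis by blast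
  qed
  have iff2: "w \<in> up_star b L g \<longleftrightarrow> w \<in> {w. snd w \<le> g (fst w)}" if "w \<in> A" for w
    using seg[of w] that by (cases w) (simp add: up_star_def A_def)
  have cl: "closed {w. snd w \<le> g (fst w)}"
    by (intro closed_Collect_le continuous_intros continuous_on_compose2[OF g]) auto
  have "A \<inter> sd_map D -` Bx = A \<inter> {w. snd w \<le> g (fst w)}" using iff1 iff2 by blast
  moreover have "openin (top_of_set A) (A \<inter> sd_map D -` Bx)" using openT by (rule openin_open_Int)
  moreover have "closedin (top_of_set A) (A \<inter> {w. snd w \<le> g (fst w)})" using cl by (rule closedin_closed_Int)
  moreover have "connected A" unfolding A_def by simp
  ultimately have "A \<inter> sd_map D -` Bx = {} \<or> A \<inter> sd_map D -` Bx = A"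
    unfolding connected_clopen by (elim allE[of _ "A \<inter> sd_map D -` Bx"]) simp
  moreover have "p \<in> A \<inter> sd_map D -` Bx" using iff1[of p] p by (simp add: A_def)
  ultimately have "p' \<in> A \<inter> sd_map D -` Bx" by (auto simp: A_def)
  then show ?thesis using iff1[of p'] by (simp add: A_def)
qed

lemma closure_image_graph:
  assumes z: "sd_map D z' \<in> closure (sd_map D ` up_bd b g 2)" and g: "continuous_on UNIV g"
  shows "snd z' = g (fst z')"
proof -
  have "z' \<in> closure (up_bd b g 2)"
    unfolding closure_approachable
  proof (intro allI impI)
    fix e :: real assume "e > 0"
    then obtain q where q: "q \<in> up_bd b g 2" "dist (sd_map D q) (sd_map D z') < e"
      using z unfolding closure_approachable by blast
    then show "\<exists>y\<in>up_bd b g 2. dist y z' < e" by (auto simp: dist_norm sd_map_diff sd_lin_norm)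
  qed
  moreover have "closed {w. snd w = g (fst w)}"
    by (intro closed_Collect_eq continuous_intros continuous_on_compose2[OF g]) auto
  moreover have "up_bd b g 2 \<subseteq> {w. snd w = g (fst w)}" by (auto simp: up_bd_def)
  ultimately show ?thesis using closure_minimal by blast
qed

context
  fixes \<Omega> :: "'n::finite pt set" and K :: real and D :: "'n special_dom"
  assumes tb: "two_ball \<Omega> K" and valid: "special_dom_valid D" and att: "attached \<Omega> D"
begin

interpretation two_ball \<Omega> K by (rule tb)

text \<open>The graph near \<open>z'\<close> is mapped into \<open>\<Omega>\<close>, so the exterior
  ball bounds the outward component of displacements along the graph: \<tau> \<theta> \<le> C
  \<tau>^2 for small \<tau> of either sign, which forces \<theta> = 0.\<close>

lemma tangent_at_graph:
  assumes P: "P \<ge> 0" "Q \<ge> 0"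
    and Pb: "\<And>j x. x \<in> ccube (2 * sd_b D) \<Longrightarrow> \<bar>partial_deriv j (sd_g D) x\<bar> \<le> P"
    and Qb: "\<And>j x x'. x \<in> ccube (2 * sd_b D) \<Longrightarrow> x' \<in> ccube (2 * sd_b D) \<Longrightarrow>
        \<bar>partial_deriv j (sd_g D) x - partial_deriv j (sd_g D) x'\<bar> \<le> Q * norm (x - x')"
    and z: "fst z' \<in> cube (2 * sd_b D)" "snd z' = sd_g D (fst z')"
       "(INF u\<in>ccube (2 * sd_b D). sd_g D u) - 4 * sd_L D * sd_b D < snd z'"
    and n: "normal (sd_map D z') n"
  shows "n \<bullet> sd_lin D (tang (sd_g D) j (fst z')) = 0"
proof -
  define g where "g = sd_g D"
  define x where "x = fst z'"
  define m where "m = (INF u\<in>ccube (2 * sd_b D). g u) - 4 * sd_L D * sd_b D"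
  define e where "e = (axis j 1 :: real ^ 'n)"
  define \<theta> where "\<theta> = n \<bullet> sd_lin D (tang g j x)"
  have g: "C2_fun g" using valid by (simp add: special_dom_valid_def g_def)
  note gc = C2_fun_continuous[OF g]
  have ne: "norm e = 1" by (simp add: e_def)
  obtain u v where star: "sd_map D ` up_star (sd_b D) (sd_L D) g = box u v \<inter> \<Omega>"
    using att unfolding attached_def sd_star_def g_def by blast
  \<comment> \<open>Q comes from the remainder of g along the axis, the other summand from the
    exterior ball and |q - z'| \<le> |\<tau>| (1 + P + Q).\<close>
  define C where "C = Q + K * (1 + P + Q)\<^sup>2"
  have C: "C \<ge> 0" using P K_pos by (simp add: C_def)
  have opC: "open (cube (2 * sd_b D) :: (real ^ 'n) set)"
  proof -
    have eq: "cube (2 * sd_b D) = box (\<chi> i. - (2 * sd_b D)) ((\<chi> i. 2 * sd_b D) :: real ^ 'n)" by (auto simp: cube_def mem_box_cart)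
    show ?thesis by (simp only: eq open_box)
  qed
  have cc: "cube (2 * sd_b D) \<subseteq> (ccube (2 * sd_b D) :: (real ^ 'n) set)" by (auto simp: cube_def ccube_def less_imp_le)
  \<comment> \<open>The parameters for which the graph point belongs to the star set; openness
    leaves room for both signs of \<tau>.\<close>
  define V where "V = {\<tau> :: real. x + \<tau> *\<^sub>R e \<in> cube (2 * sd_b D) \<and> m < g (x + \<tau> *\<^sub>R e)}"
  have "V = (\<lambda>\<tau>. x + \<tau> *\<^sub>R e) -` cube (2 * sd_b D) \<inter> {\<tau>. m < g (x + \<tau> *\<^sub>R e)}" by (auto simp: V_def)
  moreover have "open \<dots>"
    by (intro open_Int open_vimage opC continuous_intros open_Collect_less continuous_on_compose2[OF gc]) auto
  ultimately have "open V" by simp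
  moreover have "0 \<in> V" using z by (simp add: V_def x_def m_def g_def)
  ultimately obtain d where d: "d > 0" "ball 0 d \<subseteq> V" using open_contains_ball by blast
  have seg: "x + s *\<^sub>R e \<in> ccube (2 * sd_b D)" if "\<bar>s\<bar> < d" for s
  proof -
    have "s \<in> V" using d(2) that by auto
    then show ?thesis using cc unfolding V_def by blast
  qed
  have key: "\<tau> * \<theta> \<le> C * \<tau>\<^sup>2" if \<tau>: "\<bar>\<tau>\<bar> < d" "\<bar>\<tau>\<bar> \<le> 1" for \<tau>
  proof -
    define q where "q = (x + \<tau> *\<^sub>R e, g (x + \<tau> *\<^sub>R e))"
    have "\<tau> \<in> V" using d(2) \<tau> by auto
    then have "q \<in> up_star (sd_b D) (sd_L D) g" by (simp add: q_def V_def up_star_def m_def)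
    then have q\<Omega>: "sd_map D q \<in> \<Omega>" using star by blast
    define \<rho> where "\<rho> = g (x + \<tau> *\<^sub>R e) - g x - \<tau> * partial_deriv j g x"
    have gd: "g differentiable_on UNIV" using g by (simp add: C2_fun_def)
    have der: "((\<lambda>s. g (x + s *\<^sub>R e) - s * partial_deriv j g x) has_real_derivative
        (partial_deriv j g (x + s *\<^sub>R e) - partial_deriv j g x)) (at s)" for s
    proof -
      have "(\<Sum>i\<in>UNIV. e $ i * partial_deriv i g (x + s *\<^sub>R e)) = (\<Sum>i\<in>UNIV. if i = j then partial_deriv i g (x + s *\<^sub>R e) else 0)"
        by (intro sum.cong refl) (simp add: e_def axis_def)
      then have "(\<Sum>i\<in>UNIV. e $ i * partial_deriv i g (x + s *\<^sub>R e)) = partial_deriv j g (x + s *\<^sub>R e)" by simp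
      then show ?thesis using C2_fun_has_derivative[OF gd, of x e s]
        by (intro DERIV_diff) (auto intro!: derivative_eq_intros)
    qed
    have "\<bar>\<rho>\<bar> \<le> Q * \<bar>\<tau>\<bar> * \<bar>\<tau>\<bar>"
    proof -
      have "norm ((g (x + \<tau> *\<^sub>R e) - \<tau> * partial_deriv j g x) - (g (x + 0 *\<^sub>R e) - 0 * partial_deriv j g x)) \<le> (Q * \<bar>\<tau>\<bar>) * norm (\<tau> - 0)"
      proof (rule field_differentiable_bound[of "cball 0 \<bar>\<tau>\<bar>" "\<lambda>s. g (x + s *\<^sub>R e) - s * partial_deriv j g x" "\<lambda>s. partial_deriv j g (x + s *\<^sub>R e) - partial_deriv j g x"])
        fix s :: real assume s: "s \<in> cball 0 \<bar>\<tau>\<bar>"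
        show "((\<lambda>s. g (x + s *\<^sub>R e) - s * partial_deriv j g x) has_real_derivative partial_deriv j g (x + s *\<^sub>R e) - partial_deriv j g x) (at s within cball 0 \<bar>\<tau>\<bar>)"
          using der has_field_derivative_at_within by blast
        have "\<bar>s\<bar> < d" "\<bar>s\<bar> \<le> \<bar>\<tau>\<bar>" using s \<tau> by auto
        have "\<bar>partial_deriv j g (x + s *\<^sub>R e) - partial_deriv j g x\<bar> \<le> Q * norm (x + s *\<^sub>R e - x)"
          unfolding g_def using seg[OF \<open>\<bar>s\<bar> < d\<close>] seg[of 0] d(1) by (intro Qb) auto
        also have "\<dots> \<le> Q * \<bar>\<tau>\<bar>" using ne \<open>\<bar>s\<bar> \<le> \<bar>\<tau>\<bar>\<close> P(2) by (simp add: mult_left_mono)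
        finally show "norm (partial_deriv j g (x + s *\<^sub>R e) - partial_deriv j g x) \<le> Q * \<bar>\<tau>\<bar>" by simp
      qed auto
      then show ?thesis by (simp add: \<rho>_def algebra_simps)
    qed
    then have \<rho>: "\<bar>\<rho>\<bar> \<le> Q * \<tau>\<^sup>2" by (simp add: power2_eq_square mult.assoc)
    have qz: "q - z' = \<tau> *\<^sub>R tang g j x + (0, \<rho>)"
      using z(2) by (cases z') (simp add: q_def tang_def \<rho>_def x_def g_def e_def)
    have nq: "norm (q - z') \<le> \<bar>\<tau>\<bar> * (1 + P + Q)"
    proof -
      have "norm (tang g j x) \<le> norm (axis j 1 :: real ^ 'n) + norm (partial_deriv j g x)" unfolding tang_def by (rule norm_Pair_le)
      also have "\<dots> \<le> 1 + P" using Pb[of x j] z(1) cc by (auto simp: x_def g_def)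
      finally have nt: "norm (tang g j x) \<le> 1 + P" .
      have "norm (q - z') \<le> norm (\<tau> *\<^sub>R tang g j x) + norm (0 :: real ^ 'n, \<rho>)" unfolding qz by (rule norm_triangle_ineq)
      also have "norm (\<tau> *\<^sub>R tang g j x) \<le> \<bar>\<tau>\<bar> * (1 + P)" using nt by (simp add: mult_left_mono)
      also have "norm (0 :: real ^ 'n, \<rho>) \<le> \<bar>\<tau>\<bar> * Q"
      proof -
        have "\<bar>\<tau>\<bar> * \<bar>\<tau>\<bar> * Q \<le> 1 * \<bar>\<tau>\<bar> * Q" using \<tau>(2) P(2) by (intro mult_right_mono) auto
        then show ?thesis using \<rho> by (simp add: norm_Pair power2_eq_square mult_ac)
      qed
      finally show ?thesis by (simp add: algebra_simps)
    qed
    have "n \<bullet> (sd_map D q - sd_map D z') \<le> K * (norm (sd_map D q - sd_map D z'))\<^sup>2" by (rule normal_out[OF n q\<Omega>])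
    then have 1: "n \<bullet> sd_lin D (q - z') \<le> K * (norm (q - z'))\<^sup>2" unfolding sd_map_diff sd_lin_norm .
    have "(norm (q - z'))\<^sup>2 \<le> (\<bar>\<tau>\<bar> * (1 + P + Q))\<^sup>2" using nq by (intro power_mono) auto
    then have 2: "K * (norm (q - z'))\<^sup>2 \<le> K * (1 + P + Q)\<^sup>2 * \<tau>\<^sup>2"
      using mult_left_mono[of _ _ K] K_pos by (simp add: power_mult_distrib mult_ac)
    have "n \<bullet> sd_lin D (q - z') = \<tau> * \<theta> + n \<bullet> sd_lin D (0, \<rho>)"
      unfolding qz \<theta>_def by (simp add: linear_add[OF sd_lin_linear] linear_scale[OF sd_lin_linear] inner_add_right)
    moreover have "\<bar>n \<bullet> sd_lin D (0, \<rho>)\<bar> \<le> \<bar>\<rho>\<bar>"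
      using Cauchy_Schwarz_ineq2[of n "sd_lin D (0, \<rho>)"] normal_norm(1)[OF n] by (simp add: sd_lin_norm norm_Pair)
    ultimately show ?thesis using 1 2 \<rho> unfolding C_def distrib_right by linarith
  qed
  have "\<theta> = 0"
  proof (rule ccontr)
    assume "\<theta> \<noteq> 0"
    define h where "h = min (min (d / 2) 1) (\<bar>\<theta>\<bar> / (2 * (C + 1)))"
    have h: "h > 0" "h < d" "h \<le> 1" "h \<le> \<bar>\<theta>\<bar> / (2 * (C + 1))" using d \<open>\<theta> \<noteq> 0\<close> C by (auto simp: h_def)
    have k: "(sgn \<theta> * h) * \<theta> \<le> C * (sgn \<theta> * h)\<^sup>2" by (rule key) (use h \<open>\<theta> \<noteq> 0\<close> in \<open>simp_all add: abs_mult abs_sgn_eq\<close>)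
    have k1: "(sgn \<theta> * h) * \<theta> = h * \<bar>\<theta>\<bar>" by (simp add: sgn_if)
    have k2: "(sgn \<theta> * h)\<^sup>2 = h * h" using \<open>\<theta> \<noteq> 0\<close> by (simp add: sgn_if power2_eq_square)
    have "h * \<bar>\<theta>\<bar> \<le> C * (h * h)" using k unfolding k1 k2 .
    also have "\<dots> = h * (C * h)" by (simp only: mult_ac)
    finally have "h * \<bar>\<theta>\<bar> \<le> h * (C * h)" .
    then have le: "\<bar>\<theta>\<bar> \<le> C * h" using h(1) mult_le_cancel_left_pos by blast
    have "0 < 2 * (C + 1)" using C by simp
    then have "h * (2 * (C + 1)) \<le> \<bar>\<theta>\<bar>" using h(4) by (simp only: pos_le_divide_eq)
    then have "2 * (C * h) + 2 * h \<le> \<bar>\<theta>\<bar>" by (simp add: algebra_simps)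
    moreover have "0 \<le> C * h" using C h(1) by simp
    ultimately show False using le h(1) by linarith
  qed
  then show ?thesis unfolding \<theta>_def g_def x_def .
qed

end

context
  fixes \<Omega> :: "'n::finite pt set" and K :: real and D :: "'n special_dom"
  assumes tb: "two_ball \<Omega> K" and valid: "special_dom_valid D" and att: "attached \<Omega> D"
begin

interpretation two_ball \<Omega> K by (rule tb)

text \<open>If t or the distance is not small, the Lipschitz bound for \<open>dl\<close> suffices.
  Otherwise let z be the boundary point nearest to a point of the segment: its normal is orthogonal
  to the tangent vector at z, from which the tangent vector at u differs by O(t + dl). The step of
  length O(t) therefore changes the height by O(t (t + dl)), and dl is at most its root for small
  distances. The delicate point is that z lies on the part of the boundary that is described by
  g.\<close>

lemma special_oscillation:
  assumes r: "r \<ge> (1::nat)"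
  obtains K3 where "K3 > 0"
    "\<And>t s j \<eta> u. 0 < s \<Longrightarrow> s \<le> t \<Longrightarrow> t \<le> 1 \<Longrightarrow> \<eta> \<in> up_dom (sd_b D) (sd_L D) (sd_g D) 1 \<Longrightarrow>
      u \<in> near_cube (sd_b D) (t * sd_b D) (fst \<eta>) \<Longrightarrow> norm (s *\<^sub>R tang (sd_g D) j u) \<le> K3 * t"
    "\<And>t s j \<eta> u a b. 0 < s \<Longrightarrow> s \<le> t \<Longrightarrow> t \<le> 1 \<Longrightarrow> \<eta> \<in> up_dom (sd_b D) (sd_L D) (sd_g D) 1 \<Longrightarrow>
      u \<in> near_cube (sd_b D) (t * sd_b D) (fst \<eta>) \<Longrightarrow>
      closed_segment (sd_map D \<eta>) (sd_map D (\<eta> + real r *\<^sub>R (s *\<^sub>R tang (sd_g D) j u))) \<subseteq> \<Omega> \<Longrightarrow>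
      a \<in> closed_segment (sd_map D \<eta>) (sd_map D (\<eta> + real r *\<^sub>R (s *\<^sub>R tang (sd_g D) j u))) \<Longrightarrow>
      b \<in> closed_segment (sd_map D \<eta>) (sd_map D (\<eta> + real r *\<^sub>R (s *\<^sub>R tang (sd_g D) j u))) \<Longrightarrow>
      \<bar>sqrt (dl a) - sqrt (dl b)\<bar> \<le> K3 * t"
proof -
  define g where "g = sd_g D"
  define bb where "bb = sd_b D"
  define L where "L = sd_L D"
  define T where "T = sd_map D"
  define \<rho> where "\<rho> = real r"
  define m where "m = (INF u\<in>ccube (2 * bb). g u) - 4 * L * bb"
  have b: "bb > 0" and L: "L \<ge> 1" and g: "C2_fun g"
    using valid by (auto simp: special_dom_valid_def bb_def L_def g_def)
  note gc = C2_fun_continuous[OF g]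
  have \<rho>: "\<rho> \<ge> 1" using r by (simp add: \<rho>_def)
  have b2: "2 * bb > 0" using b by simp
  have "\<exists>P Q. P \<ge> 0 \<and> Q \<ge> 0 \<and> (\<forall>j. \<forall>x\<in>ccube (2 * bb). \<bar>partial_deriv j g x\<bar> \<le> P) \<and>
      (\<forall>j. \<forall>x\<in>ccube (2 * bb). \<forall>x'\<in>ccube (2 * bb). \<bar>partial_deriv j g x - partial_deriv j g x'\<bar> \<le> Q * norm (x - x'))"
    by (rule partial_deriv_lipschitz[OF g b2]) blast
  then obtain P Q where PQ: "P \<ge> 0" "Q \<ge> 0"
    and Pb: "\<And>j x. x \<in> ccube (2 * bb) \<Longrightarrow> \<bar>partial_deriv j g x\<bar> \<le> P"
    and Qb: "\<And>j x x'. x \<in> ccube (2 * bb) \<Longrightarrow> x' \<in> ccube (2 * bb) \<Longrightarrow> \<bar>partial_deriv j g x - partial_deriv j g x'\<bar> \<le> Q * norm (x - x')"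
    by blast
  define \<Lambda> where "\<Lambda> = 1 + P"
  have \<Lambda>: "\<Lambda> \<ge> 1" using PQ by (simp add: \<Lambda>_def)
  have \<rho>\<Lambda>: "\<rho> * \<Lambda> > 0" using \<rho> \<Lambda> by simp
  define t1 where "t1 = min (bb / 4 / (\<rho> * \<Lambda>)) (1 / (8 * K) / (\<rho> * \<Lambda>))"
  define d1 where "d1 = min 1 (min (bb / 4) (1 / (8 * K)))"
  have "0 < bb / 4 / (\<rho> * \<Lambda>)" "0 < 1 / (8 * K) / (\<rho> * \<Lambda>)" using b K_pos \<rho>\<Lambda> by (simp_all only: divide_pos_pos zero_less_numeral zero_less_one mult_pos_pos)
  then have t1: "t1 > 0" by (simp add: t1_def)
  have d1: "d1 > 0" using b K_pos by (simp add: d1_def)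
  \<comment> \<open>The four constants belong to large t, large distance, the turning of the tangent
    vector, and the quadratic error of \<open>dl_height\<close>.\<close>
  define c1 where "c1 = \<rho> * \<Lambda> / t1"
  define c2 where "c2 = \<rho> * \<Lambda> / sqrt d1"
  define c3 where "c3 = \<rho> * (Q * (bb + \<rho> + 1))"
  define c4 where "c4 = 6 * K * (\<rho> * \<Lambda>)\<^sup>2"
  define C where "C = c1 + c2 + c3 + c4"
  have cs: "c1 \<ge> 0" "c2 \<ge> 0" "c3 \<ge> 0" "c4 \<ge> 0"
    using t1 d1 \<rho>\<Lambda> \<rho> PQ b K_pos by (simp_all add: c1_def c2_def c3_def c4_def less_imp_le)
  have C: "C \<ge> 0" using cs by (simp add: C_def)
  have cube2: "x \<in> cube (2 * bb)" if "x \<in> cube bb" for x :: "real ^ 'n"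
    unfolding cube_def mem_Collect_eq
  proof (intro allI conjI)
    fix i
    have a: "- bb < x $ i" "x $ i < bb" using that by (simp_all add: cube_def)
    show "- (2 * bb) < x $ i" "x $ i < 2 * bb" using a b by linarith+
  qed
  have cc: "x \<in> ccube (2 * bb)" if "x \<in> cube (2 * bb)" for x :: "real ^ 'n"
    using that by (auto simp: cube_def ccube_def less_imp_le)
  obtain bu bv where star: "T ` up_star bb L g = box bu bv \<inter> \<Omega>" and
     fr: "closure (T ` up_star bb L g) \<inter> frontier \<Omega> = closure (T ` up_bd bb g 2)"
    using att unfolding attached_def sd_star_def sd_bd_star_def g_def bb_def L_def T_def by blast
  have inf: "(INF u\<in>ccube (2 * bb). g u) \<le> g x" if "x \<in> ccube (2 * bb)" for x
  proof -
    have "ccube (2 * bb) = cbox (\<chi> i. - (2 * bb)) ((\<chi> i. 2 * bb) :: real ^ 'n)" by (auto simp: ccube_def mem_box_cart)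
    then have "compact (ccube (2 * bb) :: (real ^ 'n) set)" by simp
    then have "bdd_below (g ` ccube (2 * bb))"
      using gc by (intro bounded_imp_bdd_below compact_imp_bounded compact_continuous_image) (auto intro: continuous_on_subset)
    then show ?thesis using that by (rule cINF_lower)
  qed
  have tang_norm: "norm (tang g j u) \<le> \<Lambda>" if "u \<in> cube bb" for j u
  proof -
    have "norm (tang g j u) \<le> norm (axis j 1 :: real ^ 'n) + norm (partial_deriv j g u)" unfolding tang_def by (rule norm_Pair_le)
    then show ?thesis using Pb[OF cc[OF cube2[OF that]], of j] by (simp add: \<Lambda>_def)
  qed
  have main: "dl (T (\<eta> + \<tau>2 *\<^sub>R H)) \<le> dl (T (\<eta> + \<tau>1 *\<^sub>R H)) + C * (t\<^sup>2 + t * sqrt (dl (T (\<eta> + \<tau>1 *\<^sub>R H))))"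
    if s: "0 < s" "s \<le> t" "t \<le> 1" and \<eta>: "\<eta> \<in> up_dom bb L g 1" and u: "u \<in> near_cube bb (t * bb) (fst \<eta>)"
      and H: "H = s *\<^sub>R tang g j u" and seg: "closed_segment (T \<eta>) (T (\<eta> + \<rho> *\<^sub>R H)) \<subseteq> \<Omega>"
      and \<tau>: "0 \<le> \<tau>1" "\<tau>1 \<le> \<rho>" "0 \<le> \<tau>2" "\<tau>2 \<le> \<rho>" for s t \<eta> u j H \<tau>1 \<tau>2
  proof -
    have t: "t > 0" using s by linarith
    define \<zeta> where "\<zeta> = \<eta> + \<tau>1 *\<^sub>R H"
    define \<zeta>' where "\<zeta>' = \<eta> + \<tau>2 *\<^sub>R H"
    define q where "q = sqrt (dl (T \<zeta>))"
    have q: "q \<ge> 0" "dl (T \<zeta>) = q * q" by (simp_all add: q_def)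
    have uc: "u \<in> cube bb" "norm (u - fst \<eta>) \<le> t * bb" using u by (auto simp: near_cube_def)
    have nH: "norm H \<le> t * \<Lambda>" unfolding H norm_scaleR using s tang_norm[OF uc(1), of j] by (intro mult_mono) auto
    have move: "norm (\<tau> *\<^sub>R H) \<le> \<rho> * \<Lambda> * t" if "\<bar>\<tau>\<bar> \<le> \<rho>" for \<tau>
    proof -
      have "\<bar>\<tau>\<bar> * norm H \<le> \<rho> * (t * \<Lambda>)" using that nH by (intro mult_mono) auto
      then show ?thesis by (simp add: mult_ac)
    qed
    have diff: "\<zeta>' - \<zeta> = (\<tau>2 - \<tau>1) *\<^sub>R H" by (simp add: \<zeta>_def \<zeta>'_def scaleR_diff_left)
    have step: "norm (T \<zeta>' - T \<zeta>) \<le> \<rho> * \<Lambda> * t"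
      unfolding T_def sd_map_diff sd_lin_norm diff by (rule move) (use \<tau> in linarith)
    have nnX: "0 \<le> t * t" "0 \<le> t * q" using t q by simp_all
    have cmp: "c * (t * t + t * q) \<le> C * (t * t + t * q)" if "c \<le> C" for c
      using that nnX by (intro mult_right_mono) auto
    have goal: "dl (T \<zeta>') \<le> dl (T \<zeta>) + C * (t * t + t * q)"
    proof -
      have lip: "dl (T \<zeta>') \<le> dl (T \<zeta>) + \<rho> * \<Lambda> * t" using dl_lipschitz[of "T \<zeta>'" "T \<zeta>"] step by linarith
      consider "t > t1" | "dl (T \<zeta>) > d1" | "t \<le> t1" "dl (T \<zeta>) \<le> d1" by linarith
      then show ?thesis
      proof cases
        case 1
        have "\<rho> * \<Lambda> * t = c1 * (t1 * t)" using t1 by (simp add: c1_def)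
        also have "\<dots> \<le> c1 * (t * t + t * q)"
        proof (rule mult_left_mono[OF _ cs(1)])
          have "t1 * t \<le> t * t" using 1 t by simp
          then show "t1 * t \<le> t * t + t * q" using nnX by linarith
        qed
        also have "\<dots> \<le> C * (t * t + t * q)" by (rule cmp) (use cs in \<open>unfold C_def, linarith\<close>)
        finally show ?thesis using lip by linarith
      next
        case 2
        have "\<rho> * \<Lambda> * t = c2 * (t * sqrt d1)" using d1 by (simp add: c2_def)
        also have "\<dots> \<le> c2 * (t * t + t * q)"
        proof (rule mult_left_mono[OF _ cs(2)])
          have "sqrt d1 \<le> q" unfolding q_def using 2 by simp
          then have "t * sqrt d1 \<le> t * q" using t by simp
          then show "t * sqrt d1 \<le> t * t + t * q" using nnX by linarith
        qed
        also have "\<dots> \<le> C * (t * t + t * q)" by (rule cmp) (use cs in \<open>unfold C_def, linarith\<close>)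
        finally show ?thesis using lip by linarith
      next
        case 3
        have "\<rho> * \<Lambda> * t \<le> \<rho> * \<Lambda> * t1" using 3(1) \<rho>\<Lambda> by (intro mult_left_mono) linarith+
        moreover have "\<rho> * \<Lambda> * t1 \<le> bb / 4" "\<rho> * \<Lambda> * t1 \<le> 1 / (8 * K)"
        proof -
          have "t1 \<le> bb / 4 / (\<rho> * \<Lambda>)" "t1 \<le> 1 / (8 * K) / (\<rho> * \<Lambda>)" unfolding t1_def by (rule min.cobounded1, rule min.cobounded2)
          then show "\<rho> * \<Lambda> * t1 \<le> bb / 4" "\<rho> * \<Lambda> * t1 \<le> 1 / (8 * K)"
            unfolding mult.commute[of "\<rho> * \<Lambda>" t1] by (simp_all only: pos_le_divide_eq[OF \<rho>\<Lambda>])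
        qed
        ultimately have small: "\<rho> * \<Lambda> * t \<le> bb / 4" "\<rho> * \<Lambda> * t \<le> 1 / (8 * K)" by linarith+
        have dls: "dl (T \<zeta>) \<le> 1" "dl (T \<zeta>) \<le> bb / 4" "dl (T \<zeta>) \<le> 1 / (8 * K)" using 3(2) by (auto simp: d1_def)
        have \<eta>': "fst \<eta> \<in> cube bb" "g (fst \<eta>) - L * bb < snd \<eta>" "snd \<eta> \<le> g (fst \<eta>)"
          using \<eta> by (auto simp: up_dom_def)
        have Lb: "1 * bb \<le> L * bb" using L b by (intro mult_right_mono) auto
        \<comment> \<open>The doubled cube and the depth 4 L b leave room: within
          \<open>bb / 2\<close> of \<open>\<eta>\<close> the star set is determined by the condition
          on the graph alone.\<close>
        have region: "fst w \<in> cube (2 * bb) \<and> m < snd w" if w: "norm (w - \<eta>) \<le> bb / 2" for w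
        proof
          have "norm (fst (w - \<eta>)) \<le> bb / 2" using norm_fst_le[of "fst (w - \<eta>)" "snd (w - \<eta>)", unfolded prod.collapse] w by linarith
          then have A: "\<bar>(fst w - fst \<eta>) $ i\<bar> \<le> bb / 2" for i using component_le_norm_cart[of "fst w - fst \<eta>" i] unfolding fst_diff by linarith
          have "- (2 * bb) < fst w $ i \<and> fst w $ i < 2 * bb" for i
          proof -
            have "- bb < fst \<eta> $ i" "fst \<eta> $ i < bb" using \<eta>'(1) by (simp_all add: cube_def)
            then show ?thesis using A[of i] b unfolding vector_minus_component by (intro conjI) linarith+
          qed
          then show "fst w \<in> cube (2 * bb)" by (simp add: cube_def)
          have "\<bar>snd w - snd \<eta>\<bar> \<le> bb / 2" using norm_snd_le[of "snd (w - \<eta>)" "fst (w - \<eta>)", unfolded prod.collapse] w by simp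
          moreover have "(INF u\<in>ccube (2 * bb). g u) \<le> g (fst \<eta>)" by (intro inf cc cube2 \<eta>'(1))
          ultimately show "m < snd w" using \<eta>'(2) Lb b unfolding m_def by linarith
        qed
        have T_seg: "T (\<eta> + \<tau> *\<^sub>R H) \<in> \<Omega>" if "0 \<le> \<tau>" "\<tau> \<le> \<rho>" for \<tau>
        proof -
          have "\<eta> + \<tau> *\<^sub>R H \<in> closed_segment \<eta> (\<eta> + \<rho> *\<^sub>R H)" using that \<rho> by (subst segment_from_base) auto
          then have "T (\<eta> + \<tau> *\<^sub>R H) \<in> closed_segment (T \<eta>) (T (\<eta> + \<rho> *\<^sub>R H))"
            unfolding T_def sd_map_segment[symmetric] by (rule imageI)
          then show ?thesis using seg by blast
        qed
        have \<zeta>\<eta>: "norm (\<zeta> - \<eta>) \<le> bb / 4" using move[of \<tau>1] \<tau> small by (simp add: \<zeta>_def)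
        obtain z where z: "z \<in> frontier \<Omega>" "dl (T \<zeta>) = norm (T \<zeta> - z)" using nearest_point .
        obtain z' where z': "T z' = z" unfolding T_def using sd_map_surj by blast
        have dz: "norm (\<zeta> - z') = dl (T \<zeta>)"
        proof -
          have "dl (T \<zeta>) = norm (T \<zeta> - T z')" using z(2) z' by simp
          also have "\<dots> = norm (\<zeta> - z')" unfolding T_def sd_map_diff sd_lin_norm ..
          finally show ?thesis by (rule sym)
        qed
        have T\<zeta>: "T \<zeta> \<in> \<Omega>" "T \<zeta>' \<in> \<Omega>" using T_seg \<tau> by (simp_all add: \<zeta>_def \<zeta>'_def)
        have \<eta>star: "\<eta> \<in> up_star bb L g"
          using region[of \<eta>] b \<eta>'(3) by (cases \<eta>) (simp add: up_star_def m_def)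
        have \<zeta>star: "\<zeta> \<in> up_star bb L g"
        proof (rule up_star_connected[OF star[unfolded T_def] open_box gc \<eta>star])
          fix w assume w: "w \<in> closed_segment \<eta> \<zeta>"
          have "norm (w - \<eta>) \<le> bb / 2" using segment_bound1[OF w] \<zeta>\<eta> b by linarith
          moreover have "sd_map D w \<in> \<Omega>"
          proof -
            obtain v where v: "v \<in> {0..\<tau>1}" "w = \<eta> + v *\<^sub>R H" using w unfolding \<zeta>_def segment_from_base[OF \<tau>(1)] by blast
            then show ?thesis using T_seg[of v] \<tau>(2) by (simp add: T_def)
          qed
          ultimately show "fst w \<in> cube (2 * bb) \<and> (INF u\<in>ccube (2 * bb). g u) - 4 * L * bb < snd w \<and> sd_map D w \<in> \<Omega>"
            using region[of w] unfolding m_def by blast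
        qed
        have reg_z: "norm (w - \<eta>) \<le> bb / 2" if "w \<in> closed_segment \<zeta> z'" for w
        proof -
          have "norm (w - \<zeta>) \<le> norm (z' - \<zeta>)" using segment_bound1[OF that] .
          moreover have "norm (w - \<eta>) \<le> norm (w - \<zeta>) + norm (\<zeta> - \<eta>)" using norm_triangle_ineq[of "w - \<zeta>" "\<zeta> - \<eta>"] by simp
          ultimately show ?thesis using dz dls(2) \<zeta>\<eta> by (simp add: norm_minus_commute)
        qed
        \<comment> \<open>From \<open>\<zeta>\<close> to its foot: all points before the end are
          closer to \<open>\<zeta>\<close> than the boundary, and the end point is a boundary point,
          so the segment stays in \<open>\<Omega>\<close>.\<close>
        have z'star: "z' \<in> up_star bb L g"
        proof (rule up_star_connected[OF star[unfolded T_def] open_box gc \<zeta>star])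
          fix w assume w: "w \<in> closed_segment \<zeta> z'"
          have "T w \<in> \<Omega>"
          proof (cases "norm (w - \<zeta>) < dl (T \<zeta>)")
            case True
            then have "norm (T w - T \<zeta>) < dl (T \<zeta>)" unfolding T_def sd_map_diff sd_lin_norm .
            then show ?thesis using ball_in_domain[OF T\<zeta>(1)] interior_subset by blast
          next
            case False
            obtain v where v: "0 \<le> v" "v \<le> 1" "w = (1 - v) *\<^sub>R \<zeta> + v *\<^sub>R z'" using w unfolding in_segment by blast
            have wz: "w - \<zeta> = v *\<^sub>R (z' - \<zeta>)" unfolding v(3) by (simp add: algebra_simps)
            have "norm (w - \<zeta>) = v * dl (T \<zeta>)" unfolding wz using v dz by (simp add: norm_minus_commute)
            then have "dl (T \<zeta>) \<le> v * dl (T \<zeta>)" using False by linarith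
            then have "(1 - v) * dl (T \<zeta>) \<le> 0" by (simp add: algebra_simps)
            then have "v = 1 \<or> dl (T \<zeta>) = 0" using v dl_nonneg[of "T \<zeta>"] by (auto simp: mult_le_0_iff)
            then have "w = z'"
            proof
              assume "v = 1" then show ?thesis using v(3) by simp
            next
              assume "dl (T \<zeta>) = 0" then show ?thesis using v(3) dz by (simp add: algebra_simps)
            qed
            then show ?thesis using z(1) frontier_subset z' by blast
          qed
          then show "fst w \<in> cube (2 * bb) \<and> (INF u\<in>ccube (2 * bb). g u) - 4 * L * bb < snd w \<and> sd_map D w \<in> \<Omega>"
            using region[OF reg_z[OF w]] unfolding m_def T_def by blast
        qed
        have "T z' \<in> T ` up_star bb L g" using z'star by (rule imageI)
        then have "z \<in> closure (T ` up_star bb L g)" unfolding z' by (rule subsetD[OF closure_subset])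
        \<comment> \<open>Attachment enters here: a boundary point in the closure of the star set
          lies in the closure of the graph part.\<close>
        then have "z \<in> closure (T ` up_star bb L g) \<inter> frontier \<Omega>" using z(1) by (rule IntI)
        then have "T z' \<in> closure (T ` up_bd bb g 2)" unfolding fr z' .
        then have graph: "snd z' = g (fst z')" unfolding T_def by (rule closure_image_graph[OF _ gc])
        have regz: "fst z' \<in> cube (2 * bb)" "m < snd z'"
          using region[OF reg_z[OF ends_in_segment(2)]] by simp_all
        obtain n where n: "normal z n" using normal_exists[OF z(1)] by blast
        have perp: "n \<bullet> sd_lin D (tang g j (fst z')) = 0"
          using tangent_at_graph[OF tb valid att PQ Pb[unfolded bb_def g_def] Qb[unfolded bb_def g_def]
             regz(1)[unfolded bb_def] graph[unfolded g_def] regz(2)[unfolded m_def bb_def L_def g_def] n[folded z', unfolded T_def]]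
          unfolding g_def .
        have "n \<bullet> (z - T \<zeta>) = dl (T \<zeta>)"
        proof -
          have "T \<zeta> = z - dl (T \<zeta>) *\<^sub>R n" by (rule nearest_normal[OF T\<zeta>(1) z(2) n])
          then have "z - T \<zeta> = dl (T \<zeta>) *\<^sub>R n" by (simp add: algebra_simps)
          then show ?thesis using normal_norm(2)[OF n] by simp
        qed
        moreover have "n \<bullet> (T \<zeta>' - T \<zeta>) = ((\<tau>2 - \<tau>1) * s) * (n \<bullet> sd_lin D (tang g j u))"
          unfolding T_def sd_map_diff diff H by (simp add: linear_scale[OF sd_lin_linear])
        moreover have "n \<bullet> (z - T \<zeta>') = n \<bullet> (z - T \<zeta>) - n \<bullet> (T \<zeta>' - T \<zeta>)" by (simp add: inner_diff_right)
        ultimately have nz: "n \<bullet> (z - T \<zeta>') = dl (T \<zeta>) - ((\<tau>2 - \<tau>1) * s) * (n \<bullet> sd_lin D (tang g j u))" by simp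
        \<comment> \<open>The chain u, \<open>fst \<eta>\<close>, \<open>fst \<zeta>\<close>,
          \<open>fst z'\<close> has gaps of at most t b, \<rho> t and \<open>dl\<close>; the
          derivative of g is Lipschitz with constant Q.\<close>
        have inner: "\<bar>n \<bullet> sd_lin D (tang g j u)\<bar> \<le> Q * (t * (bb + \<rho>) + dl (T \<zeta>))"
        proof -
          define p where "p = partial_deriv j g u - partial_deriv j g (fst z')"
          have "tang g j u = tang g j (fst z') + (0, p)" by (simp add: tang_def p_def)
          then have "n \<bullet> sd_lin D (tang g j u) = n \<bullet> sd_lin D (0, p)"
            using perp by (simp add: linear_add[OF sd_lin_linear] inner_add_right)
          then have "\<bar>n \<bullet> sd_lin D (tang g j u)\<bar> \<le> \<bar>p\<bar>"
            using Cauchy_Schwarz_ineq2[of n "sd_lin D (0, p)"] normal_norm(1)[OF n] by (simp add: sd_lin_norm norm_Pair)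
          also have "\<dots> \<le> Q * norm (u - fst z')" unfolding p_def by (intro Qb cc cube2 uc(1) regz(1))
          also have "\<dots> \<le> Q * (t * (bb + \<rho>) + dl (T \<zeta>))"
          proof (rule mult_left_mono[OF _ PQ(2)])
            have e1: "u - fst z' = (u - fst \<eta>) + (fst \<eta> - fst \<zeta>) + (fst \<zeta> - fst z')" by simp
            have "norm (u - fst z') \<le> norm (u - fst \<eta>) + norm (fst \<eta> - fst \<zeta>) + norm (fst \<zeta> - fst z')"
              unfolding e1 by (intro order_trans[OF norm_triangle_ineq] add_right_mono norm_triangle_ineq)
            moreover have "norm (fst \<eta> - fst \<zeta>) \<le> \<rho> * t"
            proof -
              have "fst \<eta> - fst \<zeta> = - ((\<tau>1 * s) *\<^sub>R axis j 1)" by (simp add: \<zeta>_def H tang_def)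
              then have "norm (fst \<eta> - fst \<zeta>) = \<tau>1 * s" using \<tau> s by simp
              also have "\<dots> \<le> \<rho> * t" using \<tau> s by (intro mult_mono) auto
              finally show ?thesis .
            qed
            moreover have "norm (fst \<zeta> - fst z') \<le> dl (T \<zeta>)" using norm_fst_le[of "fst (\<zeta> - z')" "snd (\<zeta> - z')", unfolded prod.collapse] dz by simp
            moreover have "t * (bb + \<rho>) = t * bb + \<rho> * t" by (simp add: algebra_simps)
            ultimately show "norm (u - fst z') \<le> t * (bb + \<rho>) + dl (T \<zeta>)" using uc(2) by linarith
          qed
          finally show ?thesis .
        qed
        have qq: "dl (T \<zeta>) \<le> q"
        proof -
          have "q \<le> 1" unfolding q_def using dls(1) by simp
          then show ?thesis using q mult_left_mono[of q 1 q] by simp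
        qed
        have "\<bar>((\<tau>2 - \<tau>1) * s) * (n \<bullet> sd_lin D (tang g j u))\<bar> \<le> (\<rho> * t) * (Q * (t * (bb + \<rho>) + q))"
          unfolding abs_mult[of "(\<tau>2 - \<tau>1) * s"]
        proof (rule mult_mono)
          have "\<bar>\<tau>2 - \<tau>1\<bar> * \<bar>s\<bar> \<le> \<rho> * t" using \<tau> s by (intro mult_mono) auto
          then show "\<bar>(\<tau>2 - \<tau>1) * s\<bar> \<le> \<rho> * t" by (simp add: abs_mult)
          have "Q * (t * (bb + \<rho>) + dl (T \<zeta>)) \<le> Q * (t * (bb + \<rho>) + q)" using qq PQ(2) by (intro mult_left_mono) auto
          then show "\<bar>n \<bullet> sd_lin D (tang g j u)\<bar> \<le> Q * (t * (bb + \<rho>) + q)" using inner by linarith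
        qed (use \<rho> t in simp_all)
        also have "\<dots> \<le> (\<rho> * t) * (Q * ((bb + \<rho> + 1) * (t + q)))"
        proof -
          have "0 \<le> (bb + \<rho>) * q" "0 \<le> t" using b \<rho> q t by simp_all
          then have "t * (bb + \<rho>) + q \<le> (bb + \<rho> + 1) * (t + q)" by (simp add: algebra_simps)
          then show ?thesis using \<rho> t PQ(2) by (intro mult_left_mono) auto
        qed
        also have "\<dots> = c3 * (t * t + t * q)" by (simp add: c3_def algebra_simps)
        finally have A: "\<bar>((\<tau>2 - \<tau>1) * s) * (n \<bullet> sd_lin D (tang g j u))\<bar> \<le> c3 * (t * t + t * q)" .
        have Bd: "\<bar>dl (T \<zeta>') - n \<bullet> (z - T \<zeta>')\<bar> \<le> 6 * K * (\<rho> * \<Lambda> * t)\<^sup>2"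
          by (rule dl_height[OF T\<zeta>(1) z(2) n T\<zeta>(2) step small(2) dls(3)])
        have "6 * K * (\<rho> * \<Lambda> * t)\<^sup>2 = c4 * (t * t)" by (simp add: c4_def power_mult_distrib power2_eq_square)
        also have "\<dots> \<le> c4 * (t * t + t * q)" using cs(4) nnX by (intro mult_left_mono) auto
        finally have "dl (T \<zeta>') \<le> dl (T \<zeta>) + (c3 * (t * t + t * q) + c4 * (t * t + t * q))" using A Bd nz by linarith
        also have "\<dots> = dl (T \<zeta>) + (c3 + c4) * (t * t + t * q)" by (simp only: distrib_right)
        also have "\<dots> \<le> dl (T \<zeta>) + C * (t * t + t * q)" by (intro add_left_mono cmp) (use cs in \<open>unfold C_def, linarith\<close>)
        finally show ?thesis .
      qed
    qed
    then show ?thesis unfolding \<zeta>_def \<zeta>'_def q_def power2_eq_square .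
  qed
  show ?thesis
  \<comment> \<open>\<Lambda> serves the bound on the length of the step, 2 C + 1 the
    oscillation.\<close>
  proof (rule that[of "2 * C + 1 + \<Lambda>"])
    show "2 * C + 1 + \<Lambda> > 0" using C \<Lambda> by linarith
  next
    fix t s :: real and j \<eta> u
    assume s: "0 < s" "s \<le> t" "t \<le> 1" and \<eta>: "\<eta> \<in> up_dom (sd_b D) (sd_L D) (sd_g D) 1" and u: "u \<in> near_cube (sd_b D) (t * sd_b D) (fst \<eta>)"
    have "s * norm (tang g j u) \<le> t * \<Lambda>"
      using s u tang_norm[of u j] by (intro mult_mono) (auto simp: near_cube_def bb_def)
    moreover have "0 \<le> C * t" using C s by simp
    ultimately show "norm (s *\<^sub>R tang (sd_g D) j u) \<le> (2 * C + 1 + \<Lambda>) * t" using s unfolding g_def by (simp add: algebra_simps)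
  next
    fix t s :: real and j \<eta> u and a c :: "'n pt"
    assume s: "0 < s" "s \<le> t" "t \<le> 1" and \<eta>: "\<eta> \<in> up_dom (sd_b D) (sd_L D) (sd_g D) 1" and u: "u \<in> near_cube (sd_b D) (t * sd_b D) (fst \<eta>)"
      and seg: "closed_segment (sd_map D \<eta>) (sd_map D (\<eta> + real r *\<^sub>R (s *\<^sub>R tang (sd_g D) j u))) \<subseteq> \<Omega>"
      and a: "a \<in> closed_segment (sd_map D \<eta>) (sd_map D (\<eta> + real r *\<^sub>R (s *\<^sub>R tang (sd_g D) j u)))"
      and c: "c \<in> closed_segment (sd_map D \<eta>) (sd_map D (\<eta> + real r *\<^sub>R (s *\<^sub>R tang (sd_g D) j u)))"
    define H where "H = s *\<^sub>R tang g j u"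
    have par: "\<exists>\<tau>. 0 \<le> \<tau> \<and> \<tau> \<le> \<rho> \<and> y = T (\<eta> + \<tau> *\<^sub>R H)"
      if "y \<in> closed_segment (sd_map D \<eta>) (sd_map D (\<eta> + real r *\<^sub>R (s *\<^sub>R tang (sd_g D) j u)))" for y
    proof -
      have "0 \<le> \<rho>" by (simp add: \<rho>_def)
      have "y \<in> T ` closed_segment \<eta> (\<eta> + \<rho> *\<^sub>R H)"
        using that unfolding sd_map_segment[symmetric] T_def H_def \<rho>_def g_def .
      then obtain \<tau> where "\<tau> \<in> {0..\<rho>}" "y = T (\<eta> + \<tau> *\<^sub>R H)"
        unfolding segment_from_base[OF \<open>0 \<le> \<rho>\<close>] by blast
      then show ?thesis by auto
    qed
    obtain \<tau>1 where \<tau>1: "0 \<le> \<tau>1" "\<tau>1 \<le> \<rho>" "a = T (\<eta> + \<tau>1 *\<^sub>R H)" using par[OF a] by blast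
    obtain \<tau>2 where \<tau>2: "0 \<le> \<tau>2" "\<tau>2 \<le> \<rho>" "c = T (\<eta> + \<tau>2 *\<^sub>R H)" using par[OF c] by blast
    have seg': "closed_segment (T \<eta>) (T (\<eta> + \<rho> *\<^sub>R H)) \<subseteq> \<Omega>"
      using seg unfolding T_def \<rho>_def H_def g_def .
    note main' = main[OF s \<eta>[folded bb_def L_def g_def] u[folded bb_def] H_def seg']
    have "t > 0" using s by linarith
    then have "\<bar>sqrt (dl a) - sqrt (dl c)\<bar> \<le> (2 * C + 1) * t"
      using main'[OF \<tau>1(1,2) \<tau>2(1,2)] main'[OF \<tau>2(1,2) \<tau>1(1,2)] C unfolding \<tau>1(3) \<tau>2(3)
      by (intro sqrt_diff_le_symmetric) simp_all
    moreover have "0 \<le> \<Lambda> * t" using \<Lambda> s by simp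
    ultimately show "\<bar>sqrt (dl a) - sqrt (dl c)\<bar> \<le> (2 * C + 1 + \<Lambda>) * t" by (simp add: distrib_right)
  qed
qed

end

section \<open>Reduction to Borel functions\<close>

lemma epowr_mono: "a \<ge> 0 \<Longrightarrow> x \<le> y \<Longrightarrow> epowr x a \<le> epowr y a"
proof -
  assume a: "a \<ge> 0" and xy: "x \<le> y"
  show ?thesis
  proof (cases "y = \<infinity>")
    case False
    then have "enn2real x \<le> enn2real y" using xy by (intro enn2real_mono) (auto simp: less_top)
    moreover have "x \<noteq> \<infinity>" using xy False by (auto simp: top_unique)
    ultimately show ?thesis using False a by (simp add: epowr_def powr_mono2 ennreal_leI)
  qed (simp add: epowr_def)
qed

lemma epowr_ennreal: "x \<ge> 0 \<Longrightarrow> epowr (ennreal x) a = ennreal (x powr a)"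
  by (simp add: epowr_def)

lemma epowr_mult:
  assumes "C > 0"
  shows "epowr (ennreal C * x) a = ennreal (C powr a) * epowr x a"
proof (cases x)
  case (real y)
  then have "epowr (ennreal C * x) a = ennreal ((C * y) powr a)"
    using assms by (simp flip: ennreal_mult add: epowr_ennreal)
  then show ?thesis using real assms by (simp add: epowr_ennreal powr_mult ennreal_mult)
next
  case top
  then show ?thesis using assms by (simp add: epowr_def ennreal_mult_top)
qed

lemma epowr_measurable [measurable]:
  assumes [measurable]: "F \<in> borel_measurable M"
  shows "(\<lambda>x. epowr (F x) a) \<in> borel_measurable M"
  unfolding epowr_def by measurable

lemma Lp_norm_le:
  assumes p: "p \<noteq> \<infinity>" "p > 0" and B: "B > 0"
    and le: "(\<integral>\<^sup>+x\<in>S. epowr (F x) (enn2real p) \<partial>lebesgue) \<le> ennreal B * (\<integral>\<^sup>+x\<in>\<Omega>. epowr (W x) (enn2real p) \<partial>lebesgue)"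
  shows "Lp_norm p S F \<le> ennreal (B powr (1 / enn2real p)) * Lp_norm p \<Omega> W"
proof -
  have "epowr (\<integral>\<^sup>+x\<in>S. epowr (F x) (enn2real p) \<partial>lebesgue) (1 / enn2real p)
      \<le> epowr (ennreal B * (\<integral>\<^sup>+x\<in>\<Omega>. epowr (W x) (enn2real p) \<partial>lebesgue)) (1 / enn2real p)"
    by (rule epowr_mono[OF _ le]) simp
  then show ?thesis using p(1) by (simp add: Lp_norm_def epowr_mult[OF B])
qed

lemma dom_diff_cong: "(\<And>x. x \<in> \<Omega> \<Longrightarrow> f x = f' x) \<Longrightarrow> r \<ge> 1 \<Longrightarrow> dom_diff r v f \<Omega> \<eta> = dom_diff r v f' \<Omega> \<eta>"
proof -
  assume f: "\<And>x. x \<in> \<Omega> \<Longrightarrow> f x = f' x" and r: "r \<ge> 1"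
  have "f (\<eta> + real j *\<^sub>R v) = f' (\<eta> + real j *\<^sub>R v)"
    if seg: "closed_segment \<eta> (\<eta> + real r *\<^sub>R v) \<subseteq> \<Omega>" and j: "j \<le> r" for j
  proof -
    have "\<eta> + real j *\<^sub>R v \<in> closed_segment \<eta> (\<eta> + real r *\<^sub>R v)"
      using j by (subst segment_from_base) auto
    then show ?thesis using f seg by blast
  qed
  then show ?thesis unfolding dom_diff_def fin_diff_def by (auto intro!: sum.cong)
qed

text \<open>For j \<ge> 1 the map from \<eta> to the j-th node is an affine bijection, so almost
  every \<eta> avoids N at all these nodes; the node j = 0 is \<open>\<xi>\<close> itself. Hence
  changing f on a null set can alter the modulus only at base points in that set.\<close>

lemma w_mod_cong_AE:
  fixes f f' :: "'a::euclidean_space \<Rightarrow> real"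
  assumes \<Omega>: "closed \<Omega>" and q: "q \<noteq> \<infinity>" and r: "r \<ge> 1" and N: "negligible N"
    and f: "\<And>x. x \<in> \<Omega> \<Longrightarrow> x \<notin> N \<Longrightarrow> f x = f' x" and \<xi>: "\<xi> \<notin> N"
  shows "w_mod r \<Omega> q f \<xi> \<delta> = w_mod r \<Omega> q f' \<xi> \<delta>"
proof -
  define P where "P j = {\<eta>. \<xi> + (real j / real r) *\<^sub>R (\<eta> - \<xi>) \<in> N}" for j
  have neg: "negligible (P j)" if j: "j \<in> {1..r}" for j
  proof -
    have jr: "real j / real r \<noteq> 0" using j by simp
    have "P j \<subseteq> (+) \<xi> ` ((\<lambda>y. (real r / real j) *\<^sub>R y) ` ((+) (- \<xi>) ` N))"
    proof
      fix \<eta> assume "\<eta> \<in> P j"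
      then have "\<xi> + (real j / real r) *\<^sub>R (\<eta> - \<xi>) \<in> N" by (simp add: P_def)
      moreover have "\<eta> = \<xi> + (real r / real j) *\<^sub>R (- \<xi> + (\<xi> + (real j / real r) *\<^sub>R (\<eta> - \<xi>)))"
        using j by simp
      ultimately show "\<eta> \<in> (+) \<xi> ` ((\<lambda>y. (real r / real j) *\<^sub>R y) ` ((+) (- \<xi>) ` N))" by blast
    qed
    moreover have "negligible ((+) \<xi> ` ((\<lambda>y. (real r / real j) *\<^sub>R y) ` ((+) (- \<xi>) ` N)))"
      by (intro negligible_translation negligible_differentiable_image_negligible N linear_imp_differentiable_on)
         (simp_all add: linear_scaleR)
    ultimately show ?thesis using negligible_subset by blast
  qed
  have "negligible (\<Union>j\<in>{1..r}. P j)" by (intro negligible_Union) (use neg in auto)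
  then have "AE \<eta> in lebesgue. \<eta> \<notin> (\<Union>j\<in>{1..r}. P j)"
    by (intro AE_not_in) (simp add: negligible_iff_null_sets)
  then have AE: "AE \<eta> in lebesgue. dom_diff r ((\<eta> - \<xi>) /\<^sub>R real r) f \<Omega> \<xi> = dom_diff r ((\<eta> - \<xi>) /\<^sub>R real r) f' \<Omega> \<xi>"
  proof eventually_elim
    case (elim \<eta>)
    have "f (\<xi> + real j *\<^sub>R ((\<eta> - \<xi>) /\<^sub>R real r)) = f' (\<xi> + real j *\<^sub>R ((\<eta> - \<xi>) /\<^sub>R real r))"
      if seg: "closed_segment \<xi> (\<xi> + real r *\<^sub>R ((\<eta> - \<xi>) /\<^sub>R real r)) \<subseteq> \<Omega>" and j: "j \<le> r" for j
    proof (rule f)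
      have "\<xi> + real j *\<^sub>R ((\<eta> - \<xi>) /\<^sub>R real r) \<in> closed_segment \<xi> (\<xi> + real r *\<^sub>R ((\<eta> - \<xi>) /\<^sub>R real r))"
        using j by (subst segment_from_base) auto
      then show "\<xi> + real j *\<^sub>R ((\<eta> - \<xi>) /\<^sub>R real r) \<in> \<Omega>" using seg by blast
      show "\<xi> + real j *\<^sub>R ((\<eta> - \<xi>) /\<^sub>R real r) \<notin> N"
      proof (cases "j = 0")
        case False
        then have "j \<in> {1..r}" using j by simp
        then have "\<eta> \<notin> P j" using elim by blast
        then show ?thesis by (simp add: P_def divide_inverse)
      qed (use \<xi> in simp)
    qed
    then show ?case unfolding dom_diff_def fin_diff_def by (auto intro!: sum.cong)
  qed
  have "(\<integral>\<^sup>+\<eta>\<in>rho_ball \<Omega> \<xi> \<delta>. ennreal (\<bar>dom_diff r ((\<eta> - \<xi>) /\<^sub>R real r) f \<Omega> \<xi>\<bar> powr enn2real q) \<partial>lebesgue)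
      = (\<integral>\<^sup>+\<eta>\<in>rho_ball \<Omega> \<xi> \<delta>. ennreal (\<bar>dom_diff r ((\<eta> - \<xi>) /\<^sub>R real r) f' \<Omega> \<xi>\<bar> powr enn2real q) \<partial>lebesgue)"
  proof (rule nn_integral_cong_AE)
    show "AE \<eta> in lebesgue. ennreal (\<bar>dom_diff r ((\<eta> - \<xi>) /\<^sub>R real r) f \<Omega> \<xi>\<bar> powr enn2real q) * indicator (rho_ball \<Omega> \<xi> \<delta>) \<eta>
      = ennreal (\<bar>dom_diff r ((\<eta> - \<xi>) /\<^sub>R real r) f' \<Omega> \<xi>\<bar> powr enn2real q) * indicator (rho_ball \<Omega> \<xi> \<delta>) \<eta>"
      using AE by eventually_elim simp
  qed
  then show ?thesis using q by (simp add: w_mod_def)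
qed

text \<open>Numerator and denominator of the average are both parameter integrals of jointly Borel
  functions; for the measure of the ball this rests on the closedness of its graph.\<close>

lemma w_mod_measurable:
  fixes f :: "'a::euclidean_space \<Rightarrow> real"
  assumes \<Omega>: "compact \<Omega>" and q: "q \<noteq> \<infinity>" and r: "r \<ge> 1" and f: "f \<in> borel_measurable borel"
  shows "(\<lambda>\<xi>. w_mod r \<Omega> q f \<xi> \<delta>) \<in> borel_measurable borel"
proof -
  have cl: "closed \<Omega>" using \<Omega> compact_imp_closed by blast
  have "(\<lambda>p. w_integrand r \<Omega> (enn2real q) f \<delta> (fst p) (snd p)) \<in> borel_measurable (borel \<Otimes>\<^sub>M lborel)"
    using w_integrand_measurable(1)[OF cl f r, of "enn2real q" \<delta>]
    by (simp add: borel_prod[symmetric] cong: measurable_cong_sets)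
  then have [measurable]: "(\<lambda>\<xi>. \<integral>\<^sup>+\<eta>. w_integrand r \<Omega> (enn2real q) f \<delta> \<xi> \<eta> \<partial>lborel) \<in> borel_measurable borel"
    by (intro lborel.borel_measurable_nn_integral) (simp add: case_prod_unfold)
  define Gr where "Gr = {p :: 'a \<times> 'a. snd p \<in> rho_ball \<Omega> (fst p) \<delta>}"
  have "Gr \<in> sets borel" unfolding Gr_def using closed_rho_ball_graph[OF cl] by simp
  then have "indicator Gr \<in> borel_measurable (borel \<Otimes>\<^sub>M lborel)"
    by (intro borel_measurable_indicator) (simp add: borel_prod[symmetric] cong: sets_pair_measure_cong)
  then have "(\<lambda>\<xi>. \<integral>\<^sup>+\<eta>. indicator Gr (\<xi>, \<eta>) \<partial>lborel) \<in> borel_measurable borel"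
    by (intro lborel.borel_measurable_nn_integral) (simp add: case_prod_unfold)
  moreover have "(\<integral>\<^sup>+\<eta>. indicator Gr (\<xi>, \<eta>) \<partial>lborel) = emeasure lebesgue (rho_ball \<Omega> \<xi> \<delta>)" for \<xi>
  proof -
    have s: "rho_ball \<Omega> \<xi> \<delta> \<in> sets borel" using rho_ball_compact[OF \<Omega>] borel_compact by blast
    have "(\<integral>\<^sup>+\<eta>. indicator Gr (\<xi>, \<eta>) \<partial>lborel) = (\<integral>\<^sup>+\<eta>. indicator (rho_ball \<Omega> \<xi> \<delta>) \<eta> \<partial>lborel)"
      by (intro nn_integral_cong) (simp add: Gr_def indicator_def)
    also have "\<dots> = emeasure lebesgue (rho_ball \<Omega> \<xi> \<delta>)" using s by simp
    finally show ?thesis .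
  qed
  ultimately have [measurable]: "(\<lambda>\<xi>. emeasure lebesgue (rho_ball \<Omega> \<xi> \<delta>)) \<in> borel_measurable borel" by simp
  show ?thesis unfolding w_mod_finite[OF q cl f r] by measurable
qed

text \<open>Quantified over all Borel functions, so that it is a property of x and H alone and can
  be applied to a Borel modification of f. The index m may depend on the function.\<close>

definition controlled :: "nat \<Rightarrow> 'a::euclidean_space set \<Rightarrow> ennreal \<Rightarrow> real \<Rightarrow> real \<Rightarrow> nat \<Rightarrow> 'a \<Rightarrow> 'a \<Rightarrow> bool" where
  "controlled r \<Omega> q C \<delta> N x H \<longleftrightarrow> (\<forall>f\<in>borel_measurable borel. \<exists>m\<le>r * N.
     ennreal \<bar>fin_diff r H f x\<bar> \<le> ennreal C * w_mod r \<Omega> q f (x + (real m / real N) *\<^sub>R H) \<delta>)"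

text \<open>At the points of a null set where \<open>f\<close> had to be changed to become Borel, \<open>W\<close> is infinite, so
  that the pointwise bound survives the change.\<close>

lemma Borel_majorant:
  fixes f :: "'a::euclidean_space \<Rightarrow> real"
  assumes \<Omega>: "compact \<Omega>" and q: "q \<noteq> \<infinity>" and r: "r \<ge> 1" and C: "C > 0" and N: "N \<ge> 1"
    and f: "f \<in> borel_measurable (lebesgue_on \<Omega>)"
  obtains W where "W \<in> borel_measurable borel"
    "(\<integral>\<^sup>+x\<in>\<Omega>. epowr (w_mod r \<Omega> q f x \<delta>) P \<partial>lebesgue) = (\<integral>\<^sup>+x. indicator \<Omega> x * epowr (W x) P \<partial>lborel)"
    "\<And>x H. closed_segment x (x + real r *\<^sub>R H) \<subseteq> \<Omega> \<Longrightarrow> controlled r \<Omega> q C \<delta> N x H \<Longrightarrow>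
       \<exists>m\<le>r * N. ennreal \<bar>fin_diff r H f x\<bar> \<le> ennreal C * W (x + (real m / real N) *\<^sub>R H)"
proof -
  have cl: "closed \<Omega>" using \<Omega> compact_imp_closed by blast
  have "\<Omega> \<in> sets lebesgue" using borel_compact[OF \<Omega>] by simp
  then have "(\<lambda>x. if x \<in> \<Omega> then f x else 0) \<in> borel_measurable lebesgue"
    using f borel_measurable_if by blast
  from completion_ex_borel_measurable_real[OF this]
  obtain f' where f': "f' \<in> borel_measurable lborel" "AE x in lborel. (if x \<in> \<Omega> then f x else 0) = f' x" by blast
  then obtain N' where N': "N' \<in> null_sets lborel" "{x \<in> space lborel. \<not> (if x \<in> \<Omega> then f x else 0) = f' x} \<subseteq> N'"
    unfolding eventually_ae_filter by blast
  have f'b: "f' \<in> borel_measurable borel" using f'(1) by simp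
  have N'b[measurable]: "N' \<in> sets borel" using N'(1) by auto
  have eq: "f x = f' x" if "x \<in> \<Omega>" "x \<notin> N'" for x
  proof (rule ccontr)
    assume "f x \<noteq> f' x"
    then have "x \<in> {x \<in> space lborel. \<not> (if x \<in> \<Omega> then f x else 0) = f' x}" using that(1) by simp
    then show False using N'(2) that(2) by blast
  qed
  have neg: "negligible N'" using N'(1) by (simp add: negligible_iff_null_sets null_sets_completionI)
  define W where "W x = (if x \<in> N' then \<infinity> else w_mod r \<Omega> q f' x \<delta>)" for x
  note [measurable] = w_mod_measurable[OF \<Omega> q r f'b]
  have Wm[measurable]: "W \<in> borel_measurable borel" unfolding W_def by measurable
  have [measurable]: "\<Omega> \<in> sets borel" using borel_compact[OF \<Omega>] .
  show ?thesis
  proof (rule that[OF Wm])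
    have "AE x in lebesgue. x \<notin> N'" using neg by (intro AE_not_in) (simp add: negligible_iff_null_sets)
    then have "AE x in lebesgue. epowr (w_mod r \<Omega> q f x \<delta>) P * indicator \<Omega> x = indicator \<Omega> x * epowr (W x) P"
    proof eventually_elim
      case (elim x)
      then have "w_mod r \<Omega> q f x \<delta> = W x" using w_mod_cong_AE[OF cl q r neg eq elim, where \<delta> = \<delta>] elim by (simp add: W_def)
      then show ?case by (simp add: mult.commute)
    qed
    from nn_integral_cong_AE[OF this]
    show "(\<integral>\<^sup>+x\<in>\<Omega>. epowr (w_mod r \<Omega> q f x \<delta>) P \<partial>lebesgue) = (\<integral>\<^sup>+x. indicator \<Omega> x * epowr (W x) P \<partial>lborel)"
      by (simp add: nn_integral_completion)
  next
    fix x H assume seg: "closed_segment x (x + real r *\<^sub>R H) \<subseteq> \<Omega>" and ctrl: "controlled r \<Omega> q C \<delta> N x H"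
    have pt: "x + v *\<^sub>R H \<in> \<Omega>" if "0 \<le> v" "v \<le> real r" for v
    proof -
      have "x + v *\<^sub>R H \<in> closed_segment x (x + real r *\<^sub>R H)" using that by (subst segment_from_base) auto
      then show ?thesis using seg by blast
    qed
    show "\<exists>m\<le>r * N. ennreal \<bar>fin_diff r H f x\<bar> \<le> ennreal C * W (x + (real m / real N) *\<^sub>R H)"
    proof (cases "\<exists>j\<le>r. x + real j *\<^sub>R H \<in> N'")
      case True
      then obtain j where j: "j \<le> r" "x + real j *\<^sub>R H \<in> N'" by blast
      \<comment> \<open>With m = j N the evaluation point is the bad node itself, where W is
        infinite.\<close>
      have e: "real (j * N) / real N = real j" using N by simp
      have "W (x + (real (j * N) / real N) *\<^sub>R H) = \<infinity>" unfolding e W_def using j by simp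
      then have "ennreal \<bar>fin_diff r H f x\<bar> \<le> ennreal C * W (x + (real (j * N) / real N) *\<^sub>R H)"
        using C by (simp add: ennreal_mult_top)
      moreover have "j * N \<le> r * N" using j by simp
      ultimately show ?thesis by blast
    next
      case False
      have "fin_diff r H f x = fin_diff r H f' x" unfolding fin_diff_def
        using False pt by (intro sum.cong refl) (simp add: eq)
      moreover obtain m where m: "m \<le> r * N" "ennreal \<bar>fin_diff r H f' x\<bar> \<le> ennreal C * w_mod r \<Omega> q f' (x + (real m / real N) *\<^sub>R H) \<delta>"
        using ctrl f'b unfolding controlled_def by blast
      moreover have "w_mod r \<Omega> q f' y \<delta> \<le> W y" for y by (simp add: W_def)
      ultimately have "ennreal \<bar>fin_diff r H f x\<bar> \<le> ennreal C * W (x + (real m / real N) *\<^sub>R H)"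
        using order_trans[OF m(2) mult_left_mono] by simp
      then show ?thesis using m(1) by blast
    qed
  qed
qed

section \<open>Comparison of the moduli\<close>

text \<open>The case p = \<infinity>: a continuous function extended by zero is Borel and has the
  same moduli, and the supremum norm controls the modulus at every point of the segment, so no
  exceptional set arises.\<close>

lemma sup_bound:
  fixes f :: "'a::euclidean_space \<Rightarrow> real"
  assumes \<Omega>: "compact \<Omega>" and r: "r \<ge> 1" and N: "N \<ge> 1" and f: "continuous_on \<Omega> f"
    and ctrl: "controlled r \<Omega> q C \<delta> N x H" and seg: "closed_segment x (x + real r *\<^sub>R H) \<subseteq> \<Omega>"
  shows "ennreal \<bar>fin_diff r H f x\<bar> \<le> ennreal C * tau_mod r \<Omega> \<infinity> q f \<delta>"
proof -
  define f' where "f' x = indicator \<Omega> x *\<^sub>R f x" for x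
  have f': "f' \<in> borel_measurable borel"
    using borel_measurable_continuous_on_indicator[OF borel_compact[OF \<Omega>] f] unfolding f'_def[abs_def] .
  have eq: "f x = f' x" if "x \<in> \<Omega>" for x using that by (simp add: f'_def)
  have dd: "dom_diff r v f' \<Omega> \<eta> = dom_diff r v f \<Omega> \<eta>" for v \<eta> by (rule dom_diff_cong[OF _ r]) (simp add: eq)
  have w: "w_mod r \<Omega> q f' \<xi> \<delta> = w_mod r \<Omega> q f \<xi> \<delta>" for \<xi> unfolding w_mod_def dd ..
  have fd: "fin_diff r H f' x = fin_diff r H f x" using dd[of H x] seg by (simp add: dom_diff_def)
  obtain m where m: "m \<le> r * N" "ennreal \<bar>fin_diff r H f x\<bar> \<le> ennreal C * w_mod r \<Omega> q f (x + (real m / real N) *\<^sub>R H) \<delta>"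
    using ctrl f' unfolding controlled_def w[symmetric] fd[symmetric] by blast
  have "real m \<le> real r * real N" using m(1) by (simp flip: of_nat_mult)
  then have "real m / real N \<le> real r" using N by (simp add: divide_le_eq)
  then have "x + (real m / real N) *\<^sub>R H \<in> closed_segment x (x + real r *\<^sub>R H)"
    by (subst segment_from_base) auto
  then have "w_mod r \<Omega> q f (x + (real m / real N) *\<^sub>R H) \<delta> \<le> tau_mod r \<Omega> \<infinity> q f \<delta>"
    unfolding tau_mod_def Lp_norm_def using seg by (auto intro: SUP_upper)
  then show ?thesis using order_trans[OF m(2) mult_left_mono] by simp
qed

text \<open>The symmetric difference lives on the piece of the chord of half-length w centred at
  \<open>\<eta>\<close>; for negative h only the orientation changes. Its inclusion in
  \<open>\<Omega>\<close> is the condition under the indicator in \<open>cv_holds\<close>.\<close>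

lemma half_chord:
  fixes \<Omega> :: "'a::euclidean_space set"
  assumes \<Omega>: "compact \<Omega>" and e: "norm e = 1" and \<eta>: "\<eta> \<in> \<Omega>" and H: "H = (h * phi \<Omega> e \<eta>) *\<^sub>R e"
    and w: "w = real r / 2 * \<bar>h\<bar> * phi \<Omega> e \<eta>"
    and seg: "closed_segment (\<eta> - (real r / 2) *\<^sub>R H) (\<eta> - (real r / 2) *\<^sub>R H + real r *\<^sub>R H) \<subseteq> \<Omega>"
  shows "w \<le> reach \<Omega> (- e) \<eta>" "w \<le> reach \<Omega> e \<eta>"
    "a \<in> closed_segment (\<eta> - (real r / 2) *\<^sub>R H) (\<eta> - (real r / 2) *\<^sub>R H + real r *\<^sub>R H) \<Longrightarrow>
       \<exists>\<alpha>. \<bar>\<alpha>\<bar> \<le> w \<and> a = \<eta> + \<alpha> *\<^sub>R e"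
proof -
  have e': "norm (- e) = 1" using e by simp
  have "phi \<Omega> e \<eta> \<ge> 0"
    unfolding phi_eq_reach[OF \<Omega> e \<eta>] using reach_nonneg[OF \<Omega> e \<eta>] reach_nonneg[OF \<Omega> e' \<eta>] by simp
  then have w0: "w \<ge> 0" by (simp add: w)
  have "real r *\<^sub>R H = (real r / 2) *\<^sub>R H + (real r / 2) *\<^sub>R H" by (simp flip: scaleR_left_distrib)
  then have end2: "\<eta> - (real r / 2) *\<^sub>R H + real r *\<^sub>R H = \<eta> + (real r / 2) *\<^sub>R H" by simp
  have eq: "closed_segment (\<eta> - (real r / 2) *\<^sub>R H) (\<eta> - (real r / 2) *\<^sub>R H + real r *\<^sub>R H) = closed_segment (\<eta> - w *\<^sub>R e) (\<eta> + w *\<^sub>R e)"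
  proof (cases "h \<ge> 0")
    case True
    then have "(real r / 2) *\<^sub>R H = w *\<^sub>R e" by (simp add: H w)
    then show ?thesis unfolding end2 by simp
  next
    case False
    then have "(real r / 2) *\<^sub>R H = - (w *\<^sub>R e)" by (simp add: H w)
    then show ?thesis unfolding end2 by (simp add: closed_segment_commute)
  qed
  show "w \<le> reach \<Omega> (- e) \<eta>" "w \<le> reach \<Omega> e \<eta>"
    using seg unfolding eq segment_reach_iff[OF \<Omega> e \<eta> w0 w0] by blast+
  assume "a \<in> closed_segment (\<eta> - (real r / 2) *\<^sub>R H) (\<eta> - (real r / 2) *\<^sub>R H + real r *\<^sub>R H)"
  then obtain v where v: "0 \<le> v" "v \<le> 1" "a = (1 - v) *\<^sub>R (\<eta> - w *\<^sub>R e) + v *\<^sub>R (\<eta> + w *\<^sub>R e)"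
    unfolding eq in_segment by blast
  have a: "a = \<eta> + ((2 * v - 1) * w) *\<^sub>R e"
  proof -
    have "(v * w) *\<^sub>R e + (v * w) *\<^sub>R e = (v * (w * 2)) *\<^sub>R e"
      by (simp add: mult_2_right distrib_left flip: scaleR_left_distrib)
    then show ?thesis unfolding v(3) by (simp add: algebra_simps)
  qed
  have "\<bar>2 * v - 1\<bar> * w \<le> 1 * w" using v w0 by (intro mult_right_mono) auto
  then have "\<bar>(2 * v - 1) * w\<bar> \<le> w" using w0 by (simp add: abs_mult)
  then show "\<exists>\<alpha>. \<bar>\<alpha>\<bar> \<le> w \<and> a = \<eta> + \<alpha> *\<^sub>R e" using a by blast
qed

lemma phi_integrand_measurable:
  fixes \<Omega> :: "'a::euclidean_space set"
  assumes \<Omega>: "compact \<Omega>" and e: "norm e = 1" and G[measurable]: "G \<in> borel_measurable borel"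
  shows "(\<lambda>\<eta>. indicator {\<eta> \<in> \<Omega>. c * phi \<Omega> e \<eta> \<le> min (reach \<Omega> (- e) \<eta>) (reach \<Omega> e \<eta>)} \<eta> *
      G (\<eta> + (\<kappa> * phi \<Omega> e \<eta>) *\<^sub>R e) :: ennreal) \<in> borel_measurable borel"
proof -
  have e': "norm (- e) = 1" using e by simp
  note [measurable] = reach0_measurable[OF \<Omega> e] reach0_measurable[OF \<Omega> e'] borel_compact[OF \<Omega>]
  define P where "P \<eta> = sqrt (reach0 \<Omega> (- e) \<eta> * reach0 \<Omega> e \<eta>)" for \<eta>
  have [measurable]: "P \<in> borel_measurable borel" unfolding P_def by measurable
  have "(\<lambda>\<eta>. indicator {\<eta> \<in> \<Omega>. c * phi \<Omega> e \<eta> \<le> min (reach \<Omega> (- e) \<eta>) (reach \<Omega> e \<eta>)} \<eta> *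
      G (\<eta> + (\<kappa> * phi \<Omega> e \<eta>) *\<^sub>R e)) =
    (\<lambda>\<eta>. indicator {\<eta> \<in> \<Omega>. c * P \<eta> \<le> min (reach0 \<Omega> (- e) \<eta>) (reach0 \<Omega> e \<eta>)} \<eta> * G (\<eta> + (\<kappa> * P \<eta>) *\<^sub>R e))"
  proof
    fix \<eta>
    show "indicator {\<eta> \<in> \<Omega>. c * phi \<Omega> e \<eta> \<le> min (reach \<Omega> (- e) \<eta>) (reach \<Omega> e \<eta>)} \<eta> *
      G (\<eta> + (\<kappa> * phi \<Omega> e \<eta>) *\<^sub>R e) =
      indicator {\<eta> \<in> \<Omega>. c * P \<eta> \<le> min (reach0 \<Omega> (- e) \<eta>) (reach0 \<Omega> e \<eta>)} \<eta> * G (\<eta> + (\<kappa> * P \<eta>) *\<^sub>R e)"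
      by (cases "\<eta> \<in> \<Omega>") (simp_all add: P_def reach0_def phi_eq_reach[OF \<Omega> e] indicator_def)
  qed
  also have "\<dots> \<in> borel_measurable borel" by measurable
  finally show ?thesis .
qed

lemma sum_const_bound:
  assumes "\<And>m. m \<in> {..M} \<Longrightarrow> (J m :: ennreal) \<le> ennreal k * I" "k \<ge> 0"
  shows "(\<Sum>m\<in>{..M}. J m) \<le> ennreal (real (Suc M) * k) * I"
proof -
  have "(\<Sum>m\<in>{..M}. J m) \<le> (\<Sum>m\<in>{..M}. ennreal k * I)" by (rule sum_mono) (rule assms(1))
  also have "\<dots> = of_nat (Suc M) * (ennreal k * I)" by simp
  also have "\<dots> = ennreal (real (Suc M)) * ennreal k * I" by (simp only: ennreal_of_nat_eq_real_of_nat mult.assoc)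
  also have "ennreal (real (Suc M)) * ennreal k = ennreal (real (Suc M) * k)" using assms(2) by (simp only: ennreal_mult of_nat_0_le_iff)
  finally show ?thesis .
qed

text \<open>Besides C: the number of possible indices m and the factor 2 lost in the change of
  variables, both under the power 1/p.\<close>

definition phi_const :: "nat \<Rightarrow> real \<Rightarrow> nat \<Rightarrow> ennreal \<Rightarrow> real" where
  "phi_const r C N p = (if p = \<infinity> then C
     else (real (Suc (r * N)) * (C powr enn2real p * 2)) powr (1 / enn2real p))"

text \<open>The index m of the pointwise bound depends on \<open>\<eta>\<close> in an uncontrolled
  way, so the integrand is dominated by the sum over all m. In each summand the argument of W is
  \<eta> + \<kappa> \<phi> e with a constant \<kappa>, and the change of variables applies.\<close>

lemma omega_phi_dir_le:
  fixes \<Omega> :: "'n::finite pt set"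
  assumes \<Omega>: "compact \<Omega>" and q: "0 < q" "q \<le> p" and r: "r \<ge> 1" and C: "C > 0" and N: "N \<ge> 1" and e: "e \<in> Basis"
    and f: "in_Lp p \<Omega> f"
    and ctrl: "\<And>\<eta> h x H. \<eta> \<in> \<Omega> \<Longrightarrow> \<bar>h\<bar> \<le> t \<Longrightarrow> H = (h * phi \<Omega> e \<eta>) *\<^sub>R e \<Longrightarrow> x = \<eta> - (real r / 2) *\<^sub>R H \<Longrightarrow>
      closed_segment x (x + real r *\<^sub>R H) \<subseteq> \<Omega> \<Longrightarrow> controlled r \<Omega> q C \<delta> N x H"
  shows "omega_phi_dir r \<Omega> p f t e \<le> ennreal (phi_const r C N p) * tau_mod r \<Omega> p q f \<delta>"
  unfolding omega_phi_dir_def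
proof (rule SUP_least)
  fix h :: real assume "h \<in> {h. \<bar>h\<bar> \<le> min t 1}"
  then have h: "\<bar>h\<bar> \<le> t" by simp
  have ne: "norm e = 1" using e by (rule norm_Basis)
  define H where "H \<eta> = (h * phi \<Omega> e \<eta>) *\<^sub>R e" for \<eta>
  define x where "x \<eta> = \<eta> - (real r / 2) *\<^sub>R H \<eta>" for \<eta>
  define d where "d \<eta> = sym_diff r (H \<eta>) f \<Omega> \<eta>" for \<eta>
  have d: "d \<eta> = (if closed_segment (x \<eta>) (x \<eta> + real r *\<^sub>R H \<eta>) \<subseteq> \<Omega> then fin_diff r (H \<eta>) f (x \<eta>) else 0)" for \<eta>
    by (simp add: d_def sym_diff_def dom_diff_def x_def)
  have ctl: "controlled r \<Omega> q C \<delta> N (x \<eta>) (H \<eta>)" if "\<eta> \<in> \<Omega>" "closed_segment (x \<eta>) (x \<eta> + real r *\<^sub>R H \<eta>) \<subseteq> \<Omega>" for \<eta>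
    by (rule ctrl[OF that(1) h H_def x_def that(2)])
  have "Lp_norm p \<Omega> (\<lambda>\<eta>. ennreal \<bar>d \<eta>\<bar>) \<le> ennreal (phi_const r C N p) * tau_mod r \<Omega> p q f \<delta>"
  proof (cases "p = \<infinity>")
    case True
    have "continuous_on \<Omega> f" using f True by (simp add: in_Lp_def)
    then have "ennreal \<bar>d \<eta>\<bar> \<le> ennreal C * tau_mod r \<Omega> \<infinity> q f \<delta>" if "\<eta> \<in> \<Omega>" for \<eta>
      unfolding d using sup_bound[OF \<Omega> r N _ ctl[OF that]] by simp
    then show ?thesis using True by (auto simp: Lp_norm_def phi_const_def intro: SUP_least)
  next
    case False
    define P where "P = enn2real p"
    have pf: "p \<noteq> \<infinity>" "p > 0" using False q by auto
    then have P: "P > 0" unfolding P_def by (simp add: enn2real_positive_iff less_top)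
    have q': "q \<noteq> \<infinity>" using q(2) False by (auto simp: top_unique)
    have "f \<in> borel_measurable (lebesgue_on \<Omega>)" using f False by (simp add: in_Lp_def)
    from Borel_majorant[OF \<Omega> q' r C N this, of \<delta> P]
    obtain W where W: "W \<in> borel_measurable borel"
      "(\<integral>\<^sup>+x\<in>\<Omega>. epowr (w_mod r \<Omega> q f x \<delta>) P \<partial>lebesgue) = (\<integral>\<^sup>+x. indicator \<Omega> x * epowr (W x) P \<partial>lborel)"
      "\<And>x H. closed_segment x (x + real r *\<^sub>R H) \<subseteq> \<Omega> \<Longrightarrow> controlled r \<Omega> q C \<delta> N x H \<Longrightarrow>
         \<exists>m\<le>r * N. ennreal \<bar>fin_diff r H f x\<bar> \<le> ennreal C * W (x + (real m / real N) *\<^sub>R H)" by blast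
    define c where "c = real r / 2 * \<bar>h\<bar>"
    \<comment> \<open>The point x + (m / N) H seen from the centre \<open>\<eta>\<close>; as m / N
      runs through [0, r], the bound |\<kappa> m| \<le> c holds.\<close>
    define \<kappa> where "\<kappa> m = (real m / real N - real r / 2) * h" for m :: nat
    define g where "g m \<eta> = indicator {\<eta> \<in> \<Omega>. c * phi \<Omega> e \<eta> \<le> min (reach \<Omega> (- e) \<eta>) (reach \<Omega> e \<eta>)} \<eta> *
      epowr (W (\<eta> + (\<kappa> m * phi \<Omega> e \<eta>) *\<^sub>R e)) P" for m \<eta>
    have gm[measurable]: "g m \<in> borel_measurable borel" for m
      unfolding g_def by (rule phi_integrand_measurable[OF \<Omega> ne, of "\<lambda>y. epowr (W y) P"]) (rule epowr_measurable[OF W(1)])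
    have gi: "(\<integral>\<^sup>+\<eta>. g m \<eta> \<partial>lborel) \<le> 2 * (\<integral>\<^sup>+x. indicator \<Omega> x * epowr (W x) P \<partial>lborel)" if m: "m \<le> r * N" for m
    proof -
      have "real m \<le> real r * real N" using m by (simp flip: of_nat_mult)
      then have mr: "real m / real N \<le> real r" using N by (simp add: divide_le_eq)
      have "0 \<le> real m / real N" by simp
      then have "\<bar>real m / real N - real r / 2\<bar> \<le> real r / 2" using mr by linarith
      then have "\<bar>\<kappa> m\<bar> \<le> c" unfolding \<kappa>_def c_def abs_mult by (rule mult_right_mono) simp
      then show ?thesis unfolding g_def using cv_Basis[OF e] \<Omega> epowr_measurable[OF W(1), of P] unfolding cv_holds_def by blast
    qed
    have pointwise: "epowr (ennreal \<bar>d \<eta>\<bar>) P * indicator \<Omega> \<eta> \<le> (\<Sum>m\<in>{..r * N}. ennreal (C powr P) * g m \<eta>)" for \<eta>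
    proof (cases "\<eta> \<in> \<Omega> \<and> closed_segment (x \<eta>) (x \<eta> + real r *\<^sub>R H \<eta>) \<subseteq> \<Omega>")
      case True
      obtain m where m: "m \<le> r * N" "ennreal \<bar>fin_diff r (H \<eta>) f (x \<eta>)\<bar> \<le> ennreal C * W (x \<eta> + (real m / real N) *\<^sub>R H \<eta>)"
        using W(3)[OF _ ctl] True by blast
      have pt: "x \<eta> + (real m / real N) *\<^sub>R H \<eta> = \<eta> + (\<kappa> m * phi \<Omega> e \<eta>) *\<^sub>R e"
        by (simp add: x_def H_def \<kappa>_def algebra_simps)
      have in1: "\<eta> \<in> {\<eta> \<in> \<Omega>. c * phi \<Omega> e \<eta> \<le> min (reach \<Omega> (- e) \<eta>) (reach \<Omega> e \<eta>)}"
        using half_chord(1,2)[OF \<Omega> ne _ H_def refl, of \<eta> r] True unfolding x_def c_def by auto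
      have "epowr (ennreal \<bar>d \<eta>\<bar>) P \<le> epowr (ennreal C * W (\<eta> + (\<kappa> m * phi \<Omega> e \<eta>) *\<^sub>R e)) P"
        using m(2) True P unfolding pt d by (intro epowr_mono) simp_all
      also have "\<dots> = ennreal (C powr P) * g m \<eta>" using in1 by (simp add: epowr_mult[OF C] g_def)
      also have "\<dots> \<le> (\<Sum>m\<in>{..r * N}. ennreal (C powr P) * g m \<eta>)" by (rule member_le_sum) (use m in auto)
      finally show ?thesis using True by simp
    next
      case False
      then show ?thesis using P by (auto simp: d epowr_def indicator_def)
    qed
    \<comment> \<open>The integral over the completion agrees with the one over
      \<open>lborel\<close> for arbitrary integrands, and monotonicity takes the place of
      measurability on the left.\<close>
    have "(\<integral>\<^sup>+\<eta>\<in>\<Omega>. epowr (ennreal \<bar>d \<eta>\<bar>) P \<partial>lebesgue) \<le> (\<integral>\<^sup>+\<eta>. (\<Sum>m\<in>{..r * N}. ennreal (C powr P) * g m \<eta>) \<partial>lborel)"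
      unfolding nn_integral_completion by (rule nn_integral_mono) (rule pointwise)
    also have "\<dots> = (\<Sum>m\<in>{..r * N}. ennreal (C powr P) * (\<integral>\<^sup>+\<eta>. g m \<eta> \<partial>lborel))"
      by (simp add: nn_integral_sum nn_integral_cmult)
    also have "\<dots> \<le> ennreal (real (Suc (r * N)) * (C powr P * 2)) * (\<integral>\<^sup>+x. indicator \<Omega> x * epowr (W x) P \<partial>lborel)"
    proof (rule sum_const_bound)
      fix m assume "m \<in> {..r * N}"
      then have "ennreal (C powr P) * (\<integral>\<^sup>+\<eta>. g m \<eta> \<partial>lborel) \<le> ennreal (C powr P) * (2 * (\<integral>\<^sup>+x. indicator \<Omega> x * epowr (W x) P \<partial>lborel))"
        by (intro mult_left_mono gi) simp_all
      also have "\<dots> = ennreal (C powr P * 2) * (\<integral>\<^sup>+x. indicator \<Omega> x * epowr (W x) P \<partial>lborel)"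
        by (simp add: ennreal_mult mult.assoc)
      finally show "ennreal (C powr P) * (\<integral>\<^sup>+\<eta>. g m \<eta> \<partial>lborel) \<le> ennreal (C powr P * 2) * (\<integral>\<^sup>+x. indicator \<Omega> x * epowr (W x) P \<partial>lborel)" .
    qed simp
    finally have le: "(\<integral>\<^sup>+\<eta>\<in>\<Omega>. epowr (ennreal \<bar>d \<eta>\<bar>) P \<partial>lebesgue) \<le>
        ennreal (real (Suc (r * N)) * (C powr P * 2)) * (\<integral>\<^sup>+x\<in>\<Omega>. epowr (w_mod r \<Omega> q f x \<delta>) P \<partial>lebesgue)" unfolding W(2) .
    have "0 < real (Suc (r * N))" by (simp only: of_nat_0_less_iff zero_less_Suc)
    moreover have "0 < C powr P * 2" using C by simp
    ultimately have pos: "real (Suc (r * N)) * (C powr P * 2) > 0" by (rule mult_pos_pos)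
    have "Lp_norm p \<Omega> (\<lambda>\<eta>. ennreal \<bar>d \<eta>\<bar>) \<le> ennreal ((real (Suc (r * N)) * (C powr P * 2)) powr (1 / P)) *
        Lp_norm p \<Omega> (\<lambda>\<xi>. w_mod r \<Omega> q f \<xi> \<delta>)"
      using pos le unfolding P_def by (rule Lp_norm_le[OF pf])
    then show ?thesis using False by (simp only: phi_const_def tau_mod_def P_def if_False)
  qed
  then show "Lp_norm p \<Omega> (\<lambda>\<eta>. ennreal \<bar>sym_diff r ((h * phi \<Omega> e \<eta>) *\<^sub>R e) f \<Omega> \<eta>\<bar>) \<le> ennreal (phi_const r C N p) * tau_mod r \<Omega> p q f \<delta>"
    unfolding d_def H_def .
qed

text \<open>For fixed u the map \<eta> + w u is a translation whose horizontal part a is the same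
  for all u. After the substitution the ball is centred at \<open>fst \<zeta> - a\<close> and S no
  longer contains u, so the integral over u is the volume of a ball: the vertical shear disappears
  although w varies.\<close>

lemma shear_average:
  fixes S :: "'n::finite pt \<Rightarrow> ennreal" and w :: "real ^ 'n \<Rightarrow> 'n pt"
  assumes S[measurable]: "S \<in> borel_measurable borel" and w: "continuous_on UNIV w" and a: "\<And>u. fst (w u) = a" and \<delta>: "\<delta> \<ge> 0"
  shows "(\<lambda>\<eta>. \<integral>\<^sup>+u. indicator (cball (fst \<eta>) \<delta>) u * S (\<eta> + w u) \<partial>lborel) \<in> borel_measurable borel"
    and "(\<integral>\<^sup>+\<eta>. \<integral>\<^sup>+u. indicator (cball (fst \<eta>) \<delta>) u * S (\<eta> + w u) \<partial>lborel \<partial>lborel)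
      = ennreal (unit_ball_vol (real CARD('n)) * \<delta> ^ CARD('n)) * (\<integral>\<^sup>+\<zeta>. S \<zeta> \<partial>lborel)"
proof -
  have joint: "(\<lambda>p. indicator {p. dist (fst (fst p) - c) (snd p) \<le> \<delta>} p * S (fst p + v (snd p)))
      \<in> borel_measurable (lborel \<Otimes>\<^sub>M lborel)" if v: "continuous_on UNIV v" for c :: "real ^ 'n" and v :: "real ^ 'n \<Rightarrow> 'n pt"
  proof -
    have "closed {p :: ('n pt) \<times> (real ^ 'n). dist (fst (fst p) - c) (snd p) \<le> \<delta>}"
      by (intro closed_Collect_le continuous_intros)
    then have [measurable]: "{p :: ('n pt) \<times> (real ^ 'n). dist (fst (fst p) - c) (snd p) \<le> \<delta>} \<in> sets borel" by simp
    have "continuous_on UNIV (\<lambda>p :: ('n pt) \<times> (real ^ 'n). fst p + v (snd p))"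
      by (intro continuous_intros continuous_on_compose2[OF v]) auto
    then have [measurable]: "(\<lambda>p :: ('n pt) \<times> (real ^ 'n). fst p + v (snd p)) \<in> borel_measurable borel"
      by (rule borel_measurable_continuous_onI)
    have "(\<lambda>p. indicator {p. dist (fst (fst p) - c) (snd p) \<le> \<delta>} p * S (fst p + v (snd p))) \<in> borel_measurable borel"
      by measurable
    then show ?thesis by (simp add: lborel_prod)
  qed
  have F1: "(\<lambda>(\<eta>, u). indicator (cball (fst \<eta>) \<delta>) u * S (\<eta> + w u)) \<in> borel_measurable (lborel \<Otimes>\<^sub>M lborel)"
    using joint[OF w, of 0] by (simp add: case_prod_unfold indicator_def)
  have F2: "(\<lambda>(\<zeta>, u). indicator (cball (fst \<zeta> - a) \<delta>) u * S \<zeta>) \<in> borel_measurable (lborel \<Otimes>\<^sub>M lborel)"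
    using joint[of "\<lambda>_. 0" a] by (simp add: case_prod_unfold indicator_def)
  show "(\<lambda>\<eta>. \<integral>\<^sup>+u. indicator (cball (fst \<eta>) \<delta>) u * S (\<eta> + w u) \<partial>lborel) \<in> borel_measurable borel"
    using lborel.borel_measurable_nn_integral[OF F1] by simp
  have "(\<integral>\<^sup>+\<eta>. \<integral>\<^sup>+u. indicator (cball (fst \<eta>) \<delta>) u * S (\<eta> + w u) \<partial>lborel \<partial>lborel)
      = (\<integral>\<^sup>+u. \<integral>\<^sup>+\<eta>. indicator (cball (fst \<eta>) \<delta>) u * S (\<eta> + w u) \<partial>lborel \<partial>lborel)"
    by (rule lborel_pair.Fubini'[OF F1, symmetric])
  also have "\<dots> = (\<integral>\<^sup>+u. \<integral>\<^sup>+\<zeta>. indicator (cball (fst \<zeta> - a) \<delta>) u * S \<zeta> \<partial>lborel \<partial>lborel)"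
  proof (rule nn_integral_cong)
    fix u :: "real ^ 'n"
    have "closed {\<zeta> :: 'n pt. dist (fst \<zeta> - a) u \<le> \<delta>}" by (intro closed_Collect_le continuous_intros)
    then have [measurable]: "{\<zeta> :: 'n pt. dist (fst \<zeta> - a) u \<le> \<delta>} \<in> sets borel" by simp
    have "(\<lambda>\<zeta>. indicator {\<zeta>. dist (fst \<zeta> - a) u \<le> \<delta>} \<zeta> * S \<zeta>) \<in> borel_measurable borel" by measurable
    then have "(\<integral>\<^sup>+\<eta>. indicator {\<zeta>. dist (fst \<zeta> - a) u \<le> \<delta>} (w u + \<eta>) * S (w u + \<eta>) \<partial>lborel)
       = (\<integral>\<^sup>+\<zeta>. indicator {\<zeta>. dist (fst \<zeta> - a) u \<le> \<delta>} \<zeta> * S \<zeta> \<partial>lborel)"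
      using measure_preserving_translation[of "w u"] unfolding measure_preserving_map_def by blast
    then show "(\<integral>\<^sup>+\<eta>. indicator (cball (fst \<eta>) \<delta>) u * S (\<eta> + w u) \<partial>lborel) = (\<integral>\<^sup>+\<zeta>. indicator (cball (fst \<zeta> - a) \<delta>) u * S \<zeta> \<partial>lborel)"
      by (simp add: indicator_def a add.commute)
  qed
  also have "\<dots> = (\<integral>\<^sup>+\<zeta>. \<integral>\<^sup>+u. indicator (cball (fst \<zeta> - a) \<delta>) u * S \<zeta> \<partial>lborel \<partial>lborel)"
    by (rule lborel_pair.Fubini'[OF F2])
  also have "\<dots> = (\<integral>\<^sup>+\<zeta>. ennreal (unit_ball_vol (real CARD('n)) * \<delta> ^ CARD('n)) * S \<zeta> \<partial>lborel)"
  proof (rule nn_integral_cong)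
    fix \<zeta> :: "'n pt"
    have 1: "(\<integral>\<^sup>+u. indicator (cball (fst \<zeta> - a) \<delta>) u * S \<zeta> \<partial>lborel) = (\<integral>\<^sup>+u. indicator (cball (fst \<zeta> - a) \<delta>) u \<partial>lborel) * S \<zeta>"
      by (rule nn_integral_multc[OF borel_measurable_indicator]) simp
    have 2: "(\<integral>\<^sup>+u. indicator (cball (fst \<zeta> - a) \<delta>) u \<partial>lborel) = emeasure lborel (cball (fst \<zeta> - a) \<delta>)"
      by (rule nn_integral_indicator) simp
    have 3: "emeasure lborel (cball (fst \<zeta> - a) \<delta>) = ennreal (unit_ball_vol (real CARD('n)) * \<delta> ^ CARD('n))"
      using emeasure_cball[OF \<delta>, of "fst \<zeta> - a"] by simp
    show "(\<integral>\<^sup>+u. indicator (cball (fst \<zeta> - a) \<delta>) u * S \<zeta> \<partial>lborel) = ennreal (unit_ball_vol (real CARD('n)) * \<delta> ^ CARD('n)) * S \<zeta>"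
      unfolding 1 2 3 ..
  qed
  also have "\<dots> = ennreal (unit_ball_vol (real CARD('n)) * \<delta> ^ CARD('n)) * (\<integral>\<^sup>+\<zeta>. S \<zeta> \<partial>lborel)"
    by (rule nn_integral_cmult) simp
  finally show "(\<integral>\<^sup>+\<eta>. \<integral>\<^sup>+u. indicator (cball (fst \<eta>) \<delta>) u * S (\<eta> + w u) \<partial>lborel \<partial>lborel)
      = ennreal (unit_ball_vol (real CARD('n)) * \<delta> ^ CARD('n)) * (\<integral>\<^sup>+\<zeta>. S \<zeta> \<partial>lborel)" .
qed

lemma dom_diff_sd_map:
  "dom_diff r v (f \<circ> sd_map D) (sd_map D -` \<Omega>) \<eta> = dom_diff r (sd_lin D v) f \<Omega> (sd_map D \<eta>)"
proof -
  have pt: "sd_map D (\<eta> + c *\<^sub>R v) = sd_map D \<eta> + c *\<^sub>R sd_lin D v" for c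
    by (simp add: sd_map_add linear_scale[OF sd_lin_linear])
  have "closed_segment \<eta> (\<eta> + real r *\<^sub>R v) \<subseteq> sd_map D -` \<Omega> \<longleftrightarrow> closed_segment (sd_map D \<eta>) (sd_map D \<eta> + real r *\<^sub>R sd_lin D v) \<subseteq> \<Omega>"
    unfolding pt[symmetric] sd_map_segment[symmetric] by blast
  moreover have "fin_diff r v (f \<circ> sd_map D) \<eta> = fin_diff r (sd_lin D v) f (sd_map D \<eta>)"
    by (simp add: fin_diff_def pt)
  ultimately show ?thesis by (simp add: dom_diff_def)
qed

text \<open>The unit ball volume is what remains when the integral over a ball of radius t b is
  normalised by the n-th power of t b.\<close>

definition special_const :: "nat \<Rightarrow> real \<Rightarrow> nat \<Rightarrow> ennreal \<Rightarrow> nat \<Rightarrow> real" where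
  "special_const r C N p n = (if p = \<infinity> then C
     else (real (Suc (r * N)) * (C powr enn2real p * unit_ball_vol (real n))) powr (1 / enn2real p))"

text \<open>For each u the tangential step is a constant vector, so after enlarging
  \<open>near_cube\<close> to a ball \<open>shear_average\<close> plays the role of the change of
  variables on chords. The isometry \<open>sd_map\<close> carries the integral over to
  \<open>\<Omega>\<close>.\<close>

lemma omega_special_le:
  fixes \<Omega> :: "'n::finite pt set"
  assumes \<Omega>: "compact \<Omega>" and q: "0 < q" "q \<le> p" and r: "r \<ge> 1" and C: "C > 0" and N: "N \<ge> 1"
    and valid: "special_dom_valid D" and t: "t > 0" and f: "in_Lp p \<Omega> f"
    and ctrl: "\<And>s j \<eta> u. 0 < s \<Longrightarrow> s \<le> t \<Longrightarrow> \<eta> \<in> up_dom (sd_b D) (sd_L D) (sd_g D) 1 \<Longrightarrow>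
      u \<in> near_cube (sd_b D) (t * sd_b D) (fst \<eta>) \<Longrightarrow>
      closed_segment (sd_map D \<eta>) (sd_map D \<eta> + real r *\<^sub>R sd_lin D (s *\<^sub>R tang (sd_g D) j u)) \<subseteq> \<Omega> \<Longrightarrow>
      controlled r \<Omega> q C \<delta> N (sd_map D \<eta>) (sd_lin D (s *\<^sub>R tang (sd_g D) j u))"
  shows "omega_special r A0 \<Omega> D p f t \<le> ennreal (special_const r C N p CARD('n)) * tau_mod r \<Omega> p q f \<delta>"
proof -
  define T where "T = sd_map D"
  define g where "g = sd_g D"
  define b where "b = sd_b D"
  define L where "L = sd_L D"
  have b: "b > 0" and g: "C2_fun g" using valid by (simp_all add: special_dom_valid_def b_def g_def)
  have tb: "t * b > 0" using t b by simp
  define B where "B = up_inner A0 b L g t"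
  have BU: "\<eta> \<in> up_dom b L g 1" if "\<eta> \<in> B" for \<eta> using that by (simp add: B_def up_inner_def)
  note ctl = ctrl[folded T_def g_def b_def L_def]
  show ?thesis
    unfolding omega_special_def omega_up_def dom_diff_sd_map
    unfolding T_def[symmetric] g_def[symmetric] b_def[symmetric] L_def[symmetric] B_def[symmetric]
  proof (intro SUP_least)
    fix s :: real and j :: 'n
    assume s: "s \<in> {0<..t}"
    define v where "v u = s *\<^sub>R tang g j u" for u
    define d where "d \<eta> u = dom_diff r (sd_lin D (v u)) f \<Omega> (T \<eta>)" for \<eta> u
    have s': "0 < s" "s \<le> t" using s by auto
    note ctl' = ctl[OF s', where j = j, folded v_def]
    have "(if p = \<infinity> then SUP \<eta>\<in>B. SUP u\<in>near_cube b (t * b) (fst \<eta>). ennreal \<bar>d \<eta> u\<bar>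
        else epowr (\<integral>\<^sup>+\<eta>\<in>B. (ennreal (1 / (t * b) ^ CARD('n)) *
          (\<integral>\<^sup>+u\<in>near_cube b (t * b) (fst \<eta>). ennreal (\<bar>d \<eta> u\<bar> powr enn2real p) \<partial>lebesgue)) \<partial>lebesgue) (1 / enn2real p))
      \<le> ennreal (special_const r C N p CARD('n)) * tau_mod r \<Omega> p q f \<delta>"
    proof (cases "p = \<infinity>")
      case True
      have fc: "continuous_on \<Omega> f" using f True by (simp add: in_Lp_def)
      have "ennreal \<bar>d \<eta> u\<bar> \<le> ennreal C * tau_mod r \<Omega> \<infinity> q f \<delta>" if "\<eta> \<in> B" "u \<in> near_cube b (t * b) (fst \<eta>)" for \<eta> u
        unfolding d_def dom_diff_def using sup_bound[OF \<Omega> r N fc ctl'[OF BU[OF that(1)] that(2)]] by simp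
      then have "(SUP \<eta>\<in>B. SUP u\<in>near_cube b (t * b) (fst \<eta>). ennreal \<bar>d \<eta> u\<bar>) \<le> ennreal C * tau_mod r \<Omega> \<infinity> q f \<delta>"
        by (intro SUP_least)
      then show ?thesis using True by (simp add: special_const_def)
    next
      case False
      define P where "P = enn2real p"
      have pf: "p \<noteq> \<infinity>" "p > 0" using False q by auto
      then have P: "P > 0" unfolding P_def by (simp add: enn2real_positive_iff less_top)
      have q': "q \<noteq> \<infinity>" using q(2) False by (auto simp: top_unique)
      have "f \<in> borel_measurable (lebesgue_on \<Omega>)" using f False by (simp add: in_Lp_def)
      from Borel_majorant[OF \<Omega> q' r C N this, of \<delta> P]
      obtain W where W: "W \<in> borel_measurable borel"
        "(\<integral>\<^sup>+x\<in>\<Omega>. epowr (w_mod r \<Omega> q f x \<delta>) P \<partial>lebesgue) = (\<integral>\<^sup>+x. indicator \<Omega> x * epowr (W x) P \<partial>lborel)"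
        "\<And>x H. closed_segment x (x + real r *\<^sub>R H) \<subseteq> \<Omega> \<Longrightarrow> controlled r \<Omega> q C \<delta> N x H \<Longrightarrow>
           \<exists>m\<le>r * N. ennreal \<bar>fin_diff r H f x\<bar> \<le> ennreal C * W (x + (real m / real N) *\<^sub>R H)" by blast
      \<comment> \<open>With the restriction to \<open>\<Omega>\<close> built in, the shears may act
        on integrals over the whole space.\<close>
      define V where "V x = indicator \<Omega> x * epowr (W x) P" for x
      have \<Omega>b[measurable]: "\<Omega> \<in> sets borel" using borel_compact[OF \<Omega>] .
      note [measurable] = W(1)
      have Vm[measurable]: "V \<in> borel_measurable borel" unfolding V_def by measurable
      have Tmp: "T \<in> borel_measurable borel" "(\<integral>\<^sup>+x. V (T x) \<partial>lborel) = (\<integral>\<^sup>+x. V x \<partial>lborel)"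
        using sd_map_mp[of D] Vm unfolding measure_preserving_map_def T_def by blast+
      note [measurable] = Tmp(1)
      have S: "(\<lambda>x. V (T x)) \<in> borel_measurable borel" by measurable
      define I where "I = (\<integral>\<^sup>+x. V x \<partial>lborel)"
      define \<beta> where "\<beta> = unit_ball_vol (real CARD('n))"
      have \<beta>: "\<beta> > 0" by (simp add: \<beta>_def)
      define w where "w m u = (real m / real N) *\<^sub>R v u" for m :: nat and u
      have "partial_deriv j g differentiable_on UNIV" using g by (simp add: C2_fun_def)
      then have "continuous_on UNIV (partial_deriv j g)" by (rule differentiable_imp_continuous_on)
      then have wc: "continuous_on UNIV (w m)" for m
        unfolding w_def v_def tang_def by (intro continuous_intros)
      define k where "k m \<eta> u = indicator (cball (fst \<eta>) (t * b)) u * V (T (\<eta> + w m u))" for m \<eta> u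
      have wa: "fst (w m u) = fst (w m 0)" for m u by (simp add: w_def v_def tang_def)
      note shear = shear_average[OF S wc wa less_imp_le[OF tb]]
      have km[measurable]: "(\<lambda>\<eta>. \<integral>\<^sup>+u. k m \<eta> u \<partial>lborel) \<in> borel_measurable borel" for m
        using shear(1)[of m] unfolding k_def .
      have ki: "(\<integral>\<^sup>+\<eta>. \<integral>\<^sup>+u. k m \<eta> u \<partial>lborel \<partial>lborel) = ennreal (\<beta> * (t * b) ^ CARD('n)) * I" for m
        using shear(2)[of m] Tmp(2) unfolding k_def \<beta>_def I_def by simp
      have ku[measurable]: "k m \<eta> \<in> borel_measurable borel" for m \<eta>
      proof -
        have "continuous_on UNIV (\<lambda>u. \<eta> + w m u)" by (intro continuous_intros wc)
        then have [measurable]: "(\<lambda>u. \<eta> + w m u) \<in> borel_measurable borel" by (rule borel_measurable_continuous_onI)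
        have [measurable]: "cball (fst \<eta>) (t * b) \<in> sets borel" by simp
        show ?thesis unfolding k_def by measurable
      qed
      have pointwise: "ennreal (\<bar>d \<eta> u\<bar> powr P) \<le> (\<Sum>m\<in>{..r * N}. ennreal (C powr P) * k m \<eta> u)"
        if \<eta>: "\<eta> \<in> B" and u: "u \<in> near_cube b (t * b) (fst \<eta>)" for \<eta> u
      proof (cases "closed_segment (T \<eta>) (T \<eta> + real r *\<^sub>R sd_lin D (v u)) \<subseteq> \<Omega>")
        case True
        obtain m where m: "m \<le> r * N" "ennreal \<bar>fin_diff r (sd_lin D (v u)) f (T \<eta>)\<bar> \<le> ennreal C * W (T \<eta> + (real m / real N) *\<^sub>R sd_lin D (v u))"
          using W(3)[OF True ctl'[OF BU[OF \<eta>] u True]] by blast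
        have pt: "T \<eta> + (real m / real N) *\<^sub>R sd_lin D (v u) = T (\<eta> + w m u)"
          by (simp add: T_def sd_map_add w_def linear_scale[OF sd_lin_linear])
        have "real m \<le> real r * real N" using m(1) by (simp flip: of_nat_mult)
        then have "real m / real N \<le> real r" using N by (simp add: divide_le_eq)
        then have "T \<eta> + (real m / real N) *\<^sub>R sd_lin D (v u) \<in> closed_segment (T \<eta>) (T \<eta> + real r *\<^sub>R sd_lin D (v u))"
          by (subst segment_from_base) auto
        then have in\<Omega>: "T (\<eta> + w m u) \<in> \<Omega>" using True pt by auto
        have inb: "u \<in> cball (fst \<eta>) (t * b)" using u by (simp add: near_cube_def dist_norm norm_minus_commute)
        have "ennreal (\<bar>d \<eta> u\<bar> powr P) = epowr (ennreal \<bar>d \<eta> u\<bar>) P" by (simp add: epowr_ennreal)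
        also have "\<dots> \<le> epowr (ennreal C * W (T (\<eta> + w m u))) P"
          using m(2) True P unfolding pt d_def dom_diff_def by (intro epowr_mono) simp_all
        also have "\<dots> = ennreal (C powr P) * k m \<eta> u" using inb in\<Omega> by (simp add: epowr_mult[OF C] k_def V_def)
        also have "\<dots> \<le> (\<Sum>m\<in>{..r * N}. ennreal (C powr P) * k m \<eta> u)" by (rule member_le_sum) (use m in auto)
        finally show ?thesis .
      next
        case False
        then show ?thesis using P by (simp add: d_def dom_diff_def)
      qed
      define A where "A = ennreal (1 / (t * b) ^ CARD('n))"
      have inner: "(\<integral>\<^sup>+u\<in>near_cube b (t * b) (fst \<eta>). ennreal (\<bar>d \<eta> u\<bar> powr P) \<partial>lebesgue)
          \<le> (\<Sum>m\<in>{..r * N}. ennreal (C powr P) * (\<integral>\<^sup>+u. k m \<eta> u \<partial>lborel))" if "\<eta> \<in> B" for \<eta>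
      proof -
        have "(\<integral>\<^sup>+u\<in>near_cube b (t * b) (fst \<eta>). ennreal (\<bar>d \<eta> u\<bar> powr P) \<partial>lebesgue)
           \<le> (\<integral>\<^sup>+u. (\<Sum>m\<in>{..r * N}. ennreal (C powr P) * k m \<eta> u) \<partial>lborel)"
          unfolding nn_integral_completion using pointwise[OF that] by (intro nn_integral_mono) (simp add: indicator_def)
        also have "\<dots> = (\<Sum>m\<in>{..r * N}. ennreal (C powr P) * (\<integral>\<^sup>+u. k m \<eta> u \<partial>lborel))"
          by (simp add: nn_integral_sum nn_integral_cmult)
        finally show ?thesis .
      qed
      have "(\<integral>\<^sup>+\<eta>\<in>B. (A * (\<integral>\<^sup>+u\<in>near_cube b (t * b) (fst \<eta>). ennreal (\<bar>d \<eta> u\<bar> powr P) \<partial>lebesgue)) \<partial>lebesgue)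
          \<le> (\<integral>\<^sup>+\<eta>. A * (\<Sum>m\<in>{..r * N}. ennreal (C powr P) * (\<integral>\<^sup>+u. k m \<eta> u \<partial>lborel)) \<partial>lborel)"
        unfolding nn_integral_completion
      proof (rule nn_integral_mono)
        fix \<eta>
        show "A * (\<integral>\<^sup>+u\<in>near_cube b (t * b) (fst \<eta>). ennreal (\<bar>d \<eta> u\<bar> powr P) \<partial>lborel) * indicator B \<eta>
          \<le> A * (\<Sum>m\<in>{..r * N}. ennreal (C powr P) * (\<integral>\<^sup>+u. k m \<eta> u \<partial>lborel))"
          using mult_left_mono[OF inner[unfolded nn_integral_completion], of \<eta> A] by (cases "\<eta> \<in> B") simp_all
      qed
      also have "\<dots> = A * (\<Sum>m\<in>{..r * N}. ennreal (C powr P) * (ennreal (\<beta> * (t * b) ^ CARD('n)) * I))"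
        by (simp add: nn_integral_sum nn_integral_cmult ki)
      also have "\<dots> \<le> ennreal (real (Suc (r * N)) * (C powr P * \<beta>)) * I"
      proof -
        define X where "X = (t * b) ^ CARD('n)"
        have X: "X > 0" unfolding X_def using tb by (rule zero_less_power)
        have "A * ennreal (\<beta> * X) = ennreal (1 / X * (\<beta> * X))"
          unfolding A_def X_def[symmetric] by (rule ennreal_mult[symmetric]) (use X \<beta> in simp_all)
        also have "1 / X * (\<beta> * X) = \<beta>" using X by simp
        finally have h1: "A * ennreal (\<beta> * X) = ennreal \<beta>" .
        have h2: "ennreal (C powr P) * ennreal \<beta> = ennreal (C powr P * \<beta>)" using \<beta> by (simp add: ennreal_mult)
        have "A * (ennreal (C powr P) * (ennreal (\<beta> * X) * I)) = ennreal (C powr P) * (A * ennreal (\<beta> * X)) * I"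
          by (simp only: mult_ac)
        then have h3: "A * (ennreal (C powr P) * (ennreal (\<beta> * X) * I)) \<le> ennreal (C powr P * \<beta>) * I" unfolding h1 h2 by simp
        have "0 \<le> C powr P * \<beta>" using \<beta> by simp
        from sum_const_bound[OF h3 this] show ?thesis unfolding sum_distrib_left X_def .
      qed
      finally have le: "(\<integral>\<^sup>+\<eta>\<in>B. (A * (\<integral>\<^sup>+u\<in>near_cube b (t * b) (fst \<eta>). ennreal (\<bar>d \<eta> u\<bar> powr P) \<partial>lebesgue)) \<partial>lebesgue)
         \<le> ennreal (real (Suc (r * N)) * (C powr P * \<beta>)) * (\<integral>\<^sup>+x\<in>\<Omega>. epowr (w_mod r \<Omega> q f x \<delta>) P \<partial>lebesgue)"
        unfolding W(2) I_def V_def .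
      have "0 < real (Suc (r * N))" by (simp only: of_nat_0_less_iff zero_less_Suc)
      moreover have "0 < C powr P * \<beta>" using C \<beta> by simp
      ultimately have pos: "real (Suc (r * N)) * (C powr P * \<beta>) > 0" by (rule mult_pos_pos)
      have "0 \<le> 1 / P" using P by simp
      from epowr_mono[OF this le]
      have "epowr (\<integral>\<^sup>+\<eta>\<in>B. (A * (\<integral>\<^sup>+u\<in>near_cube b (t * b) (fst \<eta>). ennreal (\<bar>d \<eta> u\<bar> powr P) \<partial>lebesgue)) \<partial>lebesgue) (1 / P)
         \<le> ennreal ((real (Suc (r * N)) * (C powr P * \<beta>)) powr (1 / P)) * epowr (\<integral>\<^sup>+x\<in>\<Omega>. epowr (w_mod r \<Omega> q f x \<delta>) P \<partial>lebesgue) (1 / P)"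
        unfolding epowr_mult[OF pos] .
      then show ?thesis using False unfolding special_const_def tau_mod_def Lp_norm_def P_def A_def \<beta>_def by (simp only: if_False)
    qed
    then show "(if p = \<infinity> then SUP \<eta>\<in>B. SUP u\<in>near_cube b (t * b) (fst \<eta>). ennreal \<bar>dom_diff r (sd_lin D (s *\<^sub>R tang g j u)) f \<Omega> (T \<eta>)\<bar>
        else epowr (\<integral>\<^sup>+\<eta>\<in>B. (ennreal (1 / (t * b) ^ CARD('n)) *
          (\<integral>\<^sup>+u\<in>near_cube b (t * b) (fst \<eta>). ennreal (\<bar>dom_diff r (sd_lin D (s *\<^sub>R tang g j u)) f \<Omega> (T \<eta>)\<bar> powr enn2real p) \<partial>lebesgue)) \<partial>lebesgue) (1 / enn2real p))
      \<le> ennreal (special_const r C N p CARD('n)) * tau_mod r \<Omega> p q f \<delta>"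
      unfolding d_def v_def .
  qed
qed

text \<open>The length and oscillation bounds for chord steps and for the finitely many special
  domains are merged into a single K1, so that \<open>split_estimate\<close> is applied once and all
  moduli are compared at the same radius c0 t.\<close>

lemma controlled_constants:
  fixes \<Omega> :: "'n::finite pt set"
  assumes tb: "two_ball \<Omega> K" and Gs: "\<And>D. D \<in> set Gs \<Longrightarrow> special_dom_valid D \<and> attached \<Omega> D"
    and r: "r \<ge> 1" and q: "0 < q"
  obtains C c0 N where "C > 0" "c0 > 0" "N \<ge> 1"
    "\<And>e \<eta> h x H t. e \<in> Basis \<Longrightarrow> 0 < t \<Longrightarrow> t \<le> 1 \<Longrightarrow> \<eta> \<in> \<Omega> \<Longrightarrow> \<bar>h\<bar> \<le> t \<Longrightarrow>
       H = (h * phi \<Omega> e \<eta>) *\<^sub>R e \<Longrightarrow> x = \<eta> - (real r / 2) *\<^sub>R H \<Longrightarrow>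
       closed_segment x (x + real r *\<^sub>R H) \<subseteq> \<Omega> \<Longrightarrow> controlled r \<Omega> q C (c0 * t) N x H"
    "\<And>D s j \<eta> u t. D \<in> set Gs \<Longrightarrow> t \<le> 1 \<Longrightarrow> 0 < s \<Longrightarrow> s \<le> t \<Longrightarrow>
       \<eta> \<in> up_dom (sd_b D) (sd_L D) (sd_g D) 1 \<Longrightarrow> u \<in> near_cube (sd_b D) (t * sd_b D) (fst \<eta>) \<Longrightarrow>
       closed_segment (sd_map D \<eta>) (sd_map D \<eta> + real r *\<^sub>R sd_lin D (s *\<^sub>R tang (sd_g D) j u)) \<subseteq> \<Omega> \<Longrightarrow>
       controlled r \<Omega> q C (c0 * t) N (sd_map D \<eta>) (sd_lin D (s *\<^sub>R tang (sd_g D) j u))"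
proof -
  interpret two_ball \<Omega> K by (rule tb)
  define osc where "osc x = sqrt (infdist x (frontier \<Omega>))" for x
  obtain B where B: "B \<ge> 1" "\<And>x y. x \<in> \<Omega> \<Longrightarrow> y \<in> \<Omega> \<Longrightarrow> norm (x - y) \<le> B" using diameter_bound by metis
  have phi_le: "0 \<le> phi \<Omega> e \<eta>" "phi \<Omega> e \<eta> \<le> B" if \<eta>: "\<eta> \<in> \<Omega>" and e: "norm e = 1" for e \<eta>
  proof -
    have rb: "0 \<le> reach \<Omega> v \<eta>" "reach \<Omega> v \<eta> \<le> B" if v: "norm v = 1" for v
    proof -
      show nn: "0 \<le> reach \<Omega> v \<eta>" by (rule reach_nonneg[OF compact v \<eta>])
      have "\<eta> + reach \<Omega> v \<eta> *\<^sub>R v \<in> \<Omega>" by (rule reach_point[OF compact v \<eta> nn order_refl])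
      from B(2)[OF this \<eta>] show "reach \<Omega> v \<eta> \<le> B" using v nn by simp
    qed
    have e': "norm (- e) = 1" using e by simp
    have "reach \<Omega> (- e) \<eta> * reach \<Omega> e \<eta> \<le> B * B" using rb[OF e] rb[OF e'] by (intro mult_mono) linarith+
    then have "sqrt (reach \<Omega> (- e) \<eta> * reach \<Omega> e \<eta>) \<le> sqrt (B * B)" by (rule real_sqrt_le_mono)
    then show "phi \<Omega> e \<eta> \<le> B" unfolding phi_eq_reach[OF compact e \<eta>] using B(1) by simp
    show "0 \<le> phi \<Omega> e \<eta>" unfolding phi_eq_reach[OF compact e \<eta>] using rb(1)[OF e] rb(1)[OF e'] by simp
  qed
  \<comment> \<open>Collects what \<open>special_oscillation\<close> provides for one domain, so
    that a constant can be chosen for each D in the list.\<close>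
  define Q where "Q D k \<longleftrightarrow>
    (\<forall>t s j \<eta> u. 0 < s \<longrightarrow> s \<le> t \<longrightarrow> t \<le> 1 \<longrightarrow> \<eta> \<in> up_dom (sd_b D) (sd_L D) (sd_g D) 1 \<longrightarrow>
      u \<in> near_cube (sd_b D) (t * sd_b D) (fst \<eta>) \<longrightarrow> norm (s *\<^sub>R tang (sd_g D) j u) \<le> k * t) \<and>
    (\<forall>t s j \<eta> u a b. 0 < s \<longrightarrow> s \<le> t \<longrightarrow> t \<le> 1 \<longrightarrow> \<eta> \<in> up_dom (sd_b D) (sd_L D) (sd_g D) 1 \<longrightarrow>
      u \<in> near_cube (sd_b D) (t * sd_b D) (fst \<eta>) \<longrightarrow>
      closed_segment (sd_map D \<eta>) (sd_map D (\<eta> + real r *\<^sub>R (s *\<^sub>R tang (sd_g D) j u))) \<subseteq> \<Omega> \<longrightarrow>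
      a \<in> closed_segment (sd_map D \<eta>) (sd_map D (\<eta> + real r *\<^sub>R (s *\<^sub>R tang (sd_g D) j u))) \<longrightarrow>
      b \<in> closed_segment (sd_map D \<eta>) (sd_map D (\<eta> + real r *\<^sub>R (s *\<^sub>R tang (sd_g D) j u))) \<longrightarrow>
      \<bar>osc a - osc b\<bar> \<le> k * t)" for D :: "'n special_dom" and k :: real
  have "\<exists>k. k > 0 \<and> Q D k" if "D \<in> set Gs" for D
  proof -
    have va: "special_dom_valid D" "attached \<Omega> D" using Gs[OF that] by blast+
    show ?thesis
      by (rule special_oscillation[OF tb va r], rule exI, rule conjI, assumption, unfold Q_def osc_def, rule conjI)
         (intro allI impI, assumption | blast)+
  qed
  then have "\<forall>D\<in>set Gs. \<exists>k. k > 0 \<and> Q D k" by blast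
  from bchoice[OF this] obtain k where k: "\<forall>D\<in>set Gs. k D > 0 \<and> Q D (k D)" by blast
  have \<rho>: "real r / 2 > 0" using r by simp
  show thesis
  proof (rule chord_oscillation[OF \<rho>])
    fix K2 :: real
    assume K2: "K2 > 0" and chord: "\<And>\<eta> e t w \<alpha> \<beta>. \<eta> \<in> \<Omega> \<Longrightarrow> norm e = 1 \<Longrightarrow> 0 < t \<Longrightarrow> t \<le> 1 \<Longrightarrow>
       w \<le> real r / 2 * t * phi \<Omega> e \<eta> \<Longrightarrow> w \<le> reach \<Omega> e \<eta> \<Longrightarrow> w \<le> reach \<Omega> (- e) \<eta> \<Longrightarrow>
       \<bar>\<alpha>\<bar> \<le> w \<Longrightarrow> \<bar>\<beta>\<bar> \<le> w \<Longrightarrow>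
       \<bar>sqrt (infdist (\<eta> + \<alpha> *\<^sub>R e) (frontier \<Omega>)) - sqrt (infdist (\<eta> + \<beta> *\<^sub>R e) (frontier \<Omega>))\<bar> \<le> K2 * t"
    \<comment> \<open>K2 for the oscillation on chords, B for the size of \<phi> and hence the
      length of the step, the sum for the special domains.\<close>
    define K1 where "K1 = K2 + B + (\<Sum>D\<in>set Gs. k D)"
    have sum0: "0 \<le> (\<Sum>D\<in>set Gs. k D)" using k by (intro sum_nonneg) (simp add: less_imp_le)
    have kK: "k D \<le> K1" if "D \<in> set Gs" for D
    proof -
      have "k D \<le> (\<Sum>D\<in>set Gs. k D)" using k by (intro member_le_sum that) (simp_all add: less_imp_le)
      then show ?thesis unfolding K1_def using K2 B(1) by linarith
    qed
    have K1: "K1 > 0" "K2 \<le> K1" "B \<le> K1" unfolding K1_def using K2 B(1) sum0 by linarith+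
    show thesis
    proof (rule split_estimate[OF r q K1(1)])
      fix C c0 :: real and N :: nat
      assume CcN: "C > 0" "c0 > 0" "N \<ge> 1"
        and est: "\<And>f x H t. f \<in> borel_measurable borel \<Longrightarrow> 0 < t \<Longrightarrow> t \<le> 1 \<Longrightarrow> norm H \<le> K1 * t \<Longrightarrow>
           closed_segment x (x + real r *\<^sub>R H) \<subseteq> \<Omega> \<Longrightarrow>
           (\<And>a b. a \<in> closed_segment x (x + real r *\<^sub>R H) \<Longrightarrow> b \<in> closed_segment x (x + real r *\<^sub>R H) \<Longrightarrow>
              \<bar>sqrt (infdist a (frontier \<Omega>)) - sqrt (infdist b (frontier \<Omega>))\<bar> \<le> K1 * t) \<Longrightarrow>
           \<exists>m\<le>r * N. ennreal \<bar>fin_diff r H f x\<bar> \<le> ennreal C * w_mod r \<Omega> q f (x + (real m / real N) *\<^sub>R H) (c0 * t)"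
      show thesis
      proof (rule that[OF CcN])
        fix e \<eta> x H :: "'n pt" and h t :: real
        assume e: "e \<in> Basis" and t: "0 < t" "t \<le> 1" and \<eta>: "\<eta> \<in> \<Omega>" and h: "\<bar>h\<bar> \<le> t"
          and H: "H = (h * phi \<Omega> e \<eta>) *\<^sub>R e" and x: "x = \<eta> - (real r / 2) *\<^sub>R H"
          and seg: "closed_segment x (x + real r *\<^sub>R H) \<subseteq> \<Omega>"
        have ne: "norm e = 1" using e by (rule norm_Basis)
        note ph = phi_le[OF \<eta> ne]
        have nH: "norm H \<le> K1 * t"
        proof -
          have "norm H = phi \<Omega> e \<eta> * \<bar>h\<bar>" unfolding H using ne ph(1) by (simp add: abs_mult)
          also have "\<dots> \<le> K1 * t" using ph K1 h by (intro mult_mono) linarith+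
          finally show ?thesis .
        qed
        define w where "w = real r / 2 * \<bar>h\<bar> * phi \<Omega> e \<eta>"
        note half = half_chord[OF compact ne \<eta> H w_def seg[unfolded x]]
        have wle: "w \<le> real r / 2 * t * phi \<Omega> e \<eta>"
          unfolding w_def using h ph(1) by (intro mult_right_mono mult_left_mono) simp_all
        show "controlled r \<Omega> q C (c0 * t) N x H" unfolding controlled_def
        proof
          fix f :: "'n pt \<Rightarrow> real" assume f: "f \<in> borel_measurable borel"
          show "\<exists>m\<le>r * N. ennreal \<bar>fin_diff r H f x\<bar> \<le> ennreal C * w_mod r \<Omega> q f (x + (real m / real N) *\<^sub>R H) (c0 * t)"
          proof (rule est[OF f t nH seg])
            fix a b assume a: "a \<in> closed_segment x (x + real r *\<^sub>R H)" and b: "b \<in> closed_segment x (x + real r *\<^sub>R H)"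
            obtain \<alpha> where \<alpha>: "\<bar>\<alpha>\<bar> \<le> w" "a = \<eta> + \<alpha> *\<^sub>R e" using half(3)[OF a[unfolded x]] by blast
            obtain \<beta> where \<beta>: "\<bar>\<beta>\<bar> \<le> w" "b = \<eta> + \<beta> *\<^sub>R e" using half(3)[OF b[unfolded x]] by blast
            have "K2 * t \<le> K1 * t" using K1 t by (intro mult_right_mono) simp_all
            then show "\<bar>sqrt (infdist a (frontier \<Omega>)) - sqrt (infdist b (frontier \<Omega>))\<bar> \<le> K1 * t"
              using chord[OF \<eta> ne t wle half(2,1) \<alpha>(1) \<beta>(1)] unfolding \<alpha>(2) \<beta>(2) by linarith
          qed
        qed
      next
        fix D :: "'n special_dom" and s t :: real and j and \<eta> :: "'n pt" and u
        assume D: "D \<in> set Gs" and t: "t \<le> 1" and s: "0 < s" "s \<le> t"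
          and \<eta>: "\<eta> \<in> up_dom (sd_b D) (sd_L D) (sd_g D) 1" and u: "u \<in> near_cube (sd_b D) (t * sd_b D) (fst \<eta>)"
          and seg: "closed_segment (sd_map D \<eta>) (sd_map D \<eta> + real r *\<^sub>R sd_lin D (s *\<^sub>R tang (sd_g D) j u)) \<subseteq> \<Omega>"
        have t0: "0 < t" using s by linarith
        have ends: "sd_map D \<eta> + real r *\<^sub>R sd_lin D (s *\<^sub>R tang (sd_g D) j u) = sd_map D (\<eta> + real r *\<^sub>R (s *\<^sub>R tang (sd_g D) j u))"
          unfolding sd_map_add linear_scale[OF sd_lin_linear] ..
        have Qk: "Q D (k D)" using k D by blast
        have kt: "k D * t \<le> K1 * t" using kK[OF D] t0 by (intro mult_right_mono) simp_all
        show "controlled r \<Omega> q C (c0 * t) N (sd_map D \<eta>) (sd_lin D (s *\<^sub>R tang (sd_g D) j u))" unfolding controlled_def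
        proof
          fix f :: "'n pt \<Rightarrow> real" assume f: "f \<in> borel_measurable borel"
          have "norm (s *\<^sub>R tang (sd_g D) j u) \<le> k D * t" using Qk s t \<eta> u unfolding Q_def by blast
          then have nH: "norm (sd_lin D (s *\<^sub>R tang (sd_g D) j u)) \<le> K1 * t" unfolding sd_lin_norm using kt by linarith
          show "\<exists>m\<le>r * N. ennreal \<bar>fin_diff r (sd_lin D (s *\<^sub>R tang (sd_g D) j u)) f (sd_map D \<eta>)\<bar>
              \<le> ennreal C * w_mod r \<Omega> q f (sd_map D \<eta> + (real m / real N) *\<^sub>R sd_lin D (s *\<^sub>R tang (sd_g D) j u)) (c0 * t)"
          proof (rule est[OF f t0 t nH seg])
            fix a b
            assume ab: "a \<in> closed_segment (sd_map D \<eta>) (sd_map D \<eta> + real r *\<^sub>R sd_lin D (s *\<^sub>R tang (sd_g D) j u))"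
              "b \<in> closed_segment (sd_map D \<eta>) (sd_map D \<eta> + real r *\<^sub>R sd_lin D (s *\<^sub>R tang (sd_g D) j u))"
            have "\<bar>osc a - osc b\<bar> \<le> k D * t"
              using Qk[unfolded Q_def, THEN conjunct2, rule_format, OF s t \<eta> u seg[unfolded ends] ab[unfolded ends]] .
            then show "\<bar>sqrt (infdist a (frontier \<Omega>)) - sqrt (infdist b (frontier \<Omega>))\<bar> \<le> K1 * t"
              unfolding osc_def using kt by linarith
          qed
        qed
      qed
    qed
  qed
qed

lemma sum_list_bound:
  assumes "c \<ge> 0" "\<And>D. D \<in> set Ds \<Longrightarrow> (F D :: ennreal) \<le> ennreal c * X"
  shows "(\<Sum>D\<leftarrow>Ds. F D) \<le> ennreal (real (length Ds) * c) * X"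
  using assms(2)
proof (induction Ds)
  case (Cons D Ds)
  have "F D + (\<Sum>D\<leftarrow>Ds. F D) \<le> ennreal c * X + ennreal (real (length Ds) * c) * X"
    using Cons by (intro add_mono) simp_all
  also have "\<dots> = ennreal (c + real (length Ds) * c) * X"
  proof -
    have "0 \<le> real (length Ds) * c" using assms(1) by simp
    then show ?thesis using assms(1) by (simp only: distrib_right ennreal_plus)
  qed
  also have "c + real (length Ds) * c = real (length (D # Ds)) * c" by (simp add: algebra_simps)
  finally show ?case by simp
qed simp

theorem theorem1p13:
  fixes \<Omega>0 \<Omega> :: "((real ^ 'n::finite) \<times> real) set"
    and Gs :: "'n special_dom list"
    and r :: nat and A0 :: real and p q :: ennreal
  assumes "C2_domain \<Omega>0" and "\<Omega> = closure \<Omega>0"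
    and "special_cover \<Omega> Gs"
    and "r \<ge> 1" and "A0 > 1" and "0 < q" and "q \<le> p"
  shows "\<exists>C c0 :: real. C > 0 \<and> c0 > 0 \<and>
    (\<forall>f t. in_Lp p \<Omega> f \<and> 0 < t \<and> t \<le> 1 \<longrightarrow>
       omega_mod r A0 \<Omega> Gs p f t \<le> ennreal C * tau_mod r \<Omega> p q f (c0 * t))"
proof -
  obtain K where tb: "two_ball \<Omega> K" using C2_domain_two_ball[OF assms(1)] unfolding assms(2) by blast
  note cpt = two_ball.compact[OF tb]
  have Gs: "special_dom_valid D \<and> attached \<Omega> D" if "D \<in> set Gs" for D
    using assms(3) that by (simp add: special_cover_def)
  show ?thesis
  proof (rule controlled_constants[OF tb Gs assms(4,6)])
    fix C c0 :: real and N :: nat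
    assume C: "C > 0" and c0: "c0 > 0" and N: "N \<ge> 1"
      and phi: "\<And>e \<eta> h x H t. e \<in> Basis \<Longrightarrow> 0 < t \<Longrightarrow> t \<le> 1 \<Longrightarrow> \<eta> \<in> \<Omega> \<Longrightarrow> \<bar>h\<bar> \<le> t \<Longrightarrow>
       H = (h * phi \<Omega> e \<eta>) *\<^sub>R e \<Longrightarrow> x = \<eta> - (real r / 2) *\<^sub>R H \<Longrightarrow>
       closed_segment x (x + real r *\<^sub>R H) \<subseteq> \<Omega> \<Longrightarrow> controlled r \<Omega> q C (c0 * t) N x H"
      and special: "\<And>D s j \<eta> u t. D \<in> set Gs \<Longrightarrow> t \<le> 1 \<Longrightarrow> 0 < s \<Longrightarrow> s \<le> t \<Longrightarrow>
       \<eta> \<in> up_dom (sd_b D) (sd_L D) (sd_g D) 1 \<Longrightarrow> u \<in> near_cube (sd_b D) (t * sd_b D) (fst \<eta>) \<Longrightarrow>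
       closed_segment (sd_map D \<eta>) (sd_map D \<eta> + real r *\<^sub>R sd_lin D (s *\<^sub>R tang (sd_g D) j u)) \<subseteq> \<Omega> \<Longrightarrow>
       controlled r \<Omega> q C (c0 * t) N (sd_map D \<eta>) (sd_lin D (s *\<^sub>R tang (sd_g D) j u))"
    define c1 where "c1 = phi_const r C N p"
    define c2 where "c2 = special_const r C N p CARD('n)"
    have c: "c1 \<ge> 0" "c2 \<ge> 0" using C by (simp_all add: c1_def c2_def phi_const_def special_const_def)
    have c2n: "0 \<le> real (length Gs) * c2" using c(2) by simp
    \<comment> \<open>The additional 1 makes the constant positive, since c1 and c2 are only
      recorded as nonnegative.\<close>
    have main: "omega_mod r A0 \<Omega> Gs p f t \<le> ennreal (c1 + real (length Gs) * c2 + 1) * tau_mod r \<Omega> p q f (c0 * t)"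
      if f: "in_Lp p \<Omega> f" and t: "0 < t" "t \<le> 1" for f t
    proof -
      define X where "X = tau_mod r \<Omega> p q f (c0 * t)"
      have "omega_phi_dir r \<Omega> p f t e \<le> ennreal c1 * X" if e: "e \<in> Basis" for e
        unfolding c1_def X_def by (rule omega_phi_dir_le[OF cpt assms(6,7,4) C N e f phi[OF e t]])
      then have A: "omega_phi r \<Omega> p f t \<le> ennreal c1 * X" unfolding omega_phi_def by (intro Max.boundedI) auto
      have S: "omega_special r A0 \<Omega> D p f t \<le> ennreal c2 * X" if D: "D \<in> set Gs" for D
        unfolding c2_def X_def
        by (rule omega_special_le[OF cpt assms(6,7,4) C N Gs[OF D, THEN conjunct1] t(1) f special[OF D t(2)]])
      have "omega_mod r A0 \<Omega> Gs p f t \<le> ennreal c1 * X + ennreal (real (length Gs) * c2) * X"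
        unfolding omega_mod_def by (intro add_mono A sum_list_bound[OF c(2) S])
      also have "\<dots> = ennreal (c1 + real (length Gs) * c2) * X"
        using c(1) c2n by (simp only: distrib_right ennreal_plus)
      also have "\<dots> \<le> ennreal (c1 + real (length Gs) * c2 + 1) * X"
        by (intro mult_right_mono ennreal_leI) simp_all
      finally show ?thesis unfolding X_def .
    qed
    have "c1 + real (length Gs) * c2 + 1 > 0" using c(1) c2n by linarith
    then show ?thesis using c0 main by blast
  qed
qed

end
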